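(* Let $R$ be a skew-invertible Hecke symmetry over $\mathbb{C}[[h]]$, let $R(u)$ be the associated $R$-matrix with additive spectral parameter and let $\mathbf{Y}^+_{RTT}(R)$ be the associated algebra with unit $\mathbf{1}$ (all defined in the context). For any $c\in\mathbb{C}$ there exists a unique formal power series $T^-(u)$ in $\mathrm{End}\,\mathbb{C}^N\otimes \mathrm{Hom}(\mathbf{Y}^+_{RTT}(R),\mathbf{Y}^+_{RTT}(R)((u))_h)$ satisfying $T^-(u)\mathbf{1}=I\otimes\mathbf{1}$ and such that for all integers $n\geqslant 1$ \begin{align*} T^-_0(u)\,T_1^+(v_1)\cdots T_n^+(v_n)={}&R_{01}(u-v_1+hc/2)^{-1}\cdots R_{0n}(u-v_n+hc/2)^{-1}\\ &\times T_1^+(v_1)\cdots T_n^+(v_n)\,R_{0n}(u-v_n-hc/2)\cdots R_{01}(u-v_1-hc/2). \end{align*} Moreover, $T^-(u)$ is invertible in $\mathrm{End}\,\mathbb{C}^N\otimes \mathrm{Hom}(\mathbf{Y}^+_{RTT}(R),\mathbf{Y}^+_{RTT}(R)((u))_h)$ and it satisfies the following identities for operators on $\mathbf{Y}^+_{RTT}(R)$: \begin{gather*} R(u-v)\,T^-_1(u)\,T^-_2(v)=T^-_2(v)\,T^-_1(u)\,R(u-v),\\ R(u-v+hc/2)\,T^-_1(u)\,T^+_2(v)=T^+_2(v)\,T^-_1(u)\,R(u-v-hc/2). \end{gather*}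
   Context: Hecke symmetries. $N\geqslant 2$ is an integer, $h$ a formal parameter, $P=\sum_{i,j}e_{ij}\otimes e_{ji}$ and $I$ (identity) on $\mathbb{C}^N\otimes\mathbb{C}^N$ ($I$ also denotes the identity matrix in $\mathrm{End}\,\mathbb{C}^N$). For $A\in(\mathrm{End}\,\mathbb{C}^N)^{\otimes 2}$ (with any coefficients), $A_{rs}$ denotes $A$ acting on tensor factors $r$ and $s$ (first leg in factor $r$, second leg in factor $s$); e.g. $A_{21}=PA_{12}P$. A Hecke symmetry is $R\in(\mathrm{End}\,\mathbb{C}^N)^{\otimes 2}[[h]]$ with $R_{12}R_{23}R_{12}=R_{23}R_{12}R_{23}$ and $(R-e^hI)(R+e^{-h}I)=0$; it is skew-invertible if there is $\Psi\in(\mathrm{End}\,\mathbb{C}^N)^{\otimes 2}[[h]]$ with $\mathrm{tr}_2R_{12}\Psi_{23}=P_{13}=\mathrm{tr}_2\Psi_{12}R_{23}$. Normalizing series. Fix an integer $M>0$ and $0\ne a\in\mathbb{C}$. Let $\overline g(x)\in 1+x\mathbb{C}[[x,h]]$ be the unique series with $\prod_{k=0}^{M-1}\overline g(xe^{-2kh})=\frac{1-xe^{-2(M-1)h}}{1-x}$, and $\overline f(x)=\frac{1-x}{1-xe^{-2h}}\,\overline g(x)$ (expansions in nonnegative powers of $x$). Each coefficient of $h^k$ in $\overline f(x)$ is a rational function of $x$ with poles only at $x=1$; $f(u)\in\mathbb{C}((u))[[h]]$ is obtained from $\overline f(x)$ by the substitution $x=e^{-2u/a}$ followed by expansion into Laurent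 series in $u$. Additive $R$-matrix. $R(u)=\psi f(u)\big(PR+\frac{e^h-e^{-h}}{e^{2u/a}-1}P\big)\in(\mathrm{End}\,\mathbb{C}^N)^{\otimes 2}((u))[[h]]$, where $\psi$ is an invertible element of $\mathbb{C}[[h]]$ chosen so that $R_{12}(u)R_{21}(-u)=1$. Expansion convention: negative powers of $u-v+bh$ (and generally of a sum of variables) are expanded in negative powers of the variable written first, here $u$. Modules. For a $\mathbb{C}[[h]]$-module $V$, $V((u))_h$ is the set of $\sum_{r\in\mathbb{Z}}a_ru^r$, $a_r\in V$, with $a_r\to0$ $h$-adically as $r\to-\infty$. Tensor products of $\mathbb{C}[[h]]$-modules are $h$-adically completed. Algebra. $\mathbf{Y}^+_{RTT}(R)$ is the topologically free associative unital $\mathbb{C}[[h]]$-algebra generated by $t_{ij}^{(-r)}$ ($1\leqslant i,j\leqslant N$, $r\geqslant1$) subject to $R(u-v)T_1^+(u)T_2^+(v)=T_2^+(v)T_1^+(u)R(u-v)$, where $T^+(u)=\sum_{i,j}e_{ij}\otimes t^+_{ij}(u)$, $t_{ij}^+(u)=\sum_{r\geqslant1}t_{ij}^{(-r)}u^{r-1}$, and a subscript $k$ indicates that the matrix part sits in the $k$-th copy of $\mathrm{End}\,\mathbb{C}^N$. (Topologically free: the quotient of the $h$-adically completed free algebra by the smallest $h$-adically closed two-sided ideal $J$ containing the relations and such that $ha\in J$ implies $a\in J$.) In the formula defining $T^-$, copies of $\mathrm{End}\,\mathbb{C}^N$ are labelled $0,1,\dots,n$ and $T_1^+(v_1)\cdots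 T_n^+(v_n)$ is regarded as a series of elements of $\mathbf{Y}^+_{RTT}(R)$; in the operator identities $T^+$ acts by left multiplication. *)

theory Defs
  imports
    "HOL-Analysis.Analysis"
    "HOL-Algebra.QuotRing"
    "HOL-Algebra.Module"
    "HOL-Computational_Algebra.Computational_Algebra"
    "HOL-Library.Poly_Mapping"
begin

section \<open>Free monoid and formal power series in many variables\<close>

text \<open>The free monoid, written additively so that \<open>'g fword \<Rightarrow>\<^sub>0 complex\<close> is the free
  associative unital algebra on the set of generators \<open>'g\<close>.\<close>

datatype 'g fword = Word "'g list"

instantiation fword :: (type) monoid_add
begin

definition zero_fword :: "'a fword" where
  "0 = Word []"

fun plus_fword :: "'a fword \<Rightarrow> 'a fword \<Rightarrow> 'a fword" where
  "Word xs + Word ys = Word (xs @ ys)"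

instance
proof
  fix a b c :: "'a fword"
  show "a + b + c = a + (b + c)" by (cases a; cases b; cases c) simp
  show "0 + a = a" by (cases a) (simp add: zero_fword_def)
  show "a + 0 = a" by (cases a) (simp add: zero_fword_def)
qed

end

text \<open>Formal power series in commuting variables \<open>v\<^sub>0, v\<^sub>1, v\<^sub>2, \<dots>\<close> with coefficients in a ring which
  need not be commutative. The multiset \<open>m\<close> stands for the monomial \<open>\<Prod>i. v\<^sub>i ^ count m i\<close>.\<close>

typedef 'a mps = "UNIV :: (nat multiset \<Rightarrow> 'a) set"
  morphisms mps_nth Abs_mps ..

setup_lifting type_definition_mps

lemma mps_eqI: "(\<And>m. mps_nth f m = mps_nth g m) \<Longrightarrow> f = g"
  by (metis ext mps_nth_inject)

lemma mps_nth_Abs_mps [simp]: "mps_nth (Abs_mps f) = f"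
  by (simp add: Abs_mps_inverse)

definition msplits :: "nat multiset \<Rightarrow> (nat multiset \<times> nat multiset) set" where
  "msplits m = {(a, b). a + b = m}"

lemma in_msplits [simp]: "(a, b) \<in> msplits m \<longleftrightarrow> a + b = m"
  by (simp add: msplits_def)

lemma finite_submultisets: "finite {a. a \<subseteq># (m :: nat multiset)}"
proof (rule finite_subset)
  show "{a. a \<subseteq># m} \<subseteq> mset ` {ys. set ys \<subseteq> set_mset m \<and> length ys \<le> size m}"
  proof
    fix a assume "a \<in> {a. a \<subseteq># m}"
    hence a: "a \<subseteq># m" by simp
    obtain ys where ys: "mset ys = a" using ex_mset by blast
    have "set ys \<subseteq> set_mset m" using set_mset_mono[OF a] ys by (metis set_mset_mset)
    moreover have "length ys \<le> size m" using size_mset_mono[OF a] ys by (metis size_mset)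
    ultimately show "a \<in> mset ` {ys. set ys \<subseteq> set_mset m \<and> length ys \<le> size m}"
      using ys by blast
  qed
qed (simp add: finite_lists_length_le)

lemma finite_msplits [simp]: "finite (msplits m)"
proof (rule finite_subset)
  show "msplits m \<subseteq> {a. a \<subseteq># m} \<times> {a. a \<subseteq># m}"
    by (auto simp: msplits_def)
qed (simp add: finite_submultisets)

instantiation mps :: (semiring_1) semiring_1
begin

lift_definition zero_mps :: "'a mps" is "\<lambda>_. 0" .
lift_definition one_mps :: "'a mps" is "\<lambda>m. if m = {#} then 1 else 0" .
lift_definition plus_mps :: "'a mps \<Rightarrow> 'a mps \<Rightarrow> 'a mps" is "\<lambda>f g m. f m + g m" .
lift_definition times_mps :: "'a mps \<Rightarrow> 'a mps \<Rightarrow> 'a mps" is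
  "\<lambda>f g m. \<Sum>(a, b)\<in>msplits m. f a * g b" .

instance
proof
  fix a b c :: "'a mps"
  show "a + b + c = a + (b + c)" by transfer (simp add: add.assoc)
  show "a + b = b + a" by transfer (simp add: add.commute)
  show "0 + a = a" by transfer simp
  show "0 * a = 0" by transfer simp
  show "a * 0 = 0" by transfer simp
  show "(a + b) * c = a * c + b * c"
    by transfer (simp add: distrib_right sum.distrib case_prod_unfold)
  show "a * (b + c) = a * b + a * c"
    by transfer (simp add: distrib_left sum.distrib case_prod_unfold)
  show "(0 :: 'a mps) \<noteq> 1" by transfer (metis zero_neq_one)
  show "1 * a = a"
  proof (transfer, rule ext)
    fix f :: "nat multiset \<Rightarrow> 'a" and m
    have "(\<Sum>(p, q)\<in>msplits m. (if p = {#} then 1 else 0) * f q)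
        = (\<Sum>(p, q)\<in>{({#} :: nat multiset, m)}. (if p = {#} then 1 else 0) * f q)"
      by (rule sum.mono_neutral_right) (auto split: if_splits)
    thus "(\<Sum>(p, q)\<in>msplits m. (if p = {#} then 1 else 0) * f q) = f m" by simp
  qed
  show "a * 1 = a"
  proof (transfer, rule ext)
    fix f :: "nat multiset \<Rightarrow> 'a" and m
    have "(\<Sum>(p, q)\<in>msplits m. f p * (if q = {#} then 1 else 0))
        = (\<Sum>(p, q)\<in>{(m, {#} :: nat multiset)}. f p * (if q = {#} then 1 else 0))"
      by (rule sum.mono_neutral_right) (auto split: if_splits)
    thus "(\<Sum>(p, q)\<in>msplits m. f p * (if q = {#} then 1 else 0)) = f m" by simp
  qed
  show "a * b * c = a * (b * c)"
  proof (transfer, rule ext)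
    fix f g k :: "nat multiset \<Rightarrow> 'a" and m
    have "(\<Sum>(p, z)\<in>msplits m. (\<Sum>(x, y)\<in>msplits p. f x * g y) * k z)
        = (\<Sum>(p, z)\<in>msplits m. \<Sum>(x, y)\<in>msplits p. f x * g y * k z)"
      by (simp add: sum_distrib_right case_prod_unfold)
    also have "\<dots> = (\<Sum>w\<in>(SIGMA t:msplits m. msplits (fst t)).
        f (fst (snd w)) * g (snd (snd w)) * k (snd (fst w)))"
      by (simp add: sum.Sigma case_prod_unfold)
    also have "\<dots> = (\<Sum>w\<in>(SIGMA t:msplits m. msplits (snd t)).
        f (fst (fst w)) * (g (fst (snd w)) * k (snd (snd w))))"
      by (rule sum.reindex_bij_witness[where
            i = "\<lambda>((x, _), (y, z)). ((x + y, z), (x, y))" and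
            j = "\<lambda>((_, z), (x, y)). ((x, y + z), (y, z))"])
         (auto simp: mult.assoc add.assoc)
    also have "\<dots> = (\<Sum>(x, q)\<in>msplits m. \<Sum>(y, z)\<in>msplits q. f x * (g y * k z))"
      by (simp add: sum.Sigma case_prod_unfold)
    also have "\<dots> = (\<Sum>(x, q)\<in>msplits m. f x * (\<Sum>(y, z)\<in>msplits q. g y * k z))"
      by (simp add: sum_distrib_left case_prod_unfold)
    finally show "(\<Sum>(p, z)\<in>msplits m. (\<Sum>(x, y)\<in>msplits p. f x * g y) * k z)
        = (\<Sum>(x, q)\<in>msplits m. f x * (\<Sum>(y, z)\<in>msplits q. g y * k z))" .
  qed
qed

end

text \<open>\<open>vseries i f\<close> is \<open>\<Sum>m. f m v\<^sub>i ^ m\<close>.\<close>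

definition vseries :: "nat \<Rightarrow> (nat \<Rightarrow> 'a::zero) \<Rightarrow> 'a mps" where
  "vseries i f = Abs_mps (\<lambda>m. if set_mset m \<subseteq> {i} then f (size m) else 0)"

definition vconst :: "'a::zero \<Rightarrow> 'a mps" where
  "vconst x = Abs_mps (\<lambda>m. if m = {#} then x else 0)"

section \<open>Operators on tensor products of copies of the vector representation\<close>

text \<open>The tensor factors are labelled by a finite set \<open>L\<close> of natural numbers; an element of
  \<open>(End \<complex>\<^sup>N)\<^sup>\<otimes>\<^sup>L\<close> with coefficients in a ring is its matrix, with rows and columns indexed by
  \<open>multi L\<close>. An element of \<open>(End \<complex>\<^sup>N)\<^sup>\<otimes>\<^sup>2\<close> is a matrix \<open>A\<close> of type \<open>'s ^ ('n \<times> 'n) ^ ('n \<times> 'n)\<close>, where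
  \<open>A $ (i, j) $ (k, l)\<close> is the coefficient of \<open>e\<^sub>i\<^sub>k \<otimes> e\<^sub>j\<^sub>l\<close> and \<open>N = CARD('n)\<close>.\<close>

type_synonym ('n, 's) tens = "(nat \<Rightarrow> 'n) \<Rightarrow> (nat \<Rightarrow> 'n) \<Rightarrow> 's"

definition multi :: "nat set \<Rightarrow> (nat \<Rightarrow> 'n) set" where
  "multi L = PiE L (\<lambda>_. UNIV)"

definition tmult :: "nat set \<Rightarrow> ('n, 's::semiring_1) tens \<Rightarrow> ('n, 's) tens \<Rightarrow> ('n, 's) tens" where
  "tmult L A B = (\<lambda>\<alpha> \<beta>. \<Sum>\<gamma>\<in>multi L. A \<alpha> \<gamma> * B \<gamma> \<beta>)"

definition tprod :: "nat set \<Rightarrow> ('n, 's::semiring_1) tens list \<Rightarrow> ('n, 's) tens" where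
  "tprod L As = foldr (tmult L) As (\<lambda>\<alpha> \<beta>. if \<alpha> = \<beta> then 1 else 0)"

definition on_leg :: "nat set \<Rightarrow> nat \<Rightarrow> 's::semiring_1 ^ 'n ^ 'n \<Rightarrow> ('n::finite, 's) tens" where
  "on_leg L r A = (\<lambda>\<alpha> \<beta>. if \<forall>t\<in>L - {r}. \<alpha> t = \<beta> t then A $ \<alpha> r $ \<beta> r else 0)"

definition on_legs ::
  "nat set \<Rightarrow> nat \<Rightarrow> nat \<Rightarrow> 's::semiring_1 ^ ('n \<times> 'n) ^ ('n \<times> 'n) \<Rightarrow> ('n::finite, 's) tens" where
  "on_legs L r s A =
     (\<lambda>\<alpha> \<beta>. if \<forall>t\<in>L - {r, s}. \<alpha> t = \<beta> t then A $ (\<alpha> r, \<alpha> s) $ (\<beta> r, \<beta> s) else 0)"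

definition tens_eq :: "nat set \<Rightarrow> ('n, 's) tens \<Rightarrow> ('n, 's) tens \<Rightarrow> bool" where
  "tens_eq L A B \<longleftrightarrow> (\<forall>\<alpha>\<in>multi L. \<forall>\<beta>\<in>multi L. A \<alpha> \<beta> = B \<alpha> \<beta>)"

definition partial_trace :: "nat \<Rightarrow> ('n::finite, 's::semiring_1) tens \<Rightarrow> ('n, 's) tens" where
  "partial_trace t A = (\<lambda>\<alpha> \<beta>. \<Sum>x\<in>UNIV. A (\<alpha>(t := x)) (\<beta>(t := x)))"

definition flipP :: "'s::semiring_1 ^ ('n::finite \<times> 'n) ^ ('n \<times> 'n)" where
  "flipP = (\<chi> p q. if q = prod.swap p then 1 else 0)"

section \<open>Hecke symmetries\<close>

definition hecke_symmetry :: "complex fps ^ ('n::finite \<times> 'n) ^ ('n \<times> 'n) \<Rightarrow> bool" where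
  "hecke_symmetry R \<longleftrightarrow>
     (let L = {1, 2, 3}; R12 = on_legs L 1 2 R; R23 = on_legs L 2 3 R
      in tens_eq L (tprod L [R12, R23, R12]) (tprod L [R23, R12, R23])) \<and>
     (R - mat (fps_exp 1)) ** (R + mat (fps_exp (-1))) = 0"

definition skew_invertible :: "complex fps ^ ('n::finite \<times> 'n) ^ ('n \<times> 'n) \<Rightarrow> bool" where
  "skew_invertible R \<longleftrightarrow>
     (\<exists>\<Psi> :: complex fps ^ ('n \<times> 'n) ^ ('n \<times> 'n).
        let L = {1, 2, 3} in
        tens_eq {1, 3} (partial_trace 2 (tprod L [on_legs L 1 2 R, on_legs L 2 3 \<Psi>]))
                       (on_legs {1, 3} 1 3 flipP) \<and>
        tens_eq {1, 3} (partial_trace 2 (tprod L [on_legs L 1 2 \<Psi>, on_legs L 2 3 R]))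
                       (on_legs {1, 3} 1 3 flipP))"

section \<open>Normalizing series\<close>

text \<open>\<open>\<complex>[[x,h]]\<close> is \<open>complex fps fps\<close> with outer variable \<open>x\<close> and inner variable \<open>h\<close>;
  \<open>x_exp s\<close> is \<open>x e\<^sup>s\<^sup>h\<close>.\<close>

definition x_exp :: "complex \<Rightarrow> complex fps fps" where
  "x_exp s = fps_const (fps_exp s) * fps_X"

definition gbar :: "nat \<Rightarrow> complex fps fps" where
  "gbar M = (THE g. fps_nth g 0 = 1 \<and>
     (\<Prod>k<M. fps_compose g (x_exp (- 2 * of_nat k))) =
       (1 - x_exp (- 2 * of_nat (M - 1))) * inverse (1 - fps_X))"

definition fbar :: "nat \<Rightarrow> complex fps fps" where
  "fbar M = (1 - fps_X) * inverse (1 - x_exp (- 2)) * gbar M"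

text \<open>\<open>\<complex>((u))[[h]]\<close> is \<open>complex fls fps\<close>. The coefficient of \<open>h\<^sup>k\<close> in \<open>fbar M\<close> is a rational
  function \<open>p(x) / (1 - x)\<^sup>d\<close> expanded at \<open>x = 0\<close>; the corresponding coefficient of \<open>f(u)\<close> is
  the Laurent series at \<open>u = 0\<close> of that rational function at \<open>x = e\<^sup>-\<^sup>2\<^sup>u\<^sup>/\<^sup>a\<close>. It does not depend
  on the choice of the fraction.\<close>

definition fser :: "nat \<Rightarrow> complex \<Rightarrow> complex fls fps" where
  "fser M a = Abs_fps (\<lambda>k. THE F. \<exists>p d.
     Abs_fps (\<lambda>n. fps_nth (fps_nth (fbar M) n) k) * (1 - fps_X) ^ d = fps_of_poly p \<and>
     F = (let E = fps_to_fls (fps_exp (- 2 / a))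
          in poly (map_poly fls_const p) E / (1 - E) ^ d))"

section \<open>The R-matrix with additive spectral parameter\<close>

definition hconst :: "complex fps \<Rightarrow> complex fls fps" where
  "hconst s = Abs_fps (\<lambda>k. fls_const (fps_nth s k))"

definition additive_R ::
  "complex fps ^ ('n::finite \<times> 'n) ^ ('n \<times> 'n) \<Rightarrow> nat \<Rightarrow> complex \<Rightarrow> complex fps
     \<Rightarrow> complex fls fps ^ ('n \<times> 'n) ^ ('n \<times> 'n)" where
  "additive_R R M a \<psi> = (\<chi> p q. hconst \<psi> * fser M a *
     (hconst ((flipP ** R) $ p $ q) +
      hconst (fps_exp 1 - fps_exp (-1)) *
        fps_const (inverse (fps_to_fls (fps_exp (2 / a)) - 1)) * flipP $ p $ q))"

definition negate_u :: "complex fls fps \<Rightarrow> complex fls fps" where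
  "negate_u F = Abs_fps (\<lambda>k. fls_compose_fps (fps_nth F k) (- fps_X))"

definition unitary :: "complex fls fps ^ ('n::finite \<times> 'n) ^ ('n \<times> 'n) \<Rightarrow> bool" where
  "unitary Ru \<longleftrightarrow> Ru ** (flipP ** map_matrix negate_u Ru ** flipP) = mat 1"

text \<open>\<open>subst_coeff b l F\<close> is the coefficient of \<open>v\<^sup>l\<close> in \<open>F(u - v + b h)\<close>. Expanding negative powers of
  \<open>u - v + b h\<close> in negative powers of \<open>u\<close> amounts to Taylor's formula in \<open>- v + b h\<close>.\<close>

definition subst_coeff :: "complex \<Rightarrow> nat \<Rightarrow> complex fls fps \<Rightarrow> complex fls fps" where
  "subst_coeff b l F = Abs_fps (\<lambda>k. \<Sum>p\<le>k.
     fls_const ((- 1) ^ l * b ^ p / (fact l * fact p)) * (fls_deriv ^^ (l + p)) (fps_nth F (k - p)))"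

definition u_coeff :: "int \<Rightarrow> 'a::zero fls fps \<Rightarrow> 'a fps" where
  "u_coeff r F = Abs_fps (\<lambda>k. fls_nth (fps_nth F k) r)"

section \<open>The algebra\<close>

text \<open>The generator \<open>(i, j, m)\<close> stands for \<open>t\<^sub>i\<^sub>j\<^sup>(\<^sup>-\<^sup>r\<^sup>)\<close> with \<open>r = m + 1\<close>, the coefficient of \<open>u\<^sup>m\<close> in
  \<open>t\<^sub>i\<^sub>j\<^sup>+(u)\<close>. The \<open>h\<close>-adically completed free algebra is \<open>'n falg fps\<close>, and \<open>'n falg fls fps\<close> is
  the ring of Laurent series \<open>\<Sum>r. a\<^sub>r u\<^sup>r\<close> over it with \<open>a\<^sub>r \<rightarrow> 0\<close> as \<open>r \<rightarrow> -\<infinity>\<close>.\<close>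

type_synonym 'n falg = "('n \<times> 'n \<times> nat) fword \<Rightarrow>\<^sub>0 complex"

definition tgen :: "'n \<Rightarrow> 'n \<Rightarrow> nat \<Rightarrow> 'n falg" where
  "tgen i j m = Poly_Mapping.single (Word [(i, j, m)]) 1"

definition scal :: "complex \<Rightarrow> 'n falg" where
  "scal c = Poly_Mapping.single 0 c"

definition scal_h :: "complex fps \<Rightarrow> 'n falg fps" where
  "scal_h s = Abs_fps (\<lambda>k. scal (fps_nth s k))"

definition scal_uh :: "complex fls fps \<Rightarrow> 'n falg fls fps" where
  "scal_uh F = Abs_fps (\<lambda>k. Abs_fls (\<lambda>r. scal (fls_nth (fps_nth F k) r)))"

text \<open>The matrices \<open>A(u - v\<^sub>i + b h)\<close>, \<open>T\<^sup>+(v\<^sub>i)\<close> and \<open>T\<^sup>+(u)\<close>; in \<open>T\<^sup>+(v\<^sub>i)\<close> the map \<open>\<iota>\<close> embeds the free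
  algebra into the coefficient ring.\<close>

definition R_series ::
  "complex fls fps ^ ('n::finite \<times> 'n) ^ ('n \<times> 'n) \<Rightarrow> complex \<Rightarrow> nat
     \<Rightarrow> 'n falg fls fps mps ^ ('n \<times> 'n) ^ ('n \<times> 'n)" where
  "R_series A b i = map_matrix (\<lambda>F. vseries i (\<lambda>l. scal_uh (subst_coeff b l F))) A"

definition Tplus_v :: "('n falg \<Rightarrow> 's) \<Rightarrow> nat \<Rightarrow> 's::zero mps ^ 'n::finite ^ 'n" where
  "Tplus_v \<iota> i = (\<chi> k l. vseries i (\<lambda>m. \<iota> (tgen k l m)))"

definition Tplus_u :: "'n falg fls fps mps ^ 'n::finite ^ 'n" where
  "Tplus_u = (\<chi> k l. vconst (fps_const (fps_to_fls (Abs_fps (\<lambda>m. tgen k l m)))))"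

definition embed_u :: "'n falg \<Rightarrow> 'n falg fls fps" where
  "embed_u x = fps_const (fls_const x)"

text \<open>The variable \<open>v\<close> of the defining relations is \<open>v\<^sub>2\<close>.\<close>

definition RTT_relators ::
  "complex fls fps ^ ('n::finite \<times> 'n) ^ ('n \<times> 'n) \<Rightarrow> 'n falg fps set" where
  "RTT_relators Ru =
     (let L = {1, 2};
          R12 = on_legs L 1 2 (R_series Ru 0 2);
          T1 = on_leg L 1 Tplus_u;
          T2 = on_leg L 2 (Tplus_v embed_u 2);
          lhs = tprod L [R12, T1, T2];
          rhs = tprod L [T2, T1, R12]
      in {u_coeff r (mps_nth (lhs \<alpha> \<beta>) m) - u_coeff r (mps_nth (rhs \<alpha> \<beta>) m) | r m \<alpha> \<beta>.
            \<alpha> \<in> multi L \<and> \<beta> \<in> multi L})"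

definition free_alg :: "'n falg fps ring" where
  "free_alg = \<lparr>carrier = UNIV, mult = (*), one = 1, zero = 0, add = (+)\<rparr>"

text \<open>The metric on \<^typ>\<open>'a fps\<close> induces the \<open>h\<close>-adic topology, so \<^const>\<open>closed\<close> means
  \<open>h\<close>-adically closed.\<close>

definition RTT_ideal ::
  "complex fls fps ^ ('n::finite \<times> 'n) ^ ('n \<times> 'n) \<Rightarrow> 'n falg fps set" where
  "RTT_ideal Ru = \<Inter>{J. ideal J free_alg \<and> closed J \<and> (\<forall>x. fps_X * x \<in> J \<longrightarrow> x \<in> J) \<and>
     RTT_relators Ru \<subseteq> J}"

definition cls ::
  "complex fls fps ^ ('n::finite \<times> 'n) ^ ('n \<times> 'n) \<Rightarrow> 'n falg fps \<Rightarrow> 'n falg fps set" where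
  "cls Ru x = RTT_ideal Ru +>\<^bsub>free_alg\<^esub> x"

definition RTT_algebra ::
  "complex fls fps ^ ('n::finite \<times> 'n) ^ ('n \<times> 'n) \<Rightarrow> (complex fps, 'n falg fps set) module" where
  "RTT_algebra Ru =
     (let Q = free_alg Quot RTT_ideal Ru
      in \<lparr>carrier = carrier Q, mult = mult Q, one = one Q, zero = zero Q, add = add Q,
          smult = (\<lambda>s x. cls Ru (scal_h s) \<otimes>\<^bsub>Q\<^esub> x)\<rparr>)"

section \<open>Operators on modules over \<open>\<complex>[[h]]\<close>\<close>

definition h_multiples :: "(complex fps, 'y) module \<Rightarrow> nat \<Rightarrow> 'y set" where
  "h_multiples Y k = {fps_X ^ k \<odot>\<^bsub>Y\<^esub> x | x. x \<in> carrier Y}"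

text \<open>Unconditional convergence of a family to \<open>z\<close> in the \<open>h\<close>-adic topology.\<close>

definition has_hsum :: "(complex fps, 'y) module \<Rightarrow> ('i \<Rightarrow> 'y) \<Rightarrow> 'i set \<Rightarrow> 'y \<Rightarrow> bool" where
  "has_hsum Y g A z \<longleftrightarrow> z \<in> carrier Y \<and> (\<forall>i\<in>A. g i \<in> carrier Y) \<and>
     (\<forall>k. \<exists>F0. finite F0 \<and> F0 \<subseteq> A \<and>
       (\<forall>F. finite F \<and> F0 \<subseteq> F \<and> F \<subseteq> A \<longrightarrow> finsum Y g F \<ominus>\<^bsub>Y\<^esub> z \<in> h_multiples Y k))"

definition laurent_h :: "(complex fps, 'y) module \<Rightarrow> (int \<Rightarrow> 'y) set" where
  "laurent_h Y = {x. (\<forall>r. x r \<in> carrier Y) \<and> (\<forall>k. \<exists>r0. \<forall>r<r0. x r \<in> h_multiples Y k)}"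

definition hom_laurent :: "(complex fps, 'y) module \<Rightarrow> ('y \<Rightarrow> int \<Rightarrow> 'y) set" where
  "hom_laurent Y = {\<phi> \<in> carrier Y \<rightarrow>\<^sub>E laurent_h Y.
     (\<forall>x\<in>carrier Y. \<forall>y\<in>carrier Y. \<forall>r. \<phi> (x \<oplus>\<^bsub>Y\<^esub> y) r = \<phi> x r \<oplus>\<^bsub>Y\<^esub> \<phi> y r) \<and>
     (\<forall>s. \<forall>x\<in>carrier Y. \<forall>r. \<phi> (s \<odot>\<^bsub>Y\<^esub> x) r = s \<odot>\<^bsub>Y\<^esub> \<phi> x r)}"

text \<open>Elements of \<open>End \<complex>\<^sup>N \<otimes> Hom(Y, Y((u))\<^sub>h)\<close> are matrices of homomorphisms. The product of two of
  them has entries \<open>\<Sum>\<^sub>p A\<^sub>i\<^sub>p(u) B\<^sub>p\<^sub>j(u)\<close>, whose coefficients are in general infinite sums.\<close>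

type_synonym ('n, 'y) opmat = "'n \<Rightarrow> 'n \<Rightarrow> 'y \<Rightarrow> int \<Rightarrow> 'y"

definition opmats :: "(complex fps, 'y) module \<Rightarrow> ('n, 'y) opmat set" where
  "opmats Y = {T. \<forall>i j. T i j \<in> hom_laurent Y}"

definition identity_series :: "(complex fps, 'y) module \<Rightarrow> ('n, 'y) opmat" where
  "identity_series Y = (\<lambda>i j y r. if i = j \<and> r = 0 then y else \<zero>\<^bsub>Y\<^esub>)"

definition product_is_identity ::
  "(complex fps, 'y) module \<Rightarrow> ('n, 'y) opmat \<Rightarrow> ('n, 'y) opmat \<Rightarrow> bool" where
  "product_is_identity Y A B \<longleftrightarrow> (\<forall>i j r. \<forall>y\<in>carrier Y.
     has_hsum Y (\<lambda>(p, s). A i p (B p j y (r - s)) s) UNIV (identity_series Y i j y r))"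

definition op_invertible :: "(complex fps, 'y) module \<Rightarrow> ('n, 'y) opmat \<Rightarrow> bool" where
  "op_invertible Y T \<longleftrightarrow>
     (\<exists>S\<in>opmats Y. product_is_identity Y T S \<and> product_is_identity Y S T)"

text \<open>The identity \<open>R(u - v + b h) A\<^sub>1(u) B\<^sub>2(v) = B\<^sub>2(v) A\<^sub>1(u) R(u - v + b' h)\<close> of operators on \<open>Y\<close>: on every
  element of \<open>Y\<close> all coefficients of \<open>u\<^sup>r v\<^sup>s\<close> of all matrix entries of both sides converge and agree.\<close>

definition RTT_identity ::
  "(complex fps, 'y) module \<Rightarrow> complex fls fps ^ ('n::finite \<times> 'n) ^ ('n \<times> 'n)
     \<Rightarrow> complex \<Rightarrow> complex \<Rightarrow> ('n, 'y) opmat \<Rightarrow> ('n, 'y) opmat \<Rightarrow> bool" where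
  "RTT_identity Y Ru b b' A B \<longleftrightarrow> (\<forall>i j k l r s. \<forall>y\<in>carrier Y. \<exists>z.
     has_hsum Y (\<lambda>(p, q, r', s').
         u_coeff r' (subst_coeff b s' (Ru $ (i, j) $ (p, q))) \<odot>\<^bsub>Y\<^esub>
           A p k (B q l y (s - int s')) (r - r')) UNIV z \<and>
     has_hsum Y (\<lambda>(p, q, r', s').
         u_coeff r' (subst_coeff b' s' (Ru $ (p, q) $ (k, l))) \<odot>\<^bsub>Y\<^esub>
           B j q (A i p y (r - r')) (s - int s')) UNIV z)"

section \<open>The operator series\<close>

definition Tplus_op ::
  "complex fls fps ^ ('n::finite \<times> 'n) ^ ('n \<times> 'n) \<Rightarrow> ('n, 'n falg fps set) opmat" where
  "Tplus_op Ru = (\<lambda>i j y r.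
     if r < 0 then \<zero>\<^bsub>RTT_algebra Ru\<^esub>
     else cls Ru (fps_const (tgen i j (nat r))) \<otimes>\<^bsub>RTT_algebra Ru\<^esub> y)"

text \<open>The series \<open>T\<^sub>1\<^sup>+(v\<^sub>1) \<cdots> T\<^sub>n\<^sup>+(v\<^sub>n)\<close> with factors \<open>1, \<dots>, n\<close>, and the right-hand side of the formula
  defining \<open>T\<^sup>-(u)\<close> with factors \<open>0, \<dots>, n\<close>, before passing to the quotient. Since
  \<open>F(u) \<mapsto> F(u - v + b h)\<close> is a ring homomorphism, \<open>R(u - v + b h)\<^sup>-\<^sup>1\<close> is obtained from the
  inverse of \<open>R(u)\<close>.\<close>

definition Tplus_product :: "nat \<Rightarrow> ('n::finite, 'n falg fps mps) tens" where
  "Tplus_product n =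
     tprod {1..n} (map (\<lambda>i. on_leg {1..n} i (Tplus_v fps_const i)) [1..<Suc n])"

definition Tminus_rhs ::
  "complex fls fps ^ ('n::finite \<times> 'n) ^ ('n \<times> 'n) \<Rightarrow> complex \<Rightarrow> nat
     \<Rightarrow> ('n, 'n falg fls fps mps) tens" where
  "Tminus_rhs Ru c n =
     (let L = {0..n} in tprod L
        (map (\<lambda>i. on_legs L 0 i (R_series (matrix_inv Ru) (c / 2) i)) [1..<Suc n] @
         map (\<lambda>i. on_leg L i (Tplus_v embed_u i)) [1..<Suc n] @
         map (\<lambda>i. on_legs L 0 i (R_series Ru (- c / 2) i)) (rev [1..<Suc n])))"

definition Tminus_formula ::
  "complex fls fps ^ ('n::finite \<times> 'n) ^ ('n \<times> 'n) \<Rightarrow> complex \<Rightarrow> nat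
     \<Rightarrow> ('n, 'n falg fps set) opmat \<Rightarrow> bool" where
  "Tminus_formula Ru c n T \<longleftrightarrow>
     (\<forall>\<alpha>\<in>multi {0..n}. \<forall>\<beta>\<in>multi {0..n}. \<forall>m r.
        T (\<alpha> 0) (\<beta> 0)
          (cls Ru (mps_nth (Tplus_product n (restrict \<alpha> {1..n}) (restrict \<beta> {1..n})) m)) r
        = cls Ru (u_coeff r (mps_nth (Tminus_rhs Ru c n \<alpha> \<beta>) m)))"

definition is_Tminus ::
  "complex fls fps ^ ('n::finite \<times> 'n) ^ ('n \<times> 'n) \<Rightarrow> complex
     \<Rightarrow> ('n, 'n falg fps set) opmat \<Rightarrow> bool" where
  "is_Tminus Ru c T \<longleftrightarrow>
     T \<in> opmats (RTT_algebra Ru) \<and>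
     (\<forall>i j. T i j \<one>\<^bsub>RTT_algebra Ru\<^esub> =
        identity_series (RTT_algebra Ru) i j \<one>\<^bsub>RTT_algebra Ru\<^esub>) \<and>
     (\<forall>n\<ge>1. Tminus_formula Ru c n T)"

end

theory Submission
  imports Defs
begin

text \<open>The formula for \<open>T\<^sup>-(u)\<close> says that \<open>T\<^sup>-(u)\<close> acts on a word \<open>t(v\<^sub>1) \<cdots> t(v\<^sub>n)\<close> by letting each letter act in turn on an
  auxiliary space \<open>End \<complex>\<^sup>N\<close>: the entries of \<open>X \<mapsto> R(u - v + hc/2)\<^sup>-\<^sup>1 T\<^sup>+(v) X R(u - v - hc/2)\<close> define an algebra homomorphism from
  the free algebra to matrices over Laurent series in the free algebra, and \<open>T\<^sup>-(u)\<close> is its value on the identity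
  of \<open>End \<complex>\<^sup>N\<close>. The left factor \<open>R\<^sup>-\<^sup>1\<close> and the right factor \<open>R\<close> are commuting representations of the RTT relation, by
  the Yang--Baxter equation, so the homomorphism descends to the quotient algebra; being prescribed on words,
  the operator is unique by \<open>h\<close>-adic density. The inverse of \<open>T\<^sup>-(u)\<close> is built in the same way from \<open>R(u - v - hc/2)\<^sup>-\<^sup>1\<close> and
  the skew inverse of \<open>R(u - v + hc/2)\<^sup>-\<^sup>1\<close>. The latter exists since the partial transpose of \<open>R(u)\<^sup>-\<^sup>1\<close> is a rank one
  perturbation of the partial transpose of \<open>R\<close>, which is invertible by skew-invertibility (Sherman--Morrison). The operator
  identities reduce to words, where they again follow from the Yang--Baxter equation.\<close>

subsection \<open>Maps of power and Laurent series\<close>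

text \<open>The word-by-word description is effective because R(u - v + b h) is expanded in
  nonnegative powers of v: a letter goes to letters of the same or a lower mode, a word goes to
  finitely many words of the same length, and the coefficients form a matrix of commuting scalars,
  the \<open>word_kernel\<close>. Products of two such operators, whose coefficients are infinite
  sums in the algebra, become finite sums of products of kernels. An identity between them is
  checked on a single letter by exhibiting an intertwiner of auxiliary spaces that does not depend
  on the variable of the letter. All operator identities hold already in the free algebra; the ideal
  enters only when an operator has to descend. There the RTT relation lives in variables v and w
  while u is the parameter of the operator, so the Yang-Baxter equation is needed in a ring of
  Laurent series in u and v and power series in w and h. The ideal is h-adically closed and
  saturated, hence not spanned by explicit elements; it is reached through its minimality, by
  pulling its defining properties back along the homomorphism.\<close>

definition unital_hom :: "('a::ring_1 \<Rightarrow> 'b::ring_1) \<Rightarrow> bool" where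
  "unital_hom f \<longleftrightarrow> f 1 = 1 \<and> (\<forall>x y. f (x + y) = f x + f y) \<and> (\<forall>x y. f (x * y) = f x * f y)"

lemma unital_homI:
  assumes "f 1 = 1" "\<And>x y. f (x + y) = f x + f y" "\<And>x y. f (x * y) = f x * f y"
  shows "unital_hom f"
  using assms by (simp add: unital_hom_def)

lemma unital_hom_one: "unital_hom f \<Longrightarrow> f 1 = 1"
  and unital_hom_add: "unital_hom f \<Longrightarrow> f (x + y) = f x + f y"
  and unital_hom_mult: "unital_hom f \<Longrightarrow> f (x * y) = f x * f y"
  by (simp_all add: unital_hom_def)

lemma unital_hom_additive: "unital_hom f \<Longrightarrow> Modules.additive f"
  by (simp add: Modules.additive_def unital_hom_def)

lemma unital_hom_zero: "unital_hom f \<Longrightarrow> f 0 = 0"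
  by (rule Modules.additive.zero[OF unital_hom_additive])

lemma unital_hom_sum: "unital_hom f \<Longrightarrow> f (sum g S) = (\<Sum>i\<in>S. f (g i))"
  by (rule Modules.additive.sum[OF unital_hom_additive])

lemma unital_hom_diff: "unital_hom f \<Longrightarrow> f (x - y) = f x - f y"
  by (rule Modules.additive.diff[OF unital_hom_additive])

lemma unital_hom_comp: "unital_hom f \<Longrightarrow> unital_hom g \<Longrightarrow> unital_hom (\<lambda>x. f (g x))"
  by (simp add: unital_hom_def)

lemmas unital_hom_simps = unital_hom_one unital_hom_zero unital_hom_add unital_hom_diff
  unital_hom_mult unital_hom_sum

definition fps_map :: "('a::zero \<Rightarrow> 'b::zero) \<Rightarrow> 'a fps \<Rightarrow> 'b fps" where
  "fps_map f X = Abs_fps (\<lambda>k. f (fps_nth X k))"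

definition fls_map :: "('a::zero \<Rightarrow> 'b::zero) \<Rightarrow> 'a fls \<Rightarrow> 'b fls" where
  "fls_map f X = Abs_fls (\<lambda>n. f (fls_nth X n))"

lemma fps_map_nth [simp]: "fps_nth (fps_map f X) k = f (fps_nth X k)"
  by (simp add: fps_map_def)

lemma fls_map_nth:
  assumes "f 0 = 0"
  shows "fls_nth (fls_map f X) n = f (fls_nth X n)"
  unfolding fls_map_def
  by (rule nth_Abs_fls_lower_bound[of "fls_subdegree X"]) (simp add: assms)

lemma fps_map_const: "f 0 = 0 \<Longrightarrow> fps_map f (fps_const c) = fps_const (f c)"
  by (rule fps_ext) simp

text \<open>Arbitrary lower bounds replace the subdegrees, because applying a map to the
  coefficients can raise a subdegree and because several series have to share one range of
  summation.\<close>

lemma fls_mult_nth: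
  fixes f g :: "'a::semiring_1 fls"
  assumes "\<And>i. i < a \<Longrightarrow> fls_nth f i = 0" "\<And>i. i < b \<Longrightarrow> fls_nth g i = 0"
  shows "fls_nth (f * g) n = (\<Sum>i\<in>{a..n - b}. fls_nth f i * fls_nth g (n - i))"
proof -
  let ?df = "fls_subdegree f" and ?dg = "fls_subdegree g"
  let ?U = "{min a ?df..max (n - b) (n - ?dg)}"
  have "fls_nth (f * g) n = (\<Sum>i\<in>{?df..n - ?dg}. fls_nth f i * fls_nth g (n - i))"
    by (rule fls_times_nth(2))
  also have "\<dots> = (\<Sum>i\<in>?U. fls_nth f i * fls_nth g (n - i))"
  proof (rule sum.mono_neutral_left)
    show "\<forall>i\<in>?U - {?df..n - ?dg}. fls_nth f i * fls_nth g (n - i) = 0"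
    proof
      fix i assume "i \<in> ?U - {?df..n - ?dg}"
      hence "i < ?df \<or> n - i < ?dg" by auto
      thus "fls_nth f i * fls_nth g (n - i) = 0" by auto
    qed
  qed auto
  also have "\<dots> = (\<Sum>i\<in>{a..n - b}. fls_nth f i * fls_nth g (n - i))"
  proof (rule sum.mono_neutral_right)
    show "\<forall>i\<in>?U - {a..n - b}. fls_nth f i * fls_nth g (n - i) = 0"
    proof
      fix i assume "i \<in> ?U - {a..n - b}"
      hence "i < a \<or> n - i < b" by auto
      thus "fls_nth f i * fls_nth g (n - i) = 0" using assms by auto
    qed
  qed auto
  finally show ?thesis .
qed

lemma fls_sum_nth: "fls_nth (sum f S) n = (\<Sum>i\<in>S. fls_nth (f i) n)"
  by (induction S rule: infinite_finite_induct) auto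

lemma fps_map_hom: "unital_hom f \<Longrightarrow> unital_hom (fps_map f)"
  by (rule unital_homI; rule fps_ext)
     (simp_all add: unital_hom_simps fps_mult_nth)

lemma fls_map_hom:
  assumes "unital_hom f"
  shows "unital_hom (fls_map f)"
proof (rule unital_homI; rule fls_eqI)
  fix n and x y :: "'a fls"
  show "fls_nth (fls_map f 1) n = fls_nth 1 n"
    using assms by (simp add: fls_map_nth unital_hom_simps)
  show "fls_nth (fls_map f (x + y)) n = fls_nth (fls_map f x + fls_map f y) n"
    using assms by (simp add: fls_map_nth unital_hom_simps)
  have "fls_nth (fls_map f (x * y)) n
      = (\<Sum>i\<in>{fls_subdegree x..n - fls_subdegree y}. f (fls_nth x i) * f (fls_nth y (n - i)))"
    using assms by (simp add: fls_map_nth unital_hom_simps fls_times_nth(2))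
  also have "\<dots> = fls_nth (fls_map f x * fls_map f y) n"
    using assms by (subst fls_mult_nth[where a = "fls_subdegree x" and b = "fls_subdegree y"])
      (simp_all add: fls_map_nth unital_hom_simps)
  finally show "fls_nth (fls_map f (x * y)) n = fls_nth (fls_map f x * fls_map f y) n" .
qed

lemma fls_const_hom: "unital_hom (fls_const :: 'a::ring_1 \<Rightarrow> 'a fls)"
  by (rule unital_homI) (simp_all add: fls_plus_const fls_const_mult_const)

lemma fps_const_hom: "unital_hom (fps_const :: 'a::ring_1 \<Rightarrow> 'a fps)"
  by (rule unital_homI) simp_all

lemma fps_to_fls_hom: "unital_hom (fps_to_fls :: 'a::ring_1 fps \<Rightarrow> 'a fls)"
  by (rule unital_homI) (simp_all add: fls_times_fps_to_fls)

section \<open>Linear extension in a formal parameter\<close>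

lemma fps_decompose:
  fixes x :: "'a::ring_1 fps"
  shows "x = fps_const (fps_nth x 0) + fps_X * fps_shift 1 x"
proof (rule fps_ext)
  fix n show "fps_nth x n = fps_nth (fps_const (fps_nth x 0) + fps_X * fps_shift 1 x) n"
    by (cases n) auto
qed

text \<open>Splitting off the constant term gives \<open>D x = fps_X * D (fps_shift 1 x)\<close>;
  iterating, \<open>D x\<close> is divisible by every power of \<open>fps_X\<close>. Commuting with
  \<open>fps_X\<close> takes the place of continuity.\<close>

lemma fps_density:
  fixes D :: "'a::ring_1 fps \<Rightarrow> 'b::ring_1 fps"
  assumes "Modules.additive D" "\<And>x. D (fps_X * x) = fps_X * D x" "\<And>c. D (fps_const c) = 0"
  shows "D x = 0"
proof (rule fps_ext)
  fix n show "fps_nth (D x) n = fps_nth 0 n"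
  proof (induction n arbitrary: x)
    case 0
    have "D x = fps_X * D (fps_shift 1 x)"
      by (subst fps_decompose) (simp only: assms Modules.additive.add[OF assms(1)] add_0_left)
    thus ?case by simp
  next
    case (Suc n)
    have "D x = fps_X * D (fps_shift 1 x)"
      by (subst fps_decompose) (simp only: assms Modules.additive.add[OF assms(1)] add_0_left)
    thus ?case using Suc by simp
  qed
qed

text \<open>The h-linear extension of a map on coefficients. As \<open>g\<close> itself takes values
  in power series in h, the order in h of the argument and that of the value add up.\<close>

definition fps_lift :: "('a::zero \<Rightarrow> 'b::comm_monoid_add fps) \<Rightarrow> 'a fps \<Rightarrow> 'b fps" where
  "fps_lift g X = Abs_fps (\<lambda>k. \<Sum>j\<le>k. fps_nth (g (fps_nth X j)) (k - j))"

lemma fps_lift_nth: "fps_nth (fps_lift g X) k = (\<Sum>j\<le>k. fps_nth (g (fps_nth X j)) (k - j))"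
  by (simp add: fps_lift_def)

lemma fps_lift_additive:
  "Modules.additive g \<Longrightarrow> Modules.additive (fps_lift (g :: 'a::ring_1 \<Rightarrow> 'b::ring_1 fps))"
  unfolding Modules.additive_def by (auto intro!: fps_ext simp: fps_lift_nth sum.distrib)

lemma fps_lift_const:
  assumes "g 0 = 0"
  shows "fps_lift (g :: 'a::ring_1 \<Rightarrow> 'b::ring_1 fps) (fps_const c) = g c"
proof (rule fps_ext)
  fix k
  have "fps_nth (fps_lift g (fps_const c)) k
      = (\<Sum>j\<le>k. if j = 0 then fps_nth (g c) k else 0)"
    unfolding fps_lift_nth by (rule sum.cong) (auto simp: assms)
  thus "fps_nth (fps_lift g (fps_const c)) k = fps_nth (g c) k" by simp
qed

lemma fps_lift_X:
  assumes "g 0 = 0"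
  shows "fps_lift (g :: 'a::ring_1 \<Rightarrow> 'b::ring_1 fps) (fps_X * x) = fps_X * fps_lift g x"
proof (rule fps_ext)
  fix k show "fps_nth (fps_lift g (fps_X * x)) k = fps_nth (fps_X * fps_lift g x) k"
  proof (cases k)
    case 0
    thus ?thesis by (simp add: fps_lift_nth assms)
  next
    case (Suc n)
    thus ?thesis by (simp add: fps_lift_nth assms sum.atMost_Suc_shift del: sum.atMost_Suc)
  qed
qed

text \<open>The finite sum over \<open>I\<close> covers ring homomorphisms as well as entries of
  matrix-valued homomorphisms, where a product expands over the middle index. Both sides are
  h-linear in each argument, so density reduces first \<open>y\<close> and then \<open>x\<close> to
  constants.\<close>

lemma fps_lift_bilinear:
  fixes g :: "'a::ring_1 \<Rightarrow> 'b::ring_1 fps" and g1 g2 :: "'i \<Rightarrow> 'a \<Rightarrow> 'b fps"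
  assumes g: "Modules.additive g" "\<And>i. Modules.additive (g1 i)" "\<And>i. Modules.additive (g2 i)"
    and mult: "\<And>x y. g (x * y) = (\<Sum>i\<in>I. g1 i x * g2 i y)"
  shows "fps_lift g (x * y) = (\<Sum>i\<in>I. fps_lift (g1 i) x * fps_lift (g2 i) y)"
proof -
  note z = Modules.additive.zero[OF g(1)] Modules.additive.zero[OF g(2)] Modules.additive.zero[OF g(3)]
  note lad = Modules.additive.add[OF fps_lift_additive[OF g(1)]] Modules.additive.add[OF fps_lift_additive[OF g(2)]]
    Modules.additive.add[OF fps_lift_additive[OF g(3)]]
  have LX: "fps_lift g (fps_X * x) = fps_X * fps_lift g x"
    "fps_lift (g1 i) (fps_X * x) = fps_X * fps_lift (g1 i) x"
    "fps_lift (g2 i) (fps_X * x) = fps_X * fps_lift (g2 i) x" for i x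
    by (simp_all add: fps_lift_X z)
  have Xc: "a * (fps_X * b) = fps_X * (a * b)" for a b :: "'c::ring_1 fps"
    by (metis fps_mult_fps_X_commute mult.assoc)
  have 1: "fps_lift g (fps_const c * y) - (\<Sum>i\<in>I. g1 i c * fps_lift (g2 i) y) = 0" for c y
  proof (rule fps_density[where D = "\<lambda>y. fps_lift g (fps_const c * y) - (\<Sum>i\<in>I. g1 i c * fps_lift (g2 i) y)"])
    show "Modules.additive (\<lambda>y. fps_lift g (fps_const c * y) - (\<Sum>i\<in>I. g1 i c * fps_lift (g2 i) y))"
      by (simp add: Modules.additive_def distrib_left lad sum.distrib)
    show "fps_lift g (fps_const c * (fps_X * x)) - (\<Sum>i\<in>I. g1 i c * fps_lift (g2 i) (fps_X * x)) =
         fps_X * (fps_lift g (fps_const c * x) - (\<Sum>i\<in>I. g1 i c * fps_lift (g2 i) x))" for x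
      by (simp only: Xc LX right_diff_distrib sum_distrib_left)
    show "fps_lift g (fps_const c * fps_const d) - (\<Sum>i\<in>I. g1 i c * fps_lift (g2 i) (fps_const d)) = 0" for d
      by (simp add: fps_lift_const z mult)
  qed
  have "fps_lift g (x * y) - (\<Sum>i\<in>I. fps_lift (g1 i) x * fps_lift (g2 i) y) = 0"
  proof (rule fps_density[where D = "\<lambda>x. fps_lift g (x * y) - (\<Sum>i\<in>I. fps_lift (g1 i) x * fps_lift (g2 i) y)"])
    show "Modules.additive (\<lambda>x. fps_lift g (x * y) - (\<Sum>i\<in>I. fps_lift (g1 i) x * fps_lift (g2 i) y))"
      by (simp add: Modules.additive_def distrib_right lad sum.distrib)
    show "fps_lift g (fps_X * x * y) - (\<Sum>i\<in>I. fps_lift (g1 i) (fps_X * x) * fps_lift (g2 i) y) =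
         fps_X * (fps_lift g (x * y) - (\<Sum>i\<in>I. fps_lift (g1 i) x * fps_lift (g2 i) y))" for x
      by (simp only: mult.assoc LX right_diff_distrib sum_distrib_left)
    show "fps_lift g (fps_const c * y) - (\<Sum>i\<in>I. fps_lift (g1 i) (fps_const c) * fps_lift (g2 i) y) = 0" for c
      using 1[of c y] by (simp add: fps_lift_const z)
  qed
  thus ?thesis by simp
qed

lemma fps_lift_hom:
  assumes "unital_hom g"
  shows "unital_hom (fps_lift g)"
proof (rule unital_homI)
  note ad = unital_hom_additive[OF assms]
  show "fps_lift g 1 = 1"
    using fps_lift_const[of g 1] assms by (simp add: unital_hom_simps)
  show "fps_lift g (x + y) = fps_lift g x + fps_lift g y" for x y
    by (rule Modules.additive.add[OF fps_lift_additive[OF ad]])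
  show "fps_lift g (x * y) = fps_lift g x * fps_lift g y" for x y
    using fps_lift_bilinear[OF ad ad ad, where I = "{()}"] unital_hom_mult[OF assms] by simp
qed

subsection \<open>Taylor expansion\<close>

text \<open>The coefficient of t^n in the Taylor expansion of F(u + x t).\<close>

definition divided_deriv :: "complex \<Rightarrow> nat \<Rightarrow> complex fls \<Rightarrow> complex fls" where
  "divided_deriv x n F = fls_const (x ^ n / fact n) * (fls_deriv ^^ n) F"

lemma funpow_fls_deriv_const_mult:
  "(fls_deriv ^^ n) (fls_const c * F) = fls_const c * (fls_deriv ^^ n) (F :: complex fls)"
  by (induction n) simp_all

lemma funpow_fls_deriv_add:
  "(fls_deriv ^^ n) (F + G) = (fls_deriv ^^ n) F + (fls_deriv ^^ n) (G :: complex fls)"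
  by (induction n) simp_all

lemma divided_deriv_additive: "Modules.additive (divided_deriv x n)"
  by (simp add: Modules.additive_def divided_deriv_def funpow_fls_deriv_add distrib_left)

lemma divided_deriv_0 [simp]: "divided_deriv x 0 F = F"
  by (simp add: divided_deriv_def)

lemma divided_deriv_Suc:
  "fls_const (of_nat (Suc n)) * divided_deriv x (Suc n) F = fls_const x * fls_deriv (divided_deriv x n F)"
proof -
  have "of_nat (Suc n) * (x ^ Suc n / fact (Suc n)) = x * (x ^ n / fact n)"
    by (simp add: field_simps del: of_nat_Suc)
  thus ?thesis
    unfolding divided_deriv_def
    by (simp add: mult.assoc[symmetric] fls_const_mult_const del: of_nat_Suc power_Suc fact_Suc)
qed

text \<open>With the factorials absorbed, the Leibniz rule is a Cauchy product. The induction works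
  with the (n + 1)-fold multiple, since n + 1 = (n + 1 - i) + i matches the derivative falling on
  one factor or on the other; n + 1 cancels at the end.\<close>

lemma divided_deriv_mult:
  "divided_deriv x n (F * G) = (\<Sum>i\<le>n. divided_deriv x i F * divided_deriv x (n - i) G)"
proof (induction n)
  case 0
  show ?case by simp
next
  case (Suc n)
  let ?d = "divided_deriv x" and ?c = "\<lambda>n. fls_const (of_nat n :: complex)"
  have S: "fls_const x * fls_deriv (?d i H) = ?c (Suc i) * ?d (Suc i) H" for i H
    by (rule divided_deriv_Suc[symmetric])
  have "?c (Suc n) * ?d (Suc n) (F * G) = fls_const x * fls_deriv (\<Sum>i\<le>n. ?d i F * ?d (n - i) G)"
    by (simp only: divided_deriv_Suc Suc.IH)
  also have "\<dots> = (\<Sum>i\<le>n. ?d i F * (fls_const x * fls_deriv (?d (n - i) G)) +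
       (fls_const x * fls_deriv (?d i F)) * ?d (n - i) G)"
    by (simp add: fls_deriv_sum sum_distrib_left algebra_simps)
  also have "\<dots> = (\<Sum>i\<le>n. ?c (Suc n - i) * (?d i F * ?d (Suc n - i) G)) +
       (\<Sum>i\<le>n. ?c (Suc i) * (?d (Suc i) F * ?d (Suc n - Suc i) G))"
    unfolding S sum.distrib
    by (intro arg_cong2[where f = "(+)"] sum.cong) (simp_all add: Suc_diff_le mult_ac del: of_nat_Suc)
  also have "(\<Sum>i\<le>n. ?c (Suc n - i) * (?d i F * ?d (Suc n - i) G)) =
       (\<Sum>i\<le>Suc n. ?c (Suc n - i) * (?d i F * ?d (Suc n - i) G))"
    by simp
  also have "(\<Sum>i\<le>n. ?c (Suc i) * (?d (Suc i) F * ?d (Suc n - Suc i) G)) =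
       (\<Sum>i\<le>Suc n. ?c i * (?d i F * ?d (Suc n - i) G))"
    by (subst sum.atMost_Suc_shift) simp
  also have "(\<Sum>i\<le>Suc n. ?c (Suc n - i) * (?d i F * ?d (Suc n - i) G)) +
       (\<Sum>i\<le>Suc n. ?c i * (?d i F * ?d (Suc n - i) G)) =
       (\<Sum>i\<le>Suc n. (?c (Suc n - i) + ?c i) * (?d i F * ?d (Suc n - i) G))"
    by (simp only: sum.distrib[symmetric] distrib_right)
  also have "\<dots> = (\<Sum>i\<le>Suc n. ?c (Suc n) * (?d i F * ?d (Suc n - i) G))"
    by (rule sum.cong) (simp_all add: fls_plus_const of_nat_diff)
  also have "\<dots> = ?c (Suc n) * (\<Sum>i\<le>Suc n. ?d i F * ?d (Suc n - i) G)"
    by (simp only: sum_distrib_left)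
  finally have eq: "?c (Suc n) * ?d (Suc n) (F * G) = ?c (Suc n) * (\<Sum>i\<le>Suc n. ?d i F * ?d (Suc n - i) G)" .
  have "?c (Suc n) \<noteq> 0" by (simp del: of_nat_Suc)
  thus ?case using eq by (metis mult_left_cancel)
qed

lemma divided_deriv_one: "divided_deriv x n 1 = (if n = 0 then 1 else 0)"
proof -
  have "(fls_deriv ^^ n) (1 :: complex fls) = (if n = 0 then 1 else 0)"
    by (induction n) auto
  thus ?thesis by (simp add: divided_deriv_def)
qed

section \<open>The substitution of u - v + b h\<close>

definition shift_v :: "complex \<Rightarrow> complex fls fps \<Rightarrow> complex fls fps fps" where
  "shift_v b F = Abs_fps (\<lambda>l. subst_coeff b l F)"

lemma shift_v_nth: "fps_nth (shift_v b F) l = subst_coeff b l F"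
  by (simp add: shift_v_def)

text \<open>The substitution is done in two stages: \<open>taylor_h\<close> shifts u by b h and
  \<open>taylor_v\<close> shifts u by - v. Each is a ring homomorphism by the product rule for
  divided derivatives.\<close>

definition taylor_h :: "complex \<Rightarrow> complex fls \<Rightarrow> complex fls fps" where
  "taylor_h b F = Abs_fps (\<lambda>p. divided_deriv b p F)"

definition taylor_v :: "complex fls fps \<Rightarrow> complex fls fps fps" where
  "taylor_v F = Abs_fps (\<lambda>l. fps_map (divided_deriv (- 1) l) F)"

lemma taylor_h_hom: "unital_hom (taylor_h b)"
  by (rule unital_homI; rule fps_ext)
     (simp_all add: taylor_h_def divided_deriv_one divided_deriv_mult fps_mult_nth
       atLeast0AtMost Modules.additive.add[OF divided_deriv_additive])

lemma taylor_v_hom: "unital_hom taylor_v"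
proof (rule unital_homI; rule fps_ext; rule fps_ext)
  fix l k and F G :: "complex fls fps"
  show "fps_nth (fps_nth (taylor_v 1) l) k = fps_nth (fps_nth 1 l) k"
    by (simp add: taylor_v_def divided_deriv_one Modules.additive.zero[OF divided_deriv_additive])
  show "fps_nth (fps_nth (taylor_v (F + G)) l) k = fps_nth (fps_nth (taylor_v F + taylor_v G) l) k"
    by (simp add: taylor_v_def Modules.additive.add[OF divided_deriv_additive])
  show "fps_nth (fps_nth (taylor_v (F * G)) l) k = fps_nth (fps_nth (taylor_v F * taylor_v G) l) k"
    by (simp add: taylor_v_def fps_mult_nth Modules.additive.sum[OF divided_deriv_additive] fps_sum_nth
        divided_deriv_mult atLeast0AtMost) (rule sum.swap)
qed

text \<open>Both shifts expand along the same derivation, and the factors 1/l! and 1/p! already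
  account for the binomial coefficients of (- v + b h)^(l + p). Multiplicativity of
  \<open>shift_v\<close> is a consequence of this factorisation.\<close>

lemma shift_v_eq: "shift_v b F = taylor_v (fps_lift (taylor_h b) F)"
proof (rule fps_ext; rule fps_ext)
  fix l k
  have "divided_deriv (- 1) l (divided_deriv b p G) =
      fls_const ((- 1) ^ l * b ^ p / (fact l * fact p)) * (fls_deriv ^^ (l + p)) G" for p G
    unfolding divided_deriv_def funpow_fls_deriv_const_mult funpow_add o_def
    by (simp only: mult.assoc[symmetric] fls_const_mult_const) (simp add: field_simps)
  hence "fps_nth (fps_nth (taylor_v (fps_lift (taylor_h b) F)) l) k =
     (\<Sum>j\<le>k. fls_const ((- 1) ^ l * b ^ (k - j) / (fact l * fact (k - j))) *
         (fls_deriv ^^ (l + (k - j))) (fps_nth F j))"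
    by (simp add: taylor_v_def fps_lift_nth taylor_h_def Modules.additive.sum[OF divided_deriv_additive])
  also have "\<dots> = (\<Sum>p\<le>k. fls_const ((- 1) ^ l * b ^ p / (fact l * fact p)) *
         (fls_deriv ^^ (l + p)) (fps_nth F (k - p)))"
    by (rule sum.reindex_bij_witness[of _ "\<lambda>p. k - p" "\<lambda>p. k - p"]) auto
  finally show "fps_nth (fps_nth (shift_v b F) l) k =
      fps_nth (fps_nth (taylor_v (fps_lift (taylor_h b) F)) l) k"
    by (simp add: shift_v_def subst_coeff_def)
qed

lemma shift_v_hom: "unital_hom (shift_v b)"
  unfolding shift_v_eq[abs_def]
  by (rule unital_hom_comp[OF taylor_v_hom fps_lift_hom[OF taylor_h_hom]])

lemma shift_v_const: "shift_v b (hconst s) = fps_const (hconst s)"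
proof (rule fps_ext; rule fps_ext)
  fix l k
  have D: "divided_deriv x n (fls_const c) = (if n = 0 then fls_const c else 0)" for x n c
    using divided_deriv_one[of x n] unfolding divided_deriv_def
    by (metis funpow_fls_deriv_const_mult mult.left_commute mult.right_neutral mult_zero_right)
  have "fps_nth (fps_lift (taylor_h b) (hconst s)) k = (\<Sum>j\<le>k. if j = k then fls_const (fps_nth s k) else 0)" for k
    unfolding fps_lift_nth by (rule sum.cong) (auto simp: taylor_h_def hconst_def D)
  hence "fps_lift (taylor_h b) (hconst s) = hconst s"
    by (intro fps_ext) (simp add: hconst_def)
  thus "fps_nth (fps_nth (shift_v b (hconst s)) l) k = fps_nth (fps_nth (fps_const (hconst s)) l) k"
    by (simp add: shift_v_eq taylor_v_def hconst_def D)
qed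

subsection \<open>Square matrices as a ring\<close>

text \<open>As a ring type, square matrices can be nested: an operator on a tensor product becomes a
  matrix whose entries are matrices, and noncommutative ring identities apply to every
  layer.\<close>

typedef ('i, 's) sqm = "UNIV :: ('i \<Rightarrow> 'i \<Rightarrow> 's) set"
  morphisms sq Sqm ..

lemma sq_Sqm [simp]: "sq (Sqm f) = f"
  by (simp add: Sqm_inverse)

lemma sqm_eqI: "(\<And>i j. sq A i j = sq B i j) \<Longrightarrow> A = B"
  by (metis ext sq_inject)

instantiation sqm :: (finite, ring_1) ring_1
begin

definition zero_sqm :: "('a, 'b) sqm" where "0 = Sqm (\<lambda>i j. 0)"
definition one_sqm :: "('a, 'b) sqm" where "1 = Sqm (\<lambda>i j. if i = j then 1 else 0)"
definition plus_sqm :: "('a, 'b) sqm \<Rightarrow> ('a, 'b) sqm \<Rightarrow> ('a, 'b) sqm" where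
  "A + B = Sqm (\<lambda>i j. sq A i j + sq B i j)"
definition minus_sqm :: "('a, 'b) sqm \<Rightarrow> ('a, 'b) sqm \<Rightarrow> ('a, 'b) sqm" where
  "A - B = Sqm (\<lambda>i j. sq A i j - sq B i j)"
definition uminus_sqm :: "('a, 'b) sqm \<Rightarrow> ('a, 'b) sqm" where
  "- A = Sqm (\<lambda>i j. - sq A i j)"
definition times_sqm :: "('a, 'b) sqm \<Rightarrow> ('a, 'b) sqm \<Rightarrow> ('a, 'b) sqm" where
  "A * B = Sqm (\<lambda>i j. \<Sum>k\<in>UNIV. sq A i k * sq B k j)"

instance
proof
  fix a b c :: "('a, 'b) sqm"
  show "a + b + c = a + (b + c)" "a + b = b + a" "0 + a = a" "- a + a = 0" "a - b = a + - b"
    by (simp_all add: plus_sqm_def zero_sqm_def uminus_sqm_def minus_sqm_def add_ac sq_inverse)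
  show "(a + b) * c = a * c + b * c" "a * (b + c) = a * b + a * c"
    by (simp_all add: plus_sqm_def times_sqm_def distrib_left distrib_right sum.distrib)
  show "1 * a = a"
    by (rule sqm_eqI) (simp add: times_sqm_def one_sqm_def if_distrib[of "\<lambda>x. x * _"] cong: if_cong)
  show "a * 1 = a"
    by (rule sqm_eqI) (simp add: times_sqm_def one_sqm_def if_distrib[of "\<lambda>x. _ * x"] cong: if_cong)
  show "(0 :: ('a, 'b) sqm) \<noteq> 1"
  proof
    assume "(0 :: ('a, 'b) sqm) = 1"
    hence "sq (0 :: ('a, 'b) sqm) undefined undefined = sq 1 undefined undefined" by simp
    thus False by (simp add: zero_sqm_def one_sqm_def)
  qed
  show "a * b * c = a * (b * c)"
  proof (rule sqm_eqI)
    fix i j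
    have "sq (a * b * c) i j = (\<Sum>k\<in>UNIV. \<Sum>l\<in>UNIV. sq a i l * sq b l k * sq c k j)"
      by (simp add: times_sqm_def sum_distrib_right)
    also have "\<dots> = (\<Sum>l\<in>UNIV. \<Sum>k\<in>UNIV. sq a i l * sq b l k * sq c k j)"
      by (rule sum.swap)
    finally show "sq (a * b * c) i j = sq (a * (b * c)) i j"
      by (simp add: times_sqm_def sum_distrib_left mult.assoc)
  qed
qed

end

lemma sq_zero [simp]: "sq 0 i j = 0"
  and sq_one: "sq 1 i j = (if i = j then 1 else 0)"
  and sq_plus [simp]: "sq (A + B) i j = sq A i j + sq B i j"
  and sq_minus [simp]: "sq (A - B) i j = sq A i j - sq B i j"
  and sq_times: "sq (A * B) i j = (\<Sum>k\<in>UNIV. sq A i k * sq B k j)"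
  by (simp_all add: zero_sqm_def one_sqm_def plus_sqm_def minus_sqm_def times_sqm_def)

lemma sq_sum: "sq (sum f S) i j = (\<Sum>s\<in>S. sq (f s) i j)"
  by (induction S rule: infinite_finite_induct) simp_all

definition sq_map :: "('a \<Rightarrow> 'b) \<Rightarrow> ('i, 'a) sqm \<Rightarrow> ('i, 'b) sqm" where
  "sq_map f A = Sqm (\<lambda>i j. f (sq A i j))"

lemma sq_sq_map [simp]: "sq (sq_map f A) i j = f (sq A i j)"
  by (simp add: sq_map_def)

lemma sq_map_hom: "unital_hom f \<Longrightarrow> unital_hom (sq_map f :: ('i::finite, 'a::ring_1) sqm \<Rightarrow> ('i, 'b::ring_1) sqm)"
  by (rule unital_homI; rule sqm_eqI) (simp_all add: sq_one sq_times unital_hom_simps)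

definition sq_diag :: "'a::ring_1 \<Rightarrow> ('i::finite, 'a) sqm" where
  "sq_diag c = Sqm (\<lambda>i j. if i = j then c else 0)"

lemma sq_diag_mult_left: "sq (sq_diag c * A) i j = c * sq A i j"
  by (simp add: sq_times sq_diag_def if_distrib[of "\<lambda>x. x * _"] cong: if_cong)

lemma sq_diag_mult_right: "sq (A * sq_diag c) i j = sq A i j * c"
  by (simp add: sq_times sq_diag_def if_distrib[of "\<lambda>x. _ * x"] cong: if_cong)

lemma sq_diag_hom: "unital_hom (sq_diag :: 'a::ring_1 \<Rightarrow> ('i::finite, 'a) sqm)"
proof (rule unital_homI; rule sqm_eqI)
  fix i j :: 'i and x y :: 'a
  show "sq (sq_diag (x * y) :: ('i, 'a) sqm) i j = sq (sq_diag x * sq_diag y) i j"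
    unfolding sq_diag_mult_left by (simp add: sq_diag_def)
qed (simp_all add: sq_diag_def sq_one)

lemma sq_diag_central: "sq_diag (c :: 'a::comm_ring_1) * A = A * sq_diag c"
  by (rule sqm_eqI) (simp add: sq_diag_mult_left sq_diag_mult_right mult.commute)

definition of_mat :: "'s ^ 'i ^ 'i \<Rightarrow> ('i::finite, 's::ring_1) sqm" where
  "of_mat A = Sqm (\<lambda>i j. A $ i $ j)"

lemma sq_of_mat [simp]: "sq (of_mat A) i j = A $ i $ j"
  by (simp add: of_mat_def)

lemma of_mat_mult: "of_mat (A ** B) = of_mat A * of_mat B"
  by (rule sqm_eqI) (simp add: sq_times matrix_matrix_mult_def)

lemma of_mat_mat: "of_mat (mat c) = sq_diag c"
  by (rule sqm_eqI) (simp add: sq_diag_def mat_def)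

lemma sum_UNIV_prod: "(\<Sum>x\<in>UNIV. f x) = (\<Sum>a\<in>UNIV. \<Sum>b\<in>UNIV. f (a, b))"
  by (simp add: sum.cartesian_product flip: UNIV_Times_UNIV)

subsection \<open>Operators on two of three tensor factors\<close>

definition legs12 :: "('n \<times> 'n, 's::ring_1) sqm \<Rightarrow> ('n::finite \<times> 'n \<times> 'n, 's) sqm" where
  "legs12 X = Sqm (\<lambda>(a, b, c) (a', b', c'). if c = c' then sq X (a, b) (a', b') else 0)"
definition legs13 :: "('n \<times> 'n, 's::ring_1) sqm \<Rightarrow> ('n::finite \<times> 'n \<times> 'n, 's) sqm" where
  "legs13 X = Sqm (\<lambda>(a, b, c) (a', b', c'). if b = b' then sq X (a, c) (a', c') else 0)"
definition legs23 :: "('n \<times> 'n, 's::ring_1) sqm \<Rightarrow> ('n::finite \<times> 'n \<times> 'n, 's) sqm" where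
  "legs23 X = Sqm (\<lambda>(a, b, c) (a', b', c'). if a = a' then sq X (b, c) (b', c') else 0)"

lemmas legs_defs = legs12_def legs13_def legs23_def

lemma if_mult_distribs:
  "(if P then x else 0) * y = (if P then x * y else (0 :: 'a::semiring_1))"
  "y * (if P then x else 0) = (if P then y * x else (0 :: 'a::semiring_1))"
  by simp_all

lemma sum_if_const: "(\<Sum>x\<in>A. if P then f x else 0) = (if P then sum f A else (0 :: 'a::semiring_1))"
  by simp

lemma legs_hom:
  "unital_hom (legs12 :: _ \<Rightarrow> ('n::finite \<times> 'n \<times> 'n, 's::ring_1) sqm)"
  "unital_hom (legs13 :: _ \<Rightarrow> ('n::finite \<times> 'n \<times> 'n, 's::ring_1) sqm)"
  "unital_hom (legs23 :: _ \<Rightarrow> ('n::finite \<times> 'n \<times> 'n, 's::ring_1) sqm)"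
  by (rule unital_homI; rule sqm_eqI;
      force simp: legs_defs sq_one sq_times sum_UNIV_prod if_mult_distribs sum_if_const cong: if_cong)+

lemmas sq_legs_simps = legs_defs sq_times sum_UNIV_prod if_mult_distribs sum_if_const
  sum_distrib_right sum_distrib_left

lemma if_conj_eq: "(if P \<and> Q then x else y) = (if P then if Q then x else y else y)"
  by simp

lemma sum_rotate:
  "(\<Sum>a\<in>A. \<Sum>b\<in>B. \<Sum>c\<in>C. f a b c) = (\<Sum>c\<in>C. \<Sum>a\<in>A. \<Sum>b\<in>B. f a b c)"
  by (subst sum.swap[of _ C B], subst sum.swap[of _ C A]) (rule refl)

lemma sq_legs_12_13_23:
  "sq (legs12 X * legs13 Y * legs23 Z) (a, b, c) (a', b', c') =
     (\<Sum>p\<in>UNIV. \<Sum>q\<in>UNIV. \<Sum>r\<in>UNIV. sq X (a, b) (p, q) * sq Y (p, c) (a', r) * sq Z (q, r) (b', c'))"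
  by (simp add: sq_legs_simps cong: if_cong) (rule sum_rotate)

lemma sq_legs_23_13_12:
  "sq (legs23 Z * legs13 Y * legs12 X) (a, b, c) (a', b', c') =
     (\<Sum>p\<in>UNIV. \<Sum>q\<in>UNIV. \<Sum>r\<in>UNIV. sq Z (b, c) (q, r) * sq Y (a, r) (p, c') * sq X (p, q) (a', b'))"
  by (simp add: sq_legs_simps cong: if_cong)

lemma sq_legs_23_12_23:
  "sq (legs23 X * legs12 Y * legs23 Z) (a, b, c) (a', b', c') =
     (\<Sum>p\<in>UNIV. \<Sum>q\<in>UNIV. \<Sum>r\<in>UNIV. sq X (b, c) (p, q) * sq Y (a, p) (a', r) * sq Z (r, q) (b', c'))"
  by (simp add: sq_legs_simps cong: if_cong) (rule trans[OF sum_rotate sum.cong[OF refl sum.swap]])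

lemma sq_legs_12_23_12:
  "sq (legs12 X * legs23 Y * legs12 Z) (a, b, c) (a', b', c') =
     (\<Sum>p\<in>UNIV. \<Sum>q\<in>UNIV. \<Sum>r\<in>UNIV. sq X (a, b) (q, r) * sq Y (r, c) (p, c') * sq Z (q, p) (a', b'))"
  by (simp add: sq_legs_simps cong: if_cong) (rule sum.swap)

text \<open>After expanding, the cubic terms agree by the braid relation. The Hecke relation turns C
  r^2 into C Z r + C, and \<open>rel\<close> then makes the coefficient of both r1 and r2 equal to A
  B on either side.\<close>

lemma braid_spectral:
  fixes r1 r2 :: "'a::ring_1"
  assumes braid: "r1 * r2 * r1 = r2 * r1 * r2"
    and hecke: "r1 * r1 = Z * r1 + 1" "r2 * r2 = Z * r2 + 1"
    and central: "\<And>x. x * A = A * x" "\<And>x. x * B = B * x" "\<And>x. x * C = C * x"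
    and rel: "C * Z + C * A + C * B = A * B"
  shows "(r2 + A) * (r1 + C) * (r2 + B) = (r1 + B) * (r2 + C) * (r1 + A)"
proof -
  have "(r2 + A) * (r1 + C) * (r2 + B) =
      r2 * r1 * r2 + A * (r1 * r2) + B * (r2 * r1) + C * (r2 * r2) + (C * B + C * A) * r2 + A * B * r1 + A * B * C"
  proof -
    have "r2 * r1 * B = B * (r2 * r1)" "r2 * C * r2 = C * (r2 * r2)" "r2 * C * B = C * B * r2"
      "A * r1 * B = A * B * r1" "A * C * r2 = C * A * r2" "A * C * B = A * B * C"
      using central by (metis mult.assoc)+
    thus ?thesis by (simp add: distrib_left distrib_right mult.assoc add_ac)
  qed
  also have "\<dots> = r2 * r1 * r2 + A * (r1 * r2) + B * (r2 * r1) + A * B * r2 + A * B * r1 + C + A * B * C"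
    unfolding hecke rel[symmetric] by (simp add: distrib_left distrib_right mult.assoc add_ac)
  also have "\<dots> = r1 * r2 * r1 + A * (r1 * r2) + B * (r2 * r1) + C * (r1 * r1) + (C * B + C * A) * r1 + A * B * r2 + A * B * C"
    unfolding hecke braid rel[symmetric] by (simp add: distrib_left distrib_right mult.assoc add_ac)
  also have "\<dots> = (r1 + B) * (r2 + C) * (r1 + A)"
  proof -
    have "r1 * r2 * A = A * (r1 * r2)" "r1 * C * r1 = C * (r1 * r1)" "r1 * C * A = C * A * r1"
      "B * r2 * A = A * B * r2" "B * C * r1 = C * B * r1" "B * C * A = A * B * C"
      using central by (metis mult.assoc)+
    thus ?thesis by (simp add: distrib_left distrib_right mult.assoc add_ac)
  qed
  finally show ?thesis .
qed

text \<open>The product P X with the flip P on the left.\<close>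

definition flip_rows :: "('n \<times> 'n, 's) sqm \<Rightarrow> ('n \<times> 'n, 's) sqm" where
  "flip_rows X = Sqm (\<lambda>p. sq X (prod.swap p))"

text \<open>The condition \<open>rel\<close> is the identity satisfied by \<alpha> = 1/(x - 1),
  \<beta> = 1/(y - 1) and \<gamma> = 1/(x y - 1). The flips in \<open>Rm\<close> convert the braid
  form of the equation, which involves neighbouring legs only, into the form with legs 12, 13 and
  23.\<close>

lemma yang_baxter_hecke:
  fixes r :: "('n::finite \<times> 'n, 's::comm_ring_1) sqm"
  assumes braid: "legs12 r * legs23 r * legs12 r = legs23 r * legs12 r * legs23 r"
    and hecke: "r * r = sq_diag z * r + 1"
    and rel: "\<gamma> * (1 + \<alpha> + \<beta>) = \<alpha> * \<beta>"
  defines "Rm \<equiv> \<lambda>x. flip_rows (r + sq_diag (z * x))"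
  shows "legs12 (Rm \<alpha>) * legs13 (Rm \<gamma>) * legs23 (Rm \<beta>) = legs23 (Rm \<beta>) * legs13 (Rm \<gamma>) * legs12 (Rm \<alpha>)"
proof (rule sqm_eqI)
  let ?d = "sq_diag :: 's \<Rightarrow> ('n \<times> 'n \<times> 'n, 's) sqm"
  let ?m = "\<lambda>x. r + sq_diag (z * x)"
  have diag: "legs12 (sq_diag x) = ?d x" "legs23 (sq_diag x) = ?d x" for x
    by (rule sqm_eqI; force simp: legs_defs sq_diag_def)+
  have "(legs23 r + ?d (z * \<alpha>)) * (legs12 r + ?d (z * \<gamma>)) * (legs23 r + ?d (z * \<beta>)) =
      (legs12 r + ?d (z * \<beta>)) * (legs23 r + ?d (z * \<gamma>)) * (legs12 r + ?d (z * \<alpha>))"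
  proof (rule braid_spectral[where Z = "?d z"])
    show "legs12 r * legs12 r = ?d z * legs12 r + 1" "legs23 r * legs23 r = ?d z * legs23 r + 1"
      unfolding unital_hom_mult[OF legs_hom(1), symmetric] unital_hom_mult[OF legs_hom(3), symmetric] hecke
      by (simp_all add: diag unital_hom_simps[OF legs_hom(1)] unital_hom_simps[OF legs_hom(3)])
    have "z * \<gamma> * z + z * \<gamma> * (z * \<alpha>) + z * \<gamma> * (z * \<beta>) = z * z * (\<gamma> * (1 + \<alpha> + \<beta>))"
      by (simp add: algebra_simps)
    also have "\<dots> = z * \<alpha> * (z * \<beta>)" by (simp add: rel)
    finally show "?d (z * \<gamma>) * ?d z + ?d (z * \<gamma>) * ?d (z * \<alpha>) + ?d (z * \<gamma>) * ?d (z * \<beta>) = ?d (z * \<alpha>) * ?d (z * \<beta>)"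
      by (simp flip: unital_hom_mult[OF sq_diag_hom] unital_hom_add[OF sq_diag_hom])
  qed (simp_all add: braid sq_diag_central)
  hence eq: "legs23 (?m \<alpha>) * legs12 (?m \<gamma>) * legs23 (?m \<beta>) = legs12 (?m \<beta>) * legs23 (?m \<gamma>) * legs12 (?m \<alpha>)"
    by (simp add: unital_hom_add[OF legs_hom(1)] unital_hom_add[OF legs_hom(3)] diag)
  fix i j :: "'n \<times> 'n \<times> 'n"
  obtain a b c a' b' c' where ij: "i = (a, b, c)" "j = (a', b', c')" by (metis prod.exhaust)
  \<comment> \<open>Collecting the three flips on the left reverses the order of the tensor factors,
    whence the row index \<open>(c, b, a)\<close>.\<close>
  have "sq (legs12 (Rm \<alpha>) * legs13 (Rm \<gamma>) * legs23 (Rm \<beta>)) i j =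
      sq (legs23 (?m \<alpha>) * legs12 (?m \<gamma>) * legs23 (?m \<beta>)) (c, b, a) (a', b', c')"
    unfolding ij sq_legs_12_13_23 sq_legs_23_12_23 by (simp add: Rm_def flip_rows_def)
  also have "\<dots> = sq (legs12 (?m \<beta>) * legs23 (?m \<gamma>) * legs12 (?m \<alpha>)) (c, b, a) (a', b', c')"
    by (simp only: eq)
  also have "\<dots> = sq (legs23 (Rm \<beta>) * legs13 (Rm \<gamma>) * legs12 (Rm \<alpha>)) i j"
    unfolding ij sq_legs_23_13_12 sq_legs_12_23_12 by (simp add: Rm_def flip_rows_def)
  finally show "sq (legs12 (Rm \<alpha>) * legs13 (Rm \<gamma>) * legs23 (Rm \<beta>)) i j =
    sq (legs23 (Rm \<beta>) * legs13 (Rm \<gamma>) * legs12 (Rm \<alpha>)) i j" .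
qed

subsection \<open>Evaluation of products of tensor operators\<close>

lemma multi_upd: "\<alpha> \<in> multi L \<Longrightarrow> r \<in> L \<Longrightarrow> \<alpha>(r := x) \<in> multi L"
  by (auto simp: multi_def PiE_iff extensional_def)

lemma finite_multi: "finite L \<Longrightarrow> finite (multi L :: (nat \<Rightarrow> 'n::finite) set)"
  by (simp add: multi_def finite_PiE)

lemma multi_eqI: "\<alpha> \<in> multi L \<Longrightarrow> \<beta> \<in> multi L \<Longrightarrow> (\<And>t. t \<in> L \<Longrightarrow> \<alpha> t = \<beta> t) \<Longrightarrow> \<alpha> = \<beta>"
  by (auto simp: multi_def intro: PiE_ext)

lemma sum_multi_leg:
  fixes f :: "(nat \<Rightarrow> 'n::finite) \<Rightarrow> 's::semiring_1"
  assumes "finite L" "\<alpha> \<in> multi L" "r \<in> L"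
  shows "(\<Sum>\<gamma>\<in>multi L. if \<forall>t\<in>L - {r}. \<alpha> t = \<gamma> t then f \<gamma> else 0) = (\<Sum>x\<in>UNIV. f (\<alpha>(r := x)))"
proof -
  have "(\<Sum>\<gamma>\<in>multi L. if \<forall>t\<in>L - {r}. \<alpha> t = \<gamma> t then f \<gamma> else 0) =
      sum f {\<gamma> \<in> multi L. \<forall>t\<in>L - {r}. \<alpha> t = \<gamma> t}"
    using assms by (simp add: sum.If_cases finite_multi Int_def)
  also have "\<dots> = (\<Sum>x\<in>UNIV. f (\<alpha>(r := x)))"
  proof (rule sum.reindex_bij_witness[of _ "\<lambda>x. \<alpha>(r := x)" "\<lambda>\<gamma>. \<gamma> r"])
    fix \<gamma> assume "\<gamma> \<in> {\<gamma> \<in> multi L. \<forall>t\<in>L - {r}. \<alpha> t = \<gamma> t}"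
    thus "\<alpha>(r := \<gamma> r) = \<gamma>" by (auto intro!: multi_upd multi_eqI[of _ L] assms)
    thus "f (\<alpha>(r := \<gamma> r)) = f \<gamma>" by simp
  qed (auto intro!: multi_upd assms)
  finally show ?thesis .
qed

lemma sum_multi_legs:
  fixes f :: "(nat \<Rightarrow> 'n::finite) \<Rightarrow> 's::semiring_1"
  assumes "finite L" "\<alpha> \<in> multi L" "r \<in> L" "s \<in> L" "r \<noteq> s"
  shows "(\<Sum>\<gamma>\<in>multi L. if \<forall>t\<in>L - {r, s}. \<alpha> t = \<gamma> t then f \<gamma> else 0) =
    (\<Sum>x\<in>UNIV. \<Sum>y\<in>UNIV. f (\<alpha>(r := x, s := y)))"
proof -
  have "(\<Sum>\<gamma>\<in>multi L. if \<forall>t\<in>L - {r, s}. \<alpha> t = \<gamma> t then f \<gamma> else 0) =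
      sum f {\<gamma> \<in> multi L. \<forall>t\<in>L - {r, s}. \<alpha> t = \<gamma> t}"
    using assms by (simp add: sum.If_cases finite_multi Int_def)
  also have "\<dots> = (\<Sum>p\<in>UNIV. f (\<alpha>(r := fst p, s := snd p)))"
  proof (rule sum.reindex_bij_witness[of _ "\<lambda>p. \<alpha>(r := fst p, s := snd p)" "\<lambda>\<gamma>. (\<gamma> r, \<gamma> s)"])
    fix \<gamma> assume "\<gamma> \<in> {\<gamma> \<in> multi L. \<forall>t\<in>L - {r, s}. \<alpha> t = \<gamma> t}"
    thus "\<alpha>(r := fst (\<gamma> r, \<gamma> s), s := snd (\<gamma> r, \<gamma> s)) = \<gamma>"
      by (auto intro!: multi_upd multi_eqI[of _ L] assms)
    thus "f (\<alpha>(r := fst (\<gamma> r, \<gamma> s), s := snd (\<gamma> r, \<gamma> s))) = f \<gamma>" by simp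
  qed (use \<open>r \<noteq> s\<close> in \<open>auto intro!: multi_upd assms\<close>)
  finally show ?thesis by (simp add: sum_UNIV_prod)
qed

lemma tmult_on_leg:
  assumes "finite L" "\<alpha> \<in> multi L" "r \<in> L"
  shows "tmult L (on_leg L r A) B \<alpha> \<beta> = (\<Sum>x\<in>UNIV. A $ \<alpha> r $ x * B (\<alpha>(r := x)) \<beta>)"
  using sum_multi_leg[OF assms, of "\<lambda>\<gamma>. A $ \<alpha> r $ \<gamma> r * B \<gamma> \<beta>"]
  by (simp add: tmult_def on_leg_def if_mult_distribs cong: if_cong)

lemma tmult_on_legs:
  assumes "finite L" "\<alpha> \<in> multi L" "r \<in> L" "s \<in> L" "r \<noteq> s"
  shows "tmult L (on_legs L r s A) B \<alpha> \<beta> =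
    (\<Sum>x\<in>UNIV. \<Sum>y\<in>UNIV. A $ (\<alpha> r, \<alpha> s) $ (x, y) * B (\<alpha>(r := x, s := y)) \<beta>)"
  using sum_multi_legs[OF assms, of "\<lambda>\<gamma>. A $ (\<alpha> r, \<alpha> s) $ (\<gamma> r, \<gamma> s) * B \<gamma> \<beta>"] \<open>r \<noteq> s\<close>
  by (simp add: tmult_def on_legs_def if_mult_distribs cong: if_cong)

lemma tmult_on_legs_right:
  assumes "finite L" "\<beta> \<in> multi L" "r \<in> L" "s \<in> L" "r \<noteq> s"
  shows "tmult L B (on_legs L r s A) \<alpha> \<beta> =
    (\<Sum>x\<in>UNIV. \<Sum>y\<in>UNIV. B \<alpha> (\<beta>(r := x, s := y)) * A $ (x, y) $ (\<beta> r, \<beta> s))"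
proof -
  have "tmult L B (on_legs L r s A) \<alpha> \<beta> =
      (\<Sum>\<gamma>\<in>multi L. if \<forall>t\<in>L - {r, s}. \<beta> t = \<gamma> t then B \<alpha> \<gamma> * A $ (\<gamma> r, \<gamma> s) $ (\<beta> r, \<beta> s) else 0)"
    unfolding tmult_def on_legs_def by (rule sum.cong) auto
  also have "\<dots> = (\<Sum>x\<in>UNIV. \<Sum>y\<in>UNIV. B \<alpha> (\<beta>(r := x, s := y)) * A $ (x, y) $ (\<beta> r, \<beta> s))"
    using sum_multi_legs[OF assms, of "\<lambda>\<gamma>. B \<alpha> \<gamma> * A $ (\<gamma> r, \<gamma> s) $ (\<beta> r, \<beta> s)"] \<open>r \<noteq> s\<close> by simp
  finally show ?thesis .
qed

lemma tmult_assoc: "tmult L (tmult L A B) C = tmult L A (tmult L B C)"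
proof (intro ext)
  fix \<alpha> \<beta>
  have "tmult L (tmult L A B) C \<alpha> \<beta> = (\<Sum>\<gamma>\<in>multi L. \<Sum>\<delta>\<in>multi L. A \<alpha> \<delta> * B \<delta> \<gamma> * C \<gamma> \<beta>)"
    by (simp add: tmult_def sum_distrib_right)
  also have "\<dots> = (\<Sum>\<delta>\<in>multi L. \<Sum>\<gamma>\<in>multi L. A \<alpha> \<delta> * B \<delta> \<gamma> * C \<gamma> \<beta>)"
    by (rule sum.swap)
  finally show "tmult L (tmult L A B) C \<alpha> \<beta> = tmult L A (tmult L B C) \<alpha> \<beta>"
    by (simp add: tmult_def sum_distrib_left mult.assoc)
qed

lemma tmult_one_right:
  fixes A :: "('n::finite, 's::semiring_1) tens"
  assumes "finite L" "\<beta> \<in> multi L"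
  shows "tmult L A (\<lambda>\<alpha> \<beta>. if \<alpha> = \<beta> then 1 else 0) \<alpha> \<beta> = A \<alpha> \<beta>"
  using assms by (simp add: tmult_def if_mult_distribs finite_multi cong: if_cong)

subsection \<open>Consequences of the Hecke relation\<close>

lemma hecke_symmetry_braid:
  fixes R :: "complex fps ^ ('n::finite \<times> 'n) ^ ('n \<times> 'n)"
  assumes "hecke_symmetry R"
  shows "legs12 (of_mat R) * legs23 (of_mat R) * legs12 (of_mat R) =
    legs23 (of_mat R) * legs12 (of_mat R) * legs23 (of_mat R)"
proof (rule sqm_eqI)
  fix i j :: "'n \<times> 'n \<times> 'n"
  obtain a b c a' b' c' where ij: "i = (a, b, c)" "j = (a', b', c')" by (metis prod.exhaust)
  let ?L = "{1, 2, 3 :: nat}"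
  \<comment> \<open>Elements of \<open>multi\<close> are extensional functions, so labels outside
    \<open>?L\<close> must carry the value \<open>undefined\<close>.\<close>
  define e :: "nat \<Rightarrow> 'n" where "e = (\<lambda>_. undefined)"
  define \<alpha> where "\<alpha> = e(1 := a, 2 := b, 3 := c)"
  define \<beta> where "\<beta> = e(1 := a', 2 := b', 3 := c')"
  have in_multi: "e(1 := x, 2 := y, 3 := z) \<in> multi ?L" for x y z
    by (auto simp: e_def multi_def PiE_iff extensional_def)
  hence m: "\<alpha> \<in> multi ?L" "\<beta> \<in> multi ?L" by (simp_all add: \<alpha>_def \<beta>_def)
  have upd: "e(1 := x, 2 := y, 3 := z, 1 := x') = e(1 := x', 2 := y, 3 := z)"
    "e(1 := x, 2 := y, 3 := z, 2 := y') = e(1 := x, 2 := y', 3 := z)"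
    "e(1 := x, 2 := y, 3 := z, 3 := z') = e(1 := x, 2 := y, 3 := z')"  for x y z x' y' z'
    by (auto simp: fun_eq_iff)
  have eq: "e(1 := x, 2 := y, 3 := z) = e(1 := x', 2 := y', 3 := z') \<longleftrightarrow> x = x' \<and> y = y' \<and> z = z'"
    for x y z x' y' z'
    by (auto dest: fun_cong[of _ _ 1] fun_cong[of _ _ 2] fun_cong[of _ _ 3])
  let ?R12 = "on_legs ?L 1 2 R" and ?R23 = "on_legs ?L 2 3 R"
  have v: "(e(1 := x, 2 := y, 3 := z)) 1 = x" "(e(1 := x, 2 := y, 3 := z)) 2 = y"
      "(e(1 := x, 2 := y, 3 := z)) 3 = z" for x y z by simp_all
  note ev = tprod_def foldr.simps id_apply o_apply tmult_on_legs in_multi upd v eq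
  have L: "tprod ?L [?R12, ?R23, ?R12] \<alpha> \<beta> =
     (\<Sum>p\<in>UNIV. \<Sum>q\<in>UNIV. \<Sum>r\<in>UNIV. R $ (a, b) $ (q, r) * R $ (r, c) $ (p, c') * R $ (q, p) $ (a', b'))"
    unfolding \<alpha>_def \<beta>_def
    by (simp add: ev if_conj_eq if_mult_distribs sum_if_const sum_distrib_left mult.assoc
        del: fun_upd_apply One_nat_def cong: if_cong) (rule sum_rotate)
  have R: "tprod ?L [?R23, ?R12, ?R23] \<alpha> \<beta> =
     (\<Sum>p\<in>UNIV. \<Sum>q\<in>UNIV. \<Sum>r\<in>UNIV. R $ (b, c) $ (p, q) * R $ (a, p) $ (a', r) * R $ (r, q) $ (b', c'))"
    unfolding \<alpha>_def \<beta>_def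
    by (simp add: ev if_conj_eq if_mult_distribs sum_if_const sum_distrib_left mult.assoc
        del: fun_upd_apply One_nat_def cong: if_cong)
  have "tprod ?L [?R12, ?R23, ?R12] \<alpha> \<beta> = tprod ?L [?R23, ?R12, ?R23] \<alpha> \<beta>"
    using assms m by (auto simp: hecke_symmetry_def tens_eq_def Let_def)
  thus "sq (legs12 (of_mat R) * legs23 (of_mat R) * legs12 (of_mat R)) i j =
    sq (legs23 (of_mat R) * legs12 (of_mat R) * legs23 (of_mat R)) i j"
    unfolding L R ij sq_legs_12_23_12 sq_legs_23_12_23 by simp
qed

lemma hecke_symmetry_quadratic:
  fixes R :: "complex fps ^ ('n::finite \<times> 'n) ^ ('n \<times> 'n)"
  assumes "hecke_symmetry R"
  shows "of_mat R * of_mat R = sq_diag (fps_exp 1 - fps_exp (- 1)) * of_mat R + 1"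
proof -
  let ?r = "of_mat R" and ?d = "sq_diag :: _ \<Rightarrow> ('n \<times> 'n, complex fps) sqm"
  have add: "of_mat (A + B) = of_mat A + of_mat B" "of_mat (A - B) = of_mat A - of_mat B"
    "of_mat 0 = (0 :: ('n \<times> 'n, complex fps) sqm)" for A B :: "complex fps ^ ('n \<times> 'n) ^ ('n \<times> 'n)"
    by (rule sqm_eqI; simp)+
  have "of_mat ((R - mat (fps_exp 1)) ** (R + mat (fps_exp (- 1)))) = of_mat 0"
    using assms by (simp add: hecke_symmetry_def)
  hence "(?r - ?d (fps_exp 1)) * (?r + ?d (fps_exp (- 1))) = 0"
    by (simp add: of_mat_mult add of_mat_mat)
  moreover have "?d (fps_exp 1) * ?d (fps_exp (- 1)) = 1"
    by (simp flip: unital_hom_mult[OF sq_diag_hom] fps_exp_add_mult add: unital_hom_one[OF sq_diag_hom])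
  ultimately show ?thesis
    by (simp add: algebra_simps unital_hom_diff[OF sq_diag_hom] sq_diag_central[of _ ?r])
qed

subsection \<open>Laurent series in two variables\<close>

text \<open>In \<open>'a fls fls fps\<close> the inner Laurent variable is \<open>u\<close>, the outer one is \<open>v\<close> and the power
  series variable is \<open>h\<close>; a further outer power series variable is \<open>w\<close>.\<close>

definition incl_u :: "'a::zero fls fps \<Rightarrow> 'a fls fls fps" where
  "incl_u = fps_map fls_const"

text \<open>A renaming of the Laurent variable from u to v: every coefficient becomes a series
  constant in u.\<close>

definition incl_v :: "'a::zero fls fps \<Rightarrow> 'a fls fls fps" where
  "incl_v = fps_map (fls_map fls_const)"

definition incl_uv :: "'a::zero fls fps fps \<Rightarrow> 'a fls fls fps" where
  "incl_uv X = Abs_fps (\<lambda>k. fps_to_fls (Abs_fps (\<lambda>l. fps_nth (fps_nth X l) k)))"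

lemma incl_u_hom: "unital_hom (incl_u :: 'a::ring_1 fls fps \<Rightarrow> _)"
  unfolding incl_u_def by (intro fps_map_hom fls_const_hom)

lemma incl_v_hom: "unital_hom (incl_v :: 'a::ring_1 fls fps \<Rightarrow> _)"
  unfolding incl_v_def by (intro fps_map_hom fls_map_hom fls_const_hom)

lemma incl_uv_hom: "unital_hom (incl_uv :: 'a::ring_1 fls fps fps \<Rightarrow> _)"
proof (rule unital_homI; rule fps_ext)
  fix k and X Y :: "'a fls fps fps"
  have "Abs_fps (\<lambda>l. fps_nth (fps_nth (1 :: 'a fls fps fps) l) k) = (if k = 0 then 1 else 0)"
    by (rule fps_ext) simp
  thus "fps_nth (incl_uv (1 :: 'a fls fps fps)) k = fps_nth 1 k"
    by (simp add: incl_uv_def)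
  have "Abs_fps (\<lambda>l. fps_nth (fps_nth (X + Y) l) k) =
      Abs_fps (\<lambda>l. fps_nth (fps_nth X l) k) + Abs_fps (\<lambda>l. fps_nth (fps_nth Y l) k)"
    by (rule fps_ext) simp
  thus "fps_nth (incl_uv (X + Y)) k = fps_nth (incl_uv X + incl_uv Y) k"
    by (simp add: incl_uv_def)
  have "Abs_fps (\<lambda>l. fps_nth (fps_nth (X * Y) l) k) =
      (\<Sum>j=0..k. Abs_fps (\<lambda>l. fps_nth (fps_nth X l) j) * Abs_fps (\<lambda>l. fps_nth (fps_nth Y l) (k - j)))"
    by (rule fps_ext) (simp add: fps_mult_nth fps_sum_nth sum.swap[of _ "{0..k}"])
  thus "fps_nth (incl_uv (X * Y)) k = fps_nth (incl_uv X * incl_uv Y) k"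
    by (simp add: incl_uv_def fps_mult_nth unital_hom_sum[OF fps_to_fls_hom] unital_hom_mult[OF fps_to_fls_hom])
qed

text \<open>The values F(u - v + b h), F(u - w + b h) and F(v - w + b h) in one common ring. Each
  difference is expanded in negative powers of its first variable, so u and v are Laurent variables
  and w is a power series variable.\<close>

definition at_uv :: "complex \<Rightarrow> complex fls fps \<Rightarrow> complex fls fls fps fps" where
  "at_uv b F = fps_const (incl_uv (shift_v b F))"

definition at_uw :: "complex \<Rightarrow> complex fls fps \<Rightarrow> complex fls fls fps fps" where
  "at_uw b F = fps_map incl_u (shift_v b F)"

definition at_vw :: "complex \<Rightarrow> complex fls fps \<Rightarrow> complex fls fls fps fps" where
  "at_vw b F = fps_map incl_v (shift_v b F)"

lemma at_hom: "unital_hom (at_uv b)" "unital_hom (at_uw b)" "unital_hom (at_vw b)"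
  unfolding at_uv_def[abs_def] at_uw_def[abs_def] at_vw_def[abs_def]
  by (intro unital_hom_comp[OF _ shift_v_hom] unital_hom_comp[OF fps_const_hom incl_uv_hom]
      fps_map_hom incl_u_hom incl_v_hom)+

text \<open>Series in h alone have the same image under all three substitutions, so one embedding
  serves for the entries of the constant matrix R in all legs.\<close>

lemma at_hconst:
  "at_uw b (hconst s) = at_uv b' (hconst s)" "at_vw b (hconst s) = at_uv b' (hconst s)"
proof -
  have "Abs_fps (\<lambda>l. fps_nth (fps_nth (fps_const (hconst s)) l) k) = fps_const (fls_const (fps_nth s k))" for k
    by (rule fps_ext) (simp add: hconst_def)
  hence 1: "incl_uv (fps_const (hconst s)) = Abs_fps (\<lambda>k. fls_const (fls_const (fps_nth s k)))"
    by (simp add: incl_uv_def fps_const_to_fls)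
  have 2: "incl_u (hconst s) = Abs_fps (\<lambda>k. fls_const (fls_const (fps_nth s k)))"
    by (rule fps_ext) (simp add: incl_u_def hconst_def)
  have 3: "incl_v (hconst s) = Abs_fps (\<lambda>k. fls_const (fls_const (fps_nth s k)))"
    by (rule fps_ext, rule fls_eqI) (simp add: incl_v_def hconst_def fls_map_nth)
  show "at_uw b (hconst s) = at_uv b' (hconst s)" "at_vw b (hconst s) = at_uv b' (hconst s)"
    unfolding at_uv_def at_uw_def at_vw_def shift_v_const
    by (simp_all add: fps_map_const 1 2 3 unital_hom_zero[OF incl_u_hom] unital_hom_zero[OF incl_v_hom])
qed

section \<open>Exponentials of the spectral parameter\<close>

definition uexp :: "complex \<Rightarrow> complex fls" where
  "uexp s = fps_to_fls (fps_exp s)"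

lemma divided_deriv_uexp: "divided_deriv x n (uexp s) = fls_const ((x * s) ^ n / fact n) * uexp s"
proof -
  have "(fls_deriv ^^ n) (uexp s) = fls_const (s ^ n) * uexp s"
  proof (induction n)
    case (Suc n)
    have "fls_deriv (uexp s) = fls_const s * uexp s"
      by (simp add: uexp_def fls_deriv_fps_to_fls fls_times_fps_to_fls)
    hence "(fls_deriv ^^ Suc n) (uexp s) = fls_const (s ^ n) * (fls_const s * uexp s)"
      by (simp add: Suc)
    thus ?case by (simp add: fls_const_mult_const mult.assoc[symmetric] mult.commute)
  qed simp
  thus ?thesis
    by (simp add: divided_deriv_def mult.assoc[symmetric] fls_const_mult_const power_mult_distrib)
qed

lemma shift_v_uexp_nth:
  "fps_nth (fps_nth (shift_v b (fps_const (uexp s))) l) k =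
     fls_const ((- s) ^ l / fact l) * fls_const ((b * s) ^ k / fact k) * uexp s"
proof -
  have c: "divided_deriv x n (fls_const c * F) = fls_const c * divided_deriv x n F" for x n c F
    by (simp add: divided_deriv_def funpow_fls_deriv_const_mult)
  have "fps_lift (taylor_h b) (fps_const (uexp s)) = taylor_h b (uexp s)"
    by (rule fps_lift_const) (rule unital_hom_zero[OF taylor_h_hom])
  thus ?thesis
    by (simp add: shift_v_eq taylor_v_def taylor_h_def divided_deriv_uexp c mult.assoc[symmetric])
       (simp add: mult.commute)
qed

text \<open>The functional equation e^(s (u - v)) e^(s (v - w)) = e^(s (u - w)), in which the shifts
  by h add up. It turns additive parameters into the multiplicative ones of the Hecke form of the
  Yang-Baxter equation. For fixed powers of w and h the sum over the splittings of the power of h is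
  the addition law of \<open>fps_exp\<close>.\<close>

lemma at_uexp:
  "at_uv b (fps_const (uexp s)) * at_vw b' (fps_const (uexp s)) = at_uw (b + b') (fps_const (uexp s))"
proof (rule fps_ext, rule fps_ext)
  fix l k
  let ?e = "fps_const (uexp s)"
  let ?V = "\<lambda>s. fls_map fls_const (uexp s) :: complex fls fls"
  let ?c = "\<lambda>x. fls_const (fls_const x) :: complex fls fls"
  note hV = fls_map_hom[OF fls_const_hom]
  have A: "fps_nth (incl_uv (shift_v b ?e)) k = ?c ((b * s) ^ k / fact k) * fls_const (uexp s) * ?V (- s)" for k
  proof -
    have V: "?V (- s) = fps_to_fls (Abs_fps (\<lambda>l. fls_const ((- s) ^ l / fact l)))"
      by (rule fls_eqI) (simp add: fls_map_nth uexp_def)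
    have "Abs_fps (\<lambda>l. fps_nth (fps_nth (shift_v b ?e) l) k) =
        fps_const (fls_const ((b * s) ^ k / fact k)) * fps_const (uexp s) * Abs_fps (\<lambda>l. fls_const ((- s) ^ l / fact l))"
      by (rule fps_ext) (simp add: shift_v_uexp_nth mult_ac)
    thus ?thesis
      by (simp add: incl_uv_def V fls_times_fps_to_fls fps_const_to_fls)
  qed
  have B: "fps_nth (incl_v (fps_nth (shift_v b' ?e) l)) k =
      ?c ((- s) ^ l / fact l) * ?c ((b' * s) ^ k / fact k) * ?V s" for k
  proof -
    have "fls_map fls_const (fls_const x) = ?c x" for x
      by (rule fls_eqI) (simp add: fls_map_nth)
    thus ?thesis
      by (simp add: incl_v_def shift_v_uexp_nth unital_hom_mult[OF hV])
  qed
  have VV: "?V (- s) * ?V s = 1"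
    by (simp add: uexp_def unital_hom_mult[OF hV, symmetric] fls_times_fps_to_fls[symmetric]
        fps_exp_add_mult[symmetric] unital_hom_one[OF hV])
  have "fps_nth (fps_nth (at_uv b ?e * at_vw b' ?e) l) k =
      (\<Sum>j=0..k. fps_nth (incl_uv (shift_v b ?e)) j * fps_nth (incl_v (fps_nth (shift_v b' ?e) l)) (k - j))"
    unfolding at_uv_def at_vw_def fps_mult_left_const_nth by (simp add: fps_mult_nth)
  also have "\<dots> = (\<Sum>j=0..k. ?c ((b * s) ^ j / fact j) * ?c ((b' * s) ^ (k - j) / fact (k - j))) *
      (?c ((- s) ^ l / fact l) * fls_const (uexp s) * (?V (- s) * ?V s))"
    unfolding A B sum_distrib_right by (rule sum.cong) (simp_all only: mult_ac)
  also have "(\<Sum>j=0..k. ?c ((b * s) ^ j / fact j) * ?c ((b' * s) ^ (k - j) / fact (k - j))) =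
      ?c (((b + b') * s) ^ k / fact k)"
  proof -
    have "((b + b') * s) ^ k / fact k = fps_nth (fps_exp (b * s) * fps_exp (b' * s)) k"
      by (simp add: fps_exp_add_mult[symmetric] distrib_right)
    also have "\<dots> = (\<Sum>j=0..k. (b * s) ^ j / fact j * ((b' * s) ^ (k - j) / fact (k - j)))"
      by (simp add: fps_mult_nth)
    finally show ?thesis by (simp only: unital_hom_sum[OF fls_const_hom] unital_hom_mult[OF fls_const_hom])
  qed
  also have "\<dots> * (?c ((- s) ^ l / fact l) * fls_const (uexp s) * (?V (- s) * ?V s)) =
      fps_nth (fps_nth (at_uw (b + b') ?e) l) k"
    unfolding VV at_uw_def
    by (simp add: incl_u_def shift_v_uexp_nth unital_hom_mult[OF fls_const_hom] mult_ac del: fls_const_mult_const)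
  finally show "fps_nth (fps_nth (at_uv b ?e * at_vw b' ?e) l) k = fps_nth (fps_nth (at_uw (b + b') ?e) l) k" .
qed

lemma hconst_hom: "unital_hom hconst"
proof -
  have "hconst = fps_map fls_const" by (rule ext, rule fps_ext) (simp add: hconst_def)
  thus ?thesis by (metis fps_map_hom fls_const_hom)
qed

subsection \<open>Yang--Baxter equation with spectral parameter\<close>

lemma flipP_mult: "(flipP ** A) $ (i, j) $ q = A $ (j, i) $ q"
  by (simp add: matrix_matrix_mult_def flipP_def if_mult_distribs)

lemma mult_flipP: "(A ** flipP) $ q $ (i, j) = A $ q $ (j, i)"
proof -
  have "(A ** flipP) $ q $ (i, j) = (\<Sum>k\<in>UNIV. if k = (j, i) then A $ q $ k else 0)"
    unfolding matrix_matrix_mult_def flipP_def vec_lambda_beta by (rule sum.cong) auto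
  thus ?thesis by simp
qed

lemma inverse_fps_const_uexp:
  assumes "a \<noteq> 0"
  shows "fps_const (inverse (uexp (2 / a) - 1)) * (fps_const (uexp (2 / a)) - 1) = 1"
proof -
  have "fls_nth (uexp (2 / a) - 1) 1 \<noteq> 0" using assms by (simp add: uexp_def)
  hence "uexp (2 / a) - 1 \<noteq> 0" by (metis fls_zero_nth)
  thus ?thesis
    by (metis fps_const_1_eq_1 fps_const_mult fps_const_sub left_inverse)
qed

lemma additive_R_nth:
  "additive_R R M a \<psi> $ (i, j) $ q = hconst \<psi> * fser M a *
     (hconst (R $ (j, i) $ q) + hconst (fps_exp 1 - fps_exp (- 1)) *
        fps_const (inverse (uexp (2 / a) - 1)) * (if (j, i) = q then 1 else 0))"
proof -
  have "flipP $ (i, j) $ q = (if (j, i) = q then 1 else 0 :: complex fls fps)"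
    by (auto simp: flipP_def)
  thus ?thesis by (simp add: additive_R_def flipP_mult uexp_def)
qed

text \<open>Up to the scalar prefactor \<open>g\<close>, which is pulled out of both sides, the
  spectral parameter enters only through \<epsilon> = 1/(e - 1) with e = e^(2u/a). What remains is
  the Hecke form of the equation with scalars extended along \<open>\<iota>\<close>.\<close>

lemma additive_R_yang_baxter:
  fixes R :: "complex fps ^ ('n::finite \<times> 'n) ^ ('n \<times> 'n)" and M :: nat and \<psi> :: "complex fps"
  assumes "hecke_symmetry R" "a \<noteq> 0"
  defines "r \<equiv> of_mat (additive_R R M a \<psi>)"
  shows "legs12 (sq_map (at_uv b) r) * legs13 (sq_map (at_uw (b + b')) r) * legs23 (sq_map (at_vw b') r) =
    legs23 (sq_map (at_vw b') r) * legs13 (sq_map (at_uw (b + b')) r) * legs12 (sq_map (at_uv b) r)"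
proof -
  define \<iota> where "\<iota> = (\<lambda>s. at_uv 0 (hconst s))"
  have \<iota>: "unital_hom \<iota>" unfolding \<iota>_def by (rule unital_hom_comp[OF at_hom(1) hconst_hom])
  define g where "g = hconst \<psi> * fser M a"
  define \<epsilon> where "\<epsilon> = fps_const (inverse (uexp (2 / a) - 1))"
  define e where "e = fps_const (uexp (2 / a))"
  define z :: "complex fps" where "z = fps_exp 1 - fps_exp (- 1)"
  define r0 where "r0 = sq_map \<iota> (of_mat R)"
  define Rm where "Rm = (\<lambda>x. flip_rows (r0 + sq_diag (\<iota> z * x)))"
  have legs_map: "legs12 (sq_map f X) = sq_map f (legs12 X)" "legs23 (sq_map f X) = sq_map f (legs23 X)"
    if "f 0 = 0" for f :: "'a::ring_1 \<Rightarrow> 'b::ring_1" and X :: "('n \<times> 'n, 'a) sqm"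
    by (rule sqm_eqI; force simp: legs_defs that)+
  have braid: "legs12 r0 * legs23 r0 * legs12 r0 = legs23 r0 * legs12 r0 * legs23 r0"
    unfolding r0_def
    by (simp add: legs_map unital_hom_zero[OF \<iota>] unital_hom_mult[OF sq_map_hom[OF \<iota>], symmetric]
        hecke_symmetry_braid[OF assms(1)])
  have hecke: "r0 * r0 = sq_diag (\<iota> z) * r0 + 1"
  proof -
    have "sq_map \<iota> (sq_diag z) = (sq_diag (\<iota> z) :: ('n \<times> 'n, _) sqm)"
      by (rule sqm_eqI) (simp add: sq_diag_def unital_hom_zero[OF \<iota>])
    thus ?thesis
      unfolding r0_def
      by (simp add: unital_hom_mult[OF sq_map_hom[OF \<iota>], symmetric] hecke_symmetry_quadratic[OF assms(1)] z_def
        unital_hom_add[OF sq_map_hom[OF \<iota>]] unital_hom_one[OF sq_map_hom[OF \<iota>]])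
       (simp add: unital_hom_mult[OF sq_map_hom[OF \<iota>]])
  qed
  have form: "sq_map \<phi> r = sq_diag (\<phi> g) * Rm (\<phi> \<epsilon>)"
    if \<phi>: "unital_hom \<phi>" "\<And>s. \<phi> (hconst s) = \<iota> s" for \<phi>
  proof (rule sqm_eqI)
    fix p q :: "'n \<times> 'n"
    obtain i j where p: "p = (i, j)" by fastforce
    show "sq (sq_map \<phi> r) p q = sq (sq_diag (\<phi> g) * Rm (\<phi> \<epsilon>)) p q"
      unfolding sq_diag_mult_left p r_def Rm_def flip_rows_def r0_def
      by (simp add: additive_R_nth unital_hom_simps[OF \<phi>(1)] \<phi>(2) sq_diag_def g_def \<epsilon>_def z_def)
  qed
  have diag: "legs12 (sq_diag x) = sq_diag x" "legs13 (sq_diag x) = sq_diag x" "legs23 (sq_diag x) = sq_diag x"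
    for x :: "complex fls fls fps fps"
    by (rule sqm_eqI; force simp: legs_defs sq_diag_def)+
  let ?A = "at_uv b" and ?B = "at_uw (b + b')" and ?C = "at_vw b'"
  have \<epsilon>: "\<epsilon> * (e - 1) = 1" unfolding \<epsilon>_def e_def by (rule inverse_fps_const_uexp[OF assms(2)])
  have \<epsilon>\<phi>: "\<phi> \<epsilon> * (\<phi> e - 1) = 1" if "unital_hom \<phi>" for \<phi> :: "complex fls fps \<Rightarrow> complex fls fls fps fps"
    using arg_cong[OF \<epsilon>, of \<phi>] that by (simp add: unital_hom_simps)
  have xy: "?A e * ?C e = ?B e" unfolding e_def by (rule at_uexp)
  \<comment> \<open>With x = \<open>?A e\<close>, y = \<open>?C e\<close> and x y =
    \<open>?B e\<close> this is the identity between 1/(x - 1), 1/(y - 1) and 1/(x y - 1), obtained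
    from x y - 1 = (x - 1)(y - 1) + (x - 1) + (y - 1).\<close>
  have rel: "?B \<epsilon> * (1 + ?A \<epsilon> + ?C \<epsilon>) = ?A \<epsilon> * ?C \<epsilon>"
  proof -
    have "?A \<epsilon> * ?C \<epsilon> = ?B \<epsilon> * (?A \<epsilon> * ?C \<epsilon> * (?A e * ?C e - 1))"
      unfolding xy using \<epsilon>\<phi>[OF at_hom(2)[of "b + b'"]] by (metis mult.left_commute mult.right_neutral)
    also have "?A e * ?C e - 1 = (?A e - 1) * (?C e - 1) + (?A e - 1) + (?C e - 1)"
      by (simp add: algebra_simps)
    also have "?A \<epsilon> * ?C \<epsilon> * ((?A e - 1) * (?C e - 1) + (?A e - 1) + (?C e - 1)) =
        (?A \<epsilon> * (?A e - 1)) * (?C \<epsilon> * (?C e - 1)) + ?C \<epsilon> * (?A \<epsilon> * (?A e - 1)) + ?A \<epsilon> * (?C \<epsilon> * (?C e - 1))"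
      by (simp only: distrib_left mult_ac)
    finally show ?thesis
      by (simp add: \<epsilon>\<phi>[OF at_hom(1)] \<epsilon>\<phi>[OF at_hom(3)] add_ac)
  qed
  have f: "sq_map ?A r = sq_diag (?A g) * Rm (?A \<epsilon>)" "sq_map ?B r = sq_diag (?B g) * Rm (?B \<epsilon>)"
     "sq_map ?C r = sq_diag (?C g) * Rm (?C \<epsilon>)"
  proof -
    have h: "?A (hconst s) = \<iota> s" "?B (hconst s) = \<iota> s" "?C (hconst s) = \<iota> s" for s
      unfolding \<iota>_def by (metis at_hconst)+
    show "sq_map ?A r = sq_diag (?A g) * Rm (?A \<epsilon>)" by (rule form[OF at_hom(1) h(1)])
    show "sq_map ?B r = sq_diag (?B g) * Rm (?B \<epsilon>)" by (rule form[OF at_hom(2) h(2)])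
    show "sq_map ?C r = sq_diag (?C g) * Rm (?C \<epsilon>)" by (rule form[OF at_hom(3) h(3)])
  qed
  let ?d = "sq_diag :: _ \<Rightarrow> ('n \<times> 'n \<times> 'n, complex fls fls fps fps) sqm"
  have pull: "?d x * X * (?d y * Y) * (?d z * Z) = ?d x * ?d y * ?d z * (X * Y * Z)" for x y z X Y Z
  proof -
    have lc: "X * (?d y * Y) = ?d y * (X * Y)" for X Y y
      by (metis mult.assoc sq_diag_central)
    show ?thesis
      by (simp only: mult.assoc lc[of X y] lc[of X z] lc[of Y z])
  qed
  have comm: "?d x * ?d y * ?d z = ?d z * ?d y * ?d x" for x y z
    by (simp add: unital_hom_mult[OF sq_diag_hom, symmetric] mult_ac)
  show ?thesis
    unfolding f unital_hom_mult[OF legs_hom(1)] unital_hom_mult[OF legs_hom(2)] unital_hom_mult[OF legs_hom(3)]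
      diag pull
    using yang_baxter_hecke[OF braid hecke rel] comm by (simp add: Rm_def)
qed

subsection \<open>Inverse and skew inverse of the R-matrix\<close>

text \<open>Writing F = u^d f with a power series f reduces the claim to composition of power
  series, the factor (- u)^d being carried along as an integer power.\<close>

lemma fls_compose_neg_neg: "fls_compose_fps (fls_compose_fps F (- fps_X)) (- fps_X) = (F :: complex fls)"
proof -
  let ?c = "\<lambda>F :: complex fls. fls_compose_fps F (- fps_X)"
  let ?d = "fls_subdegree F" and ?f = "fls_base_factor_to_fps F"
  have X: "- fps_X \<noteq> (0 :: complex fps)" "fps_nth (- fps_X :: complex fps) 0 = 0" by simp_all
  have F: "F = fls_shift (- ?d) (fps_to_fls ?f)"
    by (rule fls_conv_base_factor_to_fps_shift_subdegree)
  have cf: "?c (fps_to_fls f) = fps_to_fls (fps_compose f (- fps_X))" for f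
    using X by (simp add: fls_compose_fps_to_fls)
  have "?c F = fps_to_fls (fps_compose ?f (- fps_X)) * fps_to_fls (- fps_X) powi ?d"
    by (subst F, subst fls_compose_fps_shift) (simp_all add: cf)
  hence "?c (?c F) = fps_to_fls (fps_compose (fps_compose ?f (- fps_X)) (- fps_X)) * ?c (fps_to_fls (- fps_X)) powi ?d"
    by (simp add: fls_compose_fps_mult fls_compose_fps_powi cf)
  also have "fps_compose (fps_compose ?f (- fps_X)) (- fps_X) = ?f"
    by (simp add: fps_compose_assoc[symmetric] fps_compose_uminus)
  also have "?c (fps_to_fls (- fps_X)) = fls_X"
    by (simp add: cf fps_compose_uminus fls_X_conv_shift_1[symmetric])
  also have "fps_to_fls ?f * fls_X powi ?d = F"
    by (simp only: fls_X_power_int fls_X_intpow_times_conv_shift F[symmetric])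
  finally show ?thesis .
qed

lemma negate_u_hom: "unital_hom negate_u"
proof -
  have "unital_hom (\<lambda>F :: complex fls. fls_compose_fps F (- fps_X))"
    by (rule unital_homI) (simp_all add: fls_compose_fps_mult fls_compose_fps_add)
  moreover have "negate_u = fps_map (\<lambda>F. fls_compose_fps F (- fps_X))"
    by (rule ext, rule fps_ext) (simp add: negate_u_def)
  ultimately show ?thesis by (metis fps_map_hom)
qed

lemma negate_u_negate_u: "negate_u (negate_u F) = F"
  by (rule fps_ext) (simp add: negate_u_def fls_compose_neg_neg)

lemma negate_u_hconst: "negate_u (hconst s) = hconst s"
  by (rule fps_ext) (simp add: negate_u_def hconst_def)

text \<open>Unitarity provides a right inverse. The involution u to - u followed by conjugation with
  the flip turns it into a left inverse, and \<open>matrix_inv\<close> must then be this matrix,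
  namely R(- u) with the legs exchanged.\<close>

lemma unitary_inverse:
  fixes Ru :: "complex fls fps ^ ('n::finite \<times> 'n) ^ ('n \<times> 'n)"
  assumes "unitary Ru"
  shows "of_mat Ru * of_mat (matrix_inv Ru) = 1" "of_mat (matrix_inv Ru) * of_mat Ru = 1"
    "matrix_inv Ru $ (i, j) $ (k, l) = negate_u (Ru $ (j, i) $ (l, k))"
proof -
  let ?n = "map_matrix negate_u :: complex fls fps ^ ('n \<times> 'n) ^ ('n \<times> 'n) \<Rightarrow> _"
  let ?P = "flipP :: complex fls fps ^ ('n \<times> 'n) ^ ('n \<times> 'n)"
  let ?X = "?P ** ?n Ru ** ?P"
  have mult: "?n (A ** B) = ?n A ** ?n B" for A B
    by (simp add: vec_eq_iff matrix_matrix_mult_def unital_hom_simps[OF negate_u_hom])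
  have one: "?n (mat 1) = mat 1"
    by (simp add: vec_eq_iff mat_def unital_hom_simps[OF negate_u_hom])
  have P: "?n ?P = ?P"
    by (simp add: vec_eq_iff flipP_def unital_hom_simps[OF negate_u_hom])
  have nn: "?n (?n A) = A" for A by (simp add: vec_eq_iff negate_u_negate_u)
  have PP: "?P ** ?P = mat 1"
    by (auto simp add: vec_eq_iff flipP_mult) (auto simp: flipP_def mat_def)
  have 1: "Ru ** ?X = mat 1" using assms by (simp add: unitary_def)
  have "?n (Ru ** ?X) = ?n Ru ** (?P ** Ru ** ?P)" by (simp only: mult P nn)
  hence "?n Ru ** (?P ** Ru ** ?P) = mat 1" by (simp only: 1 one)
  hence "?P ** (?n Ru ** (?P ** Ru ** ?P)) ** ?P = ?P ** mat 1 ** ?P" by (simp only:)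
  hence 2: "?X ** Ru = mat 1"
    by (simp add: matrix_mul_assoc[symmetric] PP matrix_mul_rid matrix_mul_lid)
  have inv: "matrix_inv Ru = ?X"
  proof -
    have ex: "Ru ** ?X = mat 1 \<and> ?X ** Ru = mat 1" using 1 2 by simp
    have "Ru ** matrix_inv Ru = mat 1 \<and> matrix_inv Ru ** Ru = mat 1"
      unfolding matrix_inv_def by (rule someI[of _ ?X]) (use ex in simp)
    hence "?X ** (Ru ** matrix_inv Ru) = ?X" by (simp add: matrix_mul_rid)
    thus ?thesis unfolding matrix_mul_assoc 2 by (simp add: matrix_mul_lid)
  qed
  have "of_mat (mat 1) = (1 :: ('n \<times> 'n, complex fls fps) sqm)"
    by (simp add: of_mat_mat unital_hom_one[OF sq_diag_hom])
  thus "of_mat Ru * of_mat (matrix_inv Ru) = 1" "of_mat (matrix_inv Ru) * of_mat Ru = 1"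
    unfolding inv by (simp_all add: of_mat_mult[symmetric] 1 2)
  show "matrix_inv Ru $ (i, j) $ (k, l) = negate_u (Ru $ (j, i) $ (l, k))"
    unfolding inv by (simp add: mult_flipP flipP_mult)
qed

text \<open>The rank one condition is expressed as \<open>U * P * U = s * U\<close>, and
  \<open>m\<close> plays the role of l / (1 + l s). The ring is noncommutative, so both one-sided
  inverses are verified.\<close>

lemma sherman_morrison:
  fixes U :: "'a::ring_1"
  assumes inv: "N * P = 1" "P * N = 1"
    and central: "\<And>x. x * l = l * x" "\<And>x. x * m = m * x" "\<And>x. x * s = s * x"
    and rank: "U * P * U = s * U" and m: "m + l * m * s = l"
  shows "(N + l * U) * (P - m * (P * U * P)) = 1" "(P - m * (P * U * P)) * (N + l * U) = 1"
proof -
  have mls: "m * (U * P) + l * m * s * (U * P) = l * (U * P)"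
    by (simp add: m distrib_right[symmetric])
  have "(N + l * U) * (P - m * (P * U * P)) = N * P + l * (U * P) - (N * m) * (P * U * P) - (l * (U * m)) * (P * U * P)"
    by (simp add: algebra_simps)
  also have "(N * m) * (P * U * P) = m * ((N * P) * (U * P))"
    by (simp only: central(2)[of N] mult.assoc)
  also have "(l * (U * m)) * (P * U * P) = l * m * ((U * P * U) * P)"
    by (simp only: central(2)[of U] mult.assoc)
  also have "\<dots> = l * m * s * (U * P)" unfolding rank by (simp only: mult.assoc)
  also have "N * P + l * (U * P) - m * ((N * P) * (U * P)) - l * m * s * (U * P) = 1"
    using mls by (simp add: inv algebra_simps)
  finally show "(N + l * U) * (P - m * (P * U * P)) = 1" .
  have mls: "m * (P * U) + l * m * s * (P * U) = l * (P * U)"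
    by (simp add: m distrib_right[symmetric])
  have "(P - m * (P * U * P)) * (N + l * U) = P * N + (P * l) * U - m * ((P * U) * (P * N)) - m * (P * U * (P * l) * U)"
    by (simp add: algebra_simps)
  also have "m * (P * U * (P * l) * U) = m * l * (P * (U * P * U))"
  proof -
    have "m * (P * U * (P * l) * U) = m * ((P * U * P) * l * U)" by (simp only: mult.assoc)
    also have "\<dots> = m * (l * (P * U * P) * U)" by (simp only: central(1)[of "P * U * P"])
    finally show ?thesis by (simp only: mult.assoc)
  qed
  also have "\<dots> = l * m * s * (P * U)"
  proof -
    have "m * l * (P * (s * U)) = m * l * ((P * s) * U)" by (simp only: mult.assoc)
    also have "\<dots> = (m * l) * s * (P * U)" by (simp only: central(3)[of P] mult.assoc)
    finally show ?thesis by (simp only: rank central(1)[of m])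
  qed
  also have "P * N + (P * l) * U - m * ((P * U) * (P * N)) - l * m * s * (P * U) = 1"
    using mls by (simp add: inv central(1)[of P] algebra_simps)
  finally show "(P - m * (P * U * P)) * (N + l * U) = 1" .
qed

section \<open>Skew inverses as matrix inverses\<close>

definition skew_matrix :: "'s ^ ('n \<times> 'n) ^ ('n \<times> 'n) \<Rightarrow> ('n::finite \<times> 'n, 's::ring_1) sqm" where
  "skew_matrix A = Sqm (\<lambda>(p, q) (k, j). A $ (p, k) $ (j, q))"

text \<open>Grouping the row and column index of each tensor leg into one index turns tr_2 R_12
  \<Psi>_23 into a matrix product. With the indices of the last leg taken in the opposite order, the
  flip P_13 becomes the identity matrix.\<close>

lemma skew_invertible_matrix:
  fixes R :: "complex fps ^ ('n::finite \<times> 'n) ^ ('n \<times> 'n)"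
  assumes "skew_invertible R"
  defines "N \<equiv> Sqm (\<lambda>(p, q) (k, j). R $ (p, k) $ (q, j))"
  obtains P where "N * P = 1" "P * N = 1"
proof -
  let ?L = "{1, 2, 3 :: nat}"
  obtain \<Psi> where \<Psi>:
    "tens_eq {1, 3} (partial_trace 2 (tprod ?L [on_legs ?L 1 2 R, on_legs ?L 2 3 \<Psi>])) (on_legs {1, 3} 1 3 flipP)"
    "tens_eq {1, 3} (partial_trace 2 (tprod ?L [on_legs ?L 1 2 \<Psi>, on_legs ?L 2 3 R])) (on_legs {1, 3} 1 3 flipP)"
    using assms by (auto simp: skew_invertible_def Let_def)
  have key: "(\<Sum>b\<in>UNIV. \<Sum>b'\<in>UNIV. A $ (a, b) $ (a', b') * B $ (b', c) $ (b, c')) =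
      (if (a', c') = (c, a) then 1 else 0)"
    if AB: "tens_eq {1, 3} (partial_trace 2 (tprod ?L [on_legs ?L 1 2 A, on_legs ?L 2 3 B])) (on_legs {1, 3} 1 3 flipP)"
    for A B :: "complex fps ^ ('n \<times> 'n) ^ ('n \<times> 'n)" and a a' c c'
  proof -
    define e :: "nat \<Rightarrow> 'n" where "e = (\<lambda>_. undefined)"
    let ?\<alpha> = "e(1 := a, 3 := c)" and ?\<beta> = "e(1 := a', 3 := c')"
    have m2: "e(1 := x, 3 := y) \<in> multi {1, 3}" for x y
      by (auto simp: e_def multi_def PiE_iff extensional_def)
    have in_multi: "e(1 := x, 2 := y, 3 := z) \<in> multi ?L" for x y z
      by (auto simp: e_def multi_def PiE_iff extensional_def)
    have upd: "e(1 := x, 2 := y, 3 := z, 1 := x') = e(1 := x', 2 := y, 3 := z)"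
      "e(1 := x, 2 := y, 3 := z, 2 := y') = e(1 := x, 2 := y', 3 := z)"
      "e(1 := x, 2 := y, 3 := z, 3 := z') = e(1 := x, 2 := y, 3 := z')"
      "e(1 := x, 3 := z, 2 := y') = e(1 := x, 2 := y', 3 := z)" for x y z x' y' z'
      by (auto simp: fun_eq_iff)
    have eq: "e(1 := x, 2 := y, 3 := z) = e(1 := x', 2 := y', 3 := z') \<longleftrightarrow> x = x' \<and> y = y' \<and> z = z'"
      for x y z x' y' z'
      by (auto dest: fun_cong[of _ _ 1] fun_cong[of _ _ 2] fun_cong[of _ _ 3])
    have v: "(e(1 := x, 2 := y, 3 := z)) 1 = x" "(e(1 := x, 2 := y, 3 := z)) 2 = y"
      "(e(1 := x, 2 := y, 3 := z)) 3 = z" for x y z by simp_all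
    note ev = tprod_def foldr.simps id_apply o_apply tmult_on_legs in_multi upd v eq
    have "partial_trace 2 (tprod ?L [on_legs ?L 1 2 A, on_legs ?L 2 3 B]) ?\<alpha> ?\<beta> =
        (\<Sum>b\<in>UNIV. \<Sum>b'\<in>UNIV. A $ (a, b) $ (a', b') * B $ (b', c) $ (b, c'))"
      by (simp add: partial_trace_def ev if_conj_eq if_mult_distribs sum_if_const sum_distrib_left mult.assoc
        del: fun_upd_apply One_nat_def cong: if_cong)
    moreover have "on_legs {1, 3} 1 3 flipP ?\<alpha> ?\<beta> = (if (a', c') = (c, a) then 1 else 0 :: complex fps)"
      by (auto simp: on_legs_def flipP_def)
    ultimately show ?thesis
      using AB m2 by (simp add: tens_eq_def del: One_nat_def)
  qed
  define P where "P = Sqm (\<lambda>(b, b') (c', c). \<Psi> $ (b', c) $ (b, c'))"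
  have "N * P = 1"
  proof (rule sqm_eqI)
    fix x y :: "'n \<times> 'n"
    show "sq (N * P) x y = sq 1 x y"
      using key[OF \<Psi>(1), of "fst x" "snd x" "snd y" "fst y"]
      by (cases x; cases y) (auto simp: sq_times sum_UNIV_prod N_def P_def sq_one)
  qed
  moreover have "P * N = 1"
  proof (rule sqm_eqI)
    fix x y :: "'n \<times> 'n"
    have "sq (P * N) x y = (\<Sum>b'\<in>UNIV. \<Sum>b\<in>UNIV. \<Psi> $ (snd x, b) $ (fst x, b') * R $ (b', fst y) $ (b, snd y))"
      by (cases x; cases y) (simp add: sq_times sum_UNIV_prod N_def P_def)
    also have "\<dots> = (\<Sum>b\<in>UNIV. \<Sum>b'\<in>UNIV. \<Psi> $ (snd x, b) $ (fst x, b') * R $ (b', fst y) $ (b, snd y))"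
      by (rule sum.swap)
    finally show "sq (P * N) x y = sq 1 x y"
      unfolding key[OF \<Psi>(2)] by (cases x; cases y) (auto simp: sq_one)
  qed
  ultimately show ?thesis by (rule that)
qed

text \<open>The inverse is R(- u) with exchanged legs. After regrouping the indices its constant
  part is the matrix \<open>N0\<close>, invertible by skew-invertibility, and the flip term becomes
  the rank one matrix \<open>U\<close>, so the Sherman-Morrison formula applies.\<close>

lemma additive_R_inverse_skew_invertible:
  fixes R :: "complex fps ^ ('n::finite \<times> 'n) ^ ('n \<times> 'n)"
  assumes skew: "skew_invertible R" and Ru: "Ru = additive_R R M a \<psi>" and unit: "unitary Ru"
  obtains D where "skew_matrix (matrix_inv Ru) * D = 1" "D * skew_matrix (matrix_inv Ru) = 1"
proof -
  define g where "g = hconst \<psi> * fser M a"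
  define \<epsilon> where "\<epsilon> = fps_const (inverse (uexp (2 / a) - 1))"
  define z :: "complex fps" where "z = fps_exp 1 - fps_exp (- 1)"
  let ?d = "sq_diag :: _ \<Rightarrow> ('n \<times> 'n, complex fls fps) sqm"
  \<comment> \<open>Every entry of \<open>Ru\<close> is a multiple of \<open>g\<close>, hence so is
    a diagonal entry of the product of \<open>Ru\<close> with its inverse, which equals 1.\<close>
  obtain g' where g': "g * g' = 1"
  proof -
    define p :: "'n \<times> 'n" where "p = undefined"
    obtain i j where p: "p = (i, j)" by fastforce
    have "1 = (\<Sum>q\<in>UNIV. Ru $ p $ q * matrix_inv Ru $ q $ p)"
      using arg_cong[OF unitary_inverse(1)[OF unit], of "\<lambda>A. sq A p p"] by (simp add: sq_times sq_one)
    also have "\<dots> = g * (\<Sum>q\<in>UNIV. (hconst (R $ (j, i) $ q) + hconst z * \<epsilon> * (if (j, i) = q then 1 else 0))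
        * matrix_inv Ru $ q $ p)"
      unfolding Ru p sum_distrib_left by (rule sum.cong) (simp_all only: additive_R_nth g_def z_def \<epsilon>_def mult.assoc)
    finally show ?thesis by (rule that[OF sym])
  qed
  define N0 where "N0 = sq_map hconst (Sqm (\<lambda>(p, q) (k, j). R $ (p, k) $ (q, j)))"
  obtain P0 where P0: "Sqm (\<lambda>(p, q) (k, j). R $ (p, k) $ (q, j)) * P0 = 1"
      "P0 * Sqm (\<lambda>(p, q) (k, j). R $ (p, k) $ (q, j)) = 1"
    using skew_invertible_matrix[OF skew] by blast
  define P where "P = sq_map hconst P0"
  have P: "N0 * P = 1" "P * N0 = 1"
    unfolding N0_def P_def
    by (simp_all add: unital_hom_mult[OF sq_map_hom[OF hconst_hom], symmetric] P0
        unital_hom_one[OF sq_map_hom[OF hconst_hom]])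
  define U :: "('n \<times> 'n, complex fls fps) sqm" where "U = Sqm (\<lambda>(p, q) (k, j). if p = q \<and> k = j then 1 else 0)"
  define s where "s = (\<Sum>i\<in>UNIV. \<Sum>j\<in>UNIV. sq P (i, i) (j, j))"
  define l where "l = hconst z * negate_u \<epsilon>"
  have rank: "U * P * U = ?d s * U"
  proof (rule sqm_eqI)
    fix x y :: "'n \<times> 'n"
    obtain p q k j where xy: "x = (p, q)" "y = (k, j)" by (metis prod.exhaust)
    have U: "sq (U * X) (p, q) y = (if p = q then \<Sum>i\<in>UNIV. sq X (i, i) y else 0)"
      "sq (X * U) y (p, q) = (if p = q then \<Sum>i\<in>UNIV. sq X y (i, i) else 0)" for X y p q
      by (auto simp: U_def sq_times sum_UNIV_prod if_conj_eq if_mult_distribs sum_if_const cong: if_cong)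
    show "sq (U * P * U) x y = sq (?d s * U) x y"
      unfolding sq_diag_mult_left mult.assoc unfolding xy U by (simp add: U_def s_def)
  qed
  \<comment> \<open>The factor e^h - e^(- h) of \<open>l\<close> vanishes at h = 0, so 1 + l s is a
    unit for any \<open>s\<close>.\<close>
  have "fps_nth l 0 = 0" by (simp add: l_def hconst_def z_def)
  hence "fps_nth (1 + l * s) 0 \<noteq> 0" by simp
  hence inv: "inverse (1 + l * s) * (1 + l * s) = 1" by (rule inverse_mult_eq_1)
  define m where "m = l * inverse (1 + l * s)"
  have m: "m + l * m * s = l"
  proof -
    have "m + l * m * s = l * (inverse (1 + l * s) * (1 + l * s))" by (simp add: m_def algebra_simps)
    thus ?thesis by (simp add: inv)
  qed
  have SM: "(N0 + ?d l * U) * (P - ?d m * (P * U * P)) = 1" "(P - ?d m * (P * U * P)) * (N0 + ?d l * U) = 1"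
  proof -
    have c: "X * ?d y = ?d y * X" for X y by (rule sq_diag_central[symmetric])
    have md: "?d m + ?d l * ?d m * ?d s = ?d l"
      by (simp only: unital_hom_mult[OF sq_diag_hom, symmetric] unital_hom_add[OF sq_diag_hom, symmetric] m)
    show "(N0 + ?d l * U) * (P - ?d m * (P * U * P)) = 1" "(P - ?d m * (P * U * P)) * (N0 + ?d l * U) = 1"
      by (rule sherman_morrison[OF P c c c rank md])+
  qed
  have ng: "negate_u g * negate_u g' = 1"
    using arg_cong[OF g', of negate_u] by (simp add: unital_hom_simps[OF negate_u_hom])
  have form: "skew_matrix (matrix_inv Ru) = ?d (negate_u g) * (N0 + ?d l * U)"
  proof (rule sqm_eqI)
    fix x y :: "'n \<times> 'n"
    show "sq (skew_matrix (matrix_inv Ru)) x y = sq (?d (negate_u g) * (N0 + ?d l * U)) x y"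
      unfolding sq_diag_mult_left
      by (cases x; cases y) (auto simp: skew_matrix_def Ru unitary_inverse(3)[OF unit[unfolded Ru]] additive_R_nth sq_diag_mult_left
          unital_hom_simps[OF negate_u_hom] negate_u_hconst N0_def U_def l_def g_def z_def \<epsilon>_def)
  qed
  have ng': "?d (negate_u g) * ?d (negate_u g') = 1"
    by (simp add: ng unital_hom_one[OF sq_diag_hom] flip: unital_hom_mult[OF sq_diag_hom])
  show ?thesis
  proof (rule that[of "?d (negate_u g') * (P - ?d m * (P * U * P))"])
    let ?N = "N0 + ?d l * U" and ?D = "P - ?d m * (P * U * P)"
    have "skew_matrix (matrix_inv Ru) * (?d (negate_u g') * ?D) = ?d (negate_u g) * (?N * ?d (negate_u g')) * ?D"
      by (simp only: form mult.assoc)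
    also have "\<dots> = (?d (negate_u g) * ?d (negate_u g')) * (?N * ?D)"
      by (subst sq_diag_central[of "negate_u g'" ?N, symmetric]) (simp only: mult.assoc)
    finally show "skew_matrix (matrix_inv Ru) * (?d (negate_u g') * ?D) = 1"
      by (simp only: ng' SM mult_1)
    have "?d (negate_u g') * ?D * skew_matrix (matrix_inv Ru) = ?d (negate_u g') * (?D * ?d (negate_u g)) * ?N"
      by (simp only: form mult.assoc)
    also have "\<dots> = (?d (negate_u g') * ?d (negate_u g)) * (?D * ?N)"
      by (subst sq_diag_central[of "negate_u g" ?D, symmetric]) (simp only: mult.assoc)
    also have "?d (negate_u g') * ?d (negate_u g) = 1"
      unfolding sq_diag_central[of "negate_u g'"] by (rule ng')
    finally show "?d (negate_u g') * ?D * skew_matrix (matrix_inv Ru) = 1"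
      by (simp only: SM mult_1)
  qed
qed

subsection \<open>Representations of the RTT relation\<close>

definition leg1 :: "('n, 'r::ring_1) sqm \<Rightarrow> ('n::finite \<times> 'n, 'r) sqm" where
  "leg1 X = Sqm (\<lambda>(i, j) (k, l). if j = l then sq X i k else 0)"
definition leg2 :: "('n, 'r::ring_1) sqm \<Rightarrow> ('n::finite \<times> 'n, 'r) sqm" where
  "leg2 X = Sqm (\<lambda>(i, j) (k, l). if i = k then sq X j l else 0)"

lemma leg_hom:
  "unital_hom (leg1 :: _ \<Rightarrow> ('n::finite \<times> 'n, 'r::ring_1) sqm)"
  "unital_hom (leg2 :: _ \<Rightarrow> ('n::finite \<times> 'n, 'r::ring_1) sqm)"
  by (rule unital_homI; rule sqm_eqI;
      force simp: leg1_def leg2_def sq_one sq_times sum_UNIV_prod if_mult_distribs sum_if_const cong: if_cong)+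

lemma sq_leg1_leg2: "sq (leg1 X * leg2 Y) (i, j) (k, l) = sq X i k * sq Y j l"
  by (simp add: leg1_def leg2_def sq_times sum_UNIV_prod if_mult_distribs sum_if_const cong: if_cong)

lemma sq_leg2_leg1: "sq (leg2 Y * leg1 X) (i, j) (k, l) = sq Y j l * sq X i k"
  by (simp add: leg1_def leg2_def sq_times sum_UNIV_prod if_mult_distribs sum_if_const cong: if_cong)

lemma legs_commute:
  assumes "\<And>i k j l. sq X i k * sq Y j l = sq Y j l * sq X i k"
  shows "leg1 X * leg2 Y = leg2 Y * leg1 X"
  by (rule sqm_eqI) (metis assms prod.exhaust sq_leg1_leg2 sq_leg2_leg1)

lemma leg_sq_map:
  assumes "f 0 = 0"
  shows "leg1 (sq_map f X) = sq_map f (leg1 X)" "leg2 (sq_map f X) = sq_map f (leg2 X)"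
  by (rule sqm_eqI; force simp: leg1_def leg2_def assms)+

definition rtt_rel :: "('n \<times> 'n, 'r) sqm \<Rightarrow> ('n, 'r) sqm \<Rightarrow> ('n::finite, 'r::ring_1) sqm \<Rightarrow> bool" where
  "rtt_rel R X Y \<longleftrightarrow> R * leg1 X * leg2 Y = leg2 Y * leg1 X * R"

lemma rtt_rel_map:
  assumes f: "unital_hom f" and "rtt_rel R X Y"
  shows "rtt_rel (sq_map f R) (sq_map f X) (sq_map f Y)"
  using arg_cong[OF assms(2)[unfolded rtt_rel_def], of "sq_map f"]
  by (simp add: rtt_rel_def leg_sq_map unital_hom_zero[OF f] unital_hom_mult[OF sq_map_hom[OF f]])

text \<open>In this and the next two definitions the outer indices belong to a letter and the inner
  ones to an auxiliary copy of C^N. \<open>right_rep\<close> transposes the auxiliary indices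
  because it encodes multiplication from the right; \<open>skew_rep\<close> is arranged to be the
  inverse of \<open>right_rep\<close> when \<open>D\<close> is a skew inverse.\<close>

definition left_rep :: "('n \<times> 'n, 's) sqm \<Rightarrow> ('n, ('n, 's) sqm) sqm" where
  "left_rep A = Sqm (\<lambda>k k'. Sqm (\<lambda>i p. sq A (i, k) (p, k')))"
definition right_rep :: "('n \<times> 'n, 's) sqm \<Rightarrow> ('n, ('n, 's) sqm) sqm" where
  "right_rep B = Sqm (\<lambda>k k'. Sqm (\<lambda>j q. sq B (q, k) (j, k')))"
definition skew_rep :: "('n \<times> 'n, 's) sqm \<Rightarrow> ('n, ('n, 's) sqm) sqm" where
  "skew_rep D = Sqm (\<lambda>k k'. Sqm (\<lambda>j q. sq D (k', q) (j, k)))"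

text \<open>The auxiliary space is leg 1 and the letters are legs 2 and 3; read entrywise in the
  auxiliary indices, the hypothesis is the RTT relation.\<close>

lemma rtt_left_rep:
  fixes A1 A2 C :: "('n::finite \<times> 'n, 's::comm_ring_1) sqm"
  assumes "legs23 C * legs12 A1 * legs13 A2 = legs13 A2 * legs12 A1 * legs23 C"
  shows "rtt_rel (sq_map sq_diag C) (left_rep A1) (left_rep A2)"
  unfolding rtt_rel_def
proof (rule sqm_eqI, rule sqm_eqI)
  fix I J :: "'n \<times> 'n" and x y :: 'n
  obtain i j k l where IJ: "I = (i, j)" "J = (k, l)" by (metis prod.exhaust)
  let ?X = "left_rep A1" and ?Y = "left_rep A2" and ?C = "sq_map sq_diag C :: ('n \<times> 'n, ('n, 's) sqm) sqm"
  have "sq (sq (?C * leg1 ?X * leg2 ?Y) I J) x y =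
      (\<Sum>p\<in>UNIV. \<Sum>q\<in>UNIV. \<Sum>z\<in>UNIV. sq C (i, j) (p, q) * sq A1 (x, p) (z, k) * sq A2 (z, q) (y, l))"
    unfolding mult.assoc[of ?C] IJ sq_times[of ?C] sum_UNIV_prod
    by (simp add: sq_leg1_leg2 sq_sum sq_diag_mult_left) (simp add: sq_times left_rep_def sum_distrib_left mult.assoc)
  also have "\<dots> = sq (legs23 C * legs12 A1 * legs13 A2) (x, i, j) (y, k, l)"
    by (simp add: sq_legs_simps cong: if_cong)
      (rule trans[OF sum_rotate sum.cong[OF refl sum.swap], symmetric])
  also have "\<dots> = sq (legs13 A2 * legs12 A1 * legs23 C) (x, i, j) (y, k, l)"
    by (simp only: assms)
  also have "\<dots> = (\<Sum>p\<in>UNIV. \<Sum>q\<in>UNIV. \<Sum>z\<in>UNIV. sq A2 (x, j) (z, q) * sq A1 (z, i) (y, p) * sq C (p, q) (k, l))"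
    by (simp add: sq_legs_simps cong: if_cong)
  also have "\<dots> = sq (sq (leg2 ?Y * leg1 ?X * ?C) I J) x y"
    unfolding IJ sq_times[of "leg2 ?Y * leg1 ?X"] sum_UNIV_prod
    by (simp add: sq_leg2_leg1 sq_sum sq_diag_mult_right) (simp add: sq_times left_rep_def sum_distrib_right mult.assoc)
  finally show "sq (sq (?C * leg1 ?X * leg2 ?Y) I J) x y = sq (sq (leg2 ?Y * leg1 ?X * ?C) I J) x y" .
qed

text \<open>Transposing the auxiliary indices reverses products on leg 1, so the relation C X Y = Y
  X C is read off from C_23 B2_13 B1_12 = B1_12 B2_13 C_23.\<close>

lemma rtt_right_rep:
  fixes B1 B2 C :: "('n::finite \<times> 'n, 's::comm_ring_1) sqm"
  assumes "legs12 B1 * legs13 B2 * legs23 C = legs23 C * legs13 B2 * legs12 B1"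
  shows "rtt_rel (sq_map sq_diag C) (right_rep B1) (right_rep B2)"
  unfolding rtt_rel_def
proof (rule sqm_eqI, rule sqm_eqI)
  fix I J :: "'n \<times> 'n" and x y :: 'n
  obtain i j k l where IJ: "I = (i, j)" "J = (k, l)" by (metis prod.exhaust)
  let ?X = "right_rep B1" and ?Y = "right_rep B2" and ?C = "sq_map sq_diag C :: ('n \<times> 'n, ('n, 's) sqm) sqm"
  have "sq (sq (?C * leg1 ?X * leg2 ?Y) I J) x y =
      (\<Sum>p\<in>UNIV. \<Sum>q\<in>UNIV. \<Sum>z\<in>UNIV. sq C (i, j) (p, q) * (sq B1 (z, p) (x, k) * sq B2 (y, q) (z, l)))"
    unfolding mult.assoc[of ?C] IJ sq_times[of ?C] sum_UNIV_prod
    by (simp add: sq_leg1_leg2 sq_sum sq_diag_mult_left) (simp add: sq_times right_rep_def sum_distrib_left mult.assoc)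
  also have "\<dots> = sq (legs23 C * legs13 B2 * legs12 B1) (y, i, j) (x, k, l)"
    unfolding sq_legs_23_13_12 by (rule trans[OF sum_rotate]) (simp add: mult_ac)
  also have "\<dots> = sq (legs12 B1 * legs13 B2 * legs23 C) (y, i, j) (x, k, l)"
    by (simp only: assms)
  also have "\<dots> = (\<Sum>p\<in>UNIV. \<Sum>q\<in>UNIV. \<Sum>z\<in>UNIV. sq B2 (z, j) (x, q) * sq B1 (y, i) (z, p) * sq C (p, q) (k, l))"
    unfolding sq_legs_12_13_23
    by (simp add: mult_ac) (rule sum_rotate[symmetric])
  also have "\<dots> = sq (sq (leg2 ?Y * leg1 ?X * ?C) I J) x y"
    unfolding IJ sq_times[of "leg2 ?Y * leg1 ?X"] sum_UNIV_prod
    by (simp add: sq_leg2_leg1 sq_sum sq_diag_mult_right) (simp add: sq_times right_rep_def sum_distrib_right mult.assoc)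
  finally show "sq (sq (?C * leg1 ?X * leg2 ?Y) I J) x y = sq (sq (leg2 ?Y * leg1 ?X * ?C) I J) x y" .
qed

text \<open>Under the equation suited to left multiplication, \<open>right_rep\<close> satisfies the
  RTT relation with the two letters interchanged (\<open>rev\<close>). Passing to inverses
  interchanges them again.\<close>

lemma rtt_skew_rep:
  fixes A1 A2 C D1 D2 :: "('n::finite \<times> 'n, 's::comm_ring_1) sqm"
  assumes comm: "legs23 C * legs12 A1 * legs13 A2 = legs13 A2 * legs12 A1 * legs23 C"
    and inv: "right_rep A1 * skew_rep D1 = 1" "skew_rep D1 * right_rep A1 = 1"
      "right_rep A2 * skew_rep D2 = 1" "skew_rep D2 * right_rep A2 = 1"
  shows "rtt_rel (sq_map sq_diag C) (skew_rep D1) (skew_rep D2)"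
proof -
  let ?X = "right_rep A1" and ?Y = "right_rep A2" and ?C = "sq_map sq_diag C :: ('n \<times> 'n, ('n, 's) sqm) sqm"
  let ?D = "leg1 (skew_rep D1)" and ?E = "leg2 (skew_rep D2)"
  have rev: "?C * leg2 ?Y * leg1 ?X = leg1 ?X * leg2 ?Y * ?C"
  proof (rule sqm_eqI, rule sqm_eqI)
    fix I J :: "'n \<times> 'n" and x y :: 'n
    obtain i j k l where IJ: "I = (i, j)" "J = (k, l)" by (metis prod.exhaust)
    have "sq (sq (?C * leg2 ?Y * leg1 ?X) I J) x y =
        (\<Sum>p\<in>UNIV. \<Sum>q\<in>UNIV. \<Sum>z\<in>UNIV. sq C (i, j) (p, q) * (sq A2 (z, q) (x, l) * sq A1 (y, p) (z, k)))"
      unfolding mult.assoc[of ?C] IJ sq_times[of ?C] sum_UNIV_prod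
      by (simp add: sq_leg2_leg1 sq_sum sq_diag_mult_left) (simp add: sq_times right_rep_def sum_distrib_left mult.assoc)
    also have "\<dots> = sq (legs23 C * legs12 A1 * legs13 A2) (y, i, j) (x, k, l)"
      by (simp add: sq_legs_simps mult_ac cong: if_cong)
    also have "\<dots> = sq (legs13 A2 * legs12 A1 * legs23 C) (y, i, j) (x, k, l)"
      by (simp only: comm)
    also have "\<dots> = (\<Sum>p\<in>UNIV. \<Sum>q\<in>UNIV. \<Sum>z\<in>UNIV. sq A1 (z, i) (x, p) * sq A2 (y, j) (z, q) * sq C (p, q) (k, l))"
      by (simp add: sq_legs_simps mult_ac cong: if_cong)
        (rule trans[OF sum_rotate sum.cong[OF refl sum.swap]])
    also have "\<dots> = sq (sq (leg1 ?X * leg2 ?Y * ?C) I J) x y"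
      unfolding IJ sq_times[of "leg1 ?X * leg2 ?Y"] sum_UNIV_prod
      by (simp add: sq_leg1_leg2 sq_sum sq_diag_mult_right) (simp add: sq_times right_rep_def sum_distrib_right mult.assoc)
    finally show "sq (sq (?C * leg2 ?Y * leg1 ?X) I J) x y = sq (sq (leg1 ?X * leg2 ?Y * ?C) I J) x y" .
  qed
  have d: "?D * leg1 ?X = 1" "leg1 ?X * ?D = 1" "?E * leg2 ?Y = 1" "leg2 ?Y * ?E = 1"
    by (simp_all add: inv unital_hom_mult[OF leg_hom(1), symmetric] unital_hom_mult[OF leg_hom(2), symmetric]
        unital_hom_one[OF leg_hom(1)] unital_hom_one[OF leg_hom(2)])
  have "?E * ?D * ?C = ?E * ?D * ?C * (leg2 ?Y * (leg1 ?X * ?D) * ?E)" by (simp add: d)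
  also have "\<dots> = ?E * ?D * (?C * leg2 ?Y * leg1 ?X) * ?D * ?E" by (simp only: mult.assoc)
  also have "\<dots> = ?E * (?D * leg1 ?X) * leg2 ?Y * ?C * ?D * ?E" unfolding rev by (simp only: mult.assoc)
  also have "\<dots> = ?C * ?D * ?E" by (simp add: d)
  finally show ?thesis by (simp add: rtt_rel_def)
qed

lemma skew_rep_inverse:
  fixes A :: "'s::comm_ring_1 ^ ('n::finite \<times> 'n) ^ ('n \<times> 'n)"
  assumes "skew_matrix A * D = 1" "D * skew_matrix A = 1"
  shows "right_rep (of_mat A) * skew_rep D = 1" "skew_rep D * right_rep (of_mat A) = 1"
proof -
  have "sq (sq (right_rep (of_mat A) * skew_rep D) k l) i j = sq (D * skew_matrix A) (l, j) (k, i)" for k l i j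
    by (simp add: sq_times sq_sum right_rep_def skew_rep_def skew_matrix_def sum_UNIV_prod mult.commute) (rule sum.swap)
  thus "right_rep (of_mat A) * skew_rep D = 1"
    by (intro sqm_eqI) (auto simp: assms sq_one)
  have "sq (sq (skew_rep D * right_rep (of_mat A)) k l) i j = sq (skew_matrix A * D) (j, l) (i, k)" for k l i j
    by (simp add: sq_times sq_sum right_rep_def skew_rep_def skew_matrix_def sum_UNIV_prod mult.commute)
  thus "skew_rep D * right_rep (of_mat A) = 1"
    by (intro sqm_eqI) (auto simp: assms sq_one)
qed

lemma rep_sq_map:
  "left_rep (sq_map f A) = sq_map (sq_map f) (left_rep A)"
  "right_rep (sq_map f A) = sq_map (sq_map f) (right_rep A)"
  "skew_rep (sq_map f A) = sq_map (sq_map f) (skew_rep A)"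
  by (rule sqm_eqI, rule sqm_eqI, simp add: left_rep_def right_rep_def skew_rep_def)+

subsection \<open>Kernels of operators on words\<close>

text \<open>If an operator sends the letter \<open>t\<^sub>k\<^sub>l(v)\<close> to the sum of the \<open>\<phi> k l k' l' (v) t\<^sub>k\<^sub>'\<^sub>l\<^sub>'(v)\<close>, whose coefficients are
  matrices, then \<open>word_kernel \<phi> z w w'\<close> is the coefficient of the word \<open>w'\<close> in the image of \<open>w\<close> applied to the
  vector \<open>z\<close>.\<close>

definition mode_coeff :: "nat \<Rightarrow> nat \<Rightarrow> 's::zero fps \<Rightarrow> 's" where
  "mode_coeff m m' X = (if m' \<le> m then fps_nth X (m - m') else 0)"

fun word_kernel :: "('n \<Rightarrow> 'n \<Rightarrow> 'n \<Rightarrow> 'n \<Rightarrow> ('m::finite, 's::comm_ring_1 fps) sqm) \<Rightarrow> ('m \<Rightarrow> 's)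
    \<Rightarrow> ('n \<times> 'n \<times> nat) list \<Rightarrow> ('n \<times> 'n \<times> nat) list \<Rightarrow> 'm \<Rightarrow> 's" where
  "word_kernel \<phi> z [] [] i = z i"
| "word_kernel \<phi> z ((k, l, m) # w) ((k', l', m') # w') i =
     (\<Sum>j\<in>UNIV. mode_coeff m m' (sq (\<phi> k l k' l') i j) * word_kernel \<phi> z w w' j)"
| "word_kernel \<phi> z [] (x # w') i = 0"
| "word_kernel \<phi> z (x # w) [] i = 0"

text \<open>Same length, modes not exceeding those of \<open>w\<close>, arbitrary matrix indices:
  only the powers of v restrict which words can occur. The kernel is supported on this finite
  set.\<close>

definition below :: "('n \<times> 'n \<times> nat) list \<Rightarrow> ('n \<times> 'n \<times> nat) list set" where
  "below w = {w'. list_all2 (\<lambda>(k, l, m) (k', l', m'). m' \<le> m) w w'}"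

lemma below_Nil [simp]: "below [] = {[]}"
  by (simp add: below_def)

lemma below_Cons: "below ((k, l, m) # w) =
    (\<lambda>(k', l', m', w'). (k', l', m') # w') ` (UNIV \<times> UNIV \<times> {..m} \<times> below w)"
  by (auto simp: below_def list_all2_Cons1 image_iff)

lemma finite_below: "finite (below (w :: ('n::finite \<times> 'n \<times> nat) list))"
proof (induction w)
  case (Cons x w)
  obtain k l m where "x = (k, l, m)" by (metis prod.exhaust)
  thus ?case using Cons by (simp add: below_Cons)
qed simp

lemma sum_below_Cons:
  fixes f :: "('n::finite \<times> 'n \<times> nat) list \<Rightarrow> 'a::comm_monoid_add"
  shows "(\<Sum>w'\<in>below ((k, l, m) # w). f w') =
    (\<Sum>k'\<in>UNIV. \<Sum>l'\<in>UNIV. \<Sum>m'\<le>m. \<Sum>w'\<in>below w. f ((k', l', m') # w'))"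
proof -
  have "inj_on (\<lambda>(k', l', m', w'). (k', l', m') # w') (UNIV \<times> UNIV \<times> {..m} \<times> below w)"
    by (auto simp: inj_on_def)
  thus ?thesis
    by (simp add: below_Cons sum.reindex sum.cartesian_product case_prod_unfold)
qed

lemma kernel_eq_0: "w' \<notin> below w \<Longrightarrow> word_kernel \<phi> z w w' i = 0"
proof (induction \<phi> z w w' i rule: word_kernel.induct)
  case (2 \<phi> z k l m w k' l' m' w' i)
  show ?case
  proof (cases "m' \<le> m")
    case True
    hence "w' \<notin> below w" using 2(2) by (simp add: below_def)
    thus ?thesis using 2(1) by simp
  qed (simp add: mode_coeff_def)
qed (simp_all add: below_def)

lemma below_trans: "w' \<in> below w \<Longrightarrow> w'' \<in> below w' \<Longrightarrow> w'' \<in> below w"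
  unfolding below_def mem_Collect_eq
  by (rule list_all2_trans[of "\<lambda>(k, l, m) (k', l', m'). m' \<le> m" "\<lambda>(k, l, m) (k', l', m'). m' \<le> m"
        "\<lambda>(k, l, m) (k', l', m'). m' \<le> m"]) auto

lemma mode_coeff_mult:
  fixes X Y :: "'s::comm_ring_1 fps"
  shows "(\<Sum>m'\<le>m. mode_coeff m' m'' X * mode_coeff m m' Y) = mode_coeff m m'' (X * Y)"
proof (cases "m'' \<le> m")
  case True
  have "(\<Sum>m'\<le>m. mode_coeff m' m'' X * mode_coeff m m' Y) =
      (\<Sum>m'\<in>{m''..m}. fps_nth X (m' - m'') * fps_nth Y (m - m'))"
    by (rule sum.mono_neutral_cong_right) (auto simp: mode_coeff_def)
  also have "\<dots> = (\<Sum>i\<in>{0..m - m''}. fps_nth X i * fps_nth Y (m - m'' - i))"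
    using True by (intro sum.reindex_bij_witness[of _ "\<lambda>i. i + m''" "\<lambda>i. i - m''"]) (auto simp: add.commute)
  finally show ?thesis using True by (simp add: mode_coeff_def fps_mult_nth)
qed (auto simp: mode_coeff_def intro!: sum.neutral)

lemma mode_coeff_sum: "mode_coeff m m' (sum f S) = (\<Sum>i\<in>S. mode_coeff m m' (f i :: 's::comm_ring_1 fps))"
  by (simp add: mode_coeff_def fps_sum_nth)

lemma mode_coeff_const_mult:
  "mode_coeff m m' (fps_const c * X) = c * mode_coeff m m' (X :: 's::comm_ring_1 fps)"
  "mode_coeff m m' (X * fps_const c) = mode_coeff m m' (X :: 's::comm_ring_1 fps) * c"
  by (simp_all add: mode_coeff_def)

text \<open>The letters of the operator for \<open>\<phi>\<close> applied after the operator for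
  \<open>\<phi>'\<close>; the auxiliary spaces are tensored.\<close>

definition letter_comp ::
  "('n \<Rightarrow> 'n \<Rightarrow> 'n \<Rightarrow> 'n \<Rightarrow> ('a, 's::comm_ring_1) sqm) \<Rightarrow> ('n \<Rightarrow> 'n \<Rightarrow> 'n \<Rightarrow> 'n \<Rightarrow> ('b, 's) sqm)
     \<Rightarrow> 'n::finite \<Rightarrow> 'n \<Rightarrow> 'n \<Rightarrow> 'n \<Rightarrow> ('a::finite \<times> 'b::finite, 's) sqm" where
  "letter_comp \<phi> \<phi>' k l k'' l'' = Sqm (\<lambda>(i, j) (p, q).
     \<Sum>k'\<in>UNIV. \<Sum>l'\<in>UNIV. sq (\<phi> k' l' k'' l'') i p * sq (\<phi>' k l k' l') j q)"

text \<open>Scalars commute, so the sum over intermediate words factorises letter by letter, and the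
  sum over an intermediate mode is a Cauchy product. The composite is therefore a word operator
  again.\<close>

lemma kernel_comp:
  fixes w w'' :: "('n::finite \<times> 'n \<times> nat) list"
  shows "(\<Sum>w'\<in>below w. word_kernel \<phi> z w' w'' i * word_kernel \<phi>' z' w w' j) =
    word_kernel (letter_comp \<phi> \<phi>') (\<lambda>(i, j). z i * z' j) w w'' (i, j)"
proof (induction w arbitrary: w'' i j)
  case Nil
  show ?case by (cases w'') simp_all
next
  case (Cons x w)
  obtain k l m where x: "x = (k, l, m)" by (metis prod.exhaust)
  show ?case
  proof (cases w'')
    case Nil
    thus ?thesis by (simp add: x sum_below_Cons)
  next
    case (Cons y v)
    obtain k'' l'' m'' where y: "y = (k'', l'', m'')" by (metis prod.exhaust)
    let ?a = "\<lambda>k' l' m' p. mode_coeff m' m'' (sq (\<phi> k' l' k'' l'') i p)"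
    let ?b = "\<lambda>k' l' m' q. mode_coeff m m' (sq (\<phi>' k l k' l') j q)"
    let ?K = "\<lambda>w' p. word_kernel \<phi> z w' v p" and ?K' = "\<lambda>w' q. word_kernel \<phi>' z' w w' q"
    let ?C = "\<lambda>p q. word_kernel (letter_comp \<phi> \<phi>') (\<lambda>(i, j). z i * z' j) w v (p, q)"
    have inner: "(\<Sum>w'\<in>below w. (\<Sum>p\<in>UNIV. a p * ?K w' p) * (\<Sum>q\<in>UNIV. b q * ?K' w' q)) =
        (\<Sum>p\<in>UNIV. \<Sum>q\<in>UNIV. a p * b q * ?C p q)" for a b
    proof -
      have "(\<Sum>w'\<in>below w. (\<Sum>p\<in>UNIV. a p * ?K w' p) * (\<Sum>q\<in>UNIV. b q * ?K' w' q)) =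
          (\<Sum>w'\<in>below w. \<Sum>p\<in>UNIV. \<Sum>q\<in>UNIV. a p * b q * (?K w' p * ?K' w' q))"
        by (simp add: sum_product mult_ac)
      also have "\<dots> = (\<Sum>p\<in>UNIV. \<Sum>q\<in>UNIV. \<Sum>w'\<in>below w. a p * b q * (?K w' p * ?K' w' q))"
        by (rule sum_rotate[symmetric])
      finally show ?thesis by (simp only: sum_distrib_left[symmetric] Cons.IH)
    qed
    have "(\<Sum>w'\<in>below (x # w). word_kernel \<phi> z w' w'' i * word_kernel \<phi>' z' (x # w) w' j) =
        (\<Sum>k'\<in>UNIV. \<Sum>l'\<in>UNIV. \<Sum>m'\<le>m. \<Sum>p\<in>UNIV. \<Sum>q\<in>UNIV. ?a k' l' m' p * ?b k' l' m' q * ?C p q)"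
      by (simp add: x y Cons sum_below_Cons inner)
    also have "\<dots> = (\<Sum>k'\<in>UNIV. \<Sum>l'\<in>UNIV. \<Sum>p\<in>UNIV. \<Sum>q\<in>UNIV.
        mode_coeff m m'' (sq (\<phi> k' l' k'' l'') i p * sq (\<phi>' k l k' l') j q) * ?C p q)"
      by (intro sum.cong refl)
        (simp only: mode_coeff_mult[symmetric] sum_distrib_right sum_rotate[of _ UNIV UNIV "{..m}"] sum_rotate[symmetric, of _ "{..m}"])
    also have "\<dots> = (\<Sum>p\<in>UNIV. \<Sum>q\<in>UNIV. \<Sum>k'\<in>UNIV. \<Sum>l'\<in>UNIV.
        mode_coeff m m'' (sq (\<phi> k' l' k'' l'') i p * sq (\<phi>' k l k' l') j q) * ?C p q)"
      by (subst sum_rotate[symmetric]) (intro sum.cong refl sum_rotate[symmetric])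
    also have "\<dots> = word_kernel (letter_comp \<phi> \<phi>') (\<lambda>(i, j). z i * z' j) (x # w) w'' (i, j)"
      by (simp add: x y Cons sum_UNIV_prod letter_comp_def mode_coeff_sum sum_distrib_right)
    finally show ?thesis .
  qed
qed

text \<open>The transfer principle behind the kernel identities: an intertwiner \<open>N\<close>
  that does not depend on the variable of a letter moves through the word letter by letter until it
  meets the vector \<open>z\<close>, so a single letter has to be checked.\<close>

lemma kernel_equivariant:
  fixes N :: "'a::finite \<Rightarrow> 'm::finite \<Rightarrow> 's::comm_ring_1"
  assumes eq: "\<And>k l k' l' i p. (\<Sum>j\<in>UNIV. fps_const (N i j) * sq (\<phi> k l k' l') j p) =
      (\<Sum>j\<in>UNIV. sq (\<phi>' k l k' l') i j * fps_const (N j p))"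
  shows "(\<Sum>j\<in>UNIV. N i j * word_kernel \<phi> z w w' j) = word_kernel \<phi>' (\<lambda>i. \<Sum>j\<in>UNIV. N i j * z j) w w' i"
proof (induction w arbitrary: w' i)
  case Nil
  show ?case by (cases w') simp_all
next
  case (Cons x w)
  obtain k l m where x: "x = (k, l, m)" by (metis prod.exhaust)
  show ?case
  proof (cases w')
    case Nil
    thus ?thesis by (simp add: x)
  next
    case (Cons y v)
    obtain k' l' m' where y: "y = (k', l', m')" by (metis prod.exhaust)
    let ?c = "mode_coeff m m'"
    have "(\<Sum>j\<in>UNIV. N i j * word_kernel \<phi> z (x # w) w' j) =
        (\<Sum>j\<in>UNIV. \<Sum>p\<in>UNIV. N i j * ?c (sq (\<phi> k l k' l') j p) * word_kernel \<phi> z w v p)"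
      by (simp add: x y Cons sum_distrib_left mult.assoc)
    also have "\<dots> = (\<Sum>p\<in>UNIV. (\<Sum>j\<in>UNIV. N i j * ?c (sq (\<phi> k l k' l') j p)) * word_kernel \<phi> z w v p)"
      unfolding sum_distrib_right by (rule sum.swap)
    also have "\<dots> = (\<Sum>p\<in>UNIV. (\<Sum>j\<in>UNIV. ?c (sq (\<phi>' k l k' l') i j) * N j p) * word_kernel \<phi> z w v p)"
    proof (intro sum.cong refl arg_cong2[where f = "(*)"])
      fix p
      show "(\<Sum>j\<in>UNIV. N i j * ?c (sq (\<phi> k l k' l') j p)) = (\<Sum>j\<in>UNIV. ?c (sq (\<phi>' k l k' l') i j) * N j p)"
        using arg_cong[OF eq[of i k l k' l' p], of ?c] by (simp add: mode_coeff_sum mode_coeff_const_mult)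
    qed
    also have "\<dots> = (\<Sum>j\<in>UNIV. ?c (sq (\<phi>' k l k' l') i j) * (\<Sum>p\<in>UNIV. N j p * word_kernel \<phi> z w v p))"
      unfolding sum_distrib_right sum_distrib_left mult.assoc by (rule sum.swap)
    also have "\<dots> = word_kernel \<phi>' (\<lambda>i. \<Sum>j\<in>UNIV. N i j * z j) (x # w) w' i"
      by (simp add: x y Cons Cons.IH)
    finally show ?thesis .
  qed
qed

lemma kernel_map:
  assumes f: "unital_hom f"
  shows "f (word_kernel \<phi> z w w' i) =
    word_kernel (\<lambda>k l k' l'. sq_map (fps_map f) (\<phi> k l k' l')) (\<lambda>i. f (z i)) w w' i"
proof (induction \<phi> z w w' i rule: word_kernel.induct)
  case (2 \<phi> z k l m w k' l' m' w' i)
  have "f (mode_coeff m m' X) = mode_coeff m m' (fps_map f X)" for X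
    using f by (simp add: mode_coeff_def unital_hom_zero)
  thus ?case using 2 f by (simp add: unital_hom_simps)
qed (use f in \<open>simp_all add: unital_hom_zero\<close>)

text \<open>The vector \<open>z\<close> is fixed by each letter that is kept and annihilated by
  every other transition, so no word but \<open>w\<close> itself survives.\<close>

lemma kernel_identity:
  assumes eq: "\<And>k l k' l' i. (\<Sum>p\<in>UNIV. sq (\<phi> k l k' l') i p * fps_const (z p)) =
      (if k = k' \<and> l = l' then fps_const (z i) else 0)"
  shows "word_kernel \<phi> z w w' i = (if w = w' then z i else 0)"
proof (induction w arbitrary: w' i)
  case Nil
  show ?case by (cases w') simp_all
next
  case (Cons x w)
  obtain k l m where x: "x = (k, l, m)" by (metis prod.exhaust)
  show ?case
  proof (cases w')
    case (Cons y v)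
    obtain k' l' m' where y: "y = (k', l', m')" by (metis prod.exhaust)
    have eq': "(\<Sum>p\<in>UNIV. mode_coeff m m' (sq (\<phi> k l k' l') i p) * z p) =
        mode_coeff m m' (if k = k' \<and> l = l' then fps_const (z i) else 0)"
      using arg_cong[OF eq[of k l k' l' i], of "mode_coeff m m'"]
      by (simp add: mode_coeff_sum mode_coeff_const_mult)
    have "word_kernel \<phi> z (x # w) w' i =
        (if w = v then mode_coeff m m' (if k = k' \<and> l = l' then fps_const (z i) else 0) else 0)"
      using eq' Cons.IH[of v] by (simp add: x y Cons)
    thus ?thesis by (auto simp: x y Cons mode_coeff_def)
  qed (simp add: x)
qed

subsection \<open>Letters of the two operators\<close>

text \<open>The entries (i, j) of the auxiliary matrix are treated as a vector. \<open>A\<close>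
  multiplies this matrix from the left and acts on the left letter index; \<open>B\<close>
  multiplies from the right and acts on the right letter index.\<close>

definition letter_T :: "('n \<times> 'n, 's::comm_ring_1) sqm \<Rightarrow> ('n \<times> 'n, 's) sqm
    \<Rightarrow> 'n \<Rightarrow> 'n \<Rightarrow> 'n \<Rightarrow> 'n \<Rightarrow> ('n \<times> 'n, 's) sqm" where
  "letter_T A B k l k' l' = Sqm (\<lambda>(i, j) (p, q). sq A (i, k) (p, k') * sq B (q, l') (j, l))"

text \<open>The sides are exchanged: the matrix that multiplies from the left acts on the right
  letter index, where it is to cancel the \<open>B\<close> of \<open>letter_T\<close>, and
  \<open>D\<close> acts on the left letter index.\<close>

definition letter_S :: "('n \<times> 'n, 's::comm_ring_1) sqm \<Rightarrow> ('n \<times> 'n, 's) sqm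
    \<Rightarrow> 'n \<Rightarrow> 'n \<Rightarrow> 'n \<Rightarrow> 'n \<Rightarrow> ('n \<times> 'n, 's) sqm" where
  "letter_S A D k l k' l' = Sqm (\<lambda>(i, j) (p, q). sq A (i, l') (p, l) * sq D (k', q) (j, k))"

text \<open>The identity of the auxiliary matrix algebra as a vector; the operator series are the
  values of the letter action on it.\<close>

definition delta :: "'n \<times> 'n \<Rightarrow> 's::comm_ring_1" where
  "delta = (\<lambda>(i, j). if i = j then 1 else 0)"

lemma kernel_T_S:
  fixes A :: "'s::comm_ring_1 fps ^ ('n::finite \<times> 'n) ^ ('n \<times> 'n)" and w w'' :: "('n \<times> 'n \<times> nat) list"
  assumes B: "B * B' = 1" and D: "skew_matrix A * D = 1"
  shows "(\<Sum>p\<in>UNIV. \<Sum>w'\<in>below w. word_kernel (letter_T (of_mat A) B) delta w' w'' (i, p) *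
      word_kernel (letter_S B' D) delta w w' (p, j)) = (if w = w'' \<and> i = j then 1 else (0 :: 's))"
proof -
  \<comment> \<open>\<open>N\<close> contracts the auxiliary index between the two operators.
    Through this contraction \<open>B\<close> cancels against \<open>B'\<close>, and \<psi> is what
    is left of a letter of the product.\<close>
  define N :: "'n \<times> 'n \<Rightarrow> ('n \<times> 'n) \<times> ('n \<times> 'n) \<Rightarrow> 's" where
    "N = (\<lambda>(i, j) ((i', p), (p', j')). if i = i' \<and> j = j' \<and> p = p' then 1 else 0)"
  define \<psi> :: "'n \<Rightarrow> 'n \<Rightarrow> 'n \<Rightarrow> 'n \<Rightarrow> ('n \<times> 'n, 's fps) sqm" where
    "\<psi> = (\<lambda>k l k'' l''. Sqm (\<lambda>(i, j) (a, d).
       (\<Sum>k'\<in>UNIV. A $ (i, k') $ (a, k'') * sq D (k', d) (j, k)) * (if l'' = l then 1 else 0)))"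
  let ?\<phi> = "letter_T (of_mat A) B" and ?\<phi>' = "letter_S B' D"
  let ?z = "\<lambda>(i, j). delta i * delta j :: 's"
  have BB: "(\<Sum>p\<in>UNIV. \<Sum>q\<in>UNIV. sq B (b, l) (p, q) * sq B' (p, q) (c, l')) = (if b = c \<and> l = l' then 1 else 0)"
    for b l c l'
    using arg_cong[OF B, of "\<lambda>X. sq X (b, l) (c, l')"] by (simp add: sq_times sum_UNIV_prod sq_one)
  have eq: "(\<Sum>J\<in>UNIV. fps_const (N I J) * sq (letter_comp ?\<phi> ?\<phi>' k l k'' l'') J P) =
      (\<Sum>J\<in>UNIV. sq (\<psi> k l k'' l'') I J * fps_const (N J P))" for k l k'' l'' I P
  proof -
    obtain i j where I: "I = (i, j)" by fastforce
    obtain a b c d where P: "P = ((a, b), (c, d))" by (metis prod.exhaust)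
    have "(\<Sum>J\<in>UNIV. fps_const (N I J) * sq (letter_comp ?\<phi> ?\<phi>' k l k'' l'') J P) =
       (\<Sum>p\<in>UNIV. \<Sum>k'\<in>UNIV. \<Sum>l'\<in>UNIV. (A $ (i, k') $ (a, k'') * sq D (k', d) (j, k)) * (sq B (b, l'') (p, l') * sq B' (p, l') (c, l)))"
      by (simp add: I P N_def letter_comp_def letter_T_def letter_S_def sum_UNIV_prod if_conj_eq if_mult_distribs
          sum_if_const if_distrib[of fps_const] sum_distrib_left mult_ac cong: if_cong)
    also have "\<dots> = (\<Sum>k'\<in>UNIV. \<Sum>p\<in>UNIV. \<Sum>l'\<in>UNIV. (A $ (i, k') $ (a, k'') * sq D (k', d) (j, k)) * (sq B (b, l'') (p, l') * sq B' (p, l') (c, l)))"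
      by (rule sum.swap)
    also have "\<dots> = (\<Sum>k'\<in>UNIV. (A $ (i, k') $ (a, k'') * sq D (k', d) (j, k))) * (if b = c \<and> l'' = l then 1 else 0)"
      by (simp only: sum_distrib_left[symmetric] sum_distrib_right[symmetric] BB)
    also have "\<dots> = (\<Sum>J\<in>UNIV. sq (\<psi> k l k'' l'') I J * fps_const (N J P))"
      by (simp add: I P N_def \<psi>_def sum_UNIV_prod if_conj_eq if_mult_distribs
          sum_if_const if_distrib[of fps_const] cong: if_cong)
    finally show ?thesis .
  qed
  have "(\<Sum>p\<in>UNIV. \<Sum>w'\<in>below w. word_kernel ?\<phi> delta w' w'' (i, p) * word_kernel ?\<phi>' delta w w' (p, j)) =
      (\<Sum>J\<in>UNIV. N (i, j) J * word_kernel (letter_comp ?\<phi> ?\<phi>') ?z w w'' J)"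
    unfolding kernel_comp by (simp add: N_def sum_UNIV_prod if_conj_eq if_mult_distribs sum_if_const cong: if_cong)
  also have "\<dots> = word_kernel \<psi> (\<lambda>i. \<Sum>j\<in>UNIV. N i j * ?z j) w w'' (i, j)"
    by (rule kernel_equivariant[OF eq])
  also have "(\<lambda>i. \<Sum>j\<in>UNIV. N i j * ?z j) = delta"
    by (rule ext) (auto simp: N_def delta_def sum_UNIV_prod if_conj_eq if_mult_distribs sum_if_const cong: if_cong)
  \<comment> \<open>Acting on the identity matrix, the remaining letter produces the entries of
    \<open>skew_matrix A * D\<close>, which is 1.\<close>
  also have "word_kernel \<psi> delta w w'' (i, j) = (if w = w'' then delta (i, j) else 0)"
  proof (rule kernel_identity)
    fix k l k' l' and I :: "'n \<times> 'n"
    obtain i j where I: "I = (i, j)" by fastforce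
    have "(\<Sum>p\<in>UNIV. sq (\<psi> k l k' l') I p * fps_const (delta p)) =
        (\<Sum>a\<in>UNIV. \<Sum>x\<in>UNIV. A $ (i, x) $ (a, k') * sq D (x, a) (j, k)) * (if l' = l then 1 else 0)"
      by (simp add: I \<psi>_def delta_def sum_UNIV_prod if_mult_distribs if_distrib[of fps_const] sum_if_const cong: if_cong)
    also have "(\<Sum>a\<in>UNIV. \<Sum>x\<in>UNIV. A $ (i, x) $ (a, k') * sq D (x, a) (j, k)) = sq (skew_matrix A * D) (i, k') (j, k)"
      by (subst sum.swap) (simp add: sq_times skew_matrix_def sum_UNIV_prod)
    finally show "(\<Sum>p\<in>UNIV. sq (\<psi> k l k' l') I p * fps_const (delta p)) =
        (if k = k' \<and> l = l' then fps_const (delta I) else 0)"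
      by (auto simp: D sq_one delta_def I)
  qed
  finally show ?thesis by (simp add: delta_def)
qed

lemma kernel_S_T:
  fixes A :: "'s::comm_ring_1 fps ^ ('n::finite \<times> 'n) ^ ('n \<times> 'n)" and w w'' :: "('n \<times> 'n \<times> nat) list"
  assumes B: "B' * B = 1" and D: "D * skew_matrix A = 1"
  shows "(\<Sum>p\<in>UNIV. \<Sum>w'\<in>below w. word_kernel (letter_S B' D) delta w' w'' (i, p) *
      word_kernel (letter_T (of_mat A) B) delta w w' (p, j)) = (if w = w'' \<and> i = j then 1 else (0 :: 's))"
proof -
  \<comment> \<open>The contraction now cancels the skew inverse against \<open>A\<close>; the
    relation \<open>B' * B = 1\<close> enters when the remaining letter acts on the identity
    matrix.\<close>
  define N :: "'n \<times> 'n \<Rightarrow> ('n \<times> 'n) \<times> ('n \<times> 'n) \<Rightarrow> 's" where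
    "N = (\<lambda>(i, j) ((i', p), (p', j')). if i = i' \<and> j = j' \<and> p = p' then 1 else 0)"
  define \<psi> :: "'n \<Rightarrow> 'n \<Rightarrow> 'n \<Rightarrow> 'n \<Rightarrow> ('n \<times> 'n, 's fps) sqm" where
    "\<psi> = (\<lambda>k l k'' l''. Sqm (\<lambda>(i, j) (a, d).
       (\<Sum>l'\<in>UNIV. sq B' (i, l'') (a, l') * sq B (d, l') (j, l)) * (if k'' = k then 1 else 0)))"
  let ?\<phi> = "letter_T (of_mat A) B" and ?\<phi>' = "letter_S B' D"
  let ?z = "\<lambda>(i, j). delta i * delta j :: 's"
  have DD: "(\<Sum>q\<in>UNIV. \<Sum>p\<in>UNIV. sq D (k'', b) (p, q) * A $ (p, k) $ (c, q)) = (if b = c \<and> k'' = k then 1 else 0)"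
    for b k'' c k
    by (subst sum.swap, use arg_cong[OF D, of "\<lambda>X. sq X (k'', b) (k, c)"] in
        \<open>simp add: sq_times sum_UNIV_prod sq_one skew_matrix_def conj_commute\<close>)
  have eq: "(\<Sum>J\<in>UNIV. fps_const (N I J) * sq (letter_comp ?\<phi>' ?\<phi> k l k'' l'') J P) =
      (\<Sum>J\<in>UNIV. sq (\<psi> k l k'' l'') I J * fps_const (N J P))" for k l k'' l'' I P
  proof -
    obtain i j where I: "I = (i, j)" by fastforce
    obtain a b c d where P: "P = ((a, b), (c, d))" by (metis prod.exhaust)
    have "(\<Sum>J\<in>UNIV. fps_const (N I J) * sq (letter_comp ?\<phi>' ?\<phi> k l k'' l'') J P) =
       (\<Sum>p\<in>UNIV. \<Sum>k'\<in>UNIV. \<Sum>l'\<in>UNIV. (sq B' (i, l'') (a, l') * sq B (d, l') (j, l)) * (sq D (k'', b) (p, k') * A $ (p, k) $ (c, k')))"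
      by (simp add: I P N_def letter_comp_def letter_T_def letter_S_def sum_UNIV_prod if_conj_eq if_mult_distribs
          sum_if_const if_distrib[of fps_const] sum_distrib_left mult_ac cong: if_cong)
    also have "\<dots> = (\<Sum>l'\<in>UNIV. \<Sum>k'\<in>UNIV. \<Sum>p\<in>UNIV. (sq B' (i, l'') (a, l') * sq B (d, l') (j, l)) * (sq D (k'', b) (p, k') * A $ (p, k) $ (c, k')))"
      by (subst sum_rotate) (intro sum.cong refl sum.swap)
    also have "\<dots> = (\<Sum>l'\<in>UNIV. (sq B' (i, l'') (a, l') * sq B (d, l') (j, l))) * (if b = c \<and> k'' = k then 1 else 0)"
      by (simp only: sum_distrib_left[symmetric] sum_distrib_right[symmetric] DD)
    also have "\<dots> = (\<Sum>J\<in>UNIV. sq (\<psi> k l k'' l'') I J * fps_const (N J P))"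
      by (simp add: I P N_def \<psi>_def sum_UNIV_prod if_conj_eq if_mult_distribs
          sum_if_const if_distrib[of fps_const] cong: if_cong)
    finally show ?thesis .
  qed
  have "(\<Sum>p\<in>UNIV. \<Sum>w'\<in>below w. word_kernel ?\<phi>' delta w' w'' (i, p) * word_kernel ?\<phi> delta w w' (p, j)) =
      (\<Sum>J\<in>UNIV. N (i, j) J * word_kernel (letter_comp ?\<phi>' ?\<phi>) ?z w w'' J)"
    unfolding kernel_comp by (simp add: N_def sum_UNIV_prod if_conj_eq if_mult_distribs sum_if_const cong: if_cong)
  also have "\<dots> = word_kernel \<psi> (\<lambda>i. \<Sum>j\<in>UNIV. N i j * ?z j) w w'' (i, j)"
    by (rule kernel_equivariant[OF eq])
  also have "(\<lambda>i. \<Sum>j\<in>UNIV. N i j * ?z j) = delta"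
    by (rule ext) (auto simp: N_def delta_def sum_UNIV_prod if_conj_eq if_mult_distribs sum_if_const cong: if_cong)
  also have "word_kernel \<psi> delta w w'' (i, j) = (if w = w'' then delta (i, j) else 0)"
  proof (rule kernel_identity)
    fix k l k' l' and I :: "'n \<times> 'n"
    obtain i j where I: "I = (i, j)" by fastforce
    have "(\<Sum>p\<in>UNIV. sq (\<psi> k l k' l') I p * fps_const (delta p)) =
        (\<Sum>a\<in>UNIV. \<Sum>x\<in>UNIV. sq B' (i, l') (a, x) * sq B (a, x) (j, l)) * (if k' = k then 1 else 0)"
      by (simp add: I \<psi>_def delta_def sum_UNIV_prod if_mult_distribs if_distrib[of fps_const] sum_if_const cong: if_cong)
    also have "(\<Sum>a\<in>UNIV. \<Sum>x\<in>UNIV. sq B' (i, l') (a, x) * sq B (a, x) (j, l)) = sq (B' * B) (i, l') (j, l)"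
      by (simp add: sq_times sum_UNIV_prod)
    finally show "(\<Sum>p\<in>UNIV. sq (\<psi> k l k' l') I p * fps_const (delta p)) =
        (if k = k' \<and> l = l' then fps_const (delta I) else 0)"
      by (auto simp: B sq_one delta_def I)
  qed
  finally show ?thesis by (simp add: delta_def)
qed

text \<open>\<open>N1\<close> multiplies the composite in one order by R from the left,
  \<open>N2\<close> multiplies the composite in the other order by R from the right. By the two
  Yang-Baxter equations both intertwine with the same letters \<psi>, and both send the starting
  vector to the vector of entries of \<open>r\<close>.\<close>

lemma kernel_T_T:
  fixes R A A' B B' :: "('n::finite \<times> 'n, 's::comm_ring_1 fps) sqm" and w w'' :: "('n \<times> 'n \<times> nat) list"
    and r :: "('n \<times> 'n, 's) sqm"
  assumes R: "R = sq_map fps_const r"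
    and A: "legs12 R * legs23 A' * legs13 A = legs13 A * legs23 A' * legs12 R"
    and B: "legs12 R * legs13 B * legs23 B' = legs23 B' * legs13 B * legs12 R"
  shows "(\<Sum>p\<in>UNIV. \<Sum>q\<in>UNIV. sq r (i, j) (p, q) *
      (\<Sum>w'\<in>below w. word_kernel (letter_T A B) delta w' w'' (p, k) * word_kernel (letter_T A' B') delta w w' (q, l))) =
    (\<Sum>p\<in>UNIV. \<Sum>q\<in>UNIV. sq r (p, q) (k, l) *
      (\<Sum>w'\<in>below w. word_kernel (letter_T A' B') delta w' w'' (j, q) * word_kernel (letter_T A B) delta w w' (i, p)))"
proof -
  let ?\<phi> = "letter_T A B" and ?\<phi>' = "letter_T A' B'"
  let ?z = "\<lambda>(i, j). delta i * delta j :: 's"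
  define N1 :: "('n \<times> 'n) \<times> ('n \<times> 'n) \<Rightarrow> ('n \<times> 'n) \<times> ('n \<times> 'n) \<Rightarrow> 's" where
    "N1 = (\<lambda>((i, j), (k, l)) ((p, k'), (q, l')). if k = k' \<and> l = l' then sq r (i, j) (p, q) else 0)"
  define N2 :: "('n \<times> 'n) \<times> ('n \<times> 'n) \<Rightarrow> ('n \<times> 'n) \<times> ('n \<times> 'n) \<Rightarrow> 's" where
    "N2 = (\<lambda>((i, j), (k, l)) ((j', q), (i', p)). if i = i' \<and> j = j' then sq r (p, q) (k, l) else 0)"
  define \<psi> :: "'n \<Rightarrow> 'n \<Rightarrow> 'n \<Rightarrow> 'n \<Rightarrow> (('n \<times> 'n) \<times> ('n \<times> 'n), 's fps) sqm" where
    "\<psi> = (\<lambda>x y x'' y''. Sqm (\<lambda>((i, j), (k, l)) ((P, Q), (P', Q')).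
       sq (legs13 A * legs23 A') (i, j, x) (P, Q, x'') * sq (legs13 B * legs23 B') (P', Q', y'') (k, l, y)))"
  note ev = sum_UNIV_prod if_conj_eq if_mult_distribs sum_if_const if_distrib[of fps_const]
  have A3: "sq (legs13 A * legs23 A') (i, j, x) (P, Q, x'') =
      (\<Sum>x'\<in>UNIV. sq A (i, x) (P, x') * sq A' (j, x') (Q, x''))" for A A' :: "('n \<times> 'n, 's fps) sqm" and i j x P Q x''
    by (simp add: sq_legs_simps cong: if_cong)
  have A3': "sq (legs23 A' * legs13 A) (i, j, x) (P, Q, x'') =
      (\<Sum>x'\<in>UNIV. sq A' (j, x) (Q, x') * sq A (i, x') (P, x''))" for A A' :: "('n \<times> 'n, 's fps) sqm" and i j x P Q x''
    by (simp add: sq_legs_simps cong: if_cong)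
  have RX: "sq (legs12 R * X) (i, j, x) y = (\<Sum>p\<in>UNIV. \<Sum>q\<in>UNIV. fps_const (sq r (i, j) (p, q)) * sq X (p, q, x) y)"
    for X i j x y
    by (simp add: R legs12_def sq_times[of _ X] ev cong: if_cong)
  have XR: "sq (X * legs12 R) y (k, l, x) = (\<Sum>p\<in>UNIV. \<Sum>q\<in>UNIV. sq X y (p, q, x) * fps_const (sq r (p, q) (k, l)))"
    for X k l x y
    by (simp add: R legs12_def sq_times[of X] ev cong: if_cong)
  have eq1: "(\<Sum>J\<in>UNIV. fps_const (N1 I J) * sq (letter_comp ?\<phi> ?\<phi>' x y x'' y'') J P) =
      (\<Sum>J\<in>UNIV. sq (\<psi> x y x'' y'') I J * fps_const (N1 J P))" for x y x'' y'' I P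
  proof -
    obtain i j k l where I: "I = ((i, j), (k, l))" by (metis prod.exhaust)
    obtain a b c d where P: "P = ((a, b), (c, d))" by (metis prod.exhaust)
    have "(\<Sum>J\<in>UNIV. fps_const (N1 I J) * sq (letter_comp ?\<phi> ?\<phi>' x y x'' y'') J P) =
      (\<Sum>p\<in>UNIV. \<Sum>q\<in>UNIV. fps_const (sq r (i, j) (p, q)) *
        ((\<Sum>x'\<in>UNIV. sq A' (q, x) (c, x') * sq A (p, x') (a, x'')) * (\<Sum>y'\<in>UNIV. sq B (b, y'') (k, y') * sq B' (d, y') (l, y))))"
      by (simp add: I P N1_def letter_comp_def letter_T_def ev sum_product mult_ac cong: if_cong)
    also have "\<dots> = sq (legs12 R * (legs23 A' * legs13 A)) (i, j, x) (a, c, x'') * sq (legs13 B * legs23 B') (b, d, y'') (k, l, y)"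
      unfolding RX A3 A3' sum_distrib_right mult.assoc ..
    also have "legs12 R * (legs23 A' * legs13 A) = legs13 A * legs23 A' * legs12 R"
      using A by (simp add: mult.assoc)
    also have "sq (legs13 A * legs23 A' * legs12 R) (i, j, x) (a, c, x'') * sq (legs13 B * legs23 B') (b, d, y'') (k, l, y) =
      (\<Sum>J\<in>UNIV. sq (\<psi> x y x'' y'') I J * fps_const (N1 J P))"
      unfolding XR by (simp add: I P N1_def \<psi>_def ev sum_distrib_left sum_distrib_right mult_ac cong: if_cong)
    finally show ?thesis .
  qed
  have eq2: "(\<Sum>J\<in>UNIV. fps_const (N2 I J) * sq (letter_comp ?\<phi>' ?\<phi> x y x'' y'') J P) =
      (\<Sum>J\<in>UNIV. sq (\<psi> x y x'' y'') I J * fps_const (N2 J P))" for x y x'' y'' I P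
  proof -
    obtain i j k l where I: "I = ((i, j), (k, l))" by (metis prod.exhaust)
    obtain a b c d where P: "P = ((a, b), (c, d))" by (metis prod.exhaust)
    have "(\<Sum>J\<in>UNIV. fps_const (N2 I J) * sq (letter_comp ?\<phi>' ?\<phi> x y x'' y'') J P) =
      (\<Sum>q\<in>UNIV. \<Sum>p\<in>UNIV. (\<Sum>x'\<in>UNIV. sq A (i, x) (c, x') * sq A' (j, x') (a, x'')) *
         ((\<Sum>y'\<in>UNIV. sq B' (b, y'') (q, y') * sq B (d, y') (p, y)) * fps_const (sq r (p, q) (k, l))))"
      by (simp add: I P N2_def letter_comp_def letter_T_def ev sum_product sum_distrib_right sum_distrib_left mult_ac cong: if_cong)
        (intro sum.cong refl sum.swap)
    also have "\<dots> = (\<Sum>p\<in>UNIV. \<Sum>q\<in>UNIV. (\<Sum>x'\<in>UNIV. sq A (i, x) (c, x') * sq A' (j, x') (a, x'')) *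
         ((\<Sum>y'\<in>UNIV. sq B' (b, y'') (q, y') * sq B (d, y') (p, y)) * fps_const (sq r (p, q) (k, l))))"
      by (rule sum.swap)
    also have "\<dots> = sq (legs13 A * legs23 A') (i, j, x) (c, a, x'') * sq (legs23 B' * legs13 B * legs12 R) (d, b, y'') (k, l, y)"
      unfolding XR A3 A3' sum_distrib_left[symmetric] ..
    also have "legs23 B' * legs13 B * legs12 R = legs12 R * (legs13 B * legs23 B')"
      using B by (simp add: mult.assoc)
    also have "sq (legs13 A * legs23 A') (i, j, x) (c, a, x'') * sq (legs12 R * (legs13 B * legs23 B')) (d, b, y'') (k, l, y) =
      (\<Sum>J\<in>UNIV. sq (\<psi> x y x'' y'') I J * fps_const (N2 J P))"
      unfolding RX by (simp add: I P N2_def \<psi>_def ev sum_distrib_left sum_distrib_right mult_ac cong: if_cong)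
    finally show ?thesis .
  qed
  have "(\<Sum>p\<in>UNIV. \<Sum>q\<in>UNIV. sq r (i, j) (p, q) *
      (\<Sum>w'\<in>below w. word_kernel ?\<phi> delta w' w'' (p, k) * word_kernel ?\<phi>' delta w w' (q, l))) =
      (\<Sum>J\<in>UNIV. N1 ((i, j), (k, l)) J * word_kernel (letter_comp ?\<phi> ?\<phi>') ?z w w'' J)"
    unfolding kernel_comp by (simp add: N1_def ev cong: if_cong)
  also have "\<dots> = word_kernel \<psi> (\<lambda>i. \<Sum>j\<in>UNIV. N1 i j * ?z j) w w'' ((i, j), (k, l))"
    by (rule kernel_equivariant[OF eq1])
  also have "(\<lambda>i. \<Sum>j\<in>UNIV. N1 i j * ?z j) = (\<lambda>i. \<Sum>j\<in>UNIV. N2 i j * ?z j)"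
    by (rule ext) (auto simp: N1_def N2_def delta_def ev cong: if_cong)
  also have "word_kernel \<psi> (\<lambda>i. \<Sum>j\<in>UNIV. N2 i j * ?z j) w w'' ((i, j), (k, l)) =
      (\<Sum>J\<in>UNIV. N2 ((i, j), (k, l)) J * word_kernel (letter_comp ?\<phi>' ?\<phi>) ?z w w'' J)"
    by (rule kernel_equivariant[OF eq2, symmetric])
  also have "\<dots> = (\<Sum>q\<in>UNIV. \<Sum>p\<in>UNIV. sq r (p, q) (k, l) *
      (\<Sum>w'\<in>below w. word_kernel ?\<phi>' delta w' w'' (j, q) * word_kernel ?\<phi> delta w w' (i, p)))"
    unfolding kernel_comp by (simp add: N2_def ev cong: if_cong)
  finally show ?thesis by (subst (2) sum.swap)
qed

subsection \<open>Scalars in the free algebra\<close>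

definition central :: "'a::semiring_1 \<Rightarrow> bool" where
  "central x \<longleftrightarrow> (\<forall>y. x * y = y * x)"

lemma centralD: "central x \<Longrightarrow> x * y = y * x"
  by (simp add: central_def)

lemma central_fps:
  fixes X :: "'a::ring_1 fps"
  assumes "\<And>n. central (fps_nth X n)"
  shows "central X"
  unfolding central_def
proof (intro allI fps_ext)
  fix Y :: "'a fps" and n
  have "fps_nth (X * Y) n = (\<Sum>i=0..n. fps_nth Y (n - i) * fps_nth X i)"
    unfolding fps_mult_nth by (intro sum.cong refl centralD assms)
  also have "\<dots> = (\<Sum>i=0..n. fps_nth Y i * fps_nth X (n - i))"
    by (rule sum.reindex_bij_witness[of _ "\<lambda>i. n - i" "\<lambda>i. n - i"]) auto
  finally show "fps_nth (X * Y) n = fps_nth (Y * X) n" by (simp add: fps_mult_nth)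
qed

lemma central_fls:
  fixes X :: "'a::ring_1 fls"
  assumes "\<And>n. central (fls_nth X n)"
  shows "central X"
  unfolding central_def
proof (intro allI fls_eqI)
  fix Y :: "'a fls" and n
  let ?a = "fls_subdegree X" and ?b = "fls_subdegree Y"
  have "fls_nth (X * Y) n = (\<Sum>i\<in>{?a..n - ?b}. fls_nth Y (n - i) * fls_nth X i)"
    unfolding fls_times_nth(2) by (intro sum.cong refl centralD assms)
  also have "\<dots> = (\<Sum>i\<in>{?b..n - ?a}. fls_nth Y i * fls_nth X (n - i))"
    by (rule sum.reindex_bij_witness[of _ "\<lambda>i. n - i" "\<lambda>i. n - i"]) auto
  finally show "fls_nth (X * Y) n = fls_nth (Y * X) n" by (simp add: fls_times_nth(2))
qed

lemma falg_decompose: "x = (\<Sum>a\<in>Poly_Mapping.keys x. Poly_Mapping.single a (Poly_Mapping.lookup x a))"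
proof (rule poly_mapping_eqI)
  fix k
  show "Poly_Mapping.lookup x k =
      Poly_Mapping.lookup (\<Sum>a\<in>Poly_Mapping.keys x. Poly_Mapping.single a (Poly_Mapping.lookup x a)) k"
    by (simp add: lookup_sum lookup_single when_def in_keys_iff)
qed

lemma falg_density:
  fixes D :: "('a \<Rightarrow>\<^sub>0 'c::ab_group_add) \<Rightarrow> 'b::ab_group_add"
  assumes "Modules.additive D" "\<And>a c. D (Poly_Mapping.single a c) = 0"
  shows "D x = 0"
  by (subst falg_decompose) (simp add: Modules.additive.sum[OF assms(1)] assms(2))

lemma scal_hom: "unital_hom scal"
  by (rule unital_homI) (simp_all add: scal_def single_add mult_single)

lemma central_scal: "central (scal c)"
  unfolding central_def
proof
  fix y :: "('n \<times> 'n \<times> nat) fword \<Rightarrow>\<^sub>0 complex"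
  have "scal c * y - y * scal c = 0"
    by (rule falg_density) (auto simp: Modules.additive_def algebra_simps scal_def mult_single mult.commute)
  thus "scal c * y = y * scal c" by simp
qed

lemma scal_uh_eq: "scal_uh = fps_map (fls_map scal)"
  by (rule ext, rule fps_ext) (simp add: scal_uh_def fls_map_def)

lemma scal_h_eq: "scal_h = fps_map scal"
  by (rule ext, rule fps_ext) (simp add: scal_h_def)

lemma scal_0 [simp]: "scal 0 = 0"
  by (simp add: scal_def)

lemma scal_uh_hom: "unital_hom scal_uh"
  unfolding scal_uh_eq by (intro fps_map_hom fls_map_hom scal_hom)

lemma scal_h_hom: "unital_hom scal_h"
  unfolding scal_h_eq by (intro fps_map_hom scal_hom)

lemma central_scal_uh: "central (scal_uh X)"
  unfolding scal_uh_eq by (auto intro!: central_fps central_fls simp: fls_map_nth central_scal)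

lemma central_scal_h: "central (scal_h s)"
  unfolding scal_h_eq by (auto intro!: central_fps simp: central_scal)

lemma embed_u_hom: "unital_hom embed_u"
  unfolding embed_u_def[abs_def] by (rule unital_hom_comp[OF fps_const_hom fls_const_hom])

lemma embed_u_scal: "embed_u (scal c) = scal_uh (fps_const (fls_const c))"
  by (rule fps_ext, rule fls_eqI) (simp add: embed_u_def scal_uh_eq fls_map_nth)

section \<open>Words as a basis of the free algebra\<close>

definition monom_word :: "('n \<times> 'n \<times> nat) list \<Rightarrow> 'n falg" where
  "monom_word w = Poly_Mapping.single (Word w) 1"

lemma monom_word_Nil: "monom_word [] = 1"
  by (simp add: monom_word_def zero_fword_def[symmetric])

lemma monom_word_append: "monom_word (v @ w) = monom_word v * monom_word w"
  by (simp add: monom_word_def mult_single)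

lemma monom_word_Cons: "monom_word ((k, l, m) # w) = tgen k l m * monom_word w"
  using monom_word_append[of "[(k, l, m)]" w] by (simp add: monom_word_def tgen_def)

lemma single_eq_scal_monom: "Poly_Mapping.single (Word w) c = scal c * monom_word w"
proof -
  have "0 + Word w = Word w" by (rule add_0_left)
  thus ?thesis by (simp add: scal_def monom_word_def mult_single del: plus_fword.simps)
qed

lemma falg_word_density:
  fixes D :: "'n falg \<Rightarrow> 'b::ab_group_add"
  assumes "Modules.additive D" "\<And>w c. D (scal c * monom_word w) = 0"
  shows "D x = 0"
  using assms(1)
proof (rule falg_density)
  fix a :: "('n \<times> 'n \<times> nat) fword" and c
  obtain w where "a = Word w" by (cases a)
  thus "D (Poly_Mapping.single a c) = 0" by (simp add: single_eq_scal_monom assms(2))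
qed

subsection \<open>Laurent coefficients and \<open>h\<close>-adic approximation\<close>

lemma u_coeff_nth [simp]: "fps_nth (u_coeff r X) k = fls_nth (fps_nth X k) r"
  by (simp add: u_coeff_def)

lemma u_coeff_additive: "Modules.additive (u_coeff r :: 'a::ab_group_add fls fps \<Rightarrow> _)"
  by (auto simp: Modules.additive_def intro: fps_ext)

text \<open>The pole order in u may grow with the power of h, but up to a fixed power of h there is
  a common bound. This is the finiteness behind the later sums over powers of u.\<close>

lemma ex_lower_bound: "\<exists>a. \<forall>j\<le>k. \<forall>i<a. fls_nth (fps_nth X j) i = 0" for k :: nat
proof -
  let ?a = "Min ((\<lambda>j. fls_subdegree (fps_nth X j)) ` {..k})"
  have "fls_nth (fps_nth X j) i = 0" if "j \<le> k" "i < ?a" for i j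
  proof -
    have "?a \<le> fls_subdegree (fps_nth X j)" using that by (intro Min_le) auto
    thus ?thesis using that by simp
  qed
  thus ?thesis by blast
qed

lemma u_coeff_mult_nth:
  fixes E X :: "'a::ring_1 fls fps"
  assumes "\<forall>j\<le>k. \<forall>i<a. fls_nth (fps_nth E j) i = 0" "\<forall>j\<le>k. \<forall>i<b. fls_nth (fps_nth X j) i = 0" "j \<le> k"
  shows "fps_nth (u_coeff r (E * X)) j = (\<Sum>i\<in>{a..r - b}. fps_nth (u_coeff i E * u_coeff (r - i) X) j)"
proof -
  have "fps_nth (u_coeff r (E * X)) j = (\<Sum>l=0..j. fls_nth (fps_nth E l * fps_nth X (j - l)) r)"
    by (simp add: fps_mult_nth fls_sum_nth)
  also have "\<dots> = (\<Sum>l=0..j. \<Sum>i\<in>{a..r - b}. fls_nth (fps_nth E l) i * fls_nth (fps_nth X (j - l)) (r - i))"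
    using assms by (intro sum.cong refl fls_mult_nth) auto
  also have "\<dots> = (\<Sum>i\<in>{a..r - b}. fps_nth (u_coeff i E * u_coeff (r - i) X) j)"
    by (subst sum.swap) (simp add: fps_mult_nth)
  finally show ?thesis .
qed

text \<open>Closedness in the h-adic topology in terms of truncations;
  \<open>h_closed_iff_closed\<close> identifies it with \<open>closed\<close>.\<close>

definition h_closed :: "'a::zero fps set \<Rightarrow> bool" where
  "h_closed J \<longleftrightarrow> (\<forall>x. (\<forall>k. \<exists>y\<in>J. \<forall>j\<le>k. fps_nth x j = fps_nth y j) \<longrightarrow> x \<in> J)"

lemma h_closedD: "h_closed J \<Longrightarrow> (\<And>k. \<exists>y\<in>J. \<forall>j\<le>k. fps_nth x j = fps_nth y j) \<Longrightarrow> x \<in> J"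
  by (auto simp: h_closed_def)

text \<open>For \<open>P = UNIV\<close> this is a two-sided ideal; other choices of \<open>P\<close>
  describe stability under multiplication by scalar series.\<close>

definition submodule :: "'a::ring_1 set \<Rightarrow> 'a set \<Rightarrow> bool" where
  "submodule P J \<longleftrightarrow> 0 \<in> J \<and> (\<forall>x\<in>J. \<forall>y\<in>J. x + y \<in> J) \<and> (\<forall>p\<in>P. \<forall>x\<in>J. p * x \<in> J \<and> x * p \<in> J)"

lemma submodule_sum: "submodule P J \<Longrightarrow> (\<And>i. i \<in> S \<Longrightarrow> f i \<in> J) \<Longrightarrow> sum f S \<in> J"
  by (induction S rule: infinite_finite_induct) (auto simp: submodule_def)

text \<open>The series that vanish once their coefficients are taken modulo
  \<open>J\<close>.\<close>

definition laurent_set :: "'a::zero fps set \<Rightarrow> 'a fls fps set" where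
  "laurent_set J = {X. \<forall>r. u_coeff r X \<in> J}"

lemma laurent_set_h_closed:
  assumes "h_closed J"
  shows "h_closed (laurent_set J)"
  unfolding h_closed_def laurent_set_def
proof (intro allI impI CollectI)
  fix x r assume *: "\<forall>k. \<exists>y\<in>{X. \<forall>r. u_coeff r X \<in> J}. \<forall>j\<le>k. fps_nth x j = fps_nth y j"
  show "u_coeff r x \<in> J"
  proof (rule h_closedD[OF assms])
    fix k
    obtain y where "\<forall>r. u_coeff r y \<in> J" "\<forall>j\<le>k. fps_nth x j = fps_nth y j" using * by blast
    thus "\<exists>y\<in>J. \<forall>j\<le>k. fps_nth (u_coeff r x) j = fps_nth y j" by (intro bexI[of _ "u_coeff r y"]) auto
  qed
qed

text \<open>A coefficient of a product of Laurent series is an infinite sum that is finite modulo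
  each power of h. The finite sums lie in \<open>J\<close>, and \<open>J\<close> is h-adically
  closed.\<close>

lemma laurent_set_submodule:
  fixes J P :: "'a::ring_1 fps set"
  assumes J: "h_closed J" "submodule P J"
  shows "submodule (laurent_set P) (laurent_set J)"
proof -
  have *: "u_coeff r (E * X) \<in> J"
    if "\<And>r s. u_coeff r E * u_coeff s X \<in> J" for E X :: "'a fls fps" and r
  proof (rule h_closedD[OF J(1)])
    fix k
    obtain a b where ab: "\<forall>j\<le>k. \<forall>i<a. fls_nth (fps_nth E j) i = 0" "\<forall>j\<le>k. \<forall>i<b. fls_nth (fps_nth X j) i = 0"
      using ex_lower_bound by metis
    show "\<exists>y\<in>J. \<forall>j\<le>k. fps_nth (u_coeff r (E * X)) j = fps_nth y j"
    proof (rule bexI[of _ "\<Sum>i\<in>{a..r - b}. u_coeff i E * u_coeff (r - i) X"])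
      show "\<forall>j\<le>k. fps_nth (u_coeff r (E * X)) j = fps_nth (\<Sum>i\<in>{a..r - b}. u_coeff i E * u_coeff (r - i) X) j"
        using u_coeff_mult_nth[OF ab] by (simp add: fps_sum_nth)
      show "(\<Sum>i\<in>{a..r - b}. u_coeff i E * u_coeff (r - i) X) \<in> J"
        by (rule submodule_sum[OF J(2)]) (rule that)
    qed
  qed
  have "u_coeff r (0 :: 'a fls fps) = 0" for r by (rule fps_ext) simp
  thus ?thesis
    using J(2) by (auto simp: submodule_def laurent_set_def Modules.additive.add[OF u_coeff_additive] intro!: *)
qed

subsection \<open>The algebra homomorphism attached to a family of letters\<close>

text \<open>The coefficient of v^m in the sum of the products \<phi>(v) t(v): the mode
  \<open>m'\<close> comes from the generator and the power \<open>m - m'\<close> from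
  \<phi>.\<close>

definition letter_image :: "('n \<Rightarrow> 'n \<Rightarrow> 'n \<Rightarrow> 'n \<Rightarrow> ('m, complex fls fps fps) sqm)
    \<Rightarrow> 'n \<times> 'n \<times> nat \<Rightarrow> ('m::finite, 'n::finite falg fls fps) sqm" where
  "letter_image \<phi> = (\<lambda>(k, l, m). \<Sum>k'\<in>UNIV. \<Sum>l'\<in>UNIV. \<Sum>m'\<le>m.
     Sqm (\<lambda>i j. scal_uh (fps_nth (sq (\<phi> k l k' l') i j) (m - m')) * embed_u (tgen k' l' m')))"

definition word_image :: "('n \<Rightarrow> 'n \<Rightarrow> 'n \<Rightarrow> 'n \<Rightarrow> ('m, complex fls fps fps) sqm)
    \<Rightarrow> ('n \<times> 'n \<times> nat) list \<Rightarrow> ('m::finite, 'n::finite falg fls fps) sqm" where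
  "word_image \<phi> w = prod_list (map (letter_image \<phi>) w)"

fun the_word :: "'g fword \<Rightarrow> 'g list" where
  "the_word (Word w) = w"

definition falg_image :: "('n \<Rightarrow> 'n \<Rightarrow> 'n \<Rightarrow> 'n \<Rightarrow> ('m, complex fls fps fps) sqm)
    \<Rightarrow> 'n falg \<Rightarrow> ('m::finite, 'n::finite falg fls fps) sqm" where
  "falg_image \<phi> x = (\<Sum>a\<in>Poly_Mapping.keys x.
     sq_diag (embed_u (scal (Poly_Mapping.lookup x a))) * word_image \<phi> (the_word a))"

lemma falg_image_additive: "Modules.additive (falg_image \<phi>)"
  unfolding Modules.additive_def falg_image_def
proof (intro allI)
  fix x y
  let ?f = "\<lambda>a c. sq_diag (embed_u (scal c)) * word_image \<phi> (the_word a)"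
  show "(\<Sum>a\<in>Poly_Mapping.keys (x + y). ?f a (Poly_Mapping.lookup (x + y) a)) =
     (\<Sum>a\<in>Poly_Mapping.keys x. ?f a (Poly_Mapping.lookup x a)) +
     (\<Sum>a\<in>Poly_Mapping.keys y. ?f a (Poly_Mapping.lookup y a))"
    by (rule setsum_keys_plus_distrib)
      (simp_all add: unital_hom_simps[OF scal_hom] unital_hom_simps[OF embed_u_hom] unital_hom_simps[OF sq_diag_hom] distrib_right)
qed

lemma falg_image_monom: "falg_image \<phi> (scal c * monom_word w) = sq_diag (embed_u (scal c)) * word_image \<phi> w"
  by (cases "c = 0") (simp_all add: single_eq_scal_monom[symmetric] falg_image_def
      unital_hom_zero[OF embed_u_hom] unital_hom_zero[OF sq_diag_hom])

lemma central_sq_diag: "central c \<Longrightarrow> central (sq_diag c :: ('i::finite, 'a::ring_1) sqm)"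
  unfolding central_def by (auto intro!: sqm_eqI simp: sq_diag_mult_left sq_diag_mult_right)

text \<open>Images of words multiply under concatenation by construction, and scalars go to central
  diagonal matrices, which move past the words.\<close>

lemma falg_image_mult:
  fixes \<phi> :: "'n::finite \<Rightarrow> 'n \<Rightarrow> 'n \<Rightarrow> 'n \<Rightarrow> ('m::finite, complex fls fps fps) sqm"
  shows "falg_image \<phi> (x * y) = falg_image \<phi> x * falg_image \<phi> y"
proof -
  note add = Modules.additive.add[OF falg_image_additive]
  have 1: "falg_image \<phi> (scal c * monom_word v * y) - falg_image \<phi> (scal c * monom_word v) * falg_image \<phi> y = 0" for c v y
  proof (rule falg_word_density)
    show "Modules.additive (\<lambda>y. falg_image \<phi> (scal c * monom_word v * y) - falg_image \<phi> (scal c * monom_word v) * falg_image \<phi> y)"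
      by (simp add: Modules.additive_def add distrib_left)
    fix w d
    let ?d = "\<lambda>c. sq_diag (embed_u (scal c)) :: ('m, 'n falg fls fps) sqm"
    have "scal c * monom_word v * (scal d * monom_word w) = scal c * (monom_word v * scal d) * monom_word w"
      by (simp only: mult.assoc)
    also have "monom_word v * scal d = scal d * monom_word v" by (rule centralD[OF central_scal, symmetric])
    also have "scal c * (scal d * monom_word v) * monom_word w = scal (c * d) * monom_word (v @ w)"
      by (simp add: unital_hom_mult[OF scal_hom] monom_word_append mult.assoc)
    finally have "scal c * monom_word v * (scal d * monom_word w) = scal (c * d) * monom_word (v @ w)" .
    hence "falg_image \<phi> (scal c * monom_word v * (scal d * monom_word w)) = ?d (c * d) * (word_image \<phi> v * word_image \<phi> w)"
      by (simp add: falg_image_monom word_image_def)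
    also have "?d (c * d) = ?d c * ?d d"
      by (simp add: unital_hom_mult[OF scal_hom] unital_hom_mult[OF embed_u_hom] unital_hom_mult[OF sq_diag_hom])
    also have "?d c * ?d d * (word_image \<phi> v * word_image \<phi> w) = ?d c * (?d d * word_image \<phi> v) * word_image \<phi> w"
      by (simp only: mult.assoc)
    also have "?d d * word_image \<phi> v = word_image \<phi> v * ?d d"
      by (rule centralD) (intro central_sq_diag, simp add: embed_u_scal central_scal_uh)
    finally show "falg_image \<phi> (scal c * monom_word v * (scal d * monom_word w)) -
        falg_image \<phi> (scal c * monom_word v) * falg_image \<phi> (scal d * monom_word w) = 0"
      by (simp add: falg_image_monom mult.assoc)
  qed
  have "falg_image \<phi> (x * y) - falg_image \<phi> x * falg_image \<phi> y = 0"
  proof (rule falg_word_density[where D = "\<lambda>x. falg_image \<phi> (x * y) - falg_image \<phi> x * falg_image \<phi> y"])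
    show "Modules.additive (\<lambda>x. falg_image \<phi> (x * y) - falg_image \<phi> x * falg_image \<phi> y)"
      by (simp add: Modules.additive_def add distrib_right)
  qed (rule 1)
  thus ?thesis by simp
qed

lemma falg_image_tgen: "falg_image \<phi> (tgen k l m) = letter_image \<phi> (k, l, m)"
  using falg_image_monom[of \<phi> 1 "[(k, l, m)]"] monom_word_Cons[of k l m "[]"]
  by (simp add: unital_hom_one[OF scal_hom] unital_hom_one[OF embed_u_hom] unital_hom_one[OF sq_diag_hom]
      word_image_def monom_word_Nil)

definition image_entry :: "('n \<Rightarrow> 'n \<Rightarrow> 'n \<Rightarrow> 'n \<Rightarrow> ('m, complex fls fps fps) sqm)
    \<Rightarrow> 'm::finite \<Rightarrow> 'm \<Rightarrow> 'n falg \<Rightarrow> 'n::finite falg fls fps" where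
  "image_entry \<phi> i j x = sq (falg_image \<phi> x) i j"

lemma image_entry_additive: "Modules.additive (image_entry \<phi> i j)"
  by (simp add: Modules.additive_def image_entry_def Modules.additive.add[OF falg_image_additive])

lemma image_entry_mult: "image_entry \<phi> i j (x * y) = (\<Sum>c\<in>UNIV. image_entry \<phi> i c x * image_entry \<phi> c j y)"
  by (simp add: image_entry_def falg_image_mult sq_times)

lemma image_entry_scal: "image_entry \<phi> i j (scal c * x) = embed_u (scal c) * image_entry \<phi> i j x"
proof -
  have "falg_image \<phi> (scal c) = sq_diag (embed_u (scal c))"
    using falg_image_monom[of \<phi> c "[]"] by (simp add: monom_word_Nil word_image_def)
  thus ?thesis by (simp add: image_entry_def falg_image_mult sq_diag_mult_left)
qed

definition image_h :: "('n \<Rightarrow> 'n \<Rightarrow> 'n \<Rightarrow> 'n \<Rightarrow> ('m, complex fls fps fps) sqm)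
    \<Rightarrow> 'm::finite \<Rightarrow> 'm \<Rightarrow> 'n falg fps \<Rightarrow> 'n::finite falg fls fps" where
  "image_h \<phi> i j = fps_lift (image_entry \<phi> i j)"

lemma image_h_additive: "Modules.additive (image_h \<phi> i j)"
  unfolding image_h_def by (rule fps_lift_additive[OF image_entry_additive])

lemma image_h_mult: "image_h \<phi> i j (x * y) = (\<Sum>c\<in>UNIV. image_h \<phi> i c x * image_h \<phi> c j y)"
  unfolding image_h_def by (rule fps_lift_bilinear[OF image_entry_additive image_entry_additive image_entry_additive image_entry_mult])

lemma image_h_const: "image_h \<phi> i j (fps_const x) = image_entry \<phi> i j x"
  unfolding image_h_def by (rule fps_lift_const) (rule Modules.additive.zero[OF image_entry_additive])

lemma image_h_X: "image_h \<phi> i j (fps_X * x) = fps_X * image_h \<phi> i j x"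
  unfolding image_h_def by (rule fps_lift_X) (rule Modules.additive.zero[OF image_entry_additive])

text \<open>The closure properties of the defining ideal pull back along the homomorphism, which
  respects truncation in h and multiplication by h. By minimality of the ideal, descent then has to
  be checked on relators only.\<close>

lemma image_h_preserves_ideal:
  fixes J :: "'n::finite falg fps set" and \<phi> :: "'n \<Rightarrow> 'n \<Rightarrow> 'n \<Rightarrow> 'n \<Rightarrow> ('m::finite, complex fls fps fps) sqm"
  assumes J: "h_closed J" "submodule UNIV J" "\<And>x. fps_X * x \<in> J \<Longrightarrow> x \<in> J"
  defines "J' \<equiv> {x. \<forall>i j. image_h \<phi> i j x \<in> laurent_set J}"
  shows "h_closed J'" "submodule UNIV J'" "\<And>x. fps_X * x \<in> J' \<Longrightarrow> x \<in> J'"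
proof -
  let ?L = "laurent_set J"
  have UNIV: "laurent_set (UNIV :: 'n falg fps set) = UNIV" by (simp add: laurent_set_def)
  have L: "h_closed ?L" "submodule UNIV ?L"
    using laurent_set_h_closed[OF J(1)] laurent_set_submodule[OF J(1,2)] by (simp_all add: UNIV)
  show "h_closed J'"
    unfolding h_closed_def J'_def
  proof (intro allI impI CollectI)
    fix x i j assume *: "\<forall>k. \<exists>y\<in>{x. \<forall>i j. image_h \<phi> i j x \<in> ?L}. \<forall>j\<le>k. fps_nth x j = fps_nth y j"
    show "image_h \<phi> i j x \<in> ?L"
    proof (rule h_closedD[OF L(1)])
      fix k
      obtain y where y: "image_h \<phi> i j y \<in> ?L" "\<forall>j\<le>k. fps_nth x j = fps_nth y j" using * by blast
      have "fps_nth (image_h \<phi> i j x) n = fps_nth (image_h \<phi> i j y) n" if "n \<le> k" for n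
        using y(2) that by (simp add: image_h_def fps_lift_nth)
      thus "\<exists>y\<in>?L. \<forall>n\<le>k. fps_nth (image_h \<phi> i j x) n = fps_nth y n" using y(1) by blast
    qed
  qed
  show "submodule UNIV J'"
    unfolding submodule_def J'_def
  proof (intro conjI ballI CollectI allI)
    fix i j
    show "image_h \<phi> i j 0 \<in> ?L"
      using L(2) by (simp add: Modules.additive.zero[OF image_h_additive] submodule_def)
    fix x assume x: "x \<in> {x. \<forall>i j. image_h \<phi> i j x \<in> ?L}"
    show "image_h \<phi> i j (x + y) \<in> ?L" if "y \<in> {x. \<forall>i j. image_h \<phi> i j x \<in> ?L}" for y
      using x that L(2) by (simp add: Modules.additive.add[OF image_h_additive] submodule_def)
    fix p :: "'n falg fps"
    show "image_h \<phi> i j (p * x) \<in> ?L" "image_h \<phi> i j (x * p) \<in> ?L"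
      unfolding image_h_mult using x L(2) by (auto intro!: submodule_sum[OF L(2)] simp: submodule_def)
  qed
  fix x assume "fps_X * x \<in> J'"
  hence X: "u_coeff r (fps_X * image_h \<phi> i j x) \<in> J" for i j r
    by (simp add: J'_def image_h_X laurent_set_def)
  have "u_coeff r (fps_X * Y) = fps_X * u_coeff r Y" for r and Y :: "'n falg fls fps"
    by (rule fps_ext) simp
  thus "x \<in> J'" using X J(3) by (simp add: J'_def laurent_set_def)
qed

subsection \<open>Series in one variable inside series in many variables\<close>

lemma mps_nth_times: "mps_nth (f * g) m = (\<Sum>(a, b)\<in>msplits m. mps_nth f a * mps_nth g b)"
  by (simp add: times_mps.rep_eq)

lemma mps_nth_plus [simp]: "mps_nth (f + g) m = mps_nth f m + mps_nth g m"
  and mps_nth_0 [simp]: "mps_nth 0 m = 0"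
  by (simp_all add: plus_mps.rep_eq zero_mps.rep_eq)

lemma mps_nth_sum: "mps_nth (sum f S) m = (\<Sum>i\<in>S. mps_nth (f i) m)"
  by (induction S rule: infinite_finite_induct) simp_all

lemma mps_nth_vseries: "mps_nth (vseries i f) m = (if set_mset m \<subseteq> {i} then f (size m) else 0)"
  by (simp add: vseries_def)

text \<open>A multiset supported on one index is determined by its size, so the splittings of m
  correspond to the decompositions of a number into two summands.\<close>

lemma vseries_mult:
  fixes f g :: "nat \<Rightarrow> 'a::semiring_1"
  shows "vseries i f * vseries i g = vseries i (\<lambda>n. \<Sum>j\<le>n. f j * g (n - j))"
proof (rule mps_eqI)
  fix m
  show "mps_nth (vseries i f * vseries i g) m = mps_nth (vseries i (\<lambda>n. \<Sum>j\<le>n. f j * g (n - j))) m"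
  proof (cases "set_mset m \<subseteq> {i}")
    case True
    have "x = replicate_mset (size x) i" if "set_mset x \<subseteq> {i}" for x
      using that by (metis set_mset_subset_singletonD)
    note rep = this
    have "mps_nth (vseries i f * vseries i g) m = (\<Sum>(a, b)\<in>msplits m. f (size a) * g (size b))"
      unfolding mps_nth_times
    proof (rule sum.cong)
      fix ab assume "ab \<in> msplits m"
      moreover obtain a b where ab: "ab = (a, b)" by fastforce
      ultimately have "a + b = m" by simp
      hence "set_mset a \<subseteq> {i}" "set_mset b \<subseteq> {i}" using True by auto
      thus "(case ab of (a, b) \<Rightarrow> mps_nth (vseries i f) a * mps_nth (vseries i g) b) =
          (case ab of (a, b) \<Rightarrow> f (size a) * g (size b))"
        by (simp add: ab mps_nth_vseries)
    qed (rule refl)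
    also have "\<dots> = (\<Sum>j\<le>size m. f j * g (size m - j))"
    proof (rule sum.reindex_bij_witness[where j = "\<lambda>(a, b). size a" and i = "\<lambda>j. (replicate_mset j i, replicate_mset (size m - j) i)"])
      fix ab assume ab: "ab \<in> msplits m"
      obtain a b where [simp]: "ab = (a, b)" by fastforce
      have m: "a + b = m" using ab by simp
      have sub: "set_mset a \<subseteq> {i}" "set_mset b \<subseteq> {i}" using True m by auto
      have "size m = size a + size b" using m by auto
      thus "(replicate_mset (case ab of (a, b) \<Rightarrow> size a) i, replicate_mset (size m - (case ab of (a, b) \<Rightarrow> size a)) i) = ab"
        using rep[OF sub(1)] rep[OF sub(2)] by simp
      show "(case ab of (a, b) \<Rightarrow> size a) \<in> {..size m}" using m by auto
      show "f (case ab of (a, b) \<Rightarrow> size a) * g (size m - (case ab of (a, b) \<Rightarrow> size a)) =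
         (case ab of (a, b) \<Rightarrow> f (size a) * g (size b))" using m by auto
    next
      fix j assume "j \<in> {..size m}"
      hence "replicate_mset j i + replicate_mset (size m - j) i = replicate_mset (size m) i"
        by (intro multiset_eqI) simp
      hence "replicate_mset j i + replicate_mset (size m - j) i = m"
        using rep[OF True] by simp
      thus "(replicate_mset j i, replicate_mset (size m - j) i) \<in> msplits m" by simp
    qed simp
    finally show ?thesis using True by (simp add: mps_nth_vseries)
  next
    case False
    have "mps_nth (vseries i f * vseries i g) m = 0"
      unfolding mps_nth_times
    proof (intro sum.neutral ballI)
      fix ab assume "ab \<in> msplits m"
      moreover obtain a b where ab: "ab = (a, b)" by fastforce
      ultimately have "a + b = m" by simp
      hence "\<not> (set_mset a \<subseteq> {i} \<and> set_mset b \<subseteq> {i})" using False by auto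
      thus "(case ab of (a, b) \<Rightarrow> mps_nth (vseries i f) a * mps_nth (vseries i g) b) = 0"
        by (auto simp: ab mps_nth_vseries)
    qed
    thus ?thesis using False by (simp add: mps_nth_vseries)
  qed
qed

lemma vseries_fps_mult: "vseries i (fps_nth X) * vseries i (fps_nth Y) = vseries i (fps_nth (X * Y))"
  for X Y :: "'a::semiring_1 fps"
  by (simp add: vseries_mult fps_mult_nth[abs_def] atLeast0AtMost)

lemma vseries_fps_sum: "(\<Sum>x\<in>S. vseries i (fps_nth (f x))) = vseries i (fps_nth (sum f S))"
  for f :: "_ \<Rightarrow> 'a::semiring_1 fps"
  by (rule mps_eqI) (simp add: mps_nth_sum mps_nth_vseries fps_sum_nth)

subsection \<open>The defining relations as power series in one variable\<close>

definition gen_u :: "'n \<Rightarrow> 'n \<Rightarrow> 'n falg fls fps" where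
  "gen_u p k = fps_const (fps_to_fls (Abs_fps (\<lambda>m. tgen p k m)))"

definition gen_w :: "'n \<Rightarrow> 'n \<Rightarrow> 'n falg fls fps fps" where
  "gen_w q l = Abs_fps (\<lambda>m. embed_u (tgen q l m))"

definition rel_lhs :: "complex fls fps ^ ('n::finite \<times> 'n) ^ ('n \<times> 'n) \<Rightarrow> 'n \<times> 'n \<Rightarrow> 'n \<times> 'n \<Rightarrow> 'n falg fls fps fps" where
  "rel_lhs Ru = (\<lambda>x (k, l). \<Sum>p\<in>UNIV. \<Sum>q\<in>UNIV.
     fps_map scal_uh (shift_v 0 (Ru $ x $ (p, q))) * (fps_const (gen_u p k) * gen_w q l))"

definition rel_rhs :: "complex fls fps ^ ('n::finite \<times> 'n) ^ ('n \<times> 'n) \<Rightarrow> 'n \<times> 'n \<Rightarrow> 'n \<times> 'n \<Rightarrow> 'n falg fls fps fps" where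
  "rel_rhs Ru = (\<lambda>(i, j) y. \<Sum>p\<in>UNIV. \<Sum>q\<in>UNIV.
     gen_w j q * fps_const (gen_u i p) * fps_map scal_uh (shift_v 0 (Ru $ (p, q) $ y)))"

lemma multi_12:
  assumes "\<alpha> \<in> multi {1, 2 :: nat}"
  shows "\<alpha> = (\<lambda>_. undefined)(1 := \<alpha> 1, 2 := \<alpha> 2)"
  using assms by (auto simp: multi_def PiE_iff extensional_def)

text \<open>Relators are indexed by monomials in all variables whereas the series involve one of
  them; every other monomial contributes 0, hence the alternative \<open>z = 0\<close>.\<close>

lemma RTT_relators_eq:
  fixes Ru :: "complex fls fps ^ ('n::finite \<times> 'n) ^ ('n \<times> 'n)"
  defines "rel \<equiv> \<lambda>x y r n. u_coeff r (fps_nth (rel_lhs Ru x y) n) - u_coeff r (fps_nth (rel_rhs Ru x y) n)"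
  shows "z \<in> RTT_relators Ru \<Longrightarrow> z = 0 \<or> (\<exists>x y r n. z = rel x y r n)"
    and "rel x y r n \<in> RTT_relators Ru"
proof -
  let ?L = "{1, 2 :: nat}"
  define R12 where "R12 = on_legs ?L 1 2 (R_series Ru 0 2)"
  define T1 :: "('n, _) tens" where "T1 = on_leg ?L 1 Tplus_u"
  define T2 :: "('n, _) tens" where "T2 = on_leg ?L 2 (Tplus_v embed_u 2)"
  have ent: "R_series Ru 0 2 $ x $ y = vseries 2 (fps_nth (fps_map scal_uh (shift_v 0 (Ru $ x $ y))))"
    "Tplus_v embed_u 2 $ k $ l = vseries 2 (fps_nth (gen_w k l))"
    "Tplus_u $ k $ l = vseries 2 (fps_nth (fps_const (gen_u k l)))" for x y k l
    by (rule mps_eqI, simp add: R_series_def shift_v_nth mps_nth_vseries)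
      (rule mps_eqI, simp add: Tplus_v_def gen_w_def mps_nth_vseries,
       rule mps_eqI, auto simp: Tplus_u_def gen_u_def vconst_def mps_nth_vseries)
  define e :: "nat \<Rightarrow> 'n" where "e = (\<lambda>_. undefined)"
  have in_multi: "e(1 := x, 2 := y) \<in> multi ?L" for x y
    by (auto simp: e_def multi_def PiE_iff extensional_def)
  have upd: "e(1 := x, 2 := y, 1 := x') = e(1 := x', 2 := y)"
    "e(1 := x, 2 := y, 2 := y') = e(1 := x, 2 := y')" for x y x' y'
    by (auto simp: fun_eq_iff)
  have eq: "e(1 := x, 2 := y) = e(1 := x', 2 := y') \<longleftrightarrow> x = x' \<and> y = y'" for x y x' y'
    by (auto dest: fun_cong[of _ _ 1] fun_cong[of _ _ 2])
  have v: "(e(1 := x, 2 := y)) 1 = x" "(e(1 := x, 2 := y)) 2 = y" for x y by simp_all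
  note ev = tprod_def foldr.simps id_apply o_apply tmult_on_legs tmult_on_leg in_multi upd v eq
  have lhs: "tprod ?L [R12, T1, T2] (e(1 := i, 2 := j)) (e(1 := k, 2 := l)) =
      vseries 2 (fps_nth (rel_lhs Ru (i, j) (k, l)))" for i j k l
    unfolding R12_def T1_def T2_def rel_lhs_def
    by (simp add: ev if_conj_eq if_mult_distribs sum_if_const ent vseries_fps_mult vseries_fps_sum
        del: fun_upd_apply One_nat_def cong: if_cong)
  have rhs: "tprod ?L [T2, T1, R12] (e(1 := i, 2 := j)) (e(1 := k, 2 := l)) =
      vseries 2 (fps_nth (rel_rhs Ru (i, j) (k, l)))" for i j k l
    unfolding R12_def T1_def T2_def rel_rhs_def
    by (simp add: ev if_conj_eq if_mult_distribs sum_if_const sum_distrib_left ent vseries_fps_mult vseries_fps_sum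
        del: fun_upd_apply One_nat_def cong: if_cong) (subst sum.swap, simp add: mult.assoc)
  have rels: "RTT_relators Ru = {u_coeff r (mps_nth (tprod ?L [R12, T1, T2] \<alpha> \<beta>) m) -
      u_coeff r (mps_nth (tprod ?L [T2, T1, R12] \<alpha> \<beta>) m) | r m \<alpha> \<beta>. \<alpha> \<in> multi ?L \<and> \<beta> \<in> multi ?L}"
    unfolding RTT_relators_def Let_def R12_def T1_def T2_def by (rule refl)
  have val: "u_coeff r (mps_nth (tprod ?L [R12, T1, T2] (e(1 := i, 2 := j)) (e(1 := k, 2 := l))) m) -
      u_coeff r (mps_nth (tprod ?L [T2, T1, R12] (e(1 := i, 2 := j)) (e(1 := k, 2 := l))) m) =
      (if set_mset m \<subseteq> {2} then rel (i, j) (k, l) r (size m) else 0)" for r m i j k l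
    unfolding lhs rhs rel_def by (simp add: mps_nth_vseries)
  show "z = 0 \<or> (\<exists>x y r n. z = rel x y r n)" if z: "z \<in> RTT_relators Ru"
  proof -
    obtain r m \<alpha> \<beta> where *: "z = u_coeff r (mps_nth (tprod ?L [R12, T1, T2] \<alpha> \<beta>) m) -
      u_coeff r (mps_nth (tprod ?L [T2, T1, R12] \<alpha> \<beta>) m)" "\<alpha> \<in> multi ?L" "\<beta> \<in> multi ?L"
      using z unfolding rels by blast
    have "\<alpha> = e(1 := \<alpha> 1, 2 := \<alpha> 2)" "\<beta> = e(1 := \<beta> 1, 2 := \<beta> 2)"
      unfolding e_def using *(2,3) multi_12 by blast+
    hence z': "z = (if set_mset m \<subseteq> {2} then rel (\<alpha> 1, \<alpha> 2) (\<beta> 1, \<beta> 2) r (size m) else 0)"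
      using *(1) val by metis
    show ?thesis
    proof (cases "set_mset m \<subseteq> {2}")
      case True
      hence "z = rel (\<alpha> 1, \<alpha> 2) (\<beta> 1, \<beta> 2) r (size m)" using z' by (simp only: if_True)
      thus ?thesis by blast
    qed (use z' in simp)
  qed
  show "rel x y r n \<in> RTT_relators Ru"
  proof -
    obtain i j k l where xy: "x = (i, j)" "y = (k, l)" by (metis prod.exhaust)
    have "set_mset (replicate_mset n 2) \<subseteq> {2 :: nat}" by auto
    thus ?thesis
      unfolding rels using val[of r i j k l "replicate_mset n 2"] in_multi xy by (simp, metis)
  qed
qed

lemma fls_map_0: "f 0 = 0 \<Longrightarrow> fls_map f 0 = 0"
  by (rule fls_eqI) (simp add: fls_map_nth)

lemma fls_map_const: "f 0 = 0 \<Longrightarrow> fls_map f (fls_const c) = fls_const (f c)"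
  by (rule fls_eqI) (simp add: fls_map_nth)

subsection \<open>Coefficientwise extension of the homomorphism\<close>

definition scal_uvh :: "complex fls fls fps \<Rightarrow> 'n falg fls fls fps" where
  "scal_uvh = fps_map (fls_map (fls_map scal))"

lemma fls_map_scal_0 [simp]: "fls_map scal 0 = 0"
  by (rule fls_eqI) (simp add: fls_map_nth)

lemma scal_uvh_hom: "unital_hom scal_uvh"
  unfolding scal_uvh_def by (intro fps_map_hom fls_map_hom scal_hom)

lemma central_scal_uvh: "central (scal_uvh X)"
  unfolding scal_uvh_def by (auto intro!: central_fps central_fls simp: fls_map_nth central_scal)

lemma central_fps_map_scal_uvh: "central (fps_map scal_uvh X)"
  by (rule central_fps) (simp add: central_scal_uvh)

lemma image_h_scal:
  "image_h \<phi> i j (scal_h c * x) = scal_uh (hconst c) * image_h \<phi> i j x"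
proof -
  have 1: "image_entry \<phi> i k (scal d) = (if i = k then embed_u (scal d) else 0)" for i k d
    using image_entry_scal[of \<phi> i k d 1] falg_image_monom[of \<phi> 1 "[]"]
    by (simp add: image_entry_def monom_word_Nil word_image_def sq_one unital_hom_one[OF scal_hom]
        unital_hom_one[OF embed_u_hom] unital_hom_one[OF sq_diag_hom])
  have "image_h \<phi> i k (scal_h c) = (if i = k then scal_uh (hconst c) else 0)" for k
  proof (rule fps_ext)
    fix n
    have "fps_nth (image_h \<phi> i k (scal_h c)) n =
        (\<Sum>j\<le>n. if j = n then if i = k then fls_const (scal (fps_nth c n)) else 0 else 0)"
      unfolding image_h_def fps_lift_nth by (rule sum.cong) (auto simp: scal_h_def 1 embed_u_def)
    thus "fps_nth (image_h \<phi> i k (scal_h c)) n = fps_nth (if i = k then scal_uh (hconst c) else 0) n"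
      by (simp add: scal_uh_eq hconst_def fls_map_const)
  qed
  thus ?thesis by (simp add: image_h_mult if_mult_distribs cong: if_cong)
qed

text \<open>The Laurent variable of the argument becomes the outer variable v, and the inner
  variable u comes from the values of \<open>g\<close>. In this way the relation keeps its own
  variable while the homomorphism introduces a new one.\<close>

definition coeffwise_fls :: "('a::zero \<Rightarrow> 'b::zero fps) \<Rightarrow> 'a fls \<Rightarrow> 'b fls fps" where
  "coeffwise_fls g Y = Abs_fps (\<lambda>k. fls_map (\<lambda>x. fps_nth (g x) k) Y)"

definition coeffwise :: "('a::zero \<Rightarrow> 'b::comm_monoid_add fps) \<Rightarrow> 'a fls fps \<Rightarrow> 'b fls fps" where
  "coeffwise g = fps_lift (coeffwise_fls g)"

lemma coeffwise_fls_nth: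
  assumes "Modules.additive g"
  shows "fls_nth (fps_nth (coeffwise_fls g Y) k) s = fps_nth (g (fls_nth Y s)) k"
  by (simp add: coeffwise_fls_def fls_map_nth Modules.additive.zero[OF assms])

lemma coeffwise_fls_additive:
  assumes "Modules.additive g"
  shows "Modules.additive (coeffwise_fls g)"
  unfolding Modules.additive_def
  by (intro allI fps_ext fls_eqI) (simp add: coeffwise_fls_nth[OF assms] Modules.additive.add[OF assms])

lemma coeffwise_additive:
  fixes g :: "'a::ring_1 \<Rightarrow> 'b::ring_1 fps"
  assumes "Modules.additive g"
  shows "Modules.additive (coeffwise g)"
  unfolding coeffwise_def by (rule fps_lift_additive[OF coeffwise_fls_additive[OF assms]])

lemma coeffwise_const:
  fixes g :: "'a::ring_1 \<Rightarrow> 'b::ring_1 fps"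
  assumes "Modules.additive g"
  shows "coeffwise g (fps_const Y) = coeffwise_fls g Y"
  unfolding coeffwise_def
  by (rule fps_lift_const) (rule Modules.additive.zero[OF coeffwise_fls_additive[OF assms]])

lemma u_coeff_coeffwise:
  fixes g :: "'a::ring_1 \<Rightarrow> 'b::ring_1 fps"
  assumes "Modules.additive g"
  shows "u_coeff s (coeffwise g X) = fps_lift g (u_coeff s X)"
  by (rule fps_ext) (simp add: coeffwise_def fps_lift_nth fls_sum_nth coeffwise_fls_nth[OF assms])

text \<open>A scalar series in the variable of the relation passes through the homomorphism as the
  same series in v. Up to order h^k each coefficient of the product is a finite sum, to which
  additivity applies.\<close>

lemma coeffwise_scal:
  "coeffwise (image_entry \<phi> i j) (scal_uh e * X) = scal_uvh (incl_v e) * coeffwise (image_entry \<phi> i j) X"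
proof (rule fps_ext, rule fls_eqI)
  fix k s
  let ?g = "image_entry \<phi> i j"
  note ad = image_entry_additive[of \<phi> i j]
  obtain a b where a: "\<forall>n\<le>k. \<forall>i<a. fls_nth (fps_nth e n) i = 0" and b: "\<forall>n\<le>k. \<forall>i<b. fls_nth (fps_nth X n) i = 0"
    using ex_lower_bound by metis
  have a': "\<forall>n\<le>k. \<forall>i<a. fls_nth (fps_nth (scal_uh e) n) i = 0"
    using a by (simp add: scal_uh_eq fls_map_nth)
  have a'': "\<forall>n\<le>k. \<forall>i<a. fls_nth (fps_nth (scal_uvh (incl_v e)) n) i = 0"
    using a by (simp add: scal_uvh_def incl_v_def fls_map_nth)
  have b'': "\<forall>n\<le>k. \<forall>i<b. fls_nth (fps_nth (coeffwise ?g X) n) i = 0"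
    using b by (simp add: coeffwise_def fps_lift_nth fls_sum_nth coeffwise_fls_nth[OF ad] Modules.additive.zero[OF ad])
  have c1: "u_coeff i (scal_uh e) = scal_h (u_coeff i e)" for i
    by (rule fps_ext) (simp add: scal_uh_eq scal_h_eq fls_map_nth)
  have c2: "u_coeff i (scal_uvh (incl_v e)) = scal_uh (hconst (u_coeff i e))" for i
    by (rule fps_ext, rule fls_eqI) (simp add: scal_uvh_def scal_uh_eq incl_v_def hconst_def fls_map_nth)
  have "fls_nth (fps_nth (coeffwise ?g (scal_uh e * X)) k) s = fps_nth (image_h \<phi> i j (u_coeff s (scal_uh e * X))) k"
    using arg_cong[OF u_coeff_coeffwise[OF ad, of s "scal_uh e * X"], of "\<lambda>Z. fps_nth Z k"] by (simp add: image_h_def)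
  also have "\<dots> = fps_nth (image_h \<phi> i j (\<Sum>i\<in>{a..s - b}. scal_h (u_coeff i e) * u_coeff (s - i) X)) k"
    unfolding image_h_def fps_lift_nth
  proof (intro sum.cong refl)
    fix n assume "n \<in> {..k}"
    hence "fps_nth (u_coeff s (scal_uh e * X)) n = fps_nth (\<Sum>i\<in>{a..s - b}. scal_h (u_coeff i e) * u_coeff (s - i) X) n"
      using u_coeff_mult_nth[OF a' b, of n s] by (simp only: c1 fps_sum_nth atMost_iff)
    thus "fps_nth (?g (fps_nth (u_coeff s (scal_uh e * X)) n)) (k - n) =
       fps_nth (?g (fps_nth (\<Sum>i\<in>{a..s - b}. scal_h (u_coeff i e) * u_coeff (s - i) X) n)) (k - n)"
      by (simp only:)
  qed
  also have "\<dots> = (\<Sum>t\<in>{a..s - b}. fps_nth (scal_uh (hconst (u_coeff t e)) * image_h \<phi> i j (u_coeff (s - t) X)) k)"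
    by (simp add: Modules.additive.sum[OF image_h_additive] image_h_scal fps_sum_nth)
  also have "\<dots> = fps_nth (u_coeff s (scal_uvh (incl_v e) * coeffwise ?g X)) k"
    unfolding u_coeff_mult_nth[OF a'' b'' order.refl] c2 u_coeff_coeffwise[OF ad] image_h_def ..
  finally show "fls_nth (fps_nth (coeffwise ?g (scal_uh e * X)) k) s =
      fls_nth (fps_nth (scal_uvh (incl_v e) * coeffwise ?g X) k) s" by simp
qed

lemma coeffwise_fls_mult_const:
  "coeffwise_fls (image_entry \<phi> i j) (Y * fls_const y) =
     (\<Sum>c\<in>UNIV. coeffwise_fls (image_entry \<phi> i c) Y * incl_u (image_entry \<phi> c j y))"
  "coeffwise_fls (image_entry \<phi> i j) (fls_const y * Y) =
     (\<Sum>c\<in>UNIV. incl_u (image_entry \<phi> i c y) * coeffwise_fls (image_entry \<phi> c j) Y)"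
  by (rule fps_ext, rule fls_eqI,
      simp add: coeffwise_fls_nth[OF image_entry_additive] image_entry_mult fps_sum_nth fls_sum_nth fps_mult_nth
        incl_u_def)+

lemma scal_uh_incl: "incl_u (scal_uh X) = scal_uvh (incl_u X)" "incl_v (scal_uh X) = scal_uvh (incl_v X)"
  by (rule fps_ext, rule fls_eqI, simp add: incl_u_def incl_v_def scal_uh_eq scal_uvh_def fls_map_nth)
     (rule fps_ext, rule fls_eqI, simp add: incl_u_def incl_v_def scal_uh_eq scal_uvh_def fls_map_nth fls_map_const)

lemma incl_embed_u: "incl_u (embed_u x) = incl_v (embed_u x)"
  by (rule fps_ext) (simp add: incl_u_def incl_v_def embed_u_def fls_map_const fls_map_0)

lemma fls_map_fps_to_fls: "f 0 = 0 \<Longrightarrow> fls_map f (fps_to_fls X) = fps_to_fls (fps_map f X)"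
  by (rule fls_eqI) (simp add: fls_map_nth)

lemma sq_letter_image:
  "sq (letter_image \<phi> (k, l, m)) i j = (\<Sum>k'\<in>UNIV. \<Sum>l'\<in>UNIV. \<Sum>m'\<le>m.
     scal_uh (fps_nth (sq (\<phi> k l k' l') i j) (m - m')) * embed_u (tgen k' l' m'))"
  by (simp add: letter_image_def sq_sum)

text \<open>The sum over modes in \<open>letter_image\<close> is the Cauchy product in v of \<phi>(u
  - v) with the generating series T^+(v). \<open>incl_u_image_tgen\<close> is the counterpart for
  the second variable w of the relation.\<close>

lemma coeffwise_gen_u:
  "coeffwise_fls (image_entry \<phi> i j) (fps_to_fls (Abs_fps (tgen p k))) =
     (\<Sum>p'\<in>UNIV. \<Sum>k'\<in>UNIV. scal_uvh (incl_uv (sq (\<phi> p k p' k') i j)) * incl_v (gen_u p' k'))"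
proof (rule fps_ext)
  fix \<kappa>
  let ?\<Phi> = "\<lambda>p' k'. sq (\<phi> p k p' k') i j"
  have L: "fps_nth (coeffwise_fls (image_entry \<phi> i j) (fps_to_fls (Abs_fps (tgen p k)))) \<kappa> =
      fps_to_fls (Abs_fps (\<lambda>s. fps_nth (image_entry \<phi> i j (tgen p k s)) \<kappa>))"
    by (simp add: coeffwise_fls_def fls_map_fps_to_fls Modules.additive.zero[OF image_entry_additive] fps_map_def)
  have R: "fps_nth (scal_uvh (incl_uv (?\<Phi> p' k')) * incl_v (gen_u p' k')) \<kappa> =
      fps_to_fls (Abs_fps (\<lambda>l. fls_map scal (fps_nth (fps_nth (?\<Phi> p' k') l) \<kappa>)) * Abs_fps (\<lambda>m. fls_const (tgen p' k' m)))"
    for p' k'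
  proof -
    have "incl_v (gen_u p' k') = fps_const (fps_to_fls (Abs_fps (\<lambda>m. fls_const (tgen p' k' m))))"
      by (rule fps_ext) (simp add: incl_v_def gen_u_def fls_map_fps_to_fls fps_map_def fls_map_0)
    thus ?thesis
      by (simp add: scal_uvh_def incl_uv_def fls_map_fps_to_fls fps_map_def fls_times_fps_to_fls)
  qed
  have "Abs_fps (\<lambda>s. fps_nth (image_entry \<phi> i j (tgen p k s)) \<kappa>) =
     (\<Sum>p'\<in>UNIV. \<Sum>k'\<in>UNIV. Abs_fps (\<lambda>l. fls_map scal (fps_nth (fps_nth (?\<Phi> p' k') l) \<kappa>)) * Abs_fps (\<lambda>m. fls_const (tgen p' k' m)))"
  proof (rule fps_ext)
    fix s
    have "fps_nth (image_entry \<phi> i j (tgen p k s)) \<kappa> = (\<Sum>p'\<in>UNIV. \<Sum>k'\<in>UNIV. \<Sum>m\<le>s.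
        fls_map scal (fps_nth (fps_nth (?\<Phi> p' k') (s - m)) \<kappa>) * fls_const (tgen p' k' m))"
      by (simp add: image_entry_def falg_image_tgen sq_letter_image fps_sum_nth embed_u_def scal_uh_eq)
    also have "\<dots> = (\<Sum>p'\<in>UNIV. \<Sum>k'\<in>UNIV. \<Sum>l=0..s.
        fls_map scal (fps_nth (fps_nth (?\<Phi> p' k') l) \<kappa>) * fls_const (tgen p' k' (s - l)))"
      by (intro sum.cong refl sum.reindex_bij_witness[of _ "\<lambda>l. s - l" "\<lambda>l. s - l"]) auto
    finally show "fps_nth (Abs_fps (\<lambda>s. fps_nth (image_entry \<phi> i j (tgen p k s)) \<kappa>)) s =
      fps_nth (\<Sum>p'\<in>UNIV. \<Sum>k'\<in>UNIV. Abs_fps (\<lambda>l. fls_map scal (fps_nth (fps_nth (?\<Phi> p' k') l) \<kappa>)) * Abs_fps (\<lambda>m. fls_const (tgen p' k' m))) s"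
      by (simp add: fps_sum_nth fps_mult_nth)
  qed
  thus "fps_nth (coeffwise_fls (image_entry \<phi> i j) (fps_to_fls (Abs_fps (tgen p k)))) \<kappa> =
     fps_nth (\<Sum>p'\<in>UNIV. \<Sum>k'\<in>UNIV. scal_uvh (incl_uv (?\<Phi> p' k')) * incl_v (gen_u p' k')) \<kappa>"
    by (simp add: L R fps_sum_nth unital_hom_sum[OF fps_to_fls_hom])
qed

lemma incl_u_image_tgen:
  "incl_u (image_entry \<phi> i j (tgen q l n)) =
     fps_nth (\<Sum>q'\<in>UNIV. \<Sum>l'\<in>UNIV. fps_map scal_uvh (fps_map incl_u (sq (\<phi> q l q' l') i j)) * fps_map incl_v (gen_w q' l')) n"
proof -
  let ?\<Phi> = "\<lambda>q' l'. sq (\<phi> q l q' l') i j"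
  have "incl_u (image_entry \<phi> i j (tgen q l n)) = (\<Sum>q'\<in>UNIV. \<Sum>l'\<in>UNIV. \<Sum>m\<le>n.
      scal_uvh (incl_u (fps_nth (?\<Phi> q' l') (n - m))) * incl_v (embed_u (tgen q' l' m)))"
    by (simp add: image_entry_def falg_image_tgen sq_letter_image unital_hom_sum[OF incl_u_hom]
        unital_hom_mult[OF incl_u_hom] scal_uh_incl incl_embed_u)
  also have "\<dots> = (\<Sum>q'\<in>UNIV. \<Sum>l'\<in>UNIV. \<Sum>m=0..n.
      scal_uvh (incl_u (fps_nth (?\<Phi> q' l') m)) * incl_v (embed_u (tgen q' l' (n - m))))"
    by (intro sum.cong refl sum.reindex_bij_witness[of _ "\<lambda>l. n - l" "\<lambda>l. n - l"]) auto
  finally show ?thesis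
    by (simp add: fps_sum_nth fps_mult_nth gen_w_def)
qed

subsection \<open>The homomorphism preserves the defining relations\<close>

lemma sq_central_diag:
  assumes "\<And>i j. central (sq B i j)"
  shows "sq (A * sq_diag t * B) i j = sq (A * B) i j * t"
proof -
  have "sq (A * sq_diag t * B) i j = (\<Sum>k\<in>UNIV. sq A i k * t * sq B k j)"
    by (simp add: sq_times[of "A * sq_diag t"] sq_diag_mult_right)
  also have "\<dots> = (\<Sum>k\<in>UNIV. sq A i k * sq B k j * t)"
    by (intro sum.cong refl) (simp add: mult.assoc centralD[OF assms])
  finally show ?thesis by (simp add: sq_times sum_distrib_right)
qed

text \<open>Each generator matrix T^+(v) is replaced by a product A T^+(v) B, where A and B are
  scalar, commute with each other and satisfy the RTT relation. The image of the relation is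
  therefore the relation itself between scalar matrices, and its coefficients stay in the
  ideal.\<close>

lemma image_h_relators:
  fixes Ru :: "complex fls fps ^ ('n::finite \<times> 'n) ^ ('n \<times> 'n)"
    and \<alpha> \<beta> :: "('n, ('m::finite, complex fls fps fps) sqm) sqm"
  defines "uv \<equiv> \<lambda>X :: complex fls fps fps. fps_const (incl_uv X)" and "uw \<equiv> fps_map incl_u"
    and "C \<equiv> sq_map sq_diag (sq_map (at_vw 0) (of_mat Ru)) :: ('n \<times> 'n, ('m, complex fls fls fps fps) sqm) sqm"
  assumes \<phi>: "\<And>k l k' l'. \<phi> k l k' l' = sq \<alpha> k k' * sq \<beta> l' l"
    and rtt_\<alpha>: "rtt_rel C (sq_map (sq_map uv) \<alpha>) (sq_map (sq_map uw) \<alpha>)"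
    and rtt_\<beta>: "rtt_rel C (sq_map (sq_map uv) \<beta>) (sq_map (sq_map uw) \<beta>)"
    and comm1: "\<And>k k' l l'. sq_map uv (sq \<alpha> k k') * sq_map uw (sq \<beta> l l') = sq_map uw (sq \<beta> l l') * sq_map uv (sq \<alpha> k k')"
    and comm2: "\<And>k k' l l'. sq_map uw (sq \<alpha> k k') * sq_map uv (sq \<beta> l l') = sq_map uv (sq \<beta> l l') * sq_map uw (sq \<alpha> k k')"
    and J: "h_closed J" "submodule UNIV J" "RTT_relators Ru \<subseteq> J"
    and z: "z \<in> RTT_relators Ru"
  shows "image_h \<phi> i j z \<in> laurent_set J"
proof -
  define s3 where "s3 = fps_map (scal_uvh :: _ \<Rightarrow> 'n falg fls fls fps)"
  have s3: "unital_hom s3" unfolding s3_def by (intro fps_map_hom scal_uvh_hom)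
  have cen: "central (s3 X)" for X unfolding s3_def by (rule central_fps_map_scal_uvh)
  let ?S = "sq_map s3 :: ('m, _) sqm \<Rightarrow> _"
  have S: "unital_hom ?S" by (rule sq_map_hom[OF s3])
  have SS: "unital_hom (sq_map ?S :: ('k::finite, _) sqm \<Rightarrow> _)" by (rule sq_map_hom[OF S])
  have hom: "unital_hom uv" "unital_hom uw"
    unfolding uv_def uw_def by (intro unital_hom_comp[OF fps_const_hom incl_uv_hom] fps_map_hom incl_u_hom)+
  define A1 where "A1 = sq_map ?S (sq_map (sq_map uv) \<alpha>)"
  define A2 where "A2 = sq_map ?S (sq_map (sq_map uw) \<alpha>)"
  define B1 where "B1 = sq_map ?S (sq_map (sq_map uv) \<beta>)"
  define B2 where "B2 = sq_map ?S (sq_map (sq_map uw) \<beta>)"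
  define T1 :: "('n, ('m, 'n falg fls fls fps fps) sqm) sqm" where
    "T1 = Sqm (\<lambda>p k. sq_diag (fps_map incl_v (fps_const (gen_u p k))))"
  define T2 :: "('n, ('m, 'n falg fls fls fps fps) sqm) sqm" where
    "T2 = Sqm (\<lambda>q l. sq_diag (fps_map incl_v (gen_w q l)))"
  define R where "R = sq_map ?S C"
  have Rsq: "sq R x y = sq_diag (s3 (at_vw 0 (Ru $ x $ y)))" for x y
    by (rule sqm_eqI) (simp add: R_def C_def sq_diag_def unital_hom_zero[OF s3])
  have centS: "sq_diag t * ?S X = ?S X * sq_diag t" for t X
    by (rule sqm_eqI) (simp add: sq_diag_mult_left sq_diag_mult_right centralD[OF cen])
  have commL: "leg1 T1 * leg2 A2 = leg2 A2 * leg1 T1" "leg1 B1 * leg2 T2 = leg2 T2 * leg1 B1"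
     "leg1 B1 * leg2 A2 = leg2 A2 * leg1 B1" "leg1 A1 * leg2 T2 = leg2 T2 * leg1 A1"
     "leg1 T1 * leg2 B2 = leg2 B2 * leg1 T1" "leg1 A1 * leg2 B2 = leg2 B2 * leg1 A1"
    by (rule legs_commute; simp add: T1_def T2_def A1_def A2_def B1_def B2_def centS comm1 comm2
        unital_hom_mult[OF S, symmetric])+
  have rA: "R * leg1 A1 * leg2 A2 = leg2 A2 * leg1 A1 * R" and rB: "R * leg1 B1 * leg2 B2 = leg2 B2 * leg1 B1 * R"
    using rtt_rel_map[OF S rtt_\<alpha>] rtt_rel_map[OF S rtt_\<beta>]
    by (simp_all add: rtt_rel_def A1_def A2_def B1_def B2_def R_def)
  define X1 where "X1 = A1 * T1 * B1"
  define X2 where "X2 = A2 * T2 * B2"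
  define W where "W = R * leg1 T1 * leg2 T2 - leg2 T2 * leg1 T1 * R"
  \<comment> \<open>The factors are sorted so that the A's stand on the left, the generators in the
    middle and the B's on the right. In one product R moves inwards through the A's, in the other
    through the B's, which leaves \<open>W\<close> between them.\<close>
  have diff: "R * leg1 X1 * leg2 X2 - leg2 X2 * leg1 X1 * R = (leg2 A2 * leg1 A1) * W * (leg1 B1 * leg2 B2)"
  proof -
    let ?a = "leg1 A1" and ?t = "leg1 T1" and ?b = "leg1 B1" and ?a' = "leg2 A2" and ?t' = "leg2 T2" and ?b' = "leg2 B2"
    have X: "leg1 X1 = ?a * ?t * ?b" "leg2 X2 = ?a' * ?t' * ?b'"
      by (simp_all add: X1_def X2_def unital_hom_mult[OF leg_hom(1)] unital_hom_mult[OF leg_hom(2)])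
    have "R * leg1 X1 * leg2 X2 = R * ?a * ?t * (?b * ?a') * ?t' * ?b'" by (simp only: X mult.assoc)
    also have "\<dots> = R * ?a * (?t * ?a') * (?b * ?t') * ?b'" unfolding commL(3) by (simp only: mult.assoc)
    also have "\<dots> = (R * ?a * ?a') * ?t * ?t' * ?b * ?b'" unfolding commL(1,2) by (simp only: mult.assoc)
    finally have 1: "R * leg1 X1 * leg2 X2 = ?a' * ?a * (R * ?t * ?t') * (?b * ?b')" unfolding rA by (simp only: mult.assoc)
    have "leg2 X2 * leg1 X1 * R = ?a' * ?t' * (?b' * ?a) * ?t * ?b * R" by (simp only: X mult.assoc)
    also have "\<dots> = ?a' * (?t' * ?a) * (?b' * ?t) * ?b * R" unfolding commL(6)[symmetric] by (simp only: mult.assoc)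
    also have "\<dots> = ?a' * ?a * ?t' * ?t * (?b' * ?b * R)" unfolding commL(4,5)[symmetric] by (simp only: mult.assoc)
    finally have 2: "leg2 X2 * leg1 X1 * R = ?a' * ?a * (?t' * ?t * R) * (?b * ?b')" unfolding rB[symmetric] by (simp only: mult.assoc)
    show ?thesis unfolding 1 2 W_def by (simp only: right_diff_distrib left_diff_distrib)
  qed
  let ?g = "image_entry \<phi>"
  \<comment> \<open>The entries of \<open>X1\<close> and \<open>X2\<close> are the images of the
    generating series in the variables v and w.\<close>
  have X1: "sq (sq X1 p k) i j = fps_const (coeffwise_fls (?g i j) (fps_to_fls (Abs_fps (tgen p k))))" for p k i j
  proof -
    have "sq (sq X1 p k) i j = (\<Sum>k'\<in>UNIV. \<Sum>p'\<in>UNIV. sq (sq A1 p p' * sq T1 p' k' * sq B1 k' k) i j)"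
      by (simp add: X1_def sq_times[of _ B1] sq_times[of A1] sum_distrib_right sq_sum)
    also have "\<dots> = (\<Sum>k'\<in>UNIV. \<Sum>p'\<in>UNIV. sq (?S (sq_map uv (\<phi> p k p' k'))) i j * fps_map incl_v (fps_const (gen_u p' k')))"
      by (intro sum.cong refl)
        (simp add: T1_def sq_central_diag A1_def B1_def cen \<phi> unital_hom_mult[OF S] unital_hom_mult[OF sq_map_hom[OF hom(1)]])
    also have "\<dots> = (\<Sum>p'\<in>UNIV. \<Sum>k'\<in>UNIV. sq (?S (sq_map uv (\<phi> p k p' k'))) i j * fps_map incl_v (fps_const (gen_u p' k')))"
      by (rule sum.swap)
    finally show ?thesis
      by (simp add: coeffwise_gen_u uv_def s3_def fps_map_const unital_hom_zero[OF incl_v_hom]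
          unital_hom_zero[OF scal_uvh_hom] unital_hom_sum[OF fps_const_hom])
  qed
  have X2: "sq (sq X2 q l) i j = Abs_fps (\<lambda>n. incl_u (?g i j (tgen q l n)))" for q l i j
  proof -
    have "sq (sq X2 q l) i j = (\<Sum>l'\<in>UNIV. \<Sum>q'\<in>UNIV. sq (sq A2 q q' * sq T2 q' l' * sq B2 l' l) i j)"
      by (simp add: X2_def sq_times[of _ B2] sq_times[of A2] sum_distrib_right sq_sum)
    also have "\<dots> = (\<Sum>l'\<in>UNIV. \<Sum>q'\<in>UNIV. sq (?S (sq_map uw (\<phi> q l q' l'))) i j * fps_map incl_v (gen_w q' l'))"
      by (intro sum.cong refl)
        (simp add: T2_def sq_central_diag A2_def B2_def cen \<phi> unital_hom_mult[OF S] unital_hom_mult[OF sq_map_hom[OF hom(2)]])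
    also have "\<dots> = (\<Sum>q'\<in>UNIV. \<Sum>l'\<in>UNIV. sq (?S (sq_map uw (\<phi> q l q' l'))) i j * fps_map incl_v (gen_w q' l'))"
      by (rule sum.swap)
    finally show ?thesis
      by (intro fps_ext) (simp add: incl_u_image_tgen uw_def s3_def)
  qed
  \<comment> \<open>Applied to all coefficients of the left side of the relation, the homomorphism
    yields the left side formed with the images of the generators; \<open>hatR\<close> does the same
    for the right side.\<close>
  have hatL: "fps_map (coeffwise (?g i j)) (rel_lhs Ru x y) = sq (sq (R * leg1 X1 * leg2 X2) x y) i j" for x y i j
  proof (rule fps_ext)
    fix n
    obtain k l where y: "y = (k, l)" by fastforce
    note ad = image_entry_additive[of \<phi>]
    let ?e = "\<lambda>p q. shift_v 0 (Ru $ x $ (p, q))"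
    let ?h = "\<lambda>p q m. \<Sum>c\<in>UNIV. coeffwise_fls (?g i c) (fps_to_fls (Abs_fps (tgen p k))) * incl_u (?g c j (tgen q l (n - m)))"
    have "fps_nth (fps_map (coeffwise (?g i j)) (rel_lhs Ru x y)) n = (\<Sum>p\<in>UNIV. \<Sum>q\<in>UNIV. \<Sum>m=0..n.
        coeffwise (?g i j) (scal_uh (fps_nth (?e p q) m) * fps_const (fps_to_fls (Abs_fps (tgen p k)) * fls_const (tgen q l (n - m)))))"
      by (simp add: rel_lhs_def y fps_sum_nth Modules.additive.sum[OF coeffwise_additive[OF ad]] fps_mult_nth[of "fps_map scal_uh _"]
          gen_w_def gen_u_def embed_u_def del: fls_times_fps_to_fls)
    also have "\<dots> = (\<Sum>p\<in>UNIV. \<Sum>q\<in>UNIV. \<Sum>m=0..n. scal_uvh (incl_v (fps_nth (?e p q) m)) * ?h p q m)"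
      by (simp only: coeffwise_scal coeffwise_const[OF ad] coeffwise_fls_mult_const(1))
    also have "\<dots> = (\<Sum>p\<in>UNIV. \<Sum>q\<in>UNIV. fps_nth (s3 (at_vw 0 (Ru $ x $ (p, q))) * (\<Sum>c\<in>UNIV. sq (sq X1 p k) i c * sq (sq X2 q l) c j)) n)"
      unfolding fps_mult_nth[of "s3 _"] by (simp add: X1 X2 fps_sum_nth s3_def at_vw_def)
    also have "\<dots> = fps_nth (sq (sq (R * leg1 X1 * leg2 X2) x y) i j) n"
      unfolding mult.assoc[of R] sq_times[of R] sum_UNIV_prod y
      by (simp add: sq_leg1_leg2 sq_sum Rsq sq_diag_mult_left fps_sum_nth sq_times[of "sq X1 _ _"])
    finally show "fps_nth (fps_map (coeffwise (?g i j)) (rel_lhs Ru x y)) n = fps_nth (sq (sq (R * leg1 X1 * leg2 X2) x y) i j) n" .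
  qed
  have hatR: "fps_map (coeffwise (?g i j)) (rel_rhs Ru x y) = sq (sq (leg2 X2 * leg1 X1 * R) x y) i j" for x y i j
  proof (rule fps_ext)
    fix n
    obtain a b where x: "x = (a, b)" by fastforce
    note ad = image_entry_additive[of \<phi>]
    let ?e = "\<lambda>p q. shift_v 0 (Ru $ (p, q) $ y)"
    let ?h = "\<lambda>p q m. \<Sum>c\<in>UNIV. incl_u (?g i c (tgen b q (n - m))) * coeffwise_fls (?g c j) (fps_to_fls (Abs_fps (tgen a p)))"
    have cs: "central (fps_map scal_uh X :: 'n falg fls fps fps)" for X
      by (rule central_fps) (simp add: central_scal_uh)
    have "rel_rhs Ru x y = (\<Sum>p\<in>UNIV. \<Sum>q\<in>UNIV. fps_map scal_uh (?e p q) * (gen_w b q * fps_const (gen_u a p)))"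
      unfolding rel_rhs_def x by (simp add: centralD[OF cs])
    hence "fps_nth (fps_map (coeffwise (?g i j)) (rel_rhs Ru x y)) n = (\<Sum>p\<in>UNIV. \<Sum>q\<in>UNIV. \<Sum>m=0..n.
        coeffwise (?g i j) (scal_uh (fps_nth (?e p q) m) * fps_const (fls_const (tgen b q (n - m)) * fps_to_fls (Abs_fps (tgen a p)))))"
      by (simp add: fps_sum_nth Modules.additive.sum[OF coeffwise_additive[OF ad]] fps_mult_nth[of "fps_map scal_uh _"]
          gen_w_def gen_u_def embed_u_def del: fls_times_fps_to_fls)
    also have "\<dots> = (\<Sum>p\<in>UNIV. \<Sum>q\<in>UNIV. \<Sum>m=0..n. scal_uvh (incl_v (fps_nth (?e p q) m)) * ?h p q m)"
      by (simp only: coeffwise_scal coeffwise_const[OF ad] coeffwise_fls_mult_const(2))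
    also have "\<dots> = (\<Sum>p\<in>UNIV. \<Sum>q\<in>UNIV. fps_nth (s3 (at_vw 0 (Ru $ (p, q) $ y)) * (\<Sum>c\<in>UNIV. sq (sq X2 b q) i c * sq (sq X1 a p) c j)) n)"
      unfolding fps_mult_nth[of "s3 _"] by (simp add: X1 X2 fps_sum_nth s3_def at_vw_def)
    also have "\<dots> = fps_nth (sq (sq (leg2 X2 * leg1 X1 * R) x y) i j) n"
      unfolding sq_times[of "leg2 X2 * leg1 X1"] sum_UNIV_prod x
      by (simp add: sq_leg2_leg1 sq_sum Rsq sq_diag_mult_right fps_sum_nth sq_times[of "sq X2 _ _"] centralD[OF cen])
    finally show "fps_nth (fps_map (coeffwise (?g i j)) (rel_rhs Ru x y)) n = fps_nth (sq (sq (leg2 X2 * leg1 X1 * R) x y) i j) n" .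
  qed
  have W: "sq W x y = sq_diag (fps_map incl_v (rel_lhs Ru x y - rel_rhs Ru x y))" for x y
  proof -
    note iv = fps_map_hom[OF incl_v_hom]
    obtain a b k l where xy: "x = (a, b)" "y = (k, l)" by (metis prod.exhaust)
    have e: "s3 (at_vw 0 F) = fps_map incl_v (fps_map scal_uh (shift_v 0 F))" for F
      by (rule fps_ext) (simp add: s3_def at_vw_def scal_uh_incl)
    have "sq (R * leg1 T1 * leg2 T2) x y = sq_diag (fps_map incl_v (rel_lhs Ru x y))"
      unfolding mult.assoc[of R] sq_times[of R] sum_UNIV_prod xy rel_lhs_def
      by (simp add: sq_leg1_leg2 Rsq T1_def T2_def e unital_hom_mult[OF sq_diag_hom] unital_hom_sum[OF sq_diag_hom]
          unital_hom_mult[OF iv] unital_hom_sum[OF iv])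
    moreover have "sq (leg2 T2 * leg1 T1 * R) x y = sq_diag (fps_map incl_v (rel_rhs Ru x y))"
      unfolding sq_times[of "leg2 T2 * leg1 T1"] sum_UNIV_prod xy rel_rhs_def
      by (simp add: sq_leg2_leg1 Rsq T1_def T2_def e unital_hom_mult[OF sq_diag_hom] unital_hom_sum[OF sq_diag_hom]
          unital_hom_mult[OF iv] unital_hom_sum[OF iv])
    ultimately show ?thesis
      by (simp add: W_def unital_hom_diff[OF sq_diag_hom] unital_hom_diff[OF iv])
  qed
  let ?L2 = "laurent_set (laurent_set J)"
  \<comment> \<open>The series in w, v and u all of whose coefficients lie in \<open>J\<close>. This
    set is stable under multiplication by scalar series and under finite sums.\<close>
  define Jw where "Jw = {X. \<forall>n. fps_nth X n \<in> ?L2}"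
  have sub: "submodule (laurent_set (laurent_set (range scal_h))) ?L2"
  proof -
    have "submodule (range scal_h) J" using J(2) by (simp add: submodule_def)
    thus ?thesis by (intro laurent_set_submodule laurent_set_h_closed J)
  qed
  have scal_in: "(scal_uvh X :: 'n falg fls fls fps) \<in> laurent_set (laurent_set (range scal_h))" for X
  proof -
    have "u_coeff r (u_coeff s (scal_uvh X :: 'n falg fls fls fps)) = scal_h (u_coeff r (u_coeff s X))" for r s
      by (rule fps_ext) (simp add: scal_uvh_def scal_h_eq fls_map_nth)
    thus ?thesis by (simp add: laurent_set_def)
  qed
  have Jw_scal: "s3 E * X * s3 E' \<in> Jw" if X: "X \<in> Jw" for E E' X
  proof -
    have "s3 E * X \<in> Jw" if "X \<in> Jw" for E X
      unfolding Jw_def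
    proof (intro CollectI allI)
      fix n
      show "fps_nth (s3 E * X) n \<in> ?L2"
        using that sub scal_in unfolding fps_mult_nth s3_def
        by (intro submodule_sum[OF sub]) (auto simp: submodule_def Jw_def)
    qed
    from this[OF this[OF X]] show ?thesis using centralD[OF cen] by metis
  qed
  have Jw_sum: "sum f S \<in> Jw" if "\<And>x. x \<in> S \<Longrightarrow> f x \<in> Jw" for f and S :: "'k set"
    using that by (auto simp: Jw_def fps_sum_nth intro!: submodule_sum[OF sub])
  \<comment> \<open>A series that comes from v and w alone is constant in u, so its coefficients are
    differences of the two sides of the relation, or 0.\<close>
  have W_in: "fps_map incl_v (rel_lhs Ru x y - rel_rhs Ru x y) \<in> Jw" for x y
  proof -
    have iv: "u_coeff r (u_coeff s (incl_v Y)) = (if r = 0 then u_coeff s Y else 0)" for r s and Y :: "'n falg fls fps"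
      by (rule fps_ext) (simp add: incl_v_def fls_map_nth)
    have "u_coeff s (fps_nth (rel_lhs Ru x y - rel_rhs Ru x y) n) \<in> J" for s n
      using RTT_relators_eq(2)[of s Ru x y n] J(3)
      by (auto simp: Modules.additive.diff[OF u_coeff_additive])
    thus ?thesis using J(2) by (simp add: Jw_def laurent_set_def iv submodule_def)
  qed
  have main: "sq (sq (R * leg1 X1 * leg2 X2) x y) i j - sq (sq (leg2 X2 * leg1 X1 * R) x y) i j \<in> Jw" for x y i j
  proof -
    have AB: "leg2 A2 * leg1 A1 = sq_map ?S (leg2 (sq_map (sq_map uw) \<alpha>) * leg1 (sq_map (sq_map uv) \<alpha>))"
       "leg1 B1 * leg2 B2 = sq_map ?S (leg1 (sq_map (sq_map uv) \<beta>) * leg2 (sq_map (sq_map uw) \<beta>))"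
      unfolding A1_def A2_def B1_def B2_def
      by (simp_all add: leg_sq_map unital_hom_zero[OF S] unital_hom_mult[OF SS])
    define A' where "A' = leg2 (sq_map (sq_map uw) \<alpha>) * leg1 (sq_map (sq_map uv) \<alpha>)"
    define B' where "B' = leg1 (sq_map (sq_map uv) \<beta>) * leg2 (sq_map (sq_map uw) \<beta>)"
    have "sq (sq (R * leg1 X1 * leg2 X2) x y) i j - sq (sq (leg2 X2 * leg1 X1 * R) x y) i j =
        sq (sq (R * leg1 X1 * leg2 X2 - leg2 X2 * leg1 X1 * R) x y) i j"
      by simp
    also have "\<dots> = sq (sq (sq_map ?S A' * W * sq_map ?S B') x y) i j"
      unfolding diff AB A'_def B'_def ..
    also have "\<dots> = (\<Sum>b\<in>UNIV. \<Sum>a\<in>UNIV. \<Sum>d\<in>UNIV. s3 (sq (sq A' x a) i d) *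
        fps_map incl_v (rel_lhs Ru a b - rel_rhs Ru a b) * s3 (sq (sq B' b y) d j))"
      by (simp add: sq_times[of _ "sq_map ?S B'"] sq_times[of "sq_map ?S A'"] sum_distrib_right sq_sum W
          sq_times[of "_ * sq_diag _"] sq_diag_mult_right)
    also have "\<dots> \<in> Jw"
      by (intro Jw_sum Jw_scal W_in)
    finally show ?thesis .
  qed
  from RTT_relators_eq(1)[OF z] show ?thesis
  proof
    assume "z = 0"
    have "u_coeff r (0 :: 'n falg fls fps) = 0" for r by (rule fps_ext) simp
    thus ?thesis using J(2) \<open>z = 0\<close> by (simp add: Modules.additive.zero[OF image_h_additive] laurent_set_def submodule_def)
  next
    assume "\<exists>x y r n. z = u_coeff r (fps_nth (rel_lhs Ru x y) n) - u_coeff r (fps_nth (rel_rhs Ru x y) n)"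
    then obtain x y r n where zz: "z = u_coeff r (fps_nth (rel_lhs Ru x y) n) - u_coeff r (fps_nth (rel_rhs Ru x y) n)"
      by blast
    have c: "image_h \<phi> i j (u_coeff r X) = u_coeff r (coeffwise (?g i j) X)" for X
      by (simp add: u_coeff_coeffwise[OF image_entry_additive] image_h_def)
    have "image_h \<phi> i j z = u_coeff r (fps_nth (fps_map (coeffwise (?g i j)) (rel_lhs Ru x y) -
        fps_map (coeffwise (?g i j)) (rel_rhs Ru x y)) n)"
      unfolding zz by (simp add: Modules.additive.diff[OF image_h_additive] c Modules.additive.diff[OF u_coeff_additive])
    also have "\<dots> \<in> laurent_set J"
      using main[of x y i j] unfolding hatL hatR Jw_def laurent_set_def by blast
    finally show ?thesis .
  qed
qed

subsection \<open>The operator attached to a family of letters\<close>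

text \<open>With I = (i, j) this is the (i, j) entry of the operator attached to \<phi>: the
  matrix-valued homomorphism is applied to the identity of the auxiliary algebra, whose nonzero
  components are the pairs (p, p).\<close>

definition tau :: "('n \<Rightarrow> 'n \<Rightarrow> 'n \<Rightarrow> 'n \<Rightarrow> ('n \<times> 'n, complex fls fps fps) sqm)
    \<Rightarrow> 'n \<times> 'n \<Rightarrow> 'n falg fps \<Rightarrow> 'n::finite falg fls fps" where
  "tau \<phi> I x = (\<Sum>p\<in>UNIV. image_h \<phi> I (p, p) x)"

lemma tau_additive: "Modules.additive (tau \<phi> I)"
  by (simp add: Modules.additive_def tau_def Modules.additive.add[OF image_h_additive] sum.distrib)

lemma tau_scal: "tau \<phi> I (scal_h c * x) = scal_uh (hconst c) * tau \<phi> I x"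
  by (simp add: tau_def image_h_scal sum_distrib_left)

lemma tau_mult: "tau \<phi> I (x * y) = (\<Sum>J\<in>UNIV. image_h \<phi> I J x * tau \<phi> J y)"
  unfolding tau_def image_h_mult sum_distrib_left by (rule sum.swap)

lemma tau_one: "tau \<phi> I 1 = (if fst I = snd I then 1 else 0)"
proof -
  have "image_h \<phi> I J 1 = (if I = J then 1 else 0)" for J
    using image_h_const[of \<phi> I J 1] falg_image_monom[of \<phi> 1 "[]"]
    by (simp add: image_entry_def monom_word_Nil word_image_def sq_one unital_hom_one[OF scal_hom]
        unital_hom_one[OF embed_u_hom] unital_hom_one[OF sq_diag_hom])
  hence "tau \<phi> I 1 = (\<Sum>p\<in>UNIV. if p = fst I then if fst I = snd I then 1 else 0 else 0)"
    unfolding tau_def by (intro sum.cong) (auto simp: prod_eq_iff)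
  thus ?thesis by simp
qed

lemma tau_gen:
  "tau \<phi> I (fps_const (tgen k l m) * x) = (\<Sum>J\<in>UNIV. \<Sum>k'\<in>UNIV. \<Sum>l'\<in>UNIV. \<Sum>m'\<le>m.
     scal_uh (fps_nth (sq (\<phi> k l k' l') I J) (m - m')) * embed_u (tgen k' l' m') * tau \<phi> J x)"
  by (simp add: tau_mult image_h_const image_entry_def falg_image_tgen sq_letter_image sum_distrib_right)

lemma fps_const_monom_Cons:
  "fps_const (monom_word ((k, l, m) # w)) = fps_const (tgen k l m) * fps_const (monom_word w)"
  by (simp add: monom_word_Cons)

text \<open>Scalars are central, so the coefficients of all letters can be collected in front of the
  word, where they form the kernel.\<close>

lemma tau_word:
  "tau \<phi> I (fps_const (monom_word w)) =
     (\<Sum>w'\<in>below w. scal_uh (word_kernel \<phi> delta w w' I) * embed_u (monom_word w'))"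
proof (induction w arbitrary: I)
  case Nil
  show ?case
    by (simp add: monom_word_Nil tau_one delta_def case_prod_unfold unital_hom_simps[OF embed_u_hom]
        unital_hom_simps[OF scal_uh_hom])
next
  case (Cons x w)
  obtain k l m where x: "x = (k, l, m)" by (metis prod.exhaust)
  let ?\<phi> = "\<lambda>k' l' m' J. scal_uh (fps_nth (sq (\<phi> k l k' l') I J) (m - m'))"
  let ?K = "\<lambda>w' J. scal_uh (word_kernel \<phi> delta w w' J)"
  let ?e = "\<lambda>k' l' m' w'. embed_u (monom_word ((k', l', m') # w'))"
  have step: "?\<phi> k' l' m' J * embed_u (tgen k' l' m') * (?K w' J * embed_u (monom_word w')) =
      (?\<phi> k' l' m' J * ?K w' J) * ?e k' l' m' w'" for k' l' m' J w'
  proof -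
    have "?\<phi> k' l' m' J * embed_u (tgen k' l' m') * (?K w' J * embed_u (monom_word w')) =
        ?\<phi> k' l' m' J * (embed_u (tgen k' l' m') * ?K w' J) * embed_u (monom_word w')"
      by (simp only: mult.assoc)
    also have "embed_u (tgen k' l' m') * ?K w' J = ?K w' J * embed_u (tgen k' l' m')"
      by (rule centralD[OF central_scal_uh, symmetric])
    finally show ?thesis
      by (simp add: monom_word_Cons unital_hom_mult[OF embed_u_hom] mult.assoc)
  qed
  have "tau \<phi> I (fps_const (monom_word (x # w))) = (\<Sum>J\<in>UNIV. \<Sum>k'\<in>UNIV. \<Sum>l'\<in>UNIV. \<Sum>m'\<le>m. \<Sum>w'\<in>below w.
      (?\<phi> k' l' m' J * ?K w' J) * ?e k' l' m' w')"
    unfolding x fps_const_monom_Cons tau_gen Cons.IH sum_distrib_left step ..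
  also have "\<dots> = (\<Sum>k'\<in>UNIV. \<Sum>l'\<in>UNIV. \<Sum>m'\<le>m. \<Sum>w'\<in>below w. \<Sum>J\<in>UNIV.
      (?\<phi> k' l' m' J * ?K w' J) * ?e k' l' m' w')"
    by (subst sum.swap, intro sum.cong refl, subst sum.swap, intro sum.cong refl, subst sum.swap,
        intro sum.cong refl, rule sum.swap)
  also have "\<dots> = (\<Sum>w'\<in>below (x # w). scal_uh (word_kernel \<phi> delta (x # w) w' I) * embed_u (monom_word w'))"
    unfolding x sum_below_Cons
    by (intro sum.cong refl)
      (simp add: mode_coeff_def unital_hom_sum[OF scal_uh_hom] unital_hom_mult[OF scal_uh_hom] sum_distrib_right)
  finally show ?case .
qed

subsection \<open>Evaluation of the defining formula\<close>

lemma tmult_one_left: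
  fixes A :: "('n::finite, 's::semiring_1) tens"
  assumes "finite L" "\<alpha> \<in> multi L"
  shows "tmult L (\<lambda>\<alpha> \<beta>. if \<alpha> = \<beta> then 1 else 0) A \<alpha> \<beta> = A \<alpha> \<beta>"
  using assms by (simp add: tmult_def if_mult_distribs finite_multi cong: if_cong)

lemma tprod_Cons: "tprod L (A # As) = tmult L A (tprod L As)"
  by (simp add: tprod_def)

lemma tprod_append:
  fixes As :: "('n::finite, 's::semiring_1) tens list"
  assumes "finite L" "\<alpha> \<in> multi L"
  shows "tprod L (As @ Bs) \<alpha> \<beta> = tmult L (tprod L As) (tprod L Bs) \<alpha> \<beta>"
  using assms(2)
proof (induction As arbitrary: \<alpha>)
  case Nil
  thus ?case using tmult_one_left[OF assms(1), of \<alpha> "tprod L Bs" \<beta>] by (simp add: tprod_def)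
next
  case (Cons A As)
  have "tprod L ((A # As) @ Bs) \<alpha> \<beta> = tmult L A (tmult L (tprod L As) (tprod L Bs)) \<alpha> \<beta>"
    unfolding append_Cons tprod_Cons tmult_def[of L A] by (rule sum.cong) (simp_all add: Cons.IH)
  thus ?case by (simp add: tprod_Cons tmult_assoc)
qed

lemma tprod_snoc_legs:
  fixes As :: "('n::finite, 's::semiring_1) tens list"
  assumes "finite L" "\<alpha> \<in> multi L" "\<beta> \<in> multi L" "r \<in> L" "s \<in> L" "r \<noteq> s"
  shows "tprod L (As @ [on_legs L r s A]) \<alpha> \<beta> =
    (\<Sum>x\<in>UNIV. \<Sum>y\<in>UNIV. tprod L As \<alpha> (\<beta>(r := x, s := y)) * A $ (x, y) $ (\<beta> r, \<beta> s))"
proof -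
  have "tprod L (As @ [on_legs L r s A]) \<alpha> \<beta> = tmult L (tprod L As) (tprod L [on_legs L r s A]) \<alpha> \<beta>"
    by (rule tprod_append[OF assms(1,2)])
  also have "\<dots> = tmult L (tprod L As) (on_legs L r s A) \<alpha> \<beta>"
  proof -
    have "tprod L [on_legs L r s A] \<gamma> \<beta> = on_legs L r s A \<gamma> \<beta>" for \<gamma>
      by (simp add: tprod_def tmult_one_right[OF assms(1,3)])
    thus ?thesis by (simp add: tmult_def)
  qed
  finally show ?thesis using tmult_on_legs_right[OF assms(1,3-6)] by simp
qed

text \<open>T_x acts on a factor not touched by the preceding R-matrices, and the entries of these
  are central, so T_x can be taken to the front.\<close>

lemma tprod_move_leg:
  fixes Rs :: "nat \<Rightarrow> 's::semiring_1 ^ ('n::finite \<times> 'n) ^ ('n \<times> 'n)"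
  assumes L: "finite L" "0 \<in> L" "x \<in> L" "x \<noteq> 0"
    and xs: "set xs \<subseteq> L - {0}" "x \<notin> set xs"
    and central: "\<And>y p q. central (Rs y $ p $ q)"
    and \<alpha>: "\<alpha> \<in> multi L"
  shows "tprod L (map (\<lambda>y. on_legs L 0 y (Rs y)) xs @ on_leg L x T # Bs) \<alpha> \<beta> =
    (\<Sum>l\<in>UNIV. T $ \<alpha> x $ l * tprod L (map (\<lambda>y. on_legs L 0 y (Rs y)) xs @ Bs) (\<alpha>(x := l)) \<beta>)"
  using xs \<alpha>
proof (induction xs arbitrary: \<alpha>)
  case Nil
  thus ?case using L by (simp add: tprod_Cons tmult_on_leg del: fun_upd_apply)
next
  case (Cons y xs)
  have y: "y \<in> L" "y \<noteq> 0" "y \<noteq> x" "x \<notin> set xs" "set xs \<subseteq> L - {0}" using Cons.prems by auto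
  let ?P = "\<lambda>xs. map (\<lambda>y. on_legs L 0 y (Rs y)) xs"
  have m: "\<alpha>(0 := p, y := k) \<in> multi L" "\<alpha>(x := p) \<in> multi L" for p k
    using Cons.prems L y by (auto intro!: multi_upd)
  have upd: "\<alpha>(0 := p, y := k, x := l) = \<alpha>(x := l, 0 := p, y := k)" for p k l
    using y L by (auto simp: fun_eq_iff)
  have "tprod L (?P (y # xs) @ on_leg L x T # Bs) \<alpha> \<beta> =
      (\<Sum>p\<in>UNIV. \<Sum>k\<in>UNIV. Rs y $ (\<alpha> 0, \<alpha> y) $ (p, k) *
        (\<Sum>l\<in>UNIV. T $ \<alpha> x $ l * tprod L (?P xs @ Bs) (\<alpha>(x := l, 0 := p, y := k)) \<beta>))"
    using L y Cons.prems by (simp add: tprod_Cons tmult_on_legs Cons.IH m upd del: fun_upd_apply)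
      (simp add: fun_upd_other)
  also have "\<dots> = (\<Sum>p\<in>UNIV. \<Sum>k\<in>UNIV. \<Sum>l\<in>UNIV. T $ \<alpha> x $ l *
      (Rs y $ (\<alpha> 0, \<alpha> y) $ (p, k) * tprod L (?P xs @ Bs) (\<alpha>(x := l, 0 := p, y := k)) \<beta>))"
    unfolding sum_distrib_left
    by (intro sum.cong refl) (simp only: mult.assoc[symmetric] centralD[OF central, of _ _ _ "T $ _ $ _"])
  also have "\<dots> = (\<Sum>l\<in>UNIV. \<Sum>p\<in>UNIV. \<Sum>k\<in>UNIV. T $ \<alpha> x $ l *
      (Rs y $ (\<alpha> 0, \<alpha> y) $ (p, k) * tprod L (?P xs @ Bs) (\<alpha>(x := l, 0 := p, y := k)) \<beta>))"
    by (rule sum_rotate)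
  also have "\<dots> = (\<Sum>l\<in>UNIV. T $ \<alpha> x $ l * tprod L (?P (y # xs) @ Bs) (\<alpha>(x := l)) \<beta>)"
    using L y Cons.prems by (simp add: tprod_Cons tmult_on_legs m sum_distrib_left del: fun_upd_apply)
      (simp add: fun_upd_other del: fun_upd_apply)
  finally show ?case .
qed

lemma vseries_central:
  fixes f :: "nat \<Rightarrow> 'a::semiring_1"
  assumes "\<And>n. central (f n)"
  shows "central (vseries i f)"
  unfolding central_def
proof (intro allI mps_eqI)
  fix Y m
  have "mps_nth (vseries i f * Y) m = (\<Sum>(a, b)\<in>msplits m. mps_nth Y b * mps_nth (vseries i f) a)"
    unfolding mps_nth_times by (intro sum.cong refl) (auto simp: mps_nth_vseries centralD[OF assms])
  also have "\<dots> = (\<Sum>(a, b)\<in>msplits m. mps_nth Y a * mps_nth (vseries i f) b)"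
    by (rule sum.reindex_bij_witness[of _ prod.swap prod.swap]) (auto simp: add.commute)
  finally show "mps_nth (vseries i f * Y) m = mps_nth (Y * vseries i f) m" by (simp add: mps_nth_times)
qed

text \<open>The second factor does not involve the variable x, so exactly one splitting of the
  monomial contributes.\<close>

lemma vseries_times_separate:
  fixes h :: "nat \<Rightarrow> 'a::semiring_1"
  assumes "\<And>b. x \<in># b \<Longrightarrow> mps_nth Q b = 0"
  shows "mps_nth (vseries x h * Q) m = h (count m x) * mps_nth Q (filter_mset (\<lambda>y. y \<noteq> x) m)"
proof -
  let ?a = "replicate_mset (count m x) x" and ?b = "filter_mset (\<lambda>y. y \<noteq> x) m"
  have ab: "?a + ?b = m" by (rule multiset_eqI) auto
  have "mps_nth (vseries x h * Q) m = (\<Sum>(a, b)\<in>{(?a, ?b)}. mps_nth (vseries x h) a * mps_nth Q b)"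
    unfolding mps_nth_times
  proof (rule sum.mono_neutral_right)
    show "\<forall>p\<in>msplits m - {(?a, ?b)}. (case p of (a, b) \<Rightarrow> mps_nth (vseries x h) a * mps_nth Q b) = 0"
    proof
      fix p assume p: "p \<in> msplits m - {(?a, ?b)}"
      obtain a b where [simp]: "p = (a, b)" by fastforce
      have m: "a + b = m" and ne: "\<not> (a = ?a \<and> b = ?b)" using p by auto
      have "\<not> (set_mset a \<subseteq> {x} \<and> x \<notin># b)"
      proof
        assume *: "set_mset a \<subseteq> {x} \<and> x \<notin># b"
        have "a = ?a"
        proof (rule multiset_eqI)
          fix y
          have "count b x = 0" using * by (simp add: count_eq_zero_iff)
          hence "count m x = count a x" using m by auto
          moreover have "count a y = 0" if "y \<noteq> x" using * that by (auto simp: count_eq_zero_iff)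
          ultimately show "count a y = count ?a y" by auto
        qed
        hence "b = ?b" using m ab by (metis add_left_cancel)
        thus False using ne \<open>a = ?a\<close> by simp
      qed
      thus "(case p of (a, b) \<Rightarrow> mps_nth (vseries x h) a * mps_nth Q b) = 0"
        using assms by (auto simp: mps_nth_vseries)
    qed
  qed (use ab in auto)
  moreover have "set_mset ?a \<subseteq> {x}" by auto
  ultimately show ?thesis by (simp add: mps_nth_vseries)
qed

section \<open>Coefficients of the tensor products at a fixed monomial\<close>

definition letters_word :: "(nat \<Rightarrow> 'n) \<Rightarrow> (nat \<Rightarrow> 'n) \<Rightarrow> nat multiset \<Rightarrow> nat list \<Rightarrow> ('n \<times> 'n \<times> nat) list" where
  "letters_word \<alpha> \<beta> m xs = map (\<lambda>x. (\<alpha> x, \<beta> x, count m x)) xs"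

lemma letters_word_cong:
  "(\<And>x. x \<in> set xs \<Longrightarrow> \<alpha> x = \<alpha>' x \<and> \<beta> x = \<beta>' x \<and> count m x = count m' x) \<Longrightarrow>
    letters_word \<alpha> \<beta> m xs = letters_word \<alpha>' \<beta>' m' xs"
  by (simp add: letters_word_def)

lemma tprod_Tplus:
  fixes \<alpha> \<beta> :: "nat \<Rightarrow> 'n::finite"
  assumes L: "finite L" "set xs \<subseteq> L" "distinct xs" "\<alpha> \<in> multi L" "\<beta> \<in> multi L"
  shows "mps_nth (tprod L (map (\<lambda>i. on_leg L i (Tplus_v fps_const i)) xs) \<alpha> \<beta>) m =
    (if (\<forall>t\<in>L - set xs. \<alpha> t = \<beta> t) \<and> set_mset m \<subseteq> set xs
     then fps_const (monom_word (letters_word \<alpha> \<beta> m xs)) else 0)"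
  using L
proof (induction xs arbitrary: \<alpha> m)
  case Nil
  have "\<alpha> = \<beta> \<longleftrightarrow> (\<forall>t\<in>L. \<alpha> t = \<beta> t)" using Nil.prems multi_eqI by blast
  thus ?case by (simp add: tprod_def one_mps.rep_eq letters_word_def monom_word_Nil)
next
  case (Cons x xs)
  have x: "x \<in> L" "x \<notin> set xs" "set xs \<subseteq> L" "distinct xs" using Cons.prems by auto
  let ?P = "tprod L (map (\<lambda>i. on_leg L i (Tplus_v fps_const i)) xs)"
  let ?m = "filter_mset (\<lambda>y. y \<noteq> x) m"
  have m: "\<alpha>(x := l) \<in> multi L" for l using Cons.prems x by (auto intro: multi_upd)
  note IH = Cons.IH[OF L(1) x(3,4) m Cons.prems(5)]
  have "mps_nth (tprod L (map (\<lambda>i. on_leg L i (Tplus_v fps_const i)) (x # xs)) \<alpha> \<beta>) m =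
      (\<Sum>l\<in>UNIV. mps_nth (vseries x (\<lambda>n. fps_const (tgen (\<alpha> x) l n)) * ?P (\<alpha>(x := l)) \<beta>) m)"
    using Cons.prems x by (simp add: tprod_Cons tmult_on_leg mps_nth_sum Tplus_v_def)
  also have "\<dots> = (\<Sum>l\<in>UNIV. fps_const (tgen (\<alpha> x) l (count m x)) * mps_nth (?P (\<alpha>(x := l)) \<beta>) ?m)"
    using x(2) by (intro sum.cong refl vseries_times_separate) (auto simp: IH)
  also have "\<dots> = (\<Sum>l\<in>UNIV. if l = \<beta> x then fps_const (tgen (\<alpha> x) (\<beta> x) (count m x)) * mps_nth (?P (\<alpha>(x := \<beta> x)) \<beta>) ?m else 0)"
  proof (intro sum.cong refl)
    fix l
    show "fps_const (tgen (\<alpha> x) l (count m x)) * mps_nth (?P (\<alpha>(x := l)) \<beta>) ?m =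
      (if l = \<beta> x then fps_const (tgen (\<alpha> x) (\<beta> x) (count m x)) * mps_nth (?P (\<alpha>(x := \<beta> x)) \<beta>) ?m else 0)"
    proof (cases "l = \<beta> x")
      case False
      hence "\<not> (\<forall>t\<in>L - set xs. (\<alpha>(x := l)) t = \<beta> t)" using x by (auto intro!: bexI[of _ x])
      hence "mps_nth (?P (\<alpha>(x := l)) \<beta>) ?m = 0" unfolding IH by (simp only: simp_thms if_False)
      thus ?thesis using False by (simp del: fun_upd_apply)
    qed (simp del: fun_upd_apply)
  qed
  also have "\<dots> = fps_const (tgen (\<alpha> x) (\<beta> x) (count m x)) * mps_nth (?P (\<alpha>(x := \<beta> x)) \<beta>) ?m"
    by simp
  also have "\<dots> = (if (\<forall>t\<in>L - set (x # xs). \<alpha> t = \<beta> t) \<and> set_mset m \<subseteq> set (x # xs)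
     then fps_const (monom_word (letters_word \<alpha> \<beta> m (x # xs))) else 0)"
  proof -
    have 1: "(\<forall>t\<in>L - set xs. (\<alpha>(x := \<beta> x)) t = \<beta> t) \<longleftrightarrow> (\<forall>t\<in>L - set (x # xs). \<alpha> t = \<beta> t)" by auto
    have 2: "set_mset ?m \<subseteq> set xs \<longleftrightarrow> set_mset m \<subseteq> set (x # xs)" by auto
    have 3: "letters_word (\<alpha>(x := \<beta> x)) \<beta> ?m xs = letters_word \<alpha> \<beta> m xs"
      using x(2) by (intro letters_word_cong) auto
    have 4: "letters_word \<alpha> \<beta> m (x # xs) = (\<alpha> x, \<beta> x, count m x) # letters_word \<alpha> \<beta> m xs"
      by (simp add: letters_word_def)
    show ?thesis unfolding IH 1 2 3 4 fps_const_monom_Cons by simp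
  qed
  finally show ?case .
qed

lemma central_R_series: "central (R_series A b i $ p $ q)"
  by (simp add: R_series_def) (intro vseries_central central_scal_uh)

text \<open>For one tensor factor, the two R-matrix entries and the generator are series in the same
  variable; since the former are central, all three combine into the series of a single
  letter.\<close>

lemma vseries_letter:
  fixes a b :: "complex fls fps"
  shows "vseries x (\<lambda>l. scal_uh (subst_coeff c l a)) *
      (vseries x (\<lambda>m. embed_u (tgen k' l' m)) * (Q * vseries x (\<lambda>l. scal_uh (subst_coeff c' l b)))) =
    vseries x (\<lambda>n. \<Sum>m\<le>n. scal_uh (fps_nth (shift_v c a * shift_v c' b) (n - m)) * embed_u (tgen k' l' m)) * Q"
proof -
  let ?a = "vseries x (\<lambda>l. scal_uh (subst_coeff c l a))" and ?b = "vseries x (\<lambda>l. scal_uh (subst_coeff c' l b))"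
  let ?t = "vseries x (\<lambda>m. embed_u (tgen k' l' m))"
  have cb: "central ?b" by (intro vseries_central central_scal_uh)
  have "?a * (?t * (Q * ?b)) = ?a * (?t * ?b) * Q"
    unfolding centralD[OF cb, symmetric, of Q] by (simp only: mult.assoc)
  also have "\<dots> = ?a * ?b * ?t * Q"
    unfolding centralD[OF cb, symmetric, of ?t] by (simp only: mult.assoc)
  also have "?a * ?b = vseries x (\<lambda>n. scal_uh (fps_nth (shift_v c a * shift_v c' b) n))"
    unfolding vseries_mult
    by (intro arg_cong[of _ _ "vseries x"] ext)
      (simp add: fps_mult_nth shift_v_nth unital_hom_sum[OF scal_uh_hom] unital_hom_mult[OF scal_uh_hom] atLeast0AtMost)
  also have "\<dots> * ?t = vseries x (\<lambda>n. \<Sum>m\<le>n. scal_uh (fps_nth (shift_v c a * shift_v c' b) (n - m)) * embed_u (tgen k' l' m))"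
    unfolding vseries_mult
  proof (intro arg_cong[of _ _ "vseries x"] ext)
    fix n
    show "(\<Sum>j\<le>n. scal_uh (fps_nth (shift_v c a * shift_v c' b) j) * embed_u (tgen k' l' (n - j))) =
        (\<Sum>m\<le>n. scal_uh (fps_nth (shift_v c a * shift_v c' b) (n - m)) * embed_u (tgen k' l' m))"
      by (rule sum.reindex_bij_witness[of _ "\<lambda>l. n - l" "\<lambda>l. n - l"]) auto
  qed
  finally show ?thesis .
qed

text \<open>In the induction the outermost R-matrices on both sides and the generator of the first
  factor combine into one letter acting on the auxiliary factor 0. The label set \<open>L\<close>
  stays fixed, so the labels outside the list act as the identity and force equal row and column
  indices.\<close>

lemma tprod_Tminus:
  fixes Ri Ru :: "complex fls fps ^ ('n::finite \<times> 'n) ^ ('n \<times> 'n)" and \<alpha> \<beta> :: "nat \<Rightarrow> 'n" and c c' :: complex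
  defines "\<phi> \<equiv> letter_T (sq_map (shift_v c) (of_mat Ri)) (sq_map (shift_v c') (of_mat Ru))"
  assumes L: "finite L" "0 \<in> L" "set xs \<subseteq> L - {0}" "distinct xs" "\<alpha> \<in> multi L" "\<beta> \<in> multi L"
  shows "mps_nth (tprod L
       (map (\<lambda>i. on_legs L 0 i (R_series Ri c i)) xs @
        map (\<lambda>i. on_leg L i (Tplus_v embed_u i)) xs @
        map (\<lambda>i. on_legs L 0 i (R_series Ru c' i)) (rev xs)) \<alpha> \<beta>) m =
    (if (\<forall>t\<in>L - {0} - set xs. \<alpha> t = \<beta> t) \<and> set_mset m \<subseteq> set xs
     then tau \<phi> (\<alpha> 0, \<beta> 0) (fps_const (monom_word (letters_word \<alpha> \<beta> m xs))) else 0)"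
  using L
proof (induction xs arbitrary: \<alpha> \<beta> m)
  case Nil
  have "\<alpha> = \<beta> \<longleftrightarrow> (\<forall>t\<in>L - {0}. \<alpha> t = \<beta> t) \<and> \<alpha> 0 = \<beta> 0"
    using Nil.prems multi_eqI[of \<alpha> L \<beta>] by auto
  thus ?case by (auto simp: tprod_def one_mps.rep_eq letters_word_def monom_word_Nil tau_one)
next
  case (Cons x xs)
  have x: "x \<in> L" "x \<noteq> 0" "x \<notin> set xs" "set xs \<subseteq> L - {0}" "distinct xs" using Cons.prems by auto
  let ?A = "\<lambda>xs. map (\<lambda>i. on_legs L 0 i (R_series Ri c i)) xs"
  let ?T = "\<lambda>xs. map (\<lambda>i. on_leg L i (Tplus_v embed_u i)) xs"
  let ?B = "\<lambda>xs. map (\<lambda>i. on_legs L 0 i (R_series Ru c' i)) (rev xs)"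
  let ?Q = "tprod L (?A xs @ ?T xs @ ?B xs)"
  let ?m = "filter_mset (\<lambda>y. y \<noteq> x) m"
  let ?a = "\<lambda>p k. vseries x (\<lambda>l. scal_uh (subst_coeff c l (Ri $ (\<alpha> 0, \<alpha> x) $ (p, k)))) :: 'n falg fls fps mps"
  let ?b = "\<lambda>q l. vseries x (\<lambda>l'. scal_uh (subst_coeff c' l' (Ru $ (q, l) $ (\<beta> 0, \<beta> x)))) :: 'n falg fls fps mps"
  let ?t = "\<lambda>k l. vseries x (\<lambda>m. embed_u (tgen k l m)) :: 'n falg fls fps mps"
  have ma: "\<alpha>(0 := p, x := k) \<in> multi L" for p k using Cons.prems x by (intro multi_upd) auto
  have mb: "\<beta>(0 := p, x := k) \<in> multi L" for p k using Cons.prems x by (intro multi_upd) auto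
  note IH = Cons.IH[OF L(1,2) x(4,5) ma mb]
  let ?h = "\<lambda>p k l q n. \<Sum>m'\<le>n. scal_uh (fps_nth (sq (\<phi> (\<alpha> x) (\<beta> x) k l) (\<alpha> 0, \<beta> 0) (p, q)) (n - m')) * embed_u (tgen k l m')"
  have "tprod L (?A (x # xs) @ ?T (x # xs) @ ?B (x # xs)) \<alpha> \<beta> =
      (\<Sum>p\<in>UNIV. \<Sum>k\<in>UNIV. ?a p k * tprod L (?A xs @ on_leg L x (Tplus_v embed_u x) # (?T xs @ ?B (x # xs))) (\<alpha>(0 := p, x := k)) \<beta>)"
    using Cons.prems x by (simp add: tprod_Cons tmult_on_legs R_series_def del: fun_upd_apply)
  also have "\<dots> = (\<Sum>p\<in>UNIV. \<Sum>k\<in>UNIV. ?a p k * (\<Sum>l\<in>UNIV. ?t k l *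
      tprod L (?A xs @ ?T xs @ ?B (x # xs)) (\<alpha>(0 := p, x := l)) \<beta>))"
  proof -
    have upd: "\<alpha>(0 := p, x := k, x := l) = \<alpha>(0 := p, x := l)" for p k l by simp
    have "tprod L (?A xs @ on_leg L x (Tplus_v embed_u x) # (?T xs @ ?B (x # xs))) (\<alpha>(0 := p, x := k)) \<beta> =
       (\<Sum>l\<in>UNIV. ?t k l * tprod L (?A xs @ ?T xs @ ?B (x # xs)) (\<alpha>(0 := p, x := l)) \<beta>)" for p k
      by (subst tprod_move_leg[OF L(1,2) x(1,2,4,3) central_R_series ma])
        (simp add: Tplus_v_def upd del: fun_upd_apply, simp)
    thus ?thesis by simp
  qed
  also have "\<dots> = (\<Sum>p\<in>UNIV. \<Sum>k\<in>UNIV. \<Sum>l\<in>UNIV. \<Sum>q\<in>UNIV. \<Sum>l'\<in>UNIV.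
      ?a p k * (?t k l * (?Q (\<alpha>(0 := p, x := l)) (\<beta>(0 := q, x := l')) * ?b q l')))"
  proof -
    have "tprod L (?A xs @ ?T xs @ ?B (x # xs)) (\<alpha>(0 := p, x := l)) \<beta> =
       (\<Sum>q\<in>UNIV. \<Sum>l'\<in>UNIV. ?Q (\<alpha>(0 := p, x := l)) (\<beta>(0 := q, x := l')) * ?b q l')" for p l
      using tprod_snoc_legs[where As = "?A xs @ ?T xs @ ?B xs" and A = "R_series Ru c' x",
          OF L(1) ma[of p l] Cons.prems(6) L(2) x(1) x(2)[symmetric]]
      by (simp add: R_series_def del: fun_upd_apply)
    thus ?thesis by (simp add: sum_distrib_left del: fun_upd_apply)
  qed
  finally have tprod_eq: "tprod L (?A (x # xs) @ ?T (x # xs) @ ?B (x # xs)) \<alpha> \<beta> =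
      (\<Sum>p\<in>UNIV. \<Sum>k\<in>UNIV. \<Sum>l\<in>UNIV. \<Sum>q\<in>UNIV. \<Sum>l'\<in>UNIV.
        ?a p k * (?t k l * (?Q (\<alpha>(0 := p, x := l)) (\<beta>(0 := q, x := l')) * ?b q l')))" .
  have "mps_nth (tprod L (?A (x # xs) @ ?T (x # xs) @ ?B (x # xs)) \<alpha> \<beta>) m =
      (\<Sum>p\<in>UNIV. \<Sum>k\<in>UNIV. \<Sum>l\<in>UNIV. \<Sum>q\<in>UNIV. \<Sum>l'\<in>UNIV.
      if l' = l then ?h p k l q (count m x) * mps_nth (?Q (\<alpha>(0 := p, x := l)) (\<beta>(0 := q, x := l))) ?m else 0)"
    unfolding tprod_eq mps_nth_sum
  proof (intro sum.cong refl)
    fix p k l q l'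
    let ?q = "?Q (\<alpha>(0 := p, x := l)) (\<beta>(0 := q, x := l'))"
    let ?F = "\<lambda>n. \<Sum>m\<le>n. scal_uh (fps_nth (shift_v c (Ri $ (\<alpha> 0, \<alpha> x) $ (p, k)) * shift_v c' (Ru $ (q, l') $ (\<beta> 0, \<beta> x))) (n - m)) * embed_u (tgen k l m)"
    have sep: "mps_nth ?q b = 0" if "x \<in># b" for b
    proof -
      have "\<not> set_mset b \<subseteq> set xs" using that x(3) by auto
      thus ?thesis unfolding IH by (simp only: simp_thms if_False)
    qed
    have val: "mps_nth (?a p k * (?t k l * (?q * ?b q l'))) m = ?F (count m x) * mps_nth ?q ?m"
      unfolding vseries_letter by (rule vseries_times_separate[OF sep])
    show "mps_nth (?a p k * (?t k l * (?q * ?b q l'))) m =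
      (if l' = l then ?h p k l q (count m x) * mps_nth (?Q (\<alpha>(0 := p, x := l)) (\<beta>(0 := q, x := l))) ?m else 0)"
    proof (cases "l' = l")
      case True
      thus ?thesis unfolding val by (simp add: \<phi>_def letter_T_def del: fun_upd_apply)
    next
      case False
      hence "\<not> (\<forall>t\<in>L - {0} - set xs. (\<alpha>(0 := p, x := l)) t = (\<beta>(0 := q, x := l')) t)"
        using x by (auto intro!: bexI[of _ x])
      hence "mps_nth ?q ?m = 0" unfolding IH by (simp only: simp_thms if_False)
      thus ?thesis unfolding val using False by (simp del: fun_upd_apply)
    qed
  qed
  also have "\<dots> = (\<Sum>p\<in>UNIV. \<Sum>k\<in>UNIV. \<Sum>l\<in>UNIV. \<Sum>q\<in>UNIV.
      ?h p k l q (count m x) * mps_nth (?Q (\<alpha>(0 := p, x := l)) (\<beta>(0 := q, x := l))) ?m)"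
    by (simp only: sum.delta[OF finite_class.finite_UNIV] UNIV_I if_True)
  also have "\<dots> = (if (\<forall>t\<in>L - {0} - set (x # xs). \<alpha> t = \<beta> t) \<and> set_mset m \<subseteq> set (x # xs)
     then (\<Sum>p\<in>UNIV. \<Sum>k\<in>UNIV. \<Sum>l\<in>UNIV. \<Sum>q\<in>UNIV. ?h p k l q (count m x) * tau \<phi> (p, q) (fps_const (monom_word (letters_word \<alpha> \<beta> m xs)))) else 0)"
  proof -
    have 1: "(\<forall>t\<in>L - {0} - set xs. (\<alpha>(0 := p, x := l)) t = (\<beta>(0 := q, x := l)) t) \<longleftrightarrow>
        (\<forall>t\<in>L - {0} - set (x # xs). \<alpha> t = \<beta> t)" for p q l using x by auto
    have 2: "set_mset ?m \<subseteq> set xs \<longleftrightarrow> set_mset m \<subseteq> set (x # xs)" by auto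
    have 3: "letters_word (\<alpha>(0 := p, x := l)) (\<beta>(0 := q, x := l)) ?m xs = letters_word \<alpha> \<beta> m xs" for p q l
      using x by (intro letters_word_cong) auto
    have 4: "(\<alpha>(0 := p, x := l)) 0 = p" "(\<beta>(0 := p, x := l)) 0 = p" for p l using x(2) by simp_all
    have gen: "(\<Sum>p\<in>UNIV. \<Sum>k\<in>UNIV. \<Sum>l\<in>UNIV. \<Sum>q\<in>UNIV. f p k l q * (if P then g p q else 0)) =
        (if P then \<Sum>p\<in>UNIV. \<Sum>k\<in>UNIV. \<Sum>l\<in>UNIV. \<Sum>q\<in>UNIV. f p k l q * g p q else 0)"
      for P and f :: "'n \<Rightarrow> 'n \<Rightarrow> 'n \<Rightarrow> 'n \<Rightarrow> 'n falg fls fps" and g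
      by (cases P) simp_all
    show ?thesis unfolding IH 1 2 3 4 by (rule gen)
  qed
  also have "\<dots> = (if (\<forall>t\<in>L - {0} - set (x # xs). \<alpha> t = \<beta> t) \<and> set_mset m \<subseteq> set (x # xs)
     then tau \<phi> (\<alpha> 0, \<beta> 0) (fps_const (monom_word (letters_word \<alpha> \<beta> m (x # xs)))) else 0)"
  proof -
    have "(\<Sum>p\<in>UNIV. \<Sum>k\<in>UNIV. \<Sum>l\<in>UNIV. \<Sum>q\<in>UNIV. ?h p k l q (count m x) * tau \<phi> (p, q) (fps_const (monom_word (letters_word \<alpha> \<beta> m xs)))) =
      (\<Sum>p\<in>UNIV. \<Sum>q\<in>UNIV. \<Sum>k\<in>UNIV. \<Sum>l\<in>UNIV. ?h p k l q (count m x) * tau \<phi> (p, q) (fps_const (monom_word (letters_word \<alpha> \<beta> m xs))))"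
      by (intro sum.cong refl sum_rotate)
    also have "\<dots> = tau \<phi> (\<alpha> 0, \<beta> 0) (fps_const (monom_word (letters_word \<alpha> \<beta> m (x # xs))))"
    proof -
      have "letters_word \<alpha> \<beta> m (x # xs) = (\<alpha> x, \<beta> x, count m x) # letters_word \<alpha> \<beta> m xs"
        by (simp add: letters_word_def)
      thus ?thesis by (simp only: fps_const_monom_Cons tau_gen sum_UNIV_prod sum_distrib_right)
    qed
    finally show ?thesis by (simp only:)
  qed
  finally show ?case .
qed

lemma Tplus_product_nth:
  fixes \<alpha> \<beta> :: "nat \<Rightarrow> 'n::finite"
  shows "mps_nth (Tplus_product n (restrict \<alpha> {1..n}) (restrict \<beta> {1..n})) m =
    (if set_mset m \<subseteq> {1..n} then fps_const (monom_word (letters_word \<alpha> \<beta> m [1..<Suc n])) else 0)"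
proof -
  let ?xs = "[1..<Suc n]"
  have xs: "set ?xs = {1..n}" by auto
  have r: "restrict \<gamma> {1..n} \<in> multi {1..n}" for \<gamma> :: "nat \<Rightarrow> 'n" by (simp add: multi_def)
  have l: "letters_word (restrict \<alpha> {1..n}) (restrict \<beta> {1..n}) m ?xs = letters_word \<alpha> \<beta> m ?xs"
    by (rule letters_word_cong) auto
  have "mps_nth (tprod {1..n} (map (\<lambda>i. on_leg {1..n} i (Tplus_v fps_const i)) ?xs) (restrict \<alpha> {1..n}) (restrict \<beta> {1..n})) m =
     (if (\<forall>t\<in>{1..n} - set ?xs. restrict \<alpha> {1..n} t = restrict \<beta> {1..n} t) \<and> set_mset m \<subseteq> set ?xs
      then fps_const (monom_word (letters_word (restrict \<alpha> {1..n}) (restrict \<beta> {1..n}) m ?xs)) else 0)"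
    by (rule tprod_Tplus) (simp_all only: r xs order.refl finite_atLeastAtMost distinct_upt)
  thus ?thesis unfolding Tplus_product_def xs l by (simp only: Diff_cancel ball_simps simp_thms)
qed

text \<open>This identifies the right-hand side of the defining formula with the operator
  \<open>tau\<close>, coefficient by coefficient; existence and uniqueness both rest on it.\<close>

lemma Tminus_rhs_nth:
  fixes Ru :: "complex fls fps ^ ('n::finite \<times> 'n) ^ ('n \<times> 'n)"
  assumes "\<alpha> \<in> multi {0..n}" "\<beta> \<in> multi {0..n}"
  shows "mps_nth (Tminus_rhs Ru c n \<alpha> \<beta>) m =
    tau (letter_T (sq_map (shift_v (c / 2)) (of_mat (matrix_inv Ru))) (sq_map (shift_v (- c / 2)) (of_mat Ru)))
      (\<alpha> 0, \<beta> 0) (mps_nth (Tplus_product n (restrict \<alpha> {1..n}) (restrict \<beta> {1..n})) m)"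
proof -
  let ?xs = "[1..<Suc n]"
  have e: "{0..n} - {0} - set ?xs = {}" and xs: "set ?xs = {1..n}" by auto
  have "mps_nth (Tminus_rhs Ru c n \<alpha> \<beta>) m = (if set_mset m \<subseteq> set ?xs then
      tau (letter_T (sq_map (shift_v (c / 2)) (of_mat (matrix_inv Ru))) (sq_map (shift_v (- c / 2)) (of_mat Ru)))
        (\<alpha> 0, \<beta> 0) (fps_const (monom_word (letters_word \<alpha> \<beta> m ?xs))) else 0)"
    unfolding Tminus_rhs_def Let_def
    by (subst tprod_Tminus) (use assms in \<open>auto simp: e\<close>)
  thus ?thesis
    unfolding xs Tplus_product_nth by (simp add: Modules.additive.zero[OF tau_additive])
qed

subsection \<open>The quotient algebra\<close>

lemma free_alg_simps [simp]:
  "carrier free_alg = UNIV" "mult free_alg = (*)" "one free_alg = 1" "zero free_alg = 0" "add free_alg = (+)"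
  by (simp_all add: free_alg_def)

lemma free_alg_ring: "ring (free_alg :: 'n falg fps ring)"
proof (rule ringI)
  show "abelian_group (free_alg :: 'n falg fps ring)"
    by (rule abelian_groupI) (auto simp: add_ac intro: exI[of _ "- x" for x] left_minus)
  show "Group.monoid (free_alg :: 'n falg fps ring)"
    by (rule monoidI) (simp_all add: mult.assoc)
qed (simp_all add: distrib_left distrib_right)

text \<open>The distance of two series is determined by the order of vanishing of their difference,
  so small balls are classes of series with a common truncation.\<close>

lemma h_closed_iff_closed: "closed J \<longleftrightarrow> h_closed (J :: 'a::group_add fps set)"
proof -
  have near: "dist y x < inverse (2 ^ k)" if "\<forall>j\<le>k. fps_nth x j = fps_nth y j" for x y :: "'a fps" and k
  proof (cases "y = x")
    case False
    hence "k < subdegree (y - x)" using that by (intro subdegree_greaterI) auto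
    thus ?thesis using False by (simp add: dist_fps_def power_strict_increasing_iff)
  qed (simp add: dist_fps_def)
  have far: "\<forall>j\<le>k. fps_nth x j = fps_nth y j" if "dist y x < inverse (2 ^ k)" for x y :: "'a fps" and k
  proof (cases "y = x")
    case False
    hence "k < subdegree (y - x)" using that by (simp add: dist_fps_def)
    thus ?thesis by (metis fps_sub_nth nth_less_subdegree_zero order.strict_trans1 right_minus_eq)
  qed simp
  show ?thesis
  proof
    assume J: "closed J"
    show "h_closed J"
      unfolding h_closed_def
    proof (intro allI impI)
      fix x assume x: "\<forall>k. \<exists>y\<in>J. \<forall>j\<le>k. fps_nth x j = fps_nth y j"
      have "\<exists>y\<in>J. dist y x < e" if e: "e > 0" for e
      proof -
        obtain k where "inverse (2 ^ k) < e" using real_arch_pow_inv[OF e, of "1/2"] by (auto simp: power_divide inverse_eq_divide)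
        thus ?thesis using x near by (meson order.strict_trans)
      qed
      thus "x \<in> J" using closed_approachable[OF J, of x] by blast
    qed
  next
    assume J: "h_closed J"
    have "x \<in> J" if x: "\<forall>e>0. \<exists>y\<in>J. dist y x < e" for x
    proof (rule h_closedD[OF J])
      fix k :: nat
      have "(0 :: real) < inverse (2 ^ k)" by simp
      then obtain y where "y \<in> J" "dist y x < inverse (2 ^ k)" using x by blast
      thus "\<exists>y\<in>J. \<forall>j\<le>k. fps_nth x j = fps_nth y j" using far by blast
    qed
    hence "closure J \<subseteq> J" by (auto simp: closure_approachable)
    thus "closed J" by (simp add: closure_subset_eq)
  qed
qed

lemma submodule_UNIV_uminus: "submodule UNIV J \<Longrightarrow> x \<in> J \<Longrightarrow> - x \<in> J"
  for J :: "'a::ring_1 set"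
  unfolding submodule_def by (metis UNIV_I mult_minus1)

lemma submodule_UNIV_diff: "submodule UNIV J \<Longrightarrow> x \<in> J \<Longrightarrow> y \<in> J \<Longrightarrow> x - y \<in> J"
  for J :: "'a::ring_1 set"
  using submodule_UNIV_uminus[of J y] unfolding submodule_def by (metis diff_conv_add_uminus)

lemma ideal_iff_submodule: "ideal J free_alg \<longleftrightarrow> submodule UNIV (J :: 'n falg fps set)"
proof
  assume "ideal J (free_alg :: 'n falg fps ring)"
  then interpret ideal J "free_alg :: 'n falg fps ring" .
  show "submodule UNIV J"
    using additive_subgroup.zero_closed[OF is_additive_subgroup] additive_subgroup.a_closed[OF is_additive_subgroup]
      I_l_closed I_r_closed by (auto simp: submodule_def)
next
  assume J: "submodule UNIV J"
  interpret ring "free_alg :: 'n falg fps ring" by (rule free_alg_ring)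
  have neg: "- x \<in> J" if "x \<in> J" for x
    by (rule submodule_UNIV_uminus[OF J that])
  have inv: "inv\<^bsub>add_monoid free_alg\<^esub> x = - x" for x :: "'n falg fps"
    using minus_equality[of "- x" x] by (simp add: a_inv_def)
  show "ideal J free_alg"
  proof (rule idealI)
    show "subgroup J (add_monoid free_alg)"
    proof (rule subgroup.intro)
      fix x assume "x \<in> J"
      thus "inv\<^bsub>add_monoid free_alg\<^esub> x \<in> J" unfolding inv by (rule neg)
    qed (use J in \<open>auto simp: submodule_def\<close>)
  qed (use J in \<open>auto simp: submodule_def free_alg_ring\<close>)
qed

text \<open>Each of the defining properties is inherited by intersections, so the ideal is itself
  the least set that has all of them.\<close>

lemma RTT_ideal_properties:
  fixes Ru :: "complex fls fps ^ ('n::finite \<times> 'n) ^ ('n \<times> 'n)"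
  defines "J \<equiv> RTT_ideal Ru"
  shows "h_closed J" "submodule UNIV J" "\<And>x. fps_X * x \<in> J \<Longrightarrow> x \<in> J" "RTT_relators Ru \<subseteq> J"
    and "\<And>J'. h_closed J' \<Longrightarrow> submodule UNIV J' \<Longrightarrow> (\<And>x. fps_X * x \<in> J' \<Longrightarrow> x \<in> J') \<Longrightarrow>
      RTT_relators Ru \<subseteq> J' \<Longrightarrow> J \<subseteq> J'"
proof -
  have J: "J = \<Inter>{J. submodule UNIV J \<and> h_closed J \<and> (\<forall>x. fps_X * x \<in> J \<longrightarrow> x \<in> J) \<and> RTT_relators Ru \<subseteq> J}"
    by (simp add: J_def RTT_ideal_def ideal_iff_submodule h_closed_iff_closed)
  show "h_closed J"
    unfolding h_closed_def
  proof (intro allI impI)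
    fix x assume x: "\<forall>k. \<exists>y\<in>J. \<forall>j\<le>k. fps_nth x j = fps_nth y j"
    have "x \<in> K" if K: "h_closed K" "J \<subseteq> K" for K
      using x K(2) by (intro h_closedD[OF K(1)]) (meson subsetD)
    moreover have "J \<subseteq> K" if "submodule UNIV K \<and> h_closed K \<and> (\<forall>x. fps_X * x \<in> K \<longrightarrow> x \<in> K) \<and> RTT_relators Ru \<subseteq> K" for K
      unfolding J using that by (intro Inter_lower) (rule CollectI)
    ultimately show "x \<in> J" by (subst J) (rule InterI, blast)
  qed
  define Q where "Q K \<longleftrightarrow> submodule UNIV K \<and> h_closed K \<and> (\<forall>x. fps_X * x \<in> K \<longrightarrow> x \<in> K) \<and> RTT_relators Ru \<subseteq> K" for K
  have in_J: "x \<in> J \<longleftrightarrow> (\<forall>K. Q K \<longrightarrow> x \<in> K)" for x unfolding J Q_def by blast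
  have sub: "0 \<in> K" "x \<in> K \<Longrightarrow> y \<in> K \<Longrightarrow> x + y \<in> K" "x \<in> K \<Longrightarrow> p * x \<in> K" "x \<in> K \<Longrightarrow> x * p \<in> K"
    "fps_X * x \<in> K \<Longrightarrow> x \<in> K" "RTT_relators Ru \<subseteq> K" if "Q K" for K x y p
    using that unfolding Q_def submodule_def by blast+
  show "submodule UNIV J"
    unfolding submodule_def[of UNIV J]
  proof (intro conjI ballI)
    show "0 \<in> J" unfolding in_J using sub(1) by simp
    show "x + y \<in> J" if "x \<in> J" "y \<in> J" for x y using that sub(2) unfolding in_J by simp
    show "p * x \<in> J" "x * p \<in> J" if "x \<in> J" for p x using that sub(3,4) unfolding in_J by simp_all
  qed
  show "fps_X * x \<in> J \<Longrightarrow> x \<in> J" for x unfolding in_J using sub(5) by blast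
  show "RTT_relators Ru \<subseteq> J" unfolding subset_iff in_J using sub(6) by blast
  show "h_closed J' \<Longrightarrow> submodule UNIV J' \<Longrightarrow> (\<And>x. fps_X * x \<in> J' \<Longrightarrow> x \<in> J') \<Longrightarrow>
      RTT_relators Ru \<subseteq> J' \<Longrightarrow> J \<subseteq> J'" for J'
    unfolding subset_iff[of J] in_J Q_def by blast
qed

lemma cls_eq_iff: "cls Ru x = cls Ru y \<longleftrightarrow> x - y \<in> RTT_ideal Ru"
proof -
  note J = RTT_ideal_properties(2)[of Ru]
  have c: "cls Ru z = (\<lambda>j. j + z) ` RTT_ideal Ru" for z
    by (auto simp: cls_def a_r_coset_def r_coset_def)
  show ?thesis
  proof
    assume "cls Ru x = cls Ru y"
    moreover have "x \<in> cls Ru x" unfolding c using J by (auto simp: submodule_def intro: image_eqI[of _ _ 0])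
    ultimately obtain j where "x = j + y" "j \<in> RTT_ideal Ru" unfolding c by auto
    thus "x - y \<in> RTT_ideal Ru" by simp
  next
    assume xy: "x - y \<in> RTT_ideal Ru"
    have "j + x \<in> cls Ru y" if "j \<in> RTT_ideal Ru" for j
      unfolding c using J xy that by (intro image_eqI[of _ _ "j + (x - y)"]) (auto simp: submodule_def)
    moreover have "j + y \<in> cls Ru x" if "j \<in> RTT_ideal Ru" for j
      unfolding c using submodule_UNIV_diff[OF J that xy] by (intro image_eqI[of _ _ "j - (x - y)"]) auto
    ultimately show "cls Ru x = cls Ru y" unfolding c by blast
  qed
qed

lemma scal_h_X: "(scal_h (fps_X ^ k) :: 'n falg fps) = fps_X ^ k"
proof -
  have "(scal_h fps_X :: 'n falg fps) = fps_X"
    by (rule fps_ext) (simp add: scal_h_eq fps_X_def unital_hom_one[OF scal_hom])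
  thus ?thesis by (induction k) (simp_all add: unital_hom_simps[OF scal_h_hom])
qed

context
  fixes Ru :: "complex fls fps ^ ('n::finite \<times> 'n) ^ ('n \<times> 'n)"
begin

lemma RTT_ideal_ideal: "ideal (RTT_ideal Ru) free_alg"
  by (simp add: ideal_iff_submodule RTT_ideal_properties(2))

lemma RTT_algebra_carrier: "carrier (RTT_algebra Ru) = range (cls Ru)"
  by (auto simp: RTT_algebra_def Let_def FactRing_def A_RCOSETS_def RCOSETS_def cls_def a_r_coset_def)

lemma RTT_algebra_cls [simp]:
  "cls Ru x \<in> carrier (RTT_algebra Ru)"
  "cls Ru x \<otimes>\<^bsub>RTT_algebra Ru\<^esub> cls Ru y = cls Ru (x * y)"
  "cls Ru x \<oplus>\<^bsub>RTT_algebra Ru\<^esub> cls Ru y = cls Ru (x + y)"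
  "s \<odot>\<^bsub>RTT_algebra Ru\<^esub> cls Ru x = cls Ru (scal_h s * x)"
proof -
  interpret ideal "RTT_ideal Ru" free_alg by (rule RTT_ideal_ideal)
  show "cls Ru x \<in> carrier (RTT_algebra Ru)" by (simp add: RTT_algebra_carrier)
  have m: "rcoset_mult free_alg (RTT_ideal Ru) (cls Ru x) (cls Ru y) = cls Ru (x * y)" for x y
    using rcoset_mult_add[of x y] by (simp add: cls_def)
  show "cls Ru x \<otimes>\<^bsub>RTT_algebra Ru\<^esub> cls Ru y = cls Ru (x * y)"
    "s \<odot>\<^bsub>RTT_algebra Ru\<^esub> cls Ru x = cls Ru (scal_h s * x)"
    using m by (simp_all add: RTT_algebra_def Let_def FactRing_def)
  show "cls Ru x \<oplus>\<^bsub>RTT_algebra Ru\<^esub> cls Ru y = cls Ru (x + y)"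
    using a_rcos_sum[of x y] by (simp add: RTT_algebra_def Let_def FactRing_def cls_def)
qed

lemma RTT_algebra_zero: "\<zero>\<^bsub>RTT_algebra Ru\<^esub> = cls Ru 0"
  and RTT_algebra_one: "\<one>\<^bsub>RTT_algebra Ru\<^esub> = cls Ru 1"
proof -
  show "\<one>\<^bsub>RTT_algebra Ru\<^esub> = cls Ru 1" by (simp add: RTT_algebra_def Let_def FactRing_def cls_def)
  have "cls Ru 0 = RTT_ideal Ru" by (auto simp: cls_def a_r_coset_def r_coset_def)
  thus "\<zero>\<^bsub>RTT_algebra Ru\<^esub> = cls Ru 0" by (simp add: RTT_algebra_def Let_def FactRing_def)
qed

lemma RTT_algebra_abelian: "abelian_group (RTT_algebra Ru)"
proof (rule abelian_groupI)
  fix y assume "y \<in> carrier (RTT_algebra Ru)"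
  then obtain x where y: "y = cls Ru x" by (auto simp: RTT_algebra_carrier)
  show "\<exists>z\<in>carrier (RTT_algebra Ru). z \<oplus>\<^bsub>RTT_algebra Ru\<^esub> y = \<zero>\<^bsub>RTT_algebra Ru\<^esub>"
    by (rule bexI[of _ "cls Ru (- x)"]) (simp_all add: y RTT_algebra_zero)
qed (auto simp: RTT_algebra_carrier RTT_algebra_zero add_ac)

lemma RTT_algebra_minus: "cls Ru x \<ominus>\<^bsub>RTT_algebra Ru\<^esub> cls Ru y = cls Ru (x - y)"
proof -
  interpret abelian_group "RTT_algebra Ru" by (rule RTT_algebra_abelian)
  have "\<ominus>\<^bsub>RTT_algebra Ru\<^esub> cls Ru y = cls Ru (- y)"
    by (rule minus_equality) (simp_all add: RTT_algebra_zero)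
  thus ?thesis by (simp add: a_minus_def)
qed

lemma RTT_algebra_finsum:
  "finite F \<Longrightarrow> finsum (RTT_algebra Ru) (\<lambda>i. cls Ru (g i)) F = cls Ru (sum g F)"
proof (induction F rule: finite_induct)
  interpret abelian_group "RTT_algebra Ru" by (rule RTT_algebra_abelian)
  case empty
  show ?case by (simp add: RTT_algebra_zero)
next
  interpret abelian_group "RTT_algebra Ru" by (rule RTT_algebra_abelian)
  case (insert x F)
  thus ?case by (simp add: finsum_insert)
qed

lemma in_h_multiples:
  assumes "\<And>j. j < k \<Longrightarrow> fps_nth x j = 0"
  shows "cls Ru x \<in> h_multiples (RTT_algebra Ru) k"
proof -
  have "x = fps_X ^ k * fps_shift k x"
    by (rule fps_ext) (use assms in \<open>auto simp: fps_X_power_mult_nth\<close>)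
  hence "cls Ru x = fps_X ^ k \<odot>\<^bsub>RTT_algebra Ru\<^esub> cls Ru (fps_shift k x)"
    by (simp add: scal_h_X)
  thus ?thesis unfolding h_multiples_def using RTT_algebra_cls(1) by blast
qed

end

subsection \<open>Unconditional \<open>h\<close>-adic sums\<close>

text \<open>Convergence before passing to the quotient, in a strong form: up to each order in h all
  but finitely many terms vanish. \<open>has_hsum_cls\<close> transfers it to the algebra.\<close>

definition hsum :: "('i \<Rightarrow> 'a::comm_monoid_add fps) \<Rightarrow> 'a fps \<Rightarrow> bool" where
  "hsum g z \<longleftrightarrow> (\<forall>k. \<exists>F. finite F \<and> (\<forall>i. i \<notin> F \<longrightarrow> (\<forall>j\<le>k. fps_nth (g i) j = 0)) \<and>
     (\<forall>j\<le>k. fps_nth z j = (\<Sum>i\<in>F. fps_nth (g i) j)))"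

lemma hsumI:
  assumes "\<And>k. \<exists>F. finite F \<and> (\<forall>i. i \<notin> F \<longrightarrow> (\<forall>j\<le>k. fps_nth (g i) j = 0)) \<and>
     (\<forall>j\<le>k. fps_nth z j = (\<Sum>i\<in>F. fps_nth (g i) j))"
  shows "hsum g z"
  using assms by (simp add: hsum_def)

lemma hsumE:
  assumes "hsum g z"
  obtains F where "finite F" "\<And>i j. i \<notin> F \<Longrightarrow> j \<le> k \<Longrightarrow> fps_nth (g i) j = 0"
    "\<And>F' j. finite F' \<Longrightarrow> F \<subseteq> F' \<Longrightarrow> j \<le> k \<Longrightarrow> fps_nth z j = (\<Sum>i\<in>F'. fps_nth (g i) j)"
proof -
  obtain F where F: "finite F" "\<forall>i. i \<notin> F \<longrightarrow> (\<forall>j\<le>k. fps_nth (g i) j = 0)"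
     "\<forall>j\<le>k. fps_nth z j = (\<Sum>i\<in>F. fps_nth (g i) j)"
    using assms unfolding hsum_def by metis
  show ?thesis
  proof (rule that[OF F(1)])
    fix F' j assume F': "finite F'" "F \<subseteq> F'" "j \<le> k"
    have "(\<Sum>i\<in>F. fps_nth (g i) j) = (\<Sum>i\<in>F'. fps_nth (g i) j)"
      using F F' by (intro sum.mono_neutral_left) auto
    thus "fps_nth z j = (\<Sum>i\<in>F'. fps_nth (g i) j)" using F F' by simp
  qed (use F in blast)
qed

lemma hsum_add:
  assumes "hsum g z" "hsum g' z'"
  shows "hsum (\<lambda>i. g i + g' i) (z + z')"
proof (rule hsumI)
  fix k
  obtain F where F: "finite F" "\<And>i j. i \<notin> F \<Longrightarrow> j \<le> k \<Longrightarrow> fps_nth (g i) j = 0"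
    "\<And>F' j. finite F' \<Longrightarrow> F \<subseteq> F' \<Longrightarrow> j \<le> k \<Longrightarrow> fps_nth z j = (\<Sum>i\<in>F'. fps_nth (g i) j)"
    by (rule hsumE[OF assms(1)]) blast
  obtain F' where F': "finite F'" "\<And>i j. i \<notin> F' \<Longrightarrow> j \<le> k \<Longrightarrow> fps_nth (g' i) j = 0"
    "\<And>F'' j. finite F'' \<Longrightarrow> F' \<subseteq> F'' \<Longrightarrow> j \<le> k \<Longrightarrow> fps_nth z' j = (\<Sum>i\<in>F''. fps_nth (g' i) j)"
    by (rule hsumE[OF assms(2)]) blast
  show "\<exists>F. finite F \<and> (\<forall>i. i \<notin> F \<longrightarrow> (\<forall>j\<le>k. fps_nth (g i + g' i) j = 0)) \<and>
     (\<forall>j\<le>k. fps_nth (z + z') j = (\<Sum>i\<in>F. fps_nth (g i + g' i) j))"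
  proof (intro exI[of _ "F \<union> F'"] conjI allI impI)
    show "fps_nth (z + z') j = (\<Sum>i\<in>F \<union> F'. fps_nth (g i + g' i) j)" if "j \<le> k" for j
      using F(1) F'(1) F(3)[of "F \<union> F'" j] F'(3)[of "F \<union> F'" j] that by (simp add: sum.distrib)
  qed (use F(1,2) F'(1,2) in auto)
qed

lemma hsum_zero: "hsum (\<lambda>i. 0) 0"
  by (rule hsumI) (auto intro: exI[of _ "{}"])

lemma hsum_sum:
  "(\<And>t. t \<in> S \<Longrightarrow> hsum (g t) (z t)) \<Longrightarrow> hsum (\<lambda>i. \<Sum>t\<in>S. g t i) (sum z S)"
  by (induction S rule: infinite_finite_induct) (auto intro: hsum_zero hsum_add)

lemma hsum_mult_left:
  fixes c :: "'a::ring_1 fps"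
  assumes "hsum g z"
  shows "hsum (\<lambda>i. c * g i) (c * z)"
proof (rule hsumI)
  fix k
  obtain F where F: "finite F" "\<And>i j. i \<notin> F \<Longrightarrow> j \<le> k \<Longrightarrow> fps_nth (g i) j = 0"
    "\<And>F' j. finite F' \<Longrightarrow> F \<subseteq> F' \<Longrightarrow> j \<le> k \<Longrightarrow> fps_nth z j = (\<Sum>i\<in>F'. fps_nth (g i) j)"
    by (rule hsumE[OF assms]) blast
  have "fps_nth (c * z) j = (\<Sum>i\<in>F. fps_nth (c * g i) j)" if "j \<le> k" for j
    unfolding fps_mult_nth by (subst sum.swap) (use that F(3)[OF F(1) order.refl] in \<open>simp add: sum_distrib_left[symmetric]\<close>)
  thus "\<exists>F. finite F \<and> (\<forall>i. i \<notin> F \<longrightarrow> (\<forall>j\<le>k. fps_nth (c * g i) j = 0)) \<and>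
     (\<forall>j\<le>k. fps_nth (c * z) j = (\<Sum>i\<in>F. fps_nth (c * g i) j))"
    using F by (intro exI[of _ F]) (auto simp: fps_mult_nth intro!: sum.neutral)
qed

lemma hsum_scal_mult:
  fixes x :: "'n falg fps"
  assumes "hsum g z"
  shows "hsum (\<lambda>i. scal_h (g i) * x) (scal_h z * x)"
proof -
  have "hsum (\<lambda>i. scal_h (g i) :: 'n falg fps) (scal_h z)"
  proof (rule hsumI)
    fix k
    obtain F where F: "finite F" "\<And>i j. i \<notin> F \<Longrightarrow> j \<le> k \<Longrightarrow> fps_nth (g i) j = 0"
      "\<And>F' j. finite F' \<Longrightarrow> F \<subseteq> F' \<Longrightarrow> j \<le> k \<Longrightarrow> fps_nth z j = (\<Sum>i\<in>F'. fps_nth (g i) j)"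
      by (rule hsumE[OF assms]) blast
    show "\<exists>F. finite F \<and> (\<forall>i. i \<notin> F \<longrightarrow> (\<forall>j\<le>k. fps_nth (scal_h (g i) :: 'n falg fps) j = 0)) \<and>
       (\<forall>j\<le>k. fps_nth (scal_h z :: 'n falg fps) j = (\<Sum>i\<in>F. fps_nth (scal_h (g i)) j))"
      using F by (intro exI[of _ F]) (auto simp: scal_h_eq unital_hom_sum[OF scal_hom])
  qed
  from hsum_mult_left[OF this, of x] show ?thesis by (simp add: centralD[OF central_scal_h])
qed

lemma hsum_unique:
  fixes z z' :: "'a::comm_monoid_add fps"
  assumes "hsum g z" "hsum g z'"
  shows "z = z'"
proof (rule fps_ext)
  fix k
  obtain F where F: "finite F"
    "\<And>F' j. finite F' \<Longrightarrow> F \<subseteq> F' \<Longrightarrow> j \<le> k \<Longrightarrow> fps_nth z j = (\<Sum>i\<in>F'. fps_nth (g i) j)"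
    by (rule hsumE[OF assms(1)]) blast
  obtain F' where F': "finite F'"
    "\<And>F'' j. finite F'' \<Longrightarrow> F' \<subseteq> F'' \<Longrightarrow> j \<le> k \<Longrightarrow> fps_nth z' j = (\<Sum>i\<in>F''. fps_nth (g i) j)"
    by (rule hsumE[OF assms(2)]) blast
  show "fps_nth z k = fps_nth z' k"
    using F(2)[of "F \<union> F'" k] F'(2)[of "F \<union> F'" k] F(1) F'(1) by simp
qed

lemma hsum_pair:
  assumes A: "finite A" "\<And>a b. a \<notin> A \<Longrightarrow> f (a, b) = 0" and h: "\<And>a. a \<in> A \<Longrightarrow> hsum (\<lambda>b. f (a, b)) (z a)"
  shows "hsum f (\<Sum>a\<in>A. z a)"
proof (rule hsumI)
  fix k
  have "\<forall>a\<in>A. \<exists>F. finite F \<and> (\<forall>b. b \<notin> F \<longrightarrow> (\<forall>j\<le>k. fps_nth (f (a, b)) j = 0)) \<and>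
     (\<forall>j\<le>k. fps_nth (z a) j = (\<Sum>b\<in>F. fps_nth (f (a, b)) j))"
    using h unfolding hsum_def by blast
  then obtain F where F: "\<And>a. a \<in> A \<Longrightarrow> finite (F a)"
    "\<And>a b j. a \<in> A \<Longrightarrow> b \<notin> F a \<Longrightarrow> j \<le> k \<Longrightarrow> fps_nth (f (a, b)) j = 0"
    "\<And>a j. a \<in> A \<Longrightarrow> j \<le> k \<Longrightarrow> fps_nth (z a) j = (\<Sum>b\<in>F a. fps_nth (f (a, b)) j)"
    by metis
  show "\<exists>F. finite F \<and> (\<forall>i. i \<notin> F \<longrightarrow> (\<forall>j\<le>k. fps_nth (f i) j = 0)) \<and>
     (\<forall>j\<le>k. fps_nth (\<Sum>a\<in>A. z a) j = (\<Sum>i\<in>F. fps_nth (f i) j))"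
  proof (intro exI[of _ "Sigma A F"] conjI allI impI)
    show "finite (Sigma A F)" using A F by auto
    show "fps_nth (f i) j = 0" if "i \<notin> Sigma A F" "j \<le> k" for i j
      using that A F by (cases i) (metis fps_zero_nth mem_Sigma_iff)
    show "fps_nth (\<Sum>a\<in>A. z a) j = (\<Sum>i\<in>Sigma A F. fps_nth (f i) j)" if "j \<le> k" for j
    proof -
      have "(\<Sum>i\<in>Sigma A F. fps_nth (f i) j) = (\<Sum>a\<in>A. \<Sum>b\<in>F a. fps_nth (f (a, b)) j)"
        using A F by (subst sum.Sigma) (auto simp: case_prod_unfold)
      thus ?thesis using F(3) that by (simp add: fps_sum_nth)
    qed
  qed
qed

lemma hsum_bij:
  assumes "bij \<pi>" "hsum (\<lambda>i. g (\<pi> i)) z"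
  shows "hsum g z"
proof (rule hsumI)
  fix k
  obtain F where F: "finite F" "\<And>i j. i \<notin> F \<Longrightarrow> j \<le> k \<Longrightarrow> fps_nth (g (\<pi> i)) j = 0"
    "\<And>F' j. finite F' \<Longrightarrow> F \<subseteq> F' \<Longrightarrow> j \<le> k \<Longrightarrow> fps_nth z j = (\<Sum>i\<in>F'. fps_nth (g (\<pi> i)) j)"
    by (rule hsumE[OF assms(2)]) blast
  have inj: "inj_on \<pi> F" using assms(1) by (meson bij_def inj_on_subset subset_UNIV)
  show "\<exists>F. finite F \<and> (\<forall>i. i \<notin> F \<longrightarrow> (\<forall>j\<le>k. fps_nth (g i) j = 0)) \<and> (\<forall>j\<le>k. fps_nth z j = (\<Sum>i\<in>F. fps_nth (g i) j))"
  proof (intro exI[of _ "\<pi> ` F"] conjI allI impI)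
    show "fps_nth (g i) j = 0" if "i \<notin> \<pi> ` F" "j \<le> k" for i j
    proof -
      obtain i' where "i = \<pi> i'" using assms(1) by (metis bij_pointE)
      thus ?thesis using that F(2) by auto
    qed
    show "fps_nth z j = (\<Sum>i\<in>\<pi> ` F. fps_nth (g i) j)" if "j \<le> k" for j
      using F(3)[OF F(1) order.refl that] by (simp add: sum.reindex[OF inj])
  qed (use F in simp)
qed

lemma hsum_u:
  fixes E X :: "'a::ring_1 fls fps"
  shows "hsum (\<lambda>i. u_coeff i E * u_coeff (r - i) X) (u_coeff r (E * X))"
proof (rule hsumI)
  fix k
  obtain a b where ab: "\<forall>j\<le>k. \<forall>i<a. fls_nth (fps_nth E j) i = 0" "\<forall>j\<le>k. \<forall>i<b. fls_nth (fps_nth X j) i = 0"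
    using ex_lower_bound by metis
  show "\<exists>F. finite F \<and> (\<forall>i. i \<notin> F \<longrightarrow> (\<forall>j\<le>k. fps_nth (u_coeff i E * u_coeff (r - i) X) j = 0)) \<and>
     (\<forall>j\<le>k. fps_nth (u_coeff r (E * X)) j = (\<Sum>i\<in>F. fps_nth (u_coeff i E * u_coeff (r - i) X) j))"
  proof (intro exI[of _ "{a..r - b}"] conjI allI impI)
    show "fps_nth (u_coeff i E * u_coeff (r - i) X) j = 0" if "i \<notin> {a..r - b}" "j \<le> k" for i j
    proof -
      have "i < a \<or> r - i < b" using that by auto
      thus ?thesis using ab that unfolding fps_mult_nth by (intro sum.neutral) auto
    qed
    show "fps_nth (u_coeff r (E * X)) j = (\<Sum>i\<in>{a..r - b}. fps_nth (u_coeff i E * u_coeff (r - i) X) j)" if "j \<le> k" for j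
      by (rule u_coeff_mult_nth[OF ab that])
  qed simp
qed

text \<open>The first factor has no negative powers of v and the second is bounded below in v up to
  order h^k, so finitely many powers of v matter. For each of them the sum over the powers of u is
  finite in the same sense.\<close>

lemma hsum_uv:
  fixes E :: "'a::ring_1 fls fps fps" and Y :: "'a fls fls fps"
  shows "hsum (\<lambda>(i, n). u_coeff i (fps_nth E n) * u_coeff (r - i) (u_coeff (s - int n) Y))
    (u_coeff r (u_coeff s (incl_uv E * Y)))"
proof (rule hsumI)
  fix k
  let ?f = "\<lambda>(i, n). u_coeff i (fps_nth E n) * u_coeff (r - i) (u_coeff (s - int n) Y)"
  obtain b where b: "\<forall>j\<le>k. \<forall>i<b. fls_nth (fps_nth Y j) i = 0"
    using ex_lower_bound by metis
  have a: "\<forall>j\<le>k. \<forall>i<0. fls_nth (fps_nth (incl_uv E) j) i = 0"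
    by (simp add: incl_uv_def)
  let ?S = "{n :: nat. int n \<le> s - b}"
  have finS: "finite ?S" by (rule finite_subset[of _ "{..nat (s - b)}"]) auto
  define \<Phi> where "\<Phi> n F \<longleftrightarrow> finite F \<and> (\<forall>i. i \<notin> F \<longrightarrow> (\<forall>j\<le>k. fps_nth (?f (i, n)) j = 0)) \<and>
     (\<forall>j\<le>k. fps_nth (u_coeff r (fps_nth E n * u_coeff (s - int n) Y)) j = (\<Sum>i\<in>F. fps_nth (?f (i, n)) j))" for n F
  have "\<forall>n. \<exists>F. \<Phi> n F"
  proof
    fix n
    show "\<exists>F. \<Phi> n F"
      using spec[OF hsum_u[of "fps_nth E n" r "u_coeff (s - int n) Y", unfolded hsum_def], of k]
      by (simp only: \<Phi>_def prod.case)
  qed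
  then obtain F where F0: "\<forall>n. \<Phi> n (F n)" by (rule choice[THEN exE])
  have F: "finite (F n)" "i \<notin> F n \<Longrightarrow> j \<le> k \<Longrightarrow> fps_nth (?f (i, n)) j = 0"
    "j \<le> k \<Longrightarrow> fps_nth (u_coeff r (fps_nth E n * u_coeff (s - int n) Y)) j = (\<Sum>i\<in>F n. fps_nth (?f (i, n)) j)" for n i j
    using spec[OF F0, of n] unfolding \<Phi>_def by blast+
  show "\<exists>F. finite F \<and> (\<forall>i. i \<notin> F \<longrightarrow> (\<forall>j\<le>k. fps_nth (?f i) j = 0)) \<and>
     (\<forall>j\<le>k. fps_nth (u_coeff r (u_coeff s (incl_uv E * Y))) j = (\<Sum>i\<in>F. fps_nth (?f i) j))"
  proof (intro exI[of _ "prod.swap ` Sigma ?S F"] conjI allI impI)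
    show "finite (prod.swap ` Sigma ?S F)" using finS F by auto
    show "fps_nth (?f x) j = 0" if "x \<notin> prod.swap ` Sigma ?S F" "j \<le> k" for x j
    proof -
      obtain i n where x: "x = (i, n)" by fastforce
      have "n \<notin> ?S \<or> i \<notin> F n" using that(1) unfolding x by (auto simp: image_iff)
      thus ?thesis
      proof
        assume "n \<notin> ?S"
        hence "s - int n < b" by simp
        thus ?thesis using b that(2) unfolding x by (auto simp: fps_mult_nth intro!: sum.neutral)
      qed (use F(2) that(2) x in blast)
    qed
    fix j assume j: "j \<le> k"
    have uc: "u_coeff (int n) (incl_uv E) = fps_nth E n" for n
      by (rule fps_ext) (simp add: incl_uv_def)
    have "fps_nth (u_coeff s (incl_uv E * Y)) j = (\<Sum>i\<in>{0..s - b}. fps_nth (u_coeff i (incl_uv E) * u_coeff (s - i) Y) j)"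
      by (rule u_coeff_mult_nth[OF a b j])
    also have "\<dots> = (\<Sum>n\<in>?S. fps_nth (fps_nth E n * u_coeff (s - int n) Y) j)"
      by (rule sum.reindex_bij_witness[of _ int nat]) (auto simp: uc[symmetric])
    finally have "fps_nth (u_coeff r (u_coeff s (incl_uv E * Y))) j =
        (\<Sum>n\<in>?S. fps_nth (u_coeff r (fps_nth E n * u_coeff (s - int n) Y)) j)"
      by (simp add: fls_sum_nth)
    also have "\<dots> = (\<Sum>n\<in>?S. \<Sum>i\<in>F n. fps_nth (?f (i, n)) j)"
      using F(3)[OF j] by simp
    also have "\<dots> = (\<Sum>x\<in>Sigma ?S F. fps_nth (?f (prod.swap x)) j)"
      using finS F(1) by (subst sum.Sigma) (auto simp: case_prod_unfold)
    also have "\<dots> = (\<Sum>x\<in>prod.swap ` Sigma ?S F. fps_nth (?f x) j)"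
      by (subst sum.reindex) (auto simp: inj_on_def)
    finally show "fps_nth (u_coeff r (u_coeff s (incl_uv E * Y))) j = (\<Sum>x\<in>prod.swap ` Sigma ?S F. fps_nth (?f x) j)" .
  qed
qed

section \<open>Density of words\<close>

definition linear_family :: "('n falg fps \<Rightarrow> 'i \<Rightarrow> 'n falg fps) \<Rightarrow> bool" where
  "linear_family G \<longleftrightarrow> (\<forall>x y i. G (x + y) i = G x i + G y i) \<and>
     (\<forall>s x i. G (scal_h s * x) i = scal_h s * G x i)"

text \<open>Linear combinations of words over C[[h]] contain all polynomials in h over the free
  algebra, and truncating a series in h gives such a polynomial.\<close>

lemma words_dense:
  fixes P :: "'n falg fps \<Rightarrow> bool"
  assumes P0: "P 0" and Padd: "\<And>x y. P x \<Longrightarrow> P y \<Longrightarrow> P (x + y)"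
    and Pscal: "\<And>s x. P x \<Longrightarrow> P (scal_h s * x)" and Pword: "\<And>w. P (fps_const (monom_word w))"
  obtains t where "P t" "x = t + scal_h (fps_X ^ Suc k) * fps_shift (Suc k) x"
proof -
  have Pconst: "P (fps_const c)" for c
  proof -
    have e: "fps_const (Poly_Mapping.single a d) = scal_h (fps_const d) * fps_const (monom_word (the_word a))"
      for a :: "('n \<times> 'n \<times> nat) fword" and d :: complex
    proof -
      obtain w where "a = Word w" by (cases a)
      moreover have "scal_h (fps_const d) = (fps_const (scal d) :: 'n falg fps)"
        by (rule fps_ext) (simp add: scal_h_eq)
      ultimately show ?thesis by (simp add: single_eq_scal_monom)
    qed
    have "P (\<Sum>a\<in>S. fps_const (Poly_Mapping.single a (d a)))" for S :: "('n \<times> 'n \<times> nat) fword set" and d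
      by (induction S rule: infinite_finite_induct) (auto intro!: P0 Padd Pscal Pword simp: e)
    moreover have "fps_const c = (\<Sum>a\<in>Poly_Mapping.keys c. fps_const (Poly_Mapping.single a (Poly_Mapping.lookup c a)))"
      by (subst falg_decompose) (rule unital_hom_sum[OF fps_const_hom])
    ultimately show ?thesis by metis
  qed
  define t where "t = (\<Sum>j\<le>k. scal_h (fps_X ^ j) * fps_const (fps_nth x j))"
  have "P (\<Sum>j\<in>S. scal_h (fps_X ^ j) * fps_const (fps_nth x j))" for S
    by (induction S rule: infinite_finite_induct) (simp_all add: P0 Padd Pscal Pconst)
  hence "P t" by (simp add: t_def)
  moreover have "x = t + scal_h (fps_X ^ Suc k) * fps_shift (Suc k) x"
  proof (rule fps_ext)
    fix n
    have "fps_nth t n = (\<Sum>j\<le>k. if j = n then fps_nth x n else 0)"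
      unfolding t_def fps_sum_nth by (rule sum.cong) (auto simp: scal_h_X fps_X_power_mult_nth)
    thus "fps_nth x n = fps_nth (t + scal_h (fps_X ^ Suc k) * fps_shift (Suc k) x) n"
      unfolding scal_h_X fps_add_nth fps_X_power_mult_nth by auto
  qed
  ultimately show ?thesis by (rule that)
qed

text \<open>Modulo h^(k + 1) the two families at \<open>x\<close> coincide with those at a
  combination of words, where both converge to the same sum. Linearity over C[[h]] makes the error a
  multiple of h^(k + 1).\<close>

lemma hsum_words_density:
  fixes G :: "'n falg fps \<Rightarrow> 'i \<Rightarrow> 'n falg fps" and G' :: "'n falg fps \<Rightarrow> 'j \<Rightarrow> 'n falg fps"
  assumes G: "linear_family G" "linear_family G'"
    and words: "\<And>w. \<exists>z. hsum (G (fps_const (monom_word w))) z \<and> hsum (G' (fps_const (monom_word w))) z"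
  shows "\<exists>z. hsum (G x) z \<and> hsum (G' x) z"
proof -
  define P where "P = (\<lambda>x. \<exists>z. hsum (G x) z \<and> hsum (G' x) z)"
  have P0: "P 0"
  proof -
    have "G 0 i = G 0 i + G 0 i" "G' 0 j = G' 0 j + G' 0 j" for i j
      using G unfolding linear_family_def by (metis add_0_left)+
    hence "G 0 = (\<lambda>i. 0)" "G' 0 = (\<lambda>j. 0)" by (auto simp: fun_eq_iff)
    thus ?thesis unfolding P_def by (intro exI[of _ 0]) (simp add: hsum_zero)
  qed
  have lin: "G (u + v) i = G u i + G v i" "G (scal_h s * u) i = scal_h s * G u i"
    "G' (u + v) j = G' u j + G' v j" "G' (scal_h s * u) j = scal_h s * G' u j" for u v s i j
    using G by (auto simp: linear_family_def)
  have fun_lin: "G (u + v) = (\<lambda>i. G u i + G v i)" "G (scal_h s * u) = (\<lambda>i. scal_h s * G u i)"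
    "G' (u + v) = (\<lambda>j. G' u j + G' v j)" "G' (scal_h s * u) = (\<lambda>j. scal_h s * G' u j)" for u v s
    by (simp_all add: fun_eq_iff lin)
  have Padd: "P (x + y)" if "P x" "P y" for x y
  proof -
    from that obtain z z' where "hsum (G x) z" "hsum (G' x) z" "hsum (G y) z'" "hsum (G' y) z'" by (auto simp: P_def)
    thus ?thesis unfolding P_def fun_lin by (intro exI[of _ "z + z'"] conjI hsum_add)
  qed
  have Pscal: "P (scal_h s * x)" if "P x" for s x
  proof -
    from that obtain z where "hsum (G x) z" "hsum (G' x) z" by (auto simp: P_def)
    thus ?thesis unfolding P_def fun_lin by (intro exI[of _ "scal_h s * z"] conjI hsum_mult_left)
  qed
  have Pword: "P (fps_const (monom_word w))" for w using words by (simp add: P_def)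
  have approx: "\<exists>t. P t \<and> (\<forall>i j. j \<le> k \<longrightarrow> fps_nth (G x i) j = fps_nth (G t i) j) \<and>
      (\<forall>i j. j \<le> k \<longrightarrow> fps_nth (G' x i) j = fps_nth (G' t i) j)" for k
  proof -
    obtain t where "P t" "x = t + scal_h (fps_X ^ Suc k) * fps_shift (Suc k) x"
      by (rule words_dense[of P, OF P0 Padd Pscal Pword])
    hence "G x i = G t i + fps_X ^ Suc k * G (fps_shift (Suc k) x) i"
      "G' x j = G' t j + fps_X ^ Suc k * G' (fps_shift (Suc k) x) j" for i j
      by (metis lin scal_h_X)+
    moreover have "fps_nth (a + fps_X ^ Suc k * b) j = fps_nth a j" if "j \<le> k" for a b :: "'n falg fps" and j
      using that unfolding fps_add_nth fps_X_power_mult_nth by simp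
    ultimately show ?thesis using \<open>P t\<close> by metis
  qed
  \<comment> \<open>The common sum is defined separately in each order of h; the approximation by
    words shows that only finitely many terms are nonzero there.\<close>
  define z where "z = Abs_fps (\<lambda>j. \<Sum>i\<in>{i. fps_nth (G x i) j \<noteq> 0}. fps_nth (G x i) j)"
  have both: "\<exists>F F'. finite F \<and> finite F' \<and> (\<forall>i. i \<notin> F \<longrightarrow> (\<forall>j\<le>k. fps_nth (G x i) j = 0)) \<and>
      (\<forall>i. i \<notin> F' \<longrightarrow> (\<forall>j\<le>k. fps_nth (G' x i) j = 0)) \<and>
      (\<forall>j\<le>k. fps_nth z j = (\<Sum>i\<in>F. fps_nth (G x i) j)) \<and> (\<forall>j\<le>k. fps_nth z j = (\<Sum>i\<in>F'. fps_nth (G' x i) j))" for k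
  proof -
    obtain t y where t: "hsum (G t) y" "hsum (G' t) y"
      "\<And>i j. j \<le> k \<Longrightarrow> fps_nth (G x i) j = fps_nth (G t i) j" "\<And>i j. j \<le> k \<Longrightarrow> fps_nth (G' x i) j = fps_nth (G' t i) j"
      using approx[of k] unfolding P_def by metis
    obtain F where F: "finite F" "\<And>i j. i \<notin> F \<Longrightarrow> j \<le> k \<Longrightarrow> fps_nth (G t i) j = 0"
      "\<And>F' j. finite F' \<Longrightarrow> F \<subseteq> F' \<Longrightarrow> j \<le> k \<Longrightarrow> fps_nth y j = (\<Sum>i\<in>F'. fps_nth (G t i) j)"
      by (rule hsumE[OF t(1)]) blast
    obtain F' where F': "finite F'" "\<And>i j. i \<notin> F' \<Longrightarrow> j \<le> k \<Longrightarrow> fps_nth (G' t i) j = 0"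
      "\<And>F'' j. finite F'' \<Longrightarrow> F' \<subseteq> F'' \<Longrightarrow> j \<le> k \<Longrightarrow> fps_nth y j = (\<Sum>i\<in>F''. fps_nth (G' t i) j)"
      by (rule hsumE[OF t(2)]) blast
    have z: "fps_nth z j = (\<Sum>i\<in>F. fps_nth (G x i) j)" if "j \<le> k" for j
    proof -
      have "(\<Sum>i\<in>{i. fps_nth (G x i) j \<noteq> 0}. fps_nth (G x i) j) = (\<Sum>i\<in>F. fps_nth (G x i) j)"
        by (rule sum.mono_neutral_left) (use F that t(3) in auto)
      thus ?thesis by (simp add: z_def)
    qed
    moreover have "fps_nth z j = (\<Sum>i\<in>F'. fps_nth (G' x i) j)" if "j \<le> k" for j
      using z[OF that] F(3)[OF F(1) order.refl that] F'(3)[OF F'(1) order.refl that] t(3,4)[OF that] by simp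
    ultimately show ?thesis
      using F(1,2) F'(1,2) t(3,4) by (intro exI[of _ F] exI[of _ F']) auto
  qed
  have "hsum (G x) z" "hsum (G' x) z"
    unfolding hsum_def using both by metis+
  thus ?thesis by blast
qed

subsection \<open>Operators on the quotient algebra\<close>

lemma has_hsum_cls:
  fixes Ru :: "complex fls fps ^ ('n::finite \<times> 'n) ^ ('n \<times> 'n)"
  assumes "hsum g z"
  shows "has_hsum (RTT_algebra Ru) (\<lambda>i. cls Ru (g i)) UNIV (cls Ru z)"
  unfolding has_hsum_def
proof (intro conjI allI ballI)
  fix k
  obtain F where F: "finite F"
    "\<And>F' j. finite F' \<Longrightarrow> F \<subseteq> F' \<Longrightarrow> j \<le> k \<Longrightarrow> fps_nth z j = (\<Sum>i\<in>F'. fps_nth (g i) j)"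
    by (rule hsumE[OF assms]) blast
  have "finsum (RTT_algebra Ru) (\<lambda>i. cls Ru (g i)) F' \<ominus>\<^bsub>RTT_algebra Ru\<^esub> cls Ru z \<in> h_multiples (RTT_algebra Ru) k"
    if F': "finite F'" "F \<subseteq> F'" for F'
  proof -
    have "fps_nth (sum g F' - z) j = 0" if "j < k" for j
      using F(2)[OF F', of j] that by (simp add: fps_sum_nth)
    thus ?thesis
      by (simp add: RTT_algebra_finsum[OF F'(1)] RTT_algebra_minus in_h_multiples)
  qed
  thus "\<exists>F0. finite F0 \<and> F0 \<subseteq> UNIV \<and> (\<forall>F. finite F \<and> F0 \<subseteq> F \<and> F \<subseteq> UNIV \<longrightarrow>
      finsum (RTT_algebra Ru) (\<lambda>i. cls Ru (g i)) F \<ominus>\<^bsub>RTT_algebra Ru\<^esub> cls Ru z \<in> h_multiples (RTT_algebra Ru) k)"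
    using F(1) by (intro exI[of _ F]) simp
qed simp_all

lemma u_coeff_scal_mult:
  "u_coeff r (scal_uh (hconst s) * X) = scal_h s * u_coeff r (X :: 'n falg fls fps)"
  by (rule fps_ext) (simp add: fps_mult_nth fls_sum_nth scal_uh_eq scal_h_eq hconst_def fls_map_const)

lemma u_coeff_scal_embed:
  "u_coeff r (scal_uh X * embed_u (m :: 'n falg)) = scal_h (u_coeff r X) * fps_const m"
  by (rule fps_ext) (simp add: scal_uh_eq scal_h_eq embed_u_def fls_map_nth)

lemma u_coeff_embed_mult: "u_coeff r (embed_u m * X) = fps_const m * u_coeff r X"
  by (rule fps_ext) (simp add: embed_u_def)

lemma u_coeff_scal_uh: "u_coeff r (scal_uh X) = scal_h (u_coeff r X)"
  by (rule fps_ext) (simp add: scal_uh_eq scal_h_eq fls_map_nth)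

text \<open>A representative of the class is picked by \<open>SOME\<close>, and the restriction to
  the carrier puts the operator into the extensional function space of
  \<open>hom_laurent\<close>.\<close>

definition quotient_op :: "complex fls fps ^ ('n::finite \<times> 'n) ^ ('n \<times> 'n)
    \<Rightarrow> ('n \<times> 'n \<Rightarrow> 'n falg fps \<Rightarrow> 'n falg fls fps) \<Rightarrow> ('n, 'n falg fps set) opmat" where
  "quotient_op Ru \<sigma> i j = (\<lambda>y\<in>carrier (RTT_algebra Ru). \<lambda>r. cls Ru (u_coeff r (\<sigma> (i, j) (SOME x. y = cls Ru x))))"

lemma quotient_op_cls:
  assumes "\<And>I. Modules.additive (\<sigma> I)"
    and "\<And>I x. x \<in> RTT_ideal Ru \<Longrightarrow> \<sigma> I x \<in> laurent_set (RTT_ideal Ru)"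
  shows "quotient_op Ru \<sigma> i j (cls Ru x) r = cls Ru (u_coeff r (\<sigma> (i, j) x))"
proof -
  define x' where "x' = (SOME x'. cls Ru x = cls Ru x')"
  have "cls Ru x = cls Ru x'" unfolding x'_def by (rule someI[of _ x]) simp
  hence "x - x' \<in> RTT_ideal Ru" by (simp add: cls_eq_iff)
  hence "u_coeff r (\<sigma> (i, j) x) - u_coeff r (\<sigma> (i, j) x') \<in> RTT_ideal Ru"
    using assms(2)[of "x - x'" "(i, j)"]
    by (simp add: laurent_set_def Modules.additive.diff[OF assms(1)] Modules.additive.diff[OF u_coeff_additive])
  hence "cls Ru (u_coeff r (\<sigma> (i, j) x')) = cls Ru (u_coeff r (\<sigma> (i, j) x))"
    by (metis cls_eq_iff)
  thus ?thesis by (simp add: quotient_op_def x'_def)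
qed

text \<open>The common bound on the poles in u up to order h^k is the condition required by
  \<open>laurent_h\<close>.\<close>

lemma quotient_op_opmats:
  assumes \<sigma>: "\<And>I. Modules.additive (\<sigma> I)" "\<And>I x. x \<in> RTT_ideal Ru \<Longrightarrow> \<sigma> I x \<in> laurent_set (RTT_ideal Ru)"
    "\<And>I s x. \<sigma> I (scal_h s * x) = scal_uh (hconst s) * \<sigma> I x"
  shows "quotient_op Ru \<sigma> \<in> opmats (RTT_algebra Ru)"
proof -
  note q = quotient_op_cls[of \<sigma> Ru, OF \<sigma>(1,2)]
  have L: "quotient_op Ru \<sigma> i j (cls Ru x) \<in> laurent_h (RTT_algebra Ru)" for i j x
  proof -
    have e: "quotient_op Ru \<sigma> i j (cls Ru x) = (\<lambda>r. cls Ru (u_coeff r (\<sigma> (i, j) x)))"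
      by (rule ext) (rule q)
    show ?thesis
      unfolding laurent_h_def e
    proof (intro CollectI conjI allI)
      fix k
      obtain a where "\<forall>n\<le>k. \<forall>r<a. fls_nth (fps_nth (\<sigma> (i, j) x) n) r = 0"
        using ex_lower_bound by blast
      thus "\<exists>r0. \<forall>r<r0. cls Ru (u_coeff r (\<sigma> (i, j) x)) \<in> h_multiples (RTT_algebra Ru) k"
        by (intro exI[of _ a] allI impI in_h_multiples) simp
    qed simp
  qed
  have "quotient_op Ru \<sigma> i j \<in> carrier (RTT_algebra Ru) \<rightarrow>\<^sub>E laurent_h (RTT_algebra Ru)" for i j
  proof (rule PiE_I)
    show "quotient_op Ru \<sigma> i j y \<in> laurent_h (RTT_algebra Ru)" if "y \<in> carrier (RTT_algebra Ru)" for y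
      using that L by (auto simp: RTT_algebra_carrier)
  qed (simp add: quotient_op_def)
  thus ?thesis
    unfolding opmats_def hom_laurent_def
    by (auto simp: RTT_algebra_carrier q Modules.additive.add[OF \<sigma>(1)] Modules.additive.add[OF u_coeff_additive]
        \<sigma>(3) u_coeff_scal_mult)
qed

subsection \<open>Composition of two operators on words\<close>

text \<open>Words below a word below \<open>w\<close> are below \<open>w\<close>, so both sums can
  run over the same finite set and the composite is governed by products of kernels.\<close>

lemma tau_tau_word:
  fixes w :: "('n::finite \<times> 'n \<times> nat) list"
  shows "u_coeff r (tau \<phi> I (u_coeff s (tau \<phi>' K (fps_const (monom_word w))))) =
    (\<Sum>w''\<in>below w. scal_h (\<Sum>w'\<in>below w. u_coeff r (word_kernel \<phi> delta w' w'' I) *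
       u_coeff s (word_kernel \<phi>' delta w w' K)) * fps_const (monom_word w''))"
proof -
  note us = Modules.additive.sum[OF u_coeff_additive] and ts = Modules.additive.sum[OF tau_additive]
  let ?a = "\<lambda>w' w''. u_coeff r (word_kernel \<phi> delta w' w'' I)" and ?b = "\<lambda>w'. u_coeff s (word_kernel \<phi>' delta w w' K)"
  have inner: "u_coeff r (tau \<phi> I (fps_const (monom_word w'))) =
      (\<Sum>w''\<in>below w. scal_h (?a w' w'') * fps_const (monom_word w''))" if "w' \<in> below w" for w'
  proof -
    have z: "u_coeff r (0 :: complex fls fps) = 0" by (rule fps_ext) simp
    have "u_coeff r (tau \<phi> I (fps_const (monom_word w'))) = (\<Sum>w''\<in>below w'. scal_h (?a w' w'') * fps_const (monom_word w''))"
      by (simp add: tau_word us u_coeff_scal_embed)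
    also have "\<dots> = (\<Sum>w''\<in>below w. scal_h (?a w' w'') * fps_const (monom_word w''))"
      by (rule sum.mono_neutral_left)
        (use that below_trans finite_below in \<open>auto simp: kernel_eq_0 z unital_hom_zero[OF scal_h_hom]\<close>)
    finally show ?thesis .
  qed
  have "u_coeff r (tau \<phi> I (u_coeff s (tau \<phi>' K (fps_const (monom_word w))))) =
      (\<Sum>w'\<in>below w. scal_h (?b w') * u_coeff r (tau \<phi> I (fps_const (monom_word w'))))"
    by (simp add: tau_word[of \<phi>'] us ts u_coeff_scal_embed tau_scal u_coeff_scal_mult)
  also have "\<dots> = (\<Sum>w'\<in>below w. \<Sum>w''\<in>below w. scal_h (?a w' w'' * ?b w') * fps_const (monom_word w''))"
    by (simp add: inner sum_distrib_left mult.assoc[symmetric] unital_hom_mult[OF scal_h_hom, symmetric] mult.commute)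
  also have "\<dots> = (\<Sum>w''\<in>below w. \<Sum>w'\<in>below w. scal_h (?a w' w'' * ?b w') * fps_const (monom_word w''))"
    by (rule sum.swap)
  finally show ?thesis by (simp add: unital_hom_sum[OF scal_h_hom] sum_distrib_right)
qed

lemma u_coeff_sum_fps: "u_coeff r (sum f S) = (\<Sum>i\<in>S. u_coeff r (f i :: 'a::ab_group_add fls fps))"
  by (rule Modules.additive.sum[OF u_coeff_additive])

text \<open>On a word the composite is a finite combination of words whose coefficients are
  u-coefficients of products of kernels. By \<open>K\<close> these add up to the coefficients of 1
  or 0, and density extends the result to all elements.\<close>

lemma hsum_tau_tau_identity:
  fixes \<phi> \<phi>' :: "'n::finite \<Rightarrow> 'n \<Rightarrow> 'n \<Rightarrow> 'n \<Rightarrow> ('n \<times> 'n, complex fls fps fps) sqm"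
  assumes K: "\<And>w w'' :: ('n \<times> 'n \<times> nat) list. (\<Sum>p\<in>UNIV. \<Sum>w'\<in>below w. word_kernel \<phi> delta w' w'' (i, p) *
      word_kernel \<phi>' delta w w' (p, j)) = (if w = w'' \<and> i = j then 1 else 0)"
  shows "hsum (\<lambda>(p, s). u_coeff s (tau \<phi> (i, p) (u_coeff (r - s) (tau \<phi>' (p, j) x))))
    (if i = j \<and> r = 0 then x else 0)"
proof -
  let ?G = "\<lambda>x (p, s). u_coeff s (tau \<phi> (i, p) (u_coeff (r - s) (tau \<phi>' (p, j) x)))"
  let ?Z = "\<lambda>x :: 'n falg fps. if i = j \<and> r = 0 then x else 0"
  \<comment> \<open>The expected value is regarded as a family with one term, since the density
    lemma compares the sums of two families.\<close>
  let ?G' = "\<lambda>x (u :: unit). ?Z x"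
  have single: "hsum (?G' x) (?Z x)" for x
    by (rule hsumI) (auto intro: exI[of _ "UNIV :: unit set"] simp: UNIV_unit)
  have lin: "linear_family ?G" "linear_family ?G'"
    unfolding linear_family_def
    by (auto simp: Modules.additive.add[OF tau_additive] Modules.additive.add[OF u_coeff_additive] tau_scal
        u_coeff_scal_mult)
  have "\<exists>z. hsum (?G x) z \<and> hsum (?G' x) z"
  proof (rule hsum_words_density[OF lin])
    fix w :: "('n \<times> 'n \<times> nat) list"
    let ?a = "\<lambda>p w' w''. word_kernel \<phi> delta w' w'' (i, p)" and ?b = "\<lambda>p w'. word_kernel \<phi>' delta w w' (p, j)"
    let ?m = "\<lambda>w''. fps_const (monom_word w'') :: 'n falg fps"
    have "hsum (?G (?m w)) (\<Sum>p\<in>UNIV. \<Sum>w''\<in>below w. scal_h (\<Sum>w'\<in>below w. u_coeff r (?a p w' w'' * ?b p w')) * ?m w'')"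
    proof (rule hsum_pair)
      fix p
      have "hsum (\<lambda>s. \<Sum>w''\<in>below w. scal_h (\<Sum>w'\<in>below w. u_coeff s (?a p w' w'') * u_coeff (r - s) (?b p w')) * ?m w'')
          (\<Sum>w''\<in>below w. scal_h (\<Sum>w'\<in>below w. u_coeff r (?a p w' w'' * ?b p w')) * ?m w'')"
        by (intro hsum_sum hsum_scal_mult hsum_u)
      thus "hsum (\<lambda>s. ?G (?m w) (p, s)) (\<Sum>w''\<in>below w. scal_h (\<Sum>w'\<in>below w. u_coeff r (?a p w' w'' * ?b p w')) * ?m w'')"
        by (simp add: tau_tau_word)
    qed simp_all
    also have "(\<Sum>p\<in>UNIV. \<Sum>w''\<in>below w. scal_h (\<Sum>w'\<in>below w. u_coeff r (?a p w' w'' * ?b p w')) * ?m w'') =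
        (\<Sum>w''\<in>below w. scal_h (u_coeff r (\<Sum>p\<in>UNIV. \<Sum>w'\<in>below w. ?a p w' w'' * ?b p w')) * ?m w'')"
      by (subst sum.swap) (simp add: u_coeff_sum_fps unital_hom_sum[OF scal_h_hom] sum_distrib_right)
    also have "\<dots> = (\<Sum>w''\<in>below w. if w'' = w then ?Z (?m w) else 0)"
    proof (rule sum.cong)
      fix w''
      have "u_coeff r (1 :: complex fls fps) = (if r = 0 then 1 else 0)" "u_coeff r (0 :: complex fls fps) = 0"
        by (rule fps_ext, simp)+
      thus "scal_h (u_coeff r (\<Sum>p\<in>UNIV. \<Sum>w'\<in>below w. ?a p w' w'' * ?b p w')) * ?m w'' = (if w'' = w then ?Z (?m w) else 0)"
        unfolding K by (auto simp: unital_hom_zero[OF scal_h_hom] unital_hom_one[OF scal_h_hom])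
    qed simp
    also have "\<dots> = ?Z (?m w)"
    proof -
      have "w \<in> below w" by (simp add: below_def list_all2_refl case_prod_unfold)
      thus ?thesis by (simp add: finite_below)
    qed
    finally show "\<exists>z. hsum (?G (?m w)) z \<and> hsum (?G' (?m w)) z" using single[of "?m w"] by blast
  qed
  then obtain z where z: "hsum (?G x) z" "hsum (?G' x) z" by blast
  have "z = ?Z x" by (rule hsum_unique[OF z(2) single])
  thus ?thesis using z(1) by simp
qed

lemma u_coeff_incl_mult:
  "u_coeff r (u_coeff s (incl_u G * incl_v H)) = u_coeff r G * u_coeff s (H :: complex fls fps)"
  by (rule fps_ext) (simp add: fps_mult_nth fls_sum_nth incl_u_def incl_v_def fls_map_nth)

text \<open>For fixed p and q, the double sum over powers of u and v is a coefficient of the product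
  of a shifted R-matrix entry with a kernel in two variables.\<close>

lemma hsum_tau_tau_word:
  fixes E :: "'n::finite \<Rightarrow> 'n \<Rightarrow> complex fls fps" and K :: "'n \<Rightarrow> 'n \<Rightarrow> ('n \<times> 'n \<times> nat) list \<Rightarrow> complex fls fls fps"
  assumes X: "\<And>p q r s. X p q r s = (\<Sum>v\<in>S. scal_h (u_coeff r (u_coeff s (K p q v))) * fps_const (monom_word v))"
  shows "hsum (\<lambda>(p, q, r', s'). scal_h (u_coeff r' (subst_coeff b s' (E p q))) * X p q (r - r') (s - int s'))
    (\<Sum>v\<in>S. scal_h (u_coeff r (u_coeff s (\<Sum>p\<in>UNIV. \<Sum>q\<in>UNIV. incl_uv (shift_v b (E p q)) * K p q v))) * fps_const (monom_word v))"
proof -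
  let ?m = "\<lambda>v. fps_const (monom_word v) :: 'n falg fps"
  let ?f = "\<lambda>(p, q, r', s'). scal_h (u_coeff r' (subst_coeff b s' (E p q))) * X p q (r - r') (s - int s')"
  let ?z = "\<lambda>p q. \<Sum>v\<in>S. scal_h (u_coeff r (u_coeff s (incl_uv (shift_v b (E p q)) * K p q v))) * ?m v"
  have "hsum (\<lambda>i. ?f (p, q, i)) (?z p q)" for p q
  proof -
    have "hsum (\<lambda>i. \<Sum>v\<in>S. scal_h ((\<lambda>(r', s'). u_coeff r' (fps_nth (shift_v b (E p q)) s') * u_coeff (r - r') (u_coeff (s - int s') (K p q v))) i) * ?m v) (?z p q)"
      by (intro hsum_sum hsum_scal_mult hsum_uv)
    moreover have "?f (p, q, i) = (\<Sum>v\<in>S. scal_h ((\<lambda>(r', s'). u_coeff r' (fps_nth (shift_v b (E p q)) s') * u_coeff (r - r') (u_coeff (s - int s') (K p q v))) i) * ?m v)" for i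
      by (cases i) (simp add: X sum_distrib_left shift_v_nth unital_hom_mult[OF scal_h_hom] mult.assoc)
    ultimately show ?thesis by (simp only:)
  qed
  note h1 = this
  have h2: "hsum (\<lambda>i. ?f (p, i)) (\<Sum>q\<in>UNIV. ?z p q)" for p
    by (rule hsum_pair[where z = "?z p"]) (simp, simp, rule h1)
  have "hsum ?f (\<Sum>p\<in>UNIV. \<Sum>q\<in>UNIV. ?z p q)"
    by (rule hsum_pair[where z = "\<lambda>p. \<Sum>q\<in>UNIV. ?z p q"]) (simp, simp, rule h2)
  also have "(\<Sum>p\<in>UNIV. \<Sum>q\<in>UNIV. ?z p q) = (\<Sum>v\<in>S. \<Sum>p\<in>UNIV. \<Sum>q\<in>UNIV. scal_h (u_coeff r (u_coeff s (incl_uv (shift_v b (E p q)) * K p q v))) * ?m v)"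
    by (rule sum_rotate)
  finally show ?thesis
    by (simp add: u_coeff_sum_fps unital_hom_sum[OF scal_h_hom] sum_distrib_right)
qed

text \<open>The two operators carry the parameters u and v; \<open>incl_u\<close> and
  \<open>incl_v\<close> keep their kernels apart, so that \<open>K\<close> is an identity of series
  in both.\<close>

lemma hsum_RTT_T_T:
  fixes \<phi> :: "'n::finite \<Rightarrow> 'n \<Rightarrow> 'n \<Rightarrow> 'n \<Rightarrow> ('n \<times> 'n, complex fls fps fps) sqm"
    and Ru :: "complex fls fps ^ ('n \<times> 'n) ^ ('n \<times> 'n)"
  assumes K: "\<And>w w'' :: ('n \<times> 'n \<times> nat) list.
     (\<Sum>p\<in>UNIV. \<Sum>q\<in>UNIV. incl_uv (shift_v 0 (Ru $ (i, j) $ (p, q))) *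
      (\<Sum>w'\<in>below w. incl_u (word_kernel \<phi> delta w' w'' (p, k)) * incl_v (word_kernel \<phi> delta w w' (q, l)))) =
    (\<Sum>p\<in>UNIV. \<Sum>q\<in>UNIV. incl_uv (shift_v 0 (Ru $ (p, q) $ (k, l))) *
      (\<Sum>w'\<in>below w. incl_v (word_kernel \<phi> delta w' w'' (j, q)) * incl_u (word_kernel \<phi> delta w w' (i, p))))"
  shows "\<exists>z. hsum (\<lambda>(p, q, r', s'). scal_h (u_coeff r' (subst_coeff 0 s' (Ru $ (i, j) $ (p, q)))) *
        u_coeff (r - r') (tau \<phi> (p, k) (u_coeff (s - int s') (tau \<phi> (q, l) x)))) z \<and>
     hsum (\<lambda>(p, q, r', s'). scal_h (u_coeff r' (subst_coeff 0 s' (Ru $ (p, q) $ (k, l)))) *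
        u_coeff (s - int s') (tau \<phi> (j, q) (u_coeff (r - r') (tau \<phi> (i, p) x)))) z"
proof -
  let ?G = "\<lambda>x (p, q, r', s'). scal_h (u_coeff r' (subst_coeff 0 s' (Ru $ (i, j) $ (p, q)))) *
        u_coeff (r - r') (tau \<phi> (p, k) (u_coeff (s - int s') (tau \<phi> (q, l) x)))"
  let ?G' = "\<lambda>x (p, q, r', s'). scal_h (u_coeff r' (subst_coeff 0 s' (Ru $ (p, q) $ (k, l)))) *
        u_coeff (s - int s') (tau \<phi> (j, q) (u_coeff (r - r') (tau \<phi> (i, p) x)))"
  have sc: "scal_h a * (scal_h s * y) = scal_h s * (scal_h a * y)" for a s and y :: "'n falg fps"
    by (simp only: mult.assoc[symmetric] centralD[OF central_scal_h, of a "scal_h s"])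
  have lin: "linear_family ?G" "linear_family ?G'"
    unfolding linear_family_def
    by (auto simp: Modules.additive.add[OF tau_additive] Modules.additive.add[OF u_coeff_additive] tau_scal
        u_coeff_scal_mult distrib_left sc)
  show ?thesis
  proof (rule hsum_words_density[OF lin])
    fix w :: "('n \<times> 'n \<times> nat) list"
    let ?m = "\<lambda>v. fps_const (monom_word v) :: 'n falg fps"
    let ?K = "\<lambda>p q v. \<Sum>w'\<in>below w. incl_u (word_kernel \<phi> delta w' v (p, k)) * incl_v (word_kernel \<phi> delta w w' (q, l))"
    let ?K' = "\<lambda>p q v. \<Sum>w'\<in>below w. incl_v (word_kernel \<phi> delta w' v (j, q)) * incl_u (word_kernel \<phi> delta w w' (i, p))"
    have 1: "u_coeff r' (tau \<phi> (p, k) (u_coeff s' (tau \<phi> (q, l) (?m w)))) =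
        (\<Sum>v\<in>below w. scal_h (u_coeff r' (u_coeff s' (?K p q v))) * ?m v)" for p q r' s'
      by (simp add: tau_tau_word u_coeff_sum_fps u_coeff_incl_mult)
    have 2: "u_coeff s' (tau \<phi> (j, q) (u_coeff r' (tau \<phi> (i, p) (?m w)))) =
        (\<Sum>v\<in>below w. scal_h (u_coeff r' (u_coeff s' (?K' p q v))) * ?m v)" for p q r' s'
      unfolding mult.commute[of "incl_v _" "incl_u _"]
      by (simp add: tau_tau_word u_coeff_sum_fps u_coeff_incl_mult mult.commute)
    have "hsum (?G (?m w)) (\<Sum>v\<in>below w. scal_h (u_coeff r (u_coeff s (\<Sum>p\<in>UNIV. \<Sum>q\<in>UNIV. incl_uv (shift_v 0 (Ru $ (i, j) $ (p, q))) * ?K p q v))) * ?m v)"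
      by (rule hsum_tau_tau_word[where E = "\<lambda>p q. Ru $ (i, j) $ (p, q)" and K = ?K]) (rule 1)
    moreover have "hsum (?G' (?m w)) (\<Sum>v\<in>below w. scal_h (u_coeff r (u_coeff s (\<Sum>p\<in>UNIV. \<Sum>q\<in>UNIV. incl_uv (shift_v 0 (Ru $ (p, q) $ (k, l))) * ?K' p q v))) * ?m v)"
      by (rule hsum_tau_tau_word[where E = "\<lambda>p q. Ru $ (p, q) $ (k, l)" and K = ?K' and
            X = "\<lambda>p q r' s'. u_coeff s' (tau \<phi> (j, q) (u_coeff r' (tau \<phi> (i, p) (?m w))))"]) (rule 2)
    ultimately show "\<exists>z. hsum (?G (?m w)) z \<and> hsum (?G' (?m w)) z"
      unfolding K by blast
  qed
qed

subsection \<open>The two letter maps preserve the ideal\<close>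

text \<open>Multiply the equation on both sides by the inverses of y and of one outer factor, in the
  order in which they cancel.\<close>

lemma yb_inverses:
  fixes x y z :: "'a::monoid_mult"
  assumes yb: "x * y * z = z * y * x"
    and inv: "x * x' = 1" "x' * x = 1" "y * y' = 1" "y' * y = 1" "z * z' = 1" "z' * z = 1"
  shows "x * z' * y' = y' * z' * x" "z * x' * y' = y' * x' * z"
proof -
  have c: "a * (b * w) = w" if "a * b = 1" for a b w :: 'a
    using that by (simp add: mult.assoc[symmetric])
  have "y' * z' * (z * y * x) * (z' * y') = x * z' * y'"
    by (simp add: mult.assoc c inv)
  moreover have "y' * z' * (x * y * z) * (z' * y') = y' * z' * x"
    by (simp add: mult.assoc c inv)
  ultimately show "x * z' * y' = y' * z' * x" by (simp only: yb)
  have "y' * x' * (x * y * z) * (x' * y') = z * x' * y'"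
    by (simp add: mult.assoc c inv)
  moreover have "y' * x' * (z * y * x) * (x' * y') = y' * x' * z"
    by (simp add: mult.assoc c inv)
  ultimately show "z * x' * y' = y' * x' * z" by (simp only: yb)
qed

lemma hom_inverse: "unital_hom f \<Longrightarrow> x * y = 1 \<Longrightarrow> f x * f y = 1"
  by (simp add: unital_hom_mult[symmetric] unital_hom_one)

lemma additive_R_yang_baxter_inverses:
  fixes R :: "complex fps ^ ('n::finite \<times> 'n) ^ ('n \<times> 'n)" and M :: nat and \<psi> :: "complex fps"
  assumes "hecke_symmetry R" "a \<noteq> 0" and Ru: "Ru = additive_R R M a \<psi>" and "unitary Ru"
  defines "r \<equiv> of_mat Ru" and "r' \<equiv> of_mat (matrix_inv Ru)"
  shows "legs12 (sq_map (at_uv b) r) * legs23 (sq_map (at_vw b') r') * legs13 (sq_map (at_uw (b + b')) r') =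
      legs13 (sq_map (at_uw (b + b')) r') * legs23 (sq_map (at_vw b') r') * legs12 (sq_map (at_uv b) r)"
    and "legs23 (sq_map (at_vw b') r) * legs12 (sq_map (at_uv b) r') * legs13 (sq_map (at_uw (b + b')) r') =
      legs13 (sq_map (at_uw (b + b')) r') * legs12 (sq_map (at_uv b) r') * legs23 (sq_map (at_vw b') r)"
proof -
  note yb = additive_R_yang_baxter[OF assms(1,2), of b M \<psi> b', folded Ru r_def]
  note i = unitary_inverse(1,2)[OF \<open>unitary Ru\<close>, folded r_def r'_def]
  note inv = hom_inverse[OF legs_hom(1) hom_inverse[OF sq_map_hom[OF at_hom(1)[of b]] i(1)]]
    hom_inverse[OF legs_hom(1) hom_inverse[OF sq_map_hom[OF at_hom(1)[of b]] i(2)]]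
    hom_inverse[OF legs_hom(2) hom_inverse[OF sq_map_hom[OF at_hom(2)[of "b + b'"]] i(1)]]
    hom_inverse[OF legs_hom(2) hom_inverse[OF sq_map_hom[OF at_hom(2)[of "b + b'"]] i(2)]]
    hom_inverse[OF legs_hom(3) hom_inverse[OF sq_map_hom[OF at_hom(3)[of b']] i(1)]]
    hom_inverse[OF legs_hom(3) hom_inverse[OF sq_map_hom[OF at_hom(3)[of b']] i(2)]]
  show "legs12 (sq_map (at_uv b) r) * legs23 (sq_map (at_vw b') r') * legs13 (sq_map (at_uw (b + b')) r') =
      legs13 (sq_map (at_uw (b + b')) r') * legs23 (sq_map (at_vw b') r') * legs12 (sq_map (at_uv b) r)"
    by (rule yb_inverses(1)[OF yb inv])
  show "legs23 (sq_map (at_vw b') r) * legs12 (sq_map (at_uv b) r') * legs13 (sq_map (at_uw (b + b')) r') =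
      legs13 (sq_map (at_uw (b + b')) r') * legs12 (sq_map (at_uv b) r') * legs23 (sq_map (at_vw b') r)"
    by (rule yb_inverses(2)[OF yb inv])
qed

lemma sq_map_sq_map: "sq_map f (sq_map g X) = sq_map (\<lambda>x. f (g x)) X"
  by (rule sqm_eqI) simp

lemma leg_sq_diag: "leg1 (sq_diag x) = sq_diag x" "leg2 (sq_diag x) = sq_diag x"
  by (rule sqm_eqI, simp add: leg1_def leg2_def sq_diag_def split: prod.split)+

text \<open>The disjunction records on which side of the auxiliary matrix the left letter index is
  acted on: for T^- it is the left side, for its inverse the right side. The two representations sit
  on different legs over commuting scalars, which gives the commutation needed by
  \<open>image_h_relators\<close>.\<close>

lemma tau_preserves_ideal:
  fixes Ru :: "complex fls fps ^ ('n::finite \<times> 'n) ^ ('n \<times> 'n)"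
    and \<alpha> \<beta> :: "('n, ('n, complex fls fps fps) sqm) sqm"
  defines "uv \<equiv> \<lambda>X :: complex fls fps fps. fps_const (incl_uv X)" and "uw \<equiv> fps_map incl_u"
    and "C \<equiv> sq_map sq_diag (sq_map (at_vw 0) (of_mat Ru)) :: ('n \<times> 'n, ('n, complex fls fls fps fps) sqm) sqm"
  assumes \<phi>: "(\<forall>k l k' l'. \<phi> k l k' l' = leg1 (sq \<alpha> k k') * leg2 (sq \<beta> l' l)) \<or>
      (\<forall>k l k' l'. \<phi> k l k' l' = leg2 (sq \<alpha> k k') * leg1 (sq \<beta> l' l))"
    and \<alpha>: "rtt_rel C (sq_map (sq_map uv) \<alpha>) (sq_map (sq_map uw) \<alpha>)"
    and \<beta>: "rtt_rel C (sq_map (sq_map uv) \<beta>) (sq_map (sq_map uw) \<beta>)"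
    and x: "x \<in> RTT_ideal Ru"
  shows "tau \<phi> I x \<in> laurent_set (RTT_ideal Ru)"
proof -
  let ?J = "RTT_ideal Ru"
  note J = RTT_ideal_properties[where Ru = Ru]
  let ?C = "sq_map sq_diag (sq_map (at_vw 0) (of_mat Ru)) :: ('n \<times> 'n, ('n \<times> 'n, complex fls fls fps fps) sqm) sqm"
  have uv0: "uv 0 = 0" "uw 0 = 0"
    by (simp_all add: uv_def uw_def unital_hom_zero[OF incl_uv_hom] unital_hom_zero[OF fps_map_hom[OF incl_u_hom]])
  have C: "sq_map leg1 C = ?C" "sq_map leg2 C = ?C"
    by (simp_all add: C_def sq_map_sq_map leg_sq_diag)
  have leg: "sq_map leg1 (sq_map (sq_map f) X) = sq_map (sq_map f) (sq_map leg1 X)"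
      "sq_map leg2 (sq_map (sq_map f) X) = sq_map (sq_map f) (sq_map leg2 X)" if "f 0 = 0"
    for f :: "complex fls fps fps \<Rightarrow> complex fls fls fps fps" and X :: "('n, ('n, complex fls fps fps) sqm) sqm"
    by (simp_all add: sq_map_sq_map leg_sq_map that)
  have rtt1: "rtt_rel ?C (sq_map (sq_map uv) (sq_map leg1 X)) (sq_map (sq_map uw) (sq_map leg1 X))"
    "rtt_rel ?C (sq_map (sq_map uv) (sq_map leg2 X)) (sq_map (sq_map uw) (sq_map leg2 X))"
    if "rtt_rel C (sq_map (sq_map uv) X) (sq_map (sq_map uw) X)" for X
    using rtt_rel_map[OF leg_hom(1) that] rtt_rel_map[OF leg_hom(2) that] by (simp_all only: C leg uv0)
  have comm: "sq_map f (leg1 X) * sq_map g (leg2 Y) = sq_map g (leg2 Y) * sq_map f (leg1 X)" if "f 0 = 0" "g 0 = 0"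
    for f g :: "complex fls fps fps \<Rightarrow> complex fls fls fps fps" and X Y :: "('n, complex fls fps fps) sqm"
    unfolding leg_sq_map[of f, OF that(1), symmetric] leg_sq_map[of g, OF that(2), symmetric]
    by (rule legs_commute) (rule mult.commute)
  note r = rtt1[OF \<alpha>, unfolded uv_def uw_def] rtt1[OF \<beta>, unfolded uv_def uw_def]
    and c = comm[of uv uw, OF uv0, unfolded uv_def uw_def] comm[of uw uv, OF uv0(2,1), unfolded uv_def uw_def]
  have rel: "image_h \<phi> i j z \<in> laurent_set ?J" if "z \<in> RTT_relators Ru" for z i j
    using \<phi>
  proof
    assume \<phi>: "\<forall>k l k' l'. \<phi> k l k' l' = leg1 (sq \<alpha> k k') * leg2 (sq \<beta> l' l)"
    show ?thesis
      by (rule image_h_relators[OF _ _ _ _ _ J(1,2,4) that, where \<alpha> = "sq_map leg1 \<alpha>" and \<beta> = "sq_map leg2 \<beta>"])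
        (simp only: \<phi> sq_sq_map, rule r(1), rule r(4), unfold sq_sq_map, rule c(1), rule c(2))
  next
    assume \<phi>: "\<forall>k l k' l'. \<phi> k l k' l' = leg2 (sq \<alpha> k k') * leg1 (sq \<beta> l' l)"
    show ?thesis
      by (rule image_h_relators[OF _ _ _ _ _ J(1,2,4) that, where \<alpha> = "sq_map leg2 \<alpha>" and \<beta> = "sq_map leg1 \<beta>"])
        (simp only: \<phi> sq_sq_map, rule r(2), rule r(3), unfold sq_sq_map, rule c(2)[symmetric], rule c(1)[symmetric])
  qed
  have "?J \<subseteq> {x. \<forall>i j. image_h \<phi> i j x \<in> laurent_set ?J}"
  proof (rule J(5))
    show "h_closed {x. \<forall>i j. image_h \<phi> i j x \<in> laurent_set ?J}"
      by (rule image_h_preserves_ideal(1)) (rule J(1), rule J(2), rule J(3))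
    show "submodule UNIV {x. \<forall>i j. image_h \<phi> i j x \<in> laurent_set ?J}"
      by (rule image_h_preserves_ideal(2)) (rule J(1), rule J(2), rule J(3))
    show "x \<in> {x. \<forall>i j. image_h \<phi> i j x \<in> laurent_set ?J}"
      if "fps_X * x \<in> {x. \<forall>i j. image_h \<phi> i j x \<in> laurent_set ?J}" for x
      by (rule image_h_preserves_ideal(3)[OF _ _ _ that]) (rule J(1), rule J(2), rule J(3))
    show "RTT_relators Ru \<subseteq> {x. \<forall>i j. image_h \<phi> i j x \<in> laurent_set ?J}"
      using rel by blast
  qed
  thus ?thesis
    unfolding tau_def using x by (intro submodule_sum[OF laurent_set_submodule[OF J(1,2)]]) blast
qed

section \<open>Descent of the shifted representations\<close>

lemma at_shift:
  "at_uv b = (\<lambda>F. fps_const (incl_uv (shift_v b F)))" "at_uw b = (\<lambda>F. fps_map incl_u (shift_v b F))"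
  "at_vw b = (\<lambda>F. fps_map incl_v (shift_v b F))"
  by (rule ext, simp add: at_uv_def at_uw_def at_vw_def)+

lemma rep_at:
  "sq_map (sq_map (\<lambda>X. fps_const (incl_uv X))) (left_rep (sq_map (shift_v b) X)) = left_rep (sq_map (at_uv b) X)"
  "sq_map (sq_map (fps_map incl_u)) (left_rep (sq_map (shift_v b) X)) = left_rep (sq_map (at_uw b) X)"
  "sq_map (sq_map (\<lambda>X. fps_const (incl_uv X))) (right_rep (sq_map (shift_v b) X)) = right_rep (sq_map (at_uv b) X)"
  "sq_map (sq_map (fps_map incl_u)) (right_rep (sq_map (shift_v b) X)) = right_rep (sq_map (at_uw b) X)"
  "sq_map (sq_map (\<lambda>X. fps_const (incl_uv X))) (skew_rep (sq_map (shift_v b) X)) = skew_rep (sq_map (at_uv b) X)"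
  "sq_map (sq_map (fps_map incl_u)) (skew_rep (sq_map (shift_v b) X)) = skew_rep (sq_map (at_uw b) X)"
  by (simp_all only: rep_sq_map[symmetric] sq_map_sq_map at_shift)

lemma of_mat_map: "of_mat (map_matrix f A) = sq_map f (of_mat A)"
  by (rule sqm_eqI) (simp add: map_matrix_def)

lemma skew_matrix_map: "skew_matrix (map_matrix f A) = sq_map f (skew_matrix A)"
  by (rule sqm_eqI) (auto simp: skew_matrix_def map_matrix_def split: prod.splits)

lemma skew_rep_inverse_map:
  fixes f :: "'a::ring_1 \<Rightarrow> 's::comm_ring_1" and A :: "'a ^ ('n::finite \<times> 'n) ^ ('n \<times> 'n)"
  assumes "skew_matrix A * D = 1" "D * skew_matrix A = 1" and f: "unital_hom f"
  shows "right_rep (sq_map f (of_mat A)) * skew_rep (sq_map f D) = 1"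
    "skew_rep (sq_map f D) * right_rep (sq_map f (of_mat A)) = 1"
proof -
  have i: "skew_matrix (map_matrix f A) * sq_map f D = 1" "sq_map f D * skew_matrix (map_matrix f A) = 1"
    unfolding skew_matrix_map by (rule hom_inverse[OF sq_map_hom[OF f]], fact)+
  show "right_rep (sq_map f (of_mat A)) * skew_rep (sq_map f D) = 1"
    "skew_rep (sq_map f D) * right_rep (sq_map f (of_mat A)) = 1"
    using skew_rep_inverse[OF i] by (simp_all only: of_mat_map)
qed

lemma tau_letter_preserves_ideal:
  fixes R :: "complex fps ^ ('n::finite \<times> 'n) ^ ('n \<times> 'n)" and M :: nat and \<psi> :: "complex fps"
  assumes R: "hecke_symmetry R" "a \<noteq> 0" "Ru = additive_R R M a \<psi>" "unitary Ru"
    and D: "skew_matrix (matrix_inv Ru) * D = 1" "D * skew_matrix (matrix_inv Ru) = 1"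
    and x: "x \<in> RTT_ideal Ru"
  shows "tau (letter_T (sq_map (shift_v b) (of_mat (matrix_inv Ru))) (sq_map (shift_v b') (of_mat Ru))) I x
      \<in> laurent_set (RTT_ideal Ru)"
    and "tau (letter_S (sq_map (shift_v b') (of_mat (matrix_inv Ru))) (sq_map (shift_v b) D)) I x
      \<in> laurent_set (RTT_ideal Ru)"
proof -
  \<comment> \<open>The RTT relation involves R(v - w) without a shift, so the equation is used with
    shift 0 in v - w and with the same shift in u - v and in u - w.\<close>
  note yb = additive_R_yang_baxter[OF R(1,2), of _ M \<psi> 0, folded R(3), unfolded add_0_right]
  note yb' = additive_R_yang_baxter_inverses(2)[OF R, of 0, unfolded add_0_right]
  show "tau (letter_T (sq_map (shift_v b) (of_mat (matrix_inv Ru))) (sq_map (shift_v b') (of_mat Ru))) I x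
      \<in> laurent_set (RTT_ideal Ru)"
  proof (rule tau_preserves_ideal[where \<alpha> = "left_rep (sq_map (shift_v b) (of_mat (matrix_inv Ru)))" and
        \<beta> = "right_rep (sq_map (shift_v b') (of_mat Ru))", OF _ _ _ x])
    show "(\<forall>k l k' l'. letter_T (sq_map (shift_v b) (of_mat (matrix_inv Ru))) (sq_map (shift_v b') (of_mat Ru)) k l k' l' =
        leg1 (sq (left_rep (sq_map (shift_v b) (of_mat (matrix_inv Ru)))) k k') * leg2 (sq (right_rep (sq_map (shift_v b') (of_mat Ru))) l' l)) \<or>
       (\<forall>k l k' l'. letter_T (sq_map (shift_v b) (of_mat (matrix_inv Ru))) (sq_map (shift_v b') (of_mat Ru)) k l k' l' =
        leg2 (sq (left_rep (sq_map (shift_v b) (of_mat (matrix_inv Ru)))) k k') * leg1 (sq (right_rep (sq_map (shift_v b') (of_mat Ru))) l' l))"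
      by (intro disjI1 allI sqm_eqI)
        (auto simp: letter_T_def left_rep_def right_rep_def sq_leg1_leg2 split: prod.splits)
  qed (unfold rep_at, rule rtt_left_rep[OF yb'], rule rtt_right_rep[OF yb])
  show "tau (letter_S (sq_map (shift_v b') (of_mat (matrix_inv Ru))) (sq_map (shift_v b) D)) I x
      \<in> laurent_set (RTT_ideal Ru)"
  proof (rule tau_preserves_ideal[where \<alpha> = "skew_rep (sq_map (shift_v b) D)" and
        \<beta> = "left_rep (sq_map (shift_v b') (of_mat (matrix_inv Ru)))", OF _ _ _ x])
    show "(\<forall>k l k' l'. letter_S (sq_map (shift_v b') (of_mat (matrix_inv Ru))) (sq_map (shift_v b) D) k l k' l' =
        leg1 (sq (skew_rep (sq_map (shift_v b) D)) k k') * leg2 (sq (left_rep (sq_map (shift_v b') (of_mat (matrix_inv Ru)))) l' l)) \<or>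
       (\<forall>k l k' l'. letter_S (sq_map (shift_v b') (of_mat (matrix_inv Ru))) (sq_map (shift_v b) D) k l k' l' =
        leg2 (sq (skew_rep (sq_map (shift_v b) D)) k k') * leg1 (sq (left_rep (sq_map (shift_v b') (of_mat (matrix_inv Ru)))) l' l))"
      by (intro disjI2 allI sqm_eqI)
        (auto simp: letter_S_def left_rep_def skew_rep_def sq_leg2_leg1 mult.commute split: prod.splits)
  qed (unfold rep_at, rule rtt_skew_rep[OF yb'], (rule skew_rep_inverse_map[OF D] at_hom)+, rule rtt_left_rep[OF yb'])
qed

subsection \<open>Relations between the operators\<close>

lemma quotient_tau_cls:
  assumes "\<And>I x. x \<in> RTT_ideal Ru \<Longrightarrow> tau \<phi> I x \<in> laurent_set (RTT_ideal Ru)"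
  shows "quotient_op Ru (tau \<phi>) i j (cls Ru x) r = cls Ru (u_coeff r (tau \<phi> (i, j) x))"
  by (rule quotient_op_cls[OF tau_additive assms])

lemma quotient_tau_opmats:
  assumes "\<And>I x. x \<in> RTT_ideal Ru \<Longrightarrow> tau \<phi> I x \<in> laurent_set (RTT_ideal Ru)"
  shows "quotient_op Ru (tau \<phi>) \<in> opmats (RTT_algebra Ru)"
  by (rule quotient_op_opmats[OF tau_additive assms tau_scal])

lemma product_is_identity_quotient:
  fixes \<phi> \<phi>' :: "'n::finite \<Rightarrow> 'n \<Rightarrow> 'n \<Rightarrow> 'n \<Rightarrow> ('n \<times> 'n, complex fls fps fps) sqm"
  assumes pres: "\<And>I x. x \<in> RTT_ideal Ru \<Longrightarrow> tau \<phi> I x \<in> laurent_set (RTT_ideal Ru)"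
      "\<And>I x. x \<in> RTT_ideal Ru \<Longrightarrow> tau \<phi>' I x \<in> laurent_set (RTT_ideal Ru)"
    and K: "\<And>i j (w :: ('n \<times> 'n \<times> nat) list) w''. (\<Sum>p\<in>UNIV. \<Sum>w'\<in>below w. word_kernel \<phi> delta w' w'' (i, p) *
      word_kernel \<phi>' delta w w' (p, j)) = (if w = w'' \<and> i = j then 1 else 0)"
  shows "product_is_identity (RTT_algebra Ru) (quotient_op Ru (tau \<phi>)) (quotient_op Ru (tau \<phi>'))"
  unfolding product_is_identity_def
proof (intro allI ballI)
  fix i j :: 'n and r y assume "y \<in> carrier (RTT_algebra Ru)"
  then obtain x where y: "y = cls Ru x" by (auto simp: RTT_algebra_carrier)
  have 1: "identity_series (RTT_algebra Ru) i j y r = cls Ru (if i = j \<and> r = 0 then x else 0)"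
    by (simp add: identity_series_def y RTT_algebra_zero)
  have 2: "(\<lambda>(p, s). quotient_op Ru (tau \<phi>) i p (quotient_op Ru (tau \<phi>') p j y (r - s)) s) =
      (\<lambda>ps. cls Ru ((\<lambda>(p, s). u_coeff s (tau \<phi> (i, p) (u_coeff (r - s) (tau \<phi>' (p, j) x)))) ps))"
    by (rule ext) (simp add: y quotient_tau_cls[OF pres(1)] quotient_tau_cls[OF pres(2)] split: prod.split)
  show "has_hsum (RTT_algebra Ru)
      (\<lambda>(p, s). quotient_op Ru (tau \<phi>) i p (quotient_op Ru (tau \<phi>') p j y (r - s)) s) UNIV
      (identity_series (RTT_algebra Ru) i j y r)"
    unfolding 1 2 by (rule has_hsum_cls[OF hsum_tau_tau_identity[OF K]])
qed

lemma sq_map_letter_T: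
  fixes f :: "'s::comm_ring_1 \<Rightarrow> 't::comm_ring_1"
  shows "unital_hom f \<Longrightarrow> sq_map f (letter_T A B k l k' l') = letter_T (sq_map f A) (sq_map f B) k l k' l'"
  by (rule sqm_eqI) (auto simp: letter_T_def unital_hom_mult split: prod.splits)

lemma kernel_letter_T_map:
  fixes f :: "'s::comm_ring_1 \<Rightarrow> 't::comm_ring_1" and A B :: "('n::finite \<times> 'n, 's fps) sqm"
  assumes f: "unital_hom f"
  shows "f (word_kernel (letter_T A B) delta w w' I) =
    word_kernel (letter_T (sq_map (fps_map f) A) (sq_map (fps_map f) B)) delta w w' I"
proof -
  have "(\<lambda>i :: 'n \<times> 'n. f (delta i)) = delta"
    by (rule ext) (simp add: delta_def unital_hom_one[OF f] unital_hom_zero[OF f] split: prod.split)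
  thus ?thesis
    unfolding kernel_map[OF f] sq_map_letter_T[OF fps_map_hom[OF f]] by simp
qed

text \<open>Here u and v are the parameters of the two operators and w is the variable of a letter.
  Both operators carry the same shifts relative to w, which is compatible with shift 0 in u -
  v.\<close>

lemma RTT_identity_T_T:
  fixes R :: "complex fps ^ ('n::finite \<times> 'n) ^ ('n \<times> 'n)" and M :: nat and \<psi> :: "complex fps" and b b' :: complex
  assumes R: "hecke_symmetry R" "a \<noteq> 0" "Ru = additive_R R M a \<psi>" "unitary Ru"
  defines "\<phi> \<equiv> letter_T (sq_map (shift_v b) (of_mat (matrix_inv Ru))) (sq_map (shift_v b') (of_mat Ru))"
  assumes pres: "\<And>I x. x \<in> RTT_ideal Ru \<Longrightarrow> tau \<phi> I x \<in> laurent_set (RTT_ideal Ru)"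
  shows "RTT_identity (RTT_algebra Ru) Ru 0 0 (quotient_op Ru (tau \<phi>)) (quotient_op Ru (tau \<phi>))"
proof -
  note q = quotient_tau_cls[OF pres]
  note yb = additive_R_yang_baxter[OF R(1,2), of 0 M \<psi>, folded R(3), unfolded add_0_left]
  note yb' = additive_R_yang_baxter_inverses(1)[OF R, of 0, unfolded add_0_left]
  let ?r = "of_mat Ru" and ?r' = "of_mat (matrix_inv Ru)"
  have uw: "sq_map (fps_map incl_u) (sq_map (shift_v e) X) = sq_map (at_uw e) X"
    "sq_map (fps_map incl_v) (sq_map (shift_v e) X) = sq_map (at_vw e) X" for e and X :: "('n \<times> 'n, complex fls fps) sqm"
    by (simp_all only: sq_map_sq_map at_shift)
  have uv: "sq_map (at_uv 0) ?r = sq_map fps_const (sq_map (\<lambda>F. incl_uv (shift_v 0 F)) ?r)"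
    by (simp only: sq_map_sq_map at_shift)
  have K: "(\<Sum>p\<in>UNIV. \<Sum>q\<in>UNIV. incl_uv (shift_v 0 (Ru $ (i, j) $ (p, q))) *
      (\<Sum>w'\<in>below w. incl_u (word_kernel \<phi> delta w' w'' (p, k)) * incl_v (word_kernel \<phi> delta w w' (q, l)))) =
    (\<Sum>p\<in>UNIV. \<Sum>q\<in>UNIV. incl_uv (shift_v 0 (Ru $ (p, q) $ (k, l))) *
      (\<Sum>w'\<in>below w. incl_v (word_kernel \<phi> delta w' w'' (j, q)) * incl_u (word_kernel \<phi> delta w w' (i, p))))"
    for w w'' :: "('n \<times> 'n \<times> nat) list" and i j k l
    using kernel_T_T[OF uv yb'[of b] yb[of b'], where i = i and j = j and k = k and l = l and w = w and w'' = w'']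
    unfolding \<phi>_def kernel_letter_T_map[OF incl_u_hom] kernel_letter_T_map[OF incl_v_hom] uw sq_sq_map sq_of_mat .
  show ?thesis
    unfolding RTT_identity_def
  proof (intro allI ballI)
    fix i j k l :: 'n and r s y assume "y \<in> carrier (RTT_algebra Ru)"
    then obtain x where y: "y = cls Ru x" by (auto simp: RTT_algebra_carrier)
    obtain z where z: "hsum (\<lambda>(p, q, r', s'). scal_h (u_coeff r' (subst_coeff 0 s' (Ru $ (i, j) $ (p, q)))) *
        u_coeff (r - r') (tau \<phi> (p, k) (u_coeff (s - int s') (tau \<phi> (q, l) x)))) z"
     "hsum (\<lambda>(p, q, r', s'). scal_h (u_coeff r' (subst_coeff 0 s' (Ru $ (p, q) $ (k, l)))) *
        u_coeff (s - int s') (tau \<phi> (j, q) (u_coeff (r - r') (tau \<phi> (i, p) x)))) z"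
      using hsum_RTT_T_T[OF K, where r = r and s = s and x = x] by blast
    show "\<exists>z. has_hsum (RTT_algebra Ru) (\<lambda>(p, q, r', s'). u_coeff r' (subst_coeff 0 s' (Ru $ (i, j) $ (p, q))) \<odot>\<^bsub>RTT_algebra Ru\<^esub>
          quotient_op Ru (tau \<phi>) p k (quotient_op Ru (tau \<phi>) q l y (s - int s')) (r - r')) UNIV z \<and>
       has_hsum (RTT_algebra Ru) (\<lambda>(p, q, r', s'). u_coeff r' (subst_coeff 0 s' (Ru $ (p, q) $ (k, l))) \<odot>\<^bsub>RTT_algebra Ru\<^esub>
          quotient_op Ru (tau \<phi>) j q (quotient_op Ru (tau \<phi>) i p y (r - r')) (s - int s')) UNIV z"
      using has_hsum_cls[OF z(1), of Ru] has_hsum_cls[OF z(2), of Ru]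
      by (intro exI[of _ "cls Ru z"]) (simp add: y q case_prod_unfold)
  qed
qed

text \<open>The generating series has no negative powers of its variable, so finitely many powers
  \<open>s'\<close> contribute and the sum is a coefficient of an ordinary power series
  product.\<close>

lemma hsum_uw:
  fixes E :: "'n::finite \<Rightarrow> 'n \<Rightarrow> complex fls fps" and G :: "'n \<Rightarrow> 'n \<Rightarrow> nat \<Rightarrow> 'n falg fls fps"
  shows "hsum (\<lambda>(p, q, r', s'). scal_h (u_coeff r' (subst_coeff b s' (E p q))) *
      (if s - int s' < 0 then 0 else u_coeff (r - r') (G p q (nat (s - int s')))))
    (if s < 0 then 0 else
      u_coeff r (fps_nth (\<Sum>p\<in>UNIV. \<Sum>q\<in>UNIV. fps_map scal_uh (shift_v b (E p q)) * Abs_fps (G p q)) (nat s)))"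
proof -
  let ?f = "\<lambda>(p, q, r', s'). scal_h (u_coeff r' (subst_coeff b s' (E p q))) *
      (if s - int s' < 0 then 0 else u_coeff (r - r') (G p q (nat (s - int s'))))"
  let ?z = "\<lambda>p q. \<Sum>s'\<in>{s'. int s' \<le> s}. u_coeff r (scal_uh (subst_coeff b s' (E p q)) * G p q (nat (s - int s')))"
  have fin: "finite {s'. int s' \<le> s}"
    by (rule finite_subset[of _ "{..nat s}"]) auto
  have h1: "hsum (\<lambda>i. ?f (p, q, i)) (?z p q)" for p q
  \<comment> \<open>The summation indices are interchanged so that the one with finite range comes
    first.\<close>
  proof (rule hsum_bij[of prod.swap])
    show "hsum (\<lambda>i. ?f (p, q, prod.swap i)) (?z p q)"
    proof (rule hsum_pair[OF fin])
      fix s' assume "s' \<in> {s'. int s' \<le> s}"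
      thus "hsum (\<lambda>r'. ?f (p, q, prod.swap (s', r'))) (u_coeff r (scal_uh (subst_coeff b s' (E p q)) * G p q (nat (s - int s'))))"
        using hsum_u[of "scal_uh (subst_coeff b s' (E p q))" r "G p q (nat (s - int s'))"]
        by (simp add: u_coeff_scal_uh)
    qed simp
  qed simp
  have h2: "hsum (\<lambda>i. ?f (p, i)) (\<Sum>q\<in>UNIV. ?z p q)" for p
    by (rule hsum_pair[where z = "?z p"]) (simp, simp, rule h1)
  have h3: "hsum ?f (\<Sum>p\<in>UNIV. \<Sum>q\<in>UNIV. ?z p q)"
    by (rule hsum_pair[where z = "\<lambda>p. \<Sum>q\<in>UNIV. ?z p q"]) (simp, simp, rule h2)
  have z: "?z p q = (if s < 0 then 0 else u_coeff r (fps_nth (fps_map scal_uh (shift_v b (E p q)) * Abs_fps (G p q)) (nat s)))" for p q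
  proof (cases "s < 0")
    case True
    hence "{s'. int s' \<le> s} = {}" by auto
    thus ?thesis using True by simp
  next
    case False
    hence "{s'. int s' \<le> s} = {0..nat s}" by auto
    moreover have "nat (s - int s') = nat s - s'" for s' by simp
    ultimately show ?thesis using False
      by (simp add: fps_mult_nth u_coeff_sum_fps shift_v_nth)
  qed
  have e: "(if s < 0 then 0 else u_coeff r (fps_nth (\<Sum>p\<in>UNIV. \<Sum>q\<in>UNIV. fps_map scal_uh (shift_v b (E p q)) *
      Abs_fps (G p q)) (nat s))) = (\<Sum>p\<in>UNIV. \<Sum>q\<in>UNIV. ?z p q)"
    unfolding z by (simp add: u_coeff_sum_fps fps_sum_nth)
  show ?thesis unfolding e by (rule h3)
qed

lemma tau_gen_series:
  fixes \<phi> :: "'n::finite \<Rightarrow> 'n \<Rightarrow> 'n \<Rightarrow> 'n \<Rightarrow> ('n \<times> 'n, complex fls fps fps) sqm"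
  shows "Abs_fps (\<lambda>n. tau \<phi> I (fps_const (tgen k l n) * x)) = (\<Sum>J\<in>UNIV. \<Sum>k'\<in>UNIV. \<Sum>l'\<in>UNIV.
     fps_map scal_uh (sq (\<phi> k l k' l') I J) * gen_w k' l' * fps_const (tau \<phi> J x))"
proof (rule fps_ext)
  fix n
  have c: "fps_nth (fps_map scal_uh X * gen_w k' l') n = (\<Sum>m\<le>n. scal_uh (fps_nth X (n - m)) * embed_u (tgen k' l' m))"
    for X and k' l' :: 'n
    unfolding fps_mult_nth by (rule sum.reindex_bij_witness[of _ "\<lambda>m. n - m" "\<lambda>m. n - m"]) (auto simp: gen_w_def)
  show "fps_nth (Abs_fps (\<lambda>n. tau \<phi> I (fps_const (tgen k l n) * x))) n = fps_nth (\<Sum>J\<in>UNIV. \<Sum>k'\<in>UNIV. \<Sum>l'\<in>UNIV.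
     fps_map scal_uh (sq (\<phi> k l k' l') I J) * gen_w k' l' * fps_const (tau \<phi> J x)) n"
    by (simp add: tau_gen fps_sum_nth c sum_distrib_right)
qed

text \<open>On T^+(v) x the leading letter contributes R(u - v + b h)^(-1) on the left and R(u - v +
  b' h) on the right. Multiplication by R(u - v + b h) removes the former, and the rest is the other
  side of the relation.\<close>

lemma RTT_T_plus_series:
  fixes Ru Ri :: "complex fls fps ^ ('n::finite \<times> 'n) ^ ('n \<times> 'n)" and b b' :: complex
  assumes inv: "of_mat Ru * of_mat Ri = 1"
  defines "\<phi> \<equiv> letter_T (sq_map (shift_v b) (of_mat Ri)) (sq_map (shift_v b') (of_mat Ru))"
  shows "(\<Sum>p\<in>UNIV. \<Sum>q\<in>UNIV. fps_map scal_uh (shift_v b (Ru $ (i, j) $ (p, q))) *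
        Abs_fps (\<lambda>n. tau \<phi> (p, k) (fps_const (tgen q l n) * x))) =
    (\<Sum>p\<in>UNIV. \<Sum>q\<in>UNIV. fps_map scal_uh (shift_v b' (Ru $ (p, q) $ (k, l))) *
        Abs_fps (\<lambda>n. embed_u (tgen j q n) * tau \<phi> (i, p) x))"
proof -
  let ?S = "fps_map scal_uh :: _ \<Rightarrow> 'n falg fls fps fps"
  have S: "unital_hom ?S" by (rule fps_map_hom[OF scal_uh_hom])
  define W where "W = (\<lambda>J k' l'. ?S (shift_v b' (Ru $ (snd J, l') $ (k, l))) * (gen_w k' l' * fps_const (tau \<phi> J x)))"
  have gen: "Abs_fps (\<lambda>n. tau \<phi> (p, k) (fps_const (tgen q l n) * x)) = (\<Sum>J\<in>UNIV. \<Sum>k'\<in>UNIV. \<Sum>l'\<in>UNIV.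
      ?S (shift_v b (Ri $ (p, q) $ (fst J, k'))) * W J k' l')" for p q
    unfolding tau_gen_series W_def
    by (intro sum.cong refl) (simp add: \<phi>_def letter_T_def unital_hom_mult[OF S] mult.assoc split: prod.split)
  have unit: "(\<Sum>P\<in>UNIV. shift_v b (Ru $ (i, j) $ P) * shift_v b (Ri $ P $ Q)) = (if (i, j) = Q then 1 else 0)" for Q
  proof -
    have "sq_map (shift_v b) (of_mat Ru) * sq_map (shift_v b) (of_mat Ri) = 1"
      by (rule hom_inverse[OF sq_map_hom[OF shift_v_hom] inv])
    hence "sq (sq_map (shift_v b) (of_mat Ru) * sq_map (shift_v b) (of_mat Ri)) (i, j) Q = sq 1 (i, j) Q" by simp
    thus ?thesis by (simp only: sq_times sq_sq_map sq_of_mat sq_one)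
  qed
  have swap: "(\<Sum>P\<in>UNIV. \<Sum>J\<in>UNIV. \<Sum>k'\<in>UNIV. \<Sum>l'\<in>UNIV. f P J k' l') =
      (\<Sum>J\<in>UNIV. \<Sum>k'\<in>UNIV. \<Sum>l'\<in>UNIV. \<Sum>P\<in>UNIV. f P J k' l')"
    for f :: "'n \<times> 'n \<Rightarrow> 'n \<times> 'n \<Rightarrow> 'n \<Rightarrow> 'n \<Rightarrow> 'n falg fls fps fps"
    by (subst sum.swap, rule sum.cong[OF refl], subst sum.swap, rule sum.cong[OF refl], rule sum.swap)
  have "(\<Sum>p\<in>UNIV. \<Sum>q\<in>UNIV. ?S (shift_v b (Ru $ (i, j) $ (p, q))) *
        Abs_fps (\<lambda>n. tau \<phi> (p, k) (fps_const (tgen q l n) * x))) =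
      (\<Sum>P\<in>UNIV. \<Sum>J\<in>UNIV. \<Sum>k'\<in>UNIV. \<Sum>l'\<in>UNIV. ?S (shift_v b (Ru $ (i, j) $ P) * shift_v b (Ri $ P $ (fst J, k'))) * W J k' l')"
    unfolding gen sum_UNIV_prod[of "\<lambda>P. \<Sum>J\<in>UNIV. _ P J"] by (simp only: sum_distrib_left unital_hom_mult[OF S] mult.assoc)
  also have "\<dots> = (\<Sum>J\<in>UNIV. \<Sum>k'\<in>UNIV. \<Sum>l'\<in>UNIV. if i = fst J then if j = k' then W J k' l' else 0 else 0)"
    unfolding swap
  proof (intro sum.cong refl)
    fix J k' l'
    have "(\<Sum>P\<in>UNIV. ?S (shift_v b (Ru $ (i, j) $ P) * shift_v b (Ri $ P $ (fst J, k'))) * W J k' l') =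
        ?S (if (i, j) = (fst J, k') then 1 else 0) * W J k' l'"
      unfolding sum_distrib_right[symmetric] unital_hom_sum[OF S, symmetric] unit ..
    thus "(\<Sum>P\<in>UNIV. ?S (shift_v b (Ru $ (i, j) $ P) * shift_v b (Ri $ P $ (fst J, k'))) * W J k' l') =
        (if i = fst J then if j = k' then W J k' l' else 0 else 0)"
      by (simp add: unital_hom_one[OF S] unital_hom_zero[OF S])
  qed
  also have "\<dots> = (\<Sum>q\<in>UNIV. \<Sum>l'\<in>UNIV. W (i, q) j l')"
    by (simp add: sum_UNIV_prod sum_if_const)
  also have "\<dots> = (\<Sum>p\<in>UNIV. \<Sum>q\<in>UNIV. ?S (shift_v b' (Ru $ (p, q) $ (k, l))) * Abs_fps (\<lambda>n. embed_u (tgen j q n) * tau \<phi> (i, p) x))"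
  proof -
    have "gen_w j q * fps_const (tau \<phi> (i, p) x) = Abs_fps (\<lambda>n. embed_u (tgen j q n) * tau \<phi> (i, p) x)" for p q
      by (rule fps_ext) (simp add: gen_w_def)
    thus ?thesis by (simp add: W_def)
  qed
  finally show ?thesis .
qed

lemma RTT_identity_T_plus:
  fixes Ru Ri :: "complex fls fps ^ ('n::finite \<times> 'n) ^ ('n \<times> 'n)" and b b' :: complex
  assumes inv: "of_mat Ru * of_mat Ri = 1"
  defines "\<phi> \<equiv> letter_T (sq_map (shift_v b) (of_mat Ri)) (sq_map (shift_v b') (of_mat Ru))"
  assumes pres: "\<And>I x. x \<in> RTT_ideal Ru \<Longrightarrow> tau \<phi> I x \<in> laurent_set (RTT_ideal Ru)"
  shows "RTT_identity (RTT_algebra Ru) Ru b b' (quotient_op Ru (tau \<phi>)) (Tplus_op Ru)"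
  unfolding RTT_identity_def
proof (intro allI ballI)
  note q = quotient_tau_cls[OF pres]
  fix i j k l :: 'n and r s y assume "y \<in> carrier (RTT_algebra Ru)"
  then obtain x where y: "y = cls Ru x" by (auto simp: RTT_algebra_carrier)
  have u0: "u_coeff r' (tau \<phi> I 0) = 0" for r' I
    by (simp add: Modules.additive.zero[OF tau_additive] Modules.additive.zero[OF u_coeff_additive])
  have Tp: "Tplus_op Ru k' l' (cls Ru x') s' = cls Ru (if s' < 0 then 0 else fps_const (tgen k' l' (nat s')) * x')"
    for k' l' x' s' by (simp add: Tplus_op_def RTT_algebra_zero)
  let ?G = "\<lambda>p q n. tau \<phi> (p, k) (fps_const (tgen q l n) * x)" and ?G' = "\<lambda>p q n. embed_u (tgen j q n) * tau \<phi> (i, p) x"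
  let ?z = "if s < 0 then 0 else u_coeff r (fps_nth (\<Sum>p\<in>UNIV. \<Sum>q\<in>UNIV. fps_map scal_uh (shift_v b' (Ru $ (p, q) $ (k, l))) *
        Abs_fps (?G' p q)) (nat s))"
  have z1: "hsum (\<lambda>(p, q, r', s'). scal_h (u_coeff r' (subst_coeff b s' (Ru $ (i, j) $ (p, q)))) *
      (if s - int s' < 0 then 0 else u_coeff (r - r') (?G p q (nat (s - int s'))))) ?z"
    using hsum_uw[of b "\<lambda>p q. Ru $ (i, j) $ (p, q)" s r ?G]
    unfolding \<phi>_def RTT_T_plus_series[OF inv] .
  have z2: "hsum (\<lambda>(p, q, r', s'). scal_h (u_coeff r' (subst_coeff b' s' (Ru $ (p, q) $ (k, l)))) *
      (if s - int s' < 0 then 0 else u_coeff (r - r') (?G' p q (nat (s - int s'))))) ?z"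
    by (rule hsum_uw)
  have e1: "(\<lambda>(p, q, r', s'). u_coeff r' (subst_coeff b s' (Ru $ (i, j) $ (p, q))) \<odot>\<^bsub>RTT_algebra Ru\<^esub>
        quotient_op Ru (tau \<phi>) p k (Tplus_op Ru q l y (s - int s')) (r - r')) =
      (\<lambda>t. cls Ru ((\<lambda>(p, q, r', s'). scal_h (u_coeff r' (subst_coeff b s' (Ru $ (i, j) $ (p, q)))) *
      (if s - int s' < 0 then 0 else u_coeff (r - r') (?G p q (nat (s - int s'))))) t))"
    by (rule ext) (simp add: y Tp q u0 split: prod.split)
  have e2: "(\<lambda>(p, q, r', s'). u_coeff r' (subst_coeff b' s' (Ru $ (p, q) $ (k, l))) \<odot>\<^bsub>RTT_algebra Ru\<^esub>
        Tplus_op Ru j q (quotient_op Ru (tau \<phi>) i p y (r - r')) (s - int s')) =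
      (\<lambda>t. cls Ru ((\<lambda>(p, q, r', s'). scal_h (u_coeff r' (subst_coeff b' s' (Ru $ (p, q) $ (k, l)))) *
      (if s - int s' < 0 then 0 else u_coeff (r - r') (?G' p q (nat (s - int s'))))) t))"
    by (rule ext) (simp add: y Tp q u_coeff_embed_mult split: prod.split)
  show "\<exists>z. has_hsum (RTT_algebra Ru) (\<lambda>(p, q, r', s'). u_coeff r' (subst_coeff b s' (Ru $ (i, j) $ (p, q))) \<odot>\<^bsub>RTT_algebra Ru\<^esub>
        quotient_op Ru (tau \<phi>) p k (Tplus_op Ru q l y (s - int s')) (r - r')) UNIV z \<and>
     has_hsum (RTT_algebra Ru) (\<lambda>(p, q, r', s'). u_coeff r' (subst_coeff b' s' (Ru $ (p, q) $ (k, l))) \<odot>\<^bsub>RTT_algebra Ru\<^esub>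
        Tplus_op Ru j q (quotient_op Ru (tau \<phi>) i p y (r - r')) (s - int s')) UNIV z"
    unfolding e1 e2 using has_hsum_cls[OF z1] has_hsum_cls[OF z2] by blast
qed

subsection \<open>Existence and uniqueness\<close>

definition Tminus_letter :: "complex fls fps ^ ('n::finite \<times> 'n) ^ ('n \<times> 'n) \<Rightarrow> complex
    \<Rightarrow> 'n \<Rightarrow> 'n \<Rightarrow> 'n \<Rightarrow> 'n \<Rightarrow> ('n \<times> 'n, complex fls fps fps) sqm" where
  "Tminus_letter Ru c =
     letter_T (sq_map (shift_v (c / 2)) (of_mat (matrix_inv Ru))) (sq_map (shift_v (- c / 2)) (of_mat Ru))"

lemma u_coeff_tau_one: "u_coeff r (tau \<phi> (i, j) 1) = (if i = j \<and> r = 0 then 1 else 0)"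
  by (rule fps_ext) (simp add: tau_one)

text \<open>The empty word is covered by the normalisation on the unit; a nonempty word is one
  coefficient of the generating series in as many variables as it has letters.\<close>

lemma Tminus_word:
  fixes Ru :: "complex fls fps ^ ('n::finite \<times> 'n) ^ ('n \<times> 'n)" and w :: "('n \<times> 'n \<times> nat) list"
  assumes T: "is_Tminus Ru c T"
  shows "T i j (cls Ru (fps_const (monom_word w))) r =
    cls Ru (u_coeff r (tau (Tminus_letter Ru c) (i, j) (fps_const (monom_word w))))"
proof (cases "w = []")
  case True
  have "T i j (cls Ru 1) r = identity_series (RTT_algebra Ru) i j (cls Ru 1) r"
    using T by (simp add: is_Tminus_def RTT_algebra_one)
  thus ?thesis
    by (simp add: True monom_word_Nil identity_series_def RTT_algebra_zero u_coeff_tau_one)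
next
  case False
  define n where "n = length w"
  \<comment> \<open>Tensor factor t carries letter t - 1 of \<open>w\<close> and factor 0 the
    auxiliary indices. The multiset \<open>m\<close> records the modes as exponents, so that the
    coefficient selected is exactly \<open>w\<close>.\<close>
  define \<alpha> where "\<alpha> = restrict (\<lambda>t. if t = 0 then i else fst (w ! (t - 1))) {0..n}"
  define \<beta> where "\<beta> = restrict (\<lambda>t. if t = 0 then j else fst (snd (w ! (t - 1)))) {0..n}"
  define m where "m = (\<Sum>t\<in>{1..n}. replicate_mset (snd (snd (w ! (t - 1)))) t)"
  have \<alpha>\<beta>: "\<alpha> \<in> multi {0..n}" "\<beta> \<in> multi {0..n}" by (simp_all add: \<alpha>_def \<beta>_def multi_def)
  have count: "count m t = (if t \<in> {1..n} then snd (snd (w ! (t - 1))) else 0)" for t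
    by (simp add: m_def count_sum)
  have m: "set_mset m \<subseteq> {1..n}"
  proof
    fix t assume "t \<in># m"
    hence "count m t > 0" by simp
    thus "t \<in> {1..n}" unfolding count by (auto split: if_splits)
  qed
  have "letters_word \<alpha> \<beta> m [1..<Suc n] = w"
    by (rule nth_equalityI) (simp_all add: letters_word_def n_def[symmetric] \<alpha>_def \<beta>_def count nth_upt del: upt_Suc)
  hence w: "mps_nth (Tplus_product n (restrict \<alpha> {1..n}) (restrict \<beta> {1..n})) m = fps_const (monom_word w)"
    using m by (simp only: Tplus_product_nth if_True)
  have "n \<ge> 1" using False by (cases w) (simp_all add: n_def)
  hence "Tminus_formula Ru c n T" using T by (simp add: is_Tminus_def)
  hence "T (\<alpha> 0) (\<beta> 0) (cls Ru (fps_const (monom_word w))) r =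
      cls Ru (u_coeff r (tau (Tminus_letter Ru c) (\<alpha> 0, \<beta> 0) (fps_const (monom_word w))))"
    unfolding Tminus_formula_def Tminus_letter_def w[symmetric] Tminus_rhs_nth[OF \<alpha>\<beta>, symmetric]
    using \<alpha>\<beta> by blast
  thus ?thesis by (simp add: \<alpha>_def \<beta>_def)
qed

text \<open>Linearity over C[[h]] sends multiples of h^k to multiples of h^k and so takes the place
  of continuity. Agreement on words extends to agreement modulo every power of h, and closedness of
  the ideal removes the error.\<close>

lemma Tminus_cls:
  fixes Ru :: "complex fls fps ^ ('n::finite \<times> 'n) ^ ('n \<times> 'n)"
  assumes T: "is_Tminus Ru c T"
  shows "T i j (cls Ru x) r = cls Ru (u_coeff r (tau (Tminus_letter Ru c) (i, j) x))"
proof -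
  define \<sigma> where "\<sigma> = (\<lambda>x. u_coeff r (tau (Tminus_letter Ru c) (i, j) x))"
  have \<sigma>: "\<sigma> (u + v) = \<sigma> u + \<sigma> v" "\<sigma> (scal_h s * u) = scal_h s * \<sigma> u" for u v s
    by (simp_all add: \<sigma>_def Modules.additive.add[OF tau_additive] Modules.additive.add[OF u_coeff_additive] tau_scal
        u_coeff_scal_mult)
  have hom: "T i j \<in> hom_laurent (RTT_algebra Ru)" using T by (simp add: is_Tminus_def opmats_def)
  have add: "T i j (cls Ru (u + v)) r = T i j (cls Ru u) r \<oplus>\<^bsub>RTT_algebra Ru\<^esub> T i j (cls Ru v) r"
    and scal: "T i j (cls Ru (scal_h s * u)) r = s \<odot>\<^bsub>RTT_algebra Ru\<^esub> T i j (cls Ru u) r"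
    and closed: "T i j (cls Ru u) r \<in> carrier (RTT_algebra Ru)" for u v s
    using hom by (auto simp: hom_laurent_def laurent_h_def simp flip: RTT_algebra_cls(3,4))
  define P where "P = (\<lambda>x. T i j (cls Ru x) r = cls Ru (\<sigma> x))"
  have P: "P (u + v)" if "P u" "P v" for u v
    using that by (simp add: P_def add \<sigma>)
  have Ps: "P (scal_h s * u)" if "P u" for s u
    using that by (simp add: P_def scal \<sigma>)
  have Pw: "P (fps_const (monom_word w))" for w
    by (simp add: P_def \<sigma>_def Tminus_word[OF T])
  have P0: "P 0"
    using Ps[OF Pw[of "[]"], of 0] by (simp add: unital_hom_zero[OF scal_h_hom])
  obtain z where z: "T i j (cls Ru x) r = cls Ru z" using closed[of x] by (auto simp: RTT_algebra_carrier)
  have "z - \<sigma> x \<in> RTT_ideal Ru"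
  proof (rule h_closedD[OF RTT_ideal_properties(1)])
    fix k
    obtain t where t: "P t" "x = t + scal_h (fps_X ^ Suc k) * fps_shift (Suc k) x"
      by (rule words_dense[of P, OF P0 P Ps Pw])
    obtain z' where z': "T i j (cls Ru (fps_shift (Suc k) x)) r = cls Ru z'"
      using closed[of "fps_shift (Suc k) x"] by (auto simp: RTT_algebra_carrier)
    have "T i j (cls Ru (t + scal_h (fps_X ^ Suc k) * fps_shift (Suc k) x)) r = cls Ru (\<sigma> t + scal_h (fps_X ^ Suc k) * z')"
      unfolding add scal z' t(1)[unfolded P_def] by simp
    hence "cls Ru z = cls Ru (\<sigma> t + scal_h (fps_X ^ Suc k) * z')" unfolding t(2)[symmetric] z .
    moreover have "\<sigma> x = \<sigma> t + scal_h (fps_X ^ Suc k) * \<sigma> (fps_shift (Suc k) x)"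
      using \<sigma>(1)[of t "scal_h (fps_X ^ Suc k) * fps_shift (Suc k) x"]
      unfolding t(2)[symmetric] \<sigma>(2) .
    moreover have "fps_nth (scal_h (fps_X ^ Suc k) * u) j = 0" if "j \<le> k" for u :: "'n falg fps" and j
      using that unfolding scal_h_X fps_X_power_mult_nth by simp
    ultimately show "\<exists>y\<in>RTT_ideal Ru. \<forall>j\<le>k. fps_nth (z - \<sigma> x) j = fps_nth y j"
      by (intro bexI[of _ "z - (\<sigma> t + scal_h (fps_X ^ Suc k) * z')"]) (auto simp: cls_eq_iff)
  qed
  thus ?thesis unfolding z \<sigma>_def by (simp add: cls_eq_iff)
qed

lemma Tminus_unique:
  fixes Ru :: "complex fls fps ^ ('n::finite \<times> 'n) ^ ('n \<times> 'n)"
  assumes T: "is_Tminus Ru c T" "is_Tminus Ru c T'"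
  shows "T = T'"
proof (intro ext)
  fix i j y r
  have e: "T i j \<in> extensional (carrier (RTT_algebra Ru))" "T' i j \<in> extensional (carrier (RTT_algebra Ru))"
    using T by (auto simp: is_Tminus_def opmats_def hom_laurent_def PiE_def)
  show "T i j y r = T' i j y r"
  proof (cases "y \<in> carrier (RTT_algebra Ru)")
    case True
    then obtain x where "y = cls Ru x" by (auto simp: RTT_algebra_carrier)
    thus ?thesis by (simp only: Tminus_cls[OF T(1)] Tminus_cls[OF T(2)])
  next
    case False
    show ?thesis unfolding extensional_arb[OF e(1) False] extensional_arb[OF e(2) False] ..
  qed
qed

lemma Tminus_exists:
  fixes Ru :: "complex fls fps ^ ('n::finite \<times> 'n) ^ ('n \<times> 'n)"
  assumes pres: "\<And>I x. x \<in> RTT_ideal Ru \<Longrightarrow> tau (Tminus_letter Ru c) I x \<in> laurent_set (RTT_ideal Ru)"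
  shows "is_Tminus Ru c (quotient_op Ru (tau (Tminus_letter Ru c)))"
proof -
  note q = quotient_tau_cls[OF pres]
  have "quotient_op Ru (tau (Tminus_letter Ru c)) i j \<one>\<^bsub>RTT_algebra Ru\<^esub> =
      identity_series (RTT_algebra Ru) i j \<one>\<^bsub>RTT_algebra Ru\<^esub>" for i j
    by (rule ext) (simp add: RTT_algebra_one q identity_series_def RTT_algebra_zero u_coeff_tau_one)
  moreover have "Tminus_formula Ru c n (quotient_op Ru (tau (Tminus_letter Ru c)))" for n
    unfolding Tminus_formula_def
    by (intro ballI allI) (simp only: q Tminus_rhs_nth Tminus_letter_def[symmetric])
  ultimately show ?thesis
    using quotient_tau_opmats[OF pres] by (simp add: is_Tminus_def)
qed

theorem proposition3p1:
  fixes R :: "complex fps ^ ('n::finite \<times> 'n) ^ ('n \<times> 'n)"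
    and M :: nat and a c :: complex and \<psi> :: "complex fps"
  assumes "CARD('n) \<ge> 2"
    and "hecke_symmetry R" and "skew_invertible R"
    and "M > 0" and "a \<noteq> 0"
    and "\<psi> dvd 1"
    and Ru: "Ru = additive_R R M a \<psi>"
    and "unitary Ru"
    and Y: "Y = RTT_algebra Ru"
  shows "(\<exists>!T. is_Tminus Ru c T) \<and>
    (\<forall>T. is_Tminus Ru c T \<longrightarrow>
       op_invertible Y T \<and>
       RTT_identity Y Ru 0 0 T T \<and>
       RTT_identity Y Ru (c / 2) (- c / 2) T (Tplus_op Ru))"
proof -
  note R = \<open>hecke_symmetry R\<close> \<open>a \<noteq> 0\<close> Ru \<open>unitary Ru\<close>
  note inv = unitary_inverse(1,2)[OF \<open>unitary Ru\<close>]
  obtain D where D: "skew_matrix (matrix_inv Ru) * D = 1" "D * skew_matrix (matrix_inv Ru) = 1"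
    by (rule additive_R_inverse_skew_invertible[OF \<open>skew_invertible R\<close> Ru \<open>unitary Ru\<close>])
  define B' where "B' = sq_map (shift_v (- c / 2)) (of_mat (matrix_inv Ru))"
  define D' where "D' = sq_map (shift_v (c / 2)) D"
  define T where "T = quotient_op Ru (tau (Tminus_letter Ru c))"
  define S where "S = quotient_op Ru (tau (letter_S B' D'))"
  have presT: "tau (Tminus_letter Ru c) I x \<in> laurent_set (RTT_ideal Ru)"
    and presS: "tau (letter_S B' D') I x \<in> laurent_set (RTT_ideal Ru)" if "x \<in> RTT_ideal Ru" for I x
    unfolding Tminus_letter_def B'_def D'_def by (rule tau_letter_preserves_ideal[OF R D that])+
  have T: "is_Tminus Ru c T" unfolding T_def by (rule Tminus_exists[OF presT])
  \<comment> \<open>The left factor is rewritten as \<open>of_mat\<close> of a shifted matrix, the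
    form in which \<open>skew_matrix\<close> can be taken of it.\<close>
  have letter: "Tminus_letter Ru c = letter_T (of_mat (map_matrix (shift_v (c / 2)) (matrix_inv Ru)))
      (sq_map (shift_v (- c / 2)) (of_mat Ru))"
    by (simp only: Tminus_letter_def of_mat_map)
  have skew: "skew_matrix (map_matrix (shift_v (c / 2)) (matrix_inv Ru)) * D' = 1"
    "D' * skew_matrix (map_matrix (shift_v (c / 2)) (matrix_inv Ru)) = 1"
    unfolding skew_matrix_map D'_def by (rule hom_inverse[OF sq_map_hom[OF shift_v_hom]], rule D)+
  have B: "sq_map (shift_v (- c / 2)) (of_mat Ru) * B' = 1" "B' * sq_map (shift_v (- c / 2)) (of_mat Ru) = 1"
    unfolding B'_def by (rule hom_inverse[OF sq_map_hom[OF shift_v_hom]], rule inv)+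
  have TS: "product_is_identity Y T S"
    unfolding Y T_def S_def
    by (rule product_is_identity_quotient[OF presT presS]) (simp_all only: letter kernel_T_S[OF B(1) skew(1)])
  have ST: "product_is_identity Y S T"
    unfolding Y T_def S_def
    by (rule product_is_identity_quotient[OF presS presT]) (simp_all only: letter kernel_S_T[OF B(2) skew(2)])
  have "S \<in> opmats Y" unfolding Y S_def by (rule quotient_tau_opmats[OF presS])
  hence "op_invertible Y T" using TS ST by (auto simp: op_invertible_def)
  moreover have "RTT_identity Y Ru 0 0 T T"
    unfolding Y T_def Tminus_letter_def
    by (rule RTT_identity_T_T[OF R]) (rule presT[unfolded Tminus_letter_def])
  moreover have "RTT_identity Y Ru (c / 2) (- c / 2) T (Tplus_op Ru)"
    unfolding Y T_def Tminus_letter_def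
    by (rule RTT_identity_T_plus[OF inv(1)]) (rule presT[unfolded Tminus_letter_def])
  ultimately show ?thesis using T Tminus_unique by blast
qed

end
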